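(* Let $\Bbbk$ be a field and let $\mathscr A=\bigoplus_{n\ge0}A_n$ be a nice tower of algebras over $\Bbbk$. Then the $\mathbb Z[q,q^{-1}]$-bilinear pairing $\langle-,-\rangle:\mathcal K(\mathscr A)\times\mathcal G^f(\mathscr A)\to\mathbb Z[q,q^{-1}]$ defined by $$\langle[P],[M]\rangle=\begin{cases}\mathrm{gdim}_\Bbbk\,(P^\psi\otimes_{A_n}M)&\text{if }P\in A_n\text{-pmod and }M\in A_n\text{-fmod for the same }n,\\0&\text{if }P\in A_n\text{-pmod},\ M\in A_m\text{-fmod},\ n\neq m,\end{cases}$$ is non-degenerate. If additionally $\Bbbk$ is algebraically closed, then the pairing is perfect.
   Context: **Nice graded algebra.** A $\mathbb Z$-graded $\Bbbk$-algebra $R=\bigoplus_{i\in\mathbb Z}R_i$ is *nice* if there is a homogeneous two-sided ideal $I$ contained in $\bigoplus_{i>0}R_i$ (or contained in $\bigoplus_{i<0}R_i$) such that every graded simple $R$-module is annihilated by $I$ and $R/I$ is finite-dimensional. **Nice tower of algebras.** $\mathscr A=\bigoplus_{n\ge0}A_n$, where for all $m,n$: (TA1) $A_n$ is a nice graded $\Bbbk$-algebra and $A_0=\Bbbk$; (TA2) there is a unital (graded) algebra morphism $A_n\otimes A_m\to A_{n+m}$; (TA3) $A_{m+n}$ is projective both as a left and as a right $A_n\otimes A_m$-module; (TA4) there is a (degree-preserving, $\Bbbk$-linear) anti-automorphism $\psi$ of $A_n$. **Notation.** $A_n\text{-fmod}$ and $A_n\text{-pmod}$ are the categories of graded finite-dimensional,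 respectively graded finitely generated projective, left $A_n$-modules (with degree-preserving maps). $G_0^f(A_n)=K_0(A_n\text{-fmod})$, and $K_\oplus(A_n)=K_0(A_n\text{-pmod})$; $\mathcal G^f(\mathscr A)=\bigoplus_nG_0^f(A_n)$, $\mathcal K(\mathscr A)=\bigoplus_nK_\oplus(A_n)$. These are $\mathbb Z[q,q^{-1}]$-modules via $q[M]=[qM]$, $(qM)_a=M_{a-1}$. $\mathrm{gdim}_\Bbbk V=\sum_a(\dim_\Bbbk V_a)q^a$. For a left $A_n$-module $P$, $P^\psi$ is the right $A_n$-module with the same underlying space and action $m\cdot a:=\psi(a)m$. Non-degenerate means that no nonzero element of either side pairs to zero with all elements of the other side. Perfect is understood componentwise: for each $n$ the pairing identifies each of $K_\oplus(A_n)$ and $G_0^f(A_n)$ with the $\mathbb Z[q,q^{-1}]$-dual of the other. *)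

theory Defs
  imports
    "Jordan_Normal_Form.VS_Connect"
    "HOL-Algebra.Algebraic_Closure"
    "HOL-Library.Poly_Mapping"
begin

section \<open>Modules over noncommutative rings\<close>

text \<open>
  Modules are records of type \<open>('r, 'm) module\<close>; as usual for these records, the fields
  \<open>mult\<close> and \<open>one\<close> of a module carry no information.  The library locale \<open>module\<close> requires a
  commutative ring of scalars, hence the following variant.  A right \<open>R\<close>-module is a left module
  over \<open>opposite R\<close>: the scalar product \<open>a \<odot> x\<close> then stands for \<open>x \<cdot> a\<close>.
\<close>

locale left_module = R?: ring R + M?: abelian_group M
  for R :: "('r, 'y) ring_scheme" (structure) and M :: "('r, 'm, 'z) module_scheme" (structure) +
  assumes smult_closed: "\<lbrakk>a \<in> carrier R; x \<in> carrier M\<rbrakk> \<Longrightarrow> a \<odot>\<^bsub>M\<^esub> x \<in> carrier M"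
    and smult_l_distr: "\<lbrakk>a \<in> carrier R; b \<in> carrier R; x \<in> carrier M\<rbrakk> \<Longrightarrow>
      (a \<oplus>\<^bsub>R\<^esub> b) \<odot>\<^bsub>M\<^esub> x = a \<odot>\<^bsub>M\<^esub> x \<oplus>\<^bsub>M\<^esub> b \<odot>\<^bsub>M\<^esub> x"
    and smult_r_distr: "\<lbrakk>a \<in> carrier R; x \<in> carrier M; y \<in> carrier M\<rbrakk> \<Longrightarrow>
      a \<odot>\<^bsub>M\<^esub> (x \<oplus>\<^bsub>M\<^esub> y) = a \<odot>\<^bsub>M\<^esub> x \<oplus>\<^bsub>M\<^esub> a \<odot>\<^bsub>M\<^esub> y"
    and smult_assoc: "\<lbrakk>a \<in> carrier R; b \<in> carrier R; x \<in> carrier M\<rbrakk> \<Longrightarrow>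
      (a \<otimes>\<^bsub>R\<^esub> b) \<odot>\<^bsub>M\<^esub> x = a \<odot>\<^bsub>M\<^esub> (b \<odot>\<^bsub>M\<^esub> x)"
    and smult_one: "x \<in> carrier M \<Longrightarrow> \<one>\<^bsub>R\<^esub> \<odot>\<^bsub>M\<^esub> x = x"

definition opposite :: "('r, 'z) ring_scheme \<Rightarrow> ('r, 'z) ring_scheme" where
  "opposite R = R\<lparr>monoid.mult := \<lambda>a b. b \<otimes>\<^bsub>R\<^esub> a\<rparr>"

definition regular_left :: "('r, 'z) ring_scheme \<Rightarrow> ('r, 'r) module" where
  "regular_left R = \<lparr>carrier = carrier R, monoid.mult = monoid.mult R, one = \<one>\<^bsub>R\<^esub>, zero = \<zero>\<^bsub>R\<^esub>, add = add R,
     smult = (\<lambda>a x. a \<otimes>\<^bsub>R\<^esub> x)\<rparr>"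

definition regular_right :: "('r, 'z) ring_scheme \<Rightarrow> ('r, 'r) module" where
  "regular_right R = \<lparr>carrier = carrier R, monoid.mult = monoid.mult R, one = \<one>\<^bsub>R\<^esub>, zero = \<zero>\<^bsub>R\<^esub>, add = add R,
     smult = (\<lambda>a x. x \<otimes>\<^bsub>R\<^esub> a)\<rparr>"

definition pullback :: "('s \<Rightarrow> 'r) \<Rightarrow> ('r, 'm, 'z) module_scheme \<Rightarrow> ('s, 'm) module" where
  "pullback h M = \<lparr>carrier = carrier M, monoid.mult = monoid.mult M, one = \<one>\<^bsub>M\<^esub>, zero = \<zero>\<^bsub>M\<^esub>, add = add M,
     smult = (\<lambda>a x. h a \<odot>\<^bsub>M\<^esub> x)\<rparr>"

definition left_submodule :: "('r, 'y) ring_scheme \<Rightarrow> 'm set \<Rightarrow> ('r, 'm, 'z) module_scheme \<Rightarrow> bool" where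
  "left_submodule R N M \<longleftrightarrow>
     subgroup N (add_monoid M) \<and> (\<forall>a\<in>carrier R. \<forall>x\<in>N. a \<odot>\<^bsub>M\<^esub> x \<in> N)"

definition quotient_module :: "('r, 'm, 'z) module_scheme \<Rightarrow> 'm set \<Rightarrow> ('r, 'm set) module" where
  "quotient_module M N = \<lparr>carrier = a_rcosets\<^bsub>M\<^esub> N, monoid.mult = undefined, one = undefined,
     zero = N, add = set_add M, smult = (\<lambda>a U. \<Union>x\<in>U. N +>\<^bsub>M\<^esub> (a \<odot>\<^bsub>M\<^esub> x))\<rparr>"

definition free_module :: "('r, 'z) ring_scheme \<Rightarrow> 's set \<Rightarrow> ('r, 's \<Rightarrow> 'r) module" where
  "free_module R S = \<lparr>carrier = {f. (\<forall>s. f s \<in> carrier R) \<and> (\<forall>s. s \<notin> S \<longrightarrow> f s = \<zero>\<^bsub>R\<^esub>) \<and>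
       finite {s. f s \<noteq> \<zero>\<^bsub>R\<^esub>}},
     monoid.mult = undefined, one = undefined, zero = (\<lambda>s. \<zero>\<^bsub>R\<^esub>), add = (\<lambda>f g s. f s \<oplus>\<^bsub>R\<^esub> g s),
     smult = (\<lambda>a f s. a \<otimes>\<^bsub>R\<^esub> f s)\<rparr>"

definition basis_vector :: "('r, 'z) ring_scheme \<Rightarrow> 's \<Rightarrow> 's \<Rightarrow> 'r" where
  "basis_vector R s = (\<lambda>t. if t = s then \<one>\<^bsub>R\<^esub> else \<zero>\<^bsub>R\<^esub>)"

definition finitely_generated :: "('r, 'y) ring_scheme \<Rightarrow> ('r, 'm, 'z) module_scheme \<Rightarrow> bool" where
  "finitely_generated R M \<longleftrightarrow> (\<exists>S. finite S \<and> S \<subseteq> carrier M \<and>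
     (\<forall>x\<in>carrier M. \<exists>c\<in>S \<rightarrow> carrier R. x = (\<Oplus>\<^bsub>M\<^esub>s\<in>S. c s \<odot>\<^bsub>M\<^esub> s)))"

text \<open>
  Direct summand of a free module.  Index sets \<open>S\<close> in the type of elements of \<open>P\<close> suffice, as \<open>P\<close>
  is a quotient of the free module on its own carrier.
\<close>

definition projective :: "('r, 'y) ring_scheme \<Rightarrow> ('r, 'm, 'z) module_scheme \<Rightarrow> bool" where
  "projective R P \<longleftrightarrow> (\<exists>S :: 'm set. \<exists>i \<in> LinearCombinations.module_hom R P (free_module R S).
     \<exists>p \<in> LinearCombinations.module_hom R (free_module R S) P. \<forall>x\<in>carrier P. p (i x) = x)"


section \<open>Graded algebras and graded modules\<close>

record ('r, 'm) gmodule = "('r, 'm) module" +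
  component :: "int \<Rightarrow> 'm set"

definition decomposition :: "('r, 'm, 'z) gmodule_scheme \<Rightarrow> 'm \<Rightarrow> (int \<Rightarrow> 'm) \<Rightarrow> bool" where
  "decomposition M x f \<longleftrightarrow> (\<forall>i. f i \<in> component M i) \<and> finite {i. f i \<noteq> \<zero>\<^bsub>M\<^esub>} \<and>
     x = (\<Oplus>\<^bsub>M\<^esub>i\<in>{i. f i \<noteq> \<zero>\<^bsub>M\<^esub>}. f i)"

definition hcomp :: "('r, 'm, 'z) gmodule_scheme \<Rightarrow> 'm \<Rightarrow> int \<Rightarrow> 'm" where
  "hcomp M x = (THE f. decomposition M x f)"

definition graded_group :: "('r, 'm, 'z) gmodule_scheme \<Rightarrow> bool" where
  "graded_group M \<longleftrightarrow> abelian_group M \<and> (\<forall>i. subgroup (component M i) (add_monoid M)) \<and>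
     (\<forall>x\<in>carrier M. \<exists>!f. decomposition M x f)"

definition homogeneous_subset :: "('r, 'm, 'z) gmodule_scheme \<Rightarrow> 'm set \<Rightarrow> bool" where
  "homogeneous_subset M N \<longleftrightarrow> (\<forall>x\<in>N. \<forall>i. hcomp M x i \<in> N)"

text \<open>A graded \<open>K\<close>-algebra is a record of type \<open>('k, 'a) gmodule\<close>, with \<open>mult\<close> and \<open>one\<close> in use.\<close>

definition graded_algebra :: "'k ring \<Rightarrow> ('k, 'a) gmodule \<Rightarrow> bool" where
  "graded_algebra K A \<longleftrightarrow> vectorspace K A \<and> ring A \<and>
     (\<forall>c\<in>carrier K. \<forall>x\<in>carrier A. \<forall>y\<in>carrier A.
        (c \<odot>\<^bsub>A\<^esub> x) \<otimes>\<^bsub>A\<^esub> y = c \<odot>\<^bsub>A\<^esub> (x \<otimes>\<^bsub>A\<^esub> y) \<and> x \<otimes>\<^bsub>A\<^esub> (c \<odot>\<^bsub>A\<^esub> y) = c \<odot>\<^bsub>A\<^esub> (x \<otimes>\<^bsub>A\<^esub> y)) \<and>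
     graded_group A \<and>
     (\<forall>i. \<forall>c\<in>carrier K. \<forall>x\<in>component A i. c \<odot>\<^bsub>A\<^esub> x \<in> component A i) \<and>
     (\<forall>i j. \<forall>x\<in>component A i. \<forall>y\<in>component A j. x \<otimes>\<^bsub>A\<^esub> y \<in> component A (i + j))"

definition ground_algebra :: "'k ring \<Rightarrow> ('k, 'k) gmodule" where
  "ground_algebra K = \<lparr>carrier = carrier K, monoid.mult = monoid.mult K, one = \<one>\<^bsub>K\<^esub>, zero = \<zero>\<^bsub>K\<^esub>, add = add K,
     smult = monoid.mult K, component = (\<lambda>i. if i = 0 then carrier K else {\<zero>\<^bsub>K\<^esub>})\<rparr>"

definition graded_algebra_hom :: "'k ring \<Rightarrow> ('k, 'a) gmodule \<Rightarrow> ('k, 'b) gmodule \<Rightarrow> ('a \<Rightarrow> 'b) set" where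
  "graded_algebra_hom K A B = {h \<in> Ring.ring_hom A B \<inter> LinearCombinations.module_hom K A B.
     \<forall>i. h ` component A i \<subseteq> component B i}"

definition graded_anti_automorphism :: "'k ring \<Rightarrow> ('k, 'a) gmodule \<Rightarrow> ('a \<Rightarrow> 'a) \<Rightarrow> bool" where
  "graded_anti_automorphism K A \<psi> \<longleftrightarrow>
     \<psi> \<in> Ring.ring_hom A (opposite A) \<inter> LinearCombinations.module_hom K A A \<and> bij_betw \<psi> (carrier A) (carrier A) \<and>
     (\<forall>i. \<psi> ` component A i \<subseteq> component A i)"

definition graded_module :: "('k, 'a) gmodule \<Rightarrow> ('a, 'm) gmodule \<Rightarrow> bool" where
  "graded_module A M \<longleftrightarrow> left_module A M \<and> graded_group M \<and>
     (\<forall>i j. \<forall>a\<in>component A i. \<forall>x\<in>component M j. a \<odot>\<^bsub>M\<^esub> x \<in> component M (i + j))"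

definition graded_hom :: "('k, 'a) gmodule \<Rightarrow> ('a, 'm) gmodule \<Rightarrow> ('a, 'n) gmodule \<Rightarrow> ('m \<Rightarrow> 'n) set" where
  "graded_hom A M N = {h \<in> LinearCombinations.module_hom A M N. \<forall>i. h ` component M i \<subseteq> component N i}"

definition shift :: "int \<Rightarrow> ('a, 'm) gmodule \<Rightarrow> ('a, 'm) gmodule" where
  "shift k M = M\<lparr>component := \<lambda>i. component M (i - k)\<rparr>"

definition graded_simple :: "('k, 'a) gmodule \<Rightarrow> ('a, 'm) gmodule \<Rightarrow> bool" where
  "graded_simple A M \<longleftrightarrow> graded_module A M \<and> carrier M \<noteq> {\<zero>\<^bsub>M\<^esub>} \<and>
     (\<forall>N. left_submodule A N M \<and> homogeneous_subset M N \<longrightarrow> N = {\<zero>\<^bsub>M\<^esub>} \<or> N = carrier M)"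

definition underlying_space :: "('k, 'a) gmodule \<Rightarrow> ('a, 'm) gmodule \<Rightarrow> ('k, 'm) module" where
  "underlying_space A M = pullback (\<lambda>c. c \<odot>\<^bsub>A\<^esub> \<one>\<^bsub>A\<^esub>) M"

text \<open>
  Isabelle/HOL types are fixed, so "all modules" has to mean "all modules carried by a subset of
  some fixed type".  We take \<open>nat \<Rightarrow> 'a\<close>, where \<open>'a\<close> is the type of elements of the algebras.  This
  loses nothing here: a finitely generated module is a quotient of a power \<open>A\<^sup>r\<close>, which embeds as a
  set into \<open>nat \<Rightarrow> 'a\<close>, and choosing representatives transports the quotient to a subset of this
  type.  Simple, finite-dimensional and finitely generated projective modules are all finitely
  generated, so each of them is isomorphic to a module of type \<open>'a amodule\<close>.
\<close>

type_synonym 'a amodule = "('a, nat \<Rightarrow> 'a) gmodule"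

definition nice_graded_algebra :: "'k ring \<Rightarrow> ('k, 'a) gmodule \<Rightarrow> bool" where
  "nice_graded_algebra K A \<longleftrightarrow> graded_algebra K A \<and>
     (\<exists>I. ideal I A \<and> homogeneous_subset A I \<and>
        (I \<subseteq> {x \<in> carrier A. \<forall>i\<le>0. hcomp A x i = \<zero>\<^bsub>A\<^esub>} \<or>
         I \<subseteq> {x \<in> carrier A. \<forall>i\<ge>0. hcomp A x i = \<zero>\<^bsub>A\<^esub>}) \<and>
        (\<forall>S :: 'a amodule. graded_simple A S \<longrightarrow> (\<forall>a\<in>I. \<forall>x\<in>carrier S. a \<odot>\<^bsub>S\<^esub> x = \<zero>\<^bsub>S\<^esub>)) \<and>
        vectorspace.fin_dim K (quotient_module A I))"


section \<open>Tensor products\<close>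

text \<open>
  For a \<open>K\<close>-algebra \<open>A\<close>, a right \<open>A\<close>-module \<open>P\<close> and a left \<open>A\<close>-module \<open>M\<close>, the tensor product
  over \<open>A\<close> is the free \<open>K\<close>-module on \<open>P \<times> M\<close> modulo the usual relations.
\<close>

definition tensor_relations ::
    "'k ring \<Rightarrow> ('k, 'a) gmodule \<Rightarrow> ('a, 'p) gmodule \<Rightarrow> ('a, 'm) gmodule \<Rightarrow> ('p \<times> 'm \<Rightarrow> 'k) set" where
  "tensor_relations K A P M = (let F = free_module K (carrier P \<times> carrier M); e = basis_vector K in
     {e (p \<oplus>\<^bsub>P\<^esub> p', m) \<ominus>\<^bsub>F\<^esub> (e (p, m) \<oplus>\<^bsub>F\<^esub> e (p', m)) | p p' m.
        p \<in> carrier P \<and> p' \<in> carrier P \<and> m \<in> carrier M} \<union>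
     {e (p, m \<oplus>\<^bsub>M\<^esub> m') \<ominus>\<^bsub>F\<^esub> (e (p, m) \<oplus>\<^bsub>F\<^esub> e (p, m')) | p m m'.
        p \<in> carrier P \<and> m \<in> carrier M \<and> m' \<in> carrier M} \<union>
     {e (a \<odot>\<^bsub>P\<^esub> p, m) \<ominus>\<^bsub>F\<^esub> e (p, a \<odot>\<^bsub>M\<^esub> m) | a p m.
        a \<in> carrier A \<and> p \<in> carrier P \<and> m \<in> carrier M} \<union>
     {e ((c \<odot>\<^bsub>A\<^esub> \<one>\<^bsub>A\<^esub>) \<odot>\<^bsub>P\<^esub> p, m) \<ominus>\<^bsub>F\<^esub> c \<odot>\<^bsub>F\<^esub> e (p, m) | c p m.
        c \<in> carrier K \<and> p \<in> carrier P \<and> m \<in> carrier M})"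

definition tensor_null ::
    "'k ring \<Rightarrow> ('k, 'a) gmodule \<Rightarrow> ('a, 'p) gmodule \<Rightarrow> ('a, 'm) gmodule \<Rightarrow> ('p \<times> 'm \<Rightarrow> 'k) set" where
  "tensor_null K A P M =
     LinearCombinations.module.span K (free_module K (carrier P \<times> carrier M)) (tensor_relations K A P M)"

definition tensor_space ::
    "'k ring \<Rightarrow> ('k, 'a) gmodule \<Rightarrow> ('a, 'p) gmodule \<Rightarrow> ('a, 'm) gmodule \<Rightarrow> ('k, ('p \<times> 'm \<Rightarrow> 'k) set) module" where
  "tensor_space K A P M =
     quotient_module (free_module K (carrier P \<times> carrier M)) (tensor_null K A P M)"

definition pure_tensor ::
    "'k ring \<Rightarrow> ('k, 'a) gmodule \<Rightarrow> ('a, 'p) gmodule \<Rightarrow> ('a, 'm) gmodule \<Rightarrow> 'p \<Rightarrow> 'm \<Rightarrow> ('p \<times> 'm \<Rightarrow> 'k) set" where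
  "pure_tensor K A P M p m =
     tensor_null K A P M +>\<^bsub>free_module K (carrier P \<times> carrier M)\<^esub> basis_vector K (p, m)"

definition tensor ::
    "'k ring \<Rightarrow> ('k, 'a) gmodule \<Rightarrow> ('a, 'p) gmodule \<Rightarrow> ('a, 'm) gmodule \<Rightarrow> ('k, ('p \<times> 'm \<Rightarrow> 'k) set) gmodule" where
  "tensor K A P M = module.extend (tensor_space K A P M)
     \<lparr>component = (\<lambda>i. LinearCombinations.module.span K (tensor_space K A P M)
        {pure_tensor K A P M p m | p m j. p \<in> component P j \<and> m \<in> component M (i - j)})\<rparr>"

text \<open>
  The algebra \<open>A \<otimes>\<^sub>K B\<close>, with \<open>(a \<otimes> b)(a' \<otimes> b') = aa' \<otimes> bb'\<close>.  Here \<open>tensor_conv\<close> is the product of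
  representatives, i.e. the product of the monoid algebra of \<open>A \<times> B\<close>.
\<close>

definition tensor_conv ::
    "'k ring \<Rightarrow> ('k, 'a) gmodule \<Rightarrow> ('k, 'b) gmodule \<Rightarrow> ('a \<times> 'b \<Rightarrow> 'k) \<Rightarrow> ('a \<times> 'b \<Rightarrow> 'k) \<Rightarrow> ('a \<times> 'b \<Rightarrow> 'k)" where
  "tensor_conv K A B x y = (let F = free_module K (carrier A \<times> carrier B) in
     \<Oplus>\<^bsub>F\<^esub>st\<in>{s. x s \<noteq> \<zero>\<^bsub>K\<^esub>} \<times> {t. y t \<noteq> \<zero>\<^bsub>K\<^esub>}. case st of ((a, b), (a', b')) \<Rightarrow>
       (x (a, b) \<otimes>\<^bsub>K\<^esub> y (a', b')) \<odot>\<^bsub>F\<^esub> basis_vector K (a \<otimes>\<^bsub>A\<^esub> a', b \<otimes>\<^bsub>B\<^esub> b'))"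

definition tensor_algebra ::
    "'k ring \<Rightarrow> ('k, 'a) gmodule \<Rightarrow> ('k, 'b) gmodule \<Rightarrow> ('k, ('a \<times> 'b \<Rightarrow> 'k) set) gmodule" where
  "tensor_algebra K A B = (tensor K (ground_algebra K) A B)
     \<lparr>monoid.mult := \<lambda>U V. \<Union>x\<in>U. \<Union>y\<in>V.
        tensor_null K (ground_algebra K) A B +>\<^bsub>free_module K (carrier A \<times> carrier B)\<^esub> tensor_conv K A B x y,
      one := pure_tensor K (ground_algebra K) A B \<one>\<^bsub>A\<^esub> \<one>\<^bsub>B\<^esub>\<rparr>"


section \<open>Nice towers of algebras\<close>

locale nice_tower =
  fixes K :: "'k ring"
    and A :: "nat \<Rightarrow> ('k, 'a) gmodule"
    and \<rho> :: "nat \<Rightarrow> nat \<Rightarrow> ('a \<times> 'a \<Rightarrow> 'k) set \<Rightarrow> 'a"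
    and \<psi> :: "nat \<Rightarrow> 'a \<Rightarrow> 'a"
  assumes base_field: "field K"
    and nice: "nice_graded_algebra K (A n)"
    and zeroth: "\<exists>h \<in> graded_algebra_hom K (ground_algebra K) (A 0). bij_betw h (carrier K) (carrier (A 0))"
    and product_hom: "\<rho> n m \<in> graded_algebra_hom K (tensor_algebra K (A n) (A m)) (A (n + m))"
    and left_projective:
      "projective (tensor_algebra K (A n) (A m)) (pullback (\<rho> n m) (regular_left (A (n + m))))"
    and right_projective:
      "projective (opposite (tensor_algebra K (A n) (A m))) (pullback (\<rho> n m) (regular_right (A (n + m))))"
    and anti_automorphism: "graded_anti_automorphism K (A n) (\<psi> n)"


section \<open>Grothendieck groups\<close>

text \<open>
  \<open>int \<Rightarrow>\<^sub>0 int\<close> with its convolution product is the group ring of the integers; \<open>single n c\<close> is the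
  monomial \<open>c q\<^sup>n\<close>.
\<close>

type_synonym laurent = "int \<Rightarrow>\<^sub>0 int"

abbreviation laurent_ring :: "laurent ring" where "laurent_ring \<equiv> class_ring"

definition short_exact ::
    "('k, 'a) gmodule \<Rightarrow> ('a, 'm) gmodule \<Rightarrow> ('a, 'm) gmodule \<Rightarrow> ('a, 'm) gmodule \<Rightarrow> bool" where
  "short_exact A M' M M'' \<longleftrightarrow> (\<exists>f \<in> graded_hom A M' M. \<exists>g \<in> graded_hom A M M''.
     inj_on f (carrier M') \<and> f ` carrier M' = a_kernel M M'' g \<and> g ` carrier M = carrier M'')"

text \<open>
  The free abelian group on a class \<open>C\<close> of graded modules closed under shifts, with the action of
  Laurent polynomials for which \<open>q\<^sup>k\<close> sends a generator \<open>M\<close> to \<open>shift k M\<close>.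
\<close>

definition free_grothendieck :: "('a, 'm) gmodule set \<Rightarrow> (laurent, ('a, 'm) gmodule \<Rightarrow>\<^sub>0 int) module" where
  "free_grothendieck C = \<lparr>carrier = {x. Poly_Mapping.keys x \<subseteq> C}, monoid.mult = undefined, one = undefined,
     zero = 0, add = (+),
     smult = (\<lambda>f x. frag_extend (\<lambda>k. frag_extend (\<lambda>M. frag_of (shift k M)) x) f)\<rparr>"

definition grothendieck_relations ::
    "('k, 'a) gmodule \<Rightarrow> ('a, 'm) gmodule set \<Rightarrow> (('a, 'm) gmodule \<Rightarrow>\<^sub>0 int) set" where
  "grothendieck_relations A C =
     generate (add_monoid (free_grothendieck C))
       {frag_of M - (frag_of M' + frag_of M'') | M' M M''.
          M' \<in> C \<and> M \<in> C \<and> M'' \<in> C \<and> short_exact A M' M M''}"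

text \<open>Isomorphic modules have the same class in \<open>K\<^sub>0\<close>, by the exact sequences with a zero term.\<close>

definition K0 :: "('k, 'a) gmodule \<Rightarrow> ('a, 'm) gmodule set \<Rightarrow> (laurent, (('a, 'm) gmodule \<Rightarrow>\<^sub>0 int) set) module" where
  "K0 A C = quotient_module (free_grothendieck C) (grothendieck_relations A C)"

definition K0_class :: "('k, 'a) gmodule \<Rightarrow> ('a, 'm) gmodule set \<Rightarrow> ('a, 'm) gmodule \<Rightarrow> (('a, 'm) gmodule \<Rightarrow>\<^sub>0 int) set" where
  "K0_class A C M = grothendieck_relations A C +>\<^bsub>free_grothendieck C\<^esub> frag_of M"

definition fmod :: "'k ring \<Rightarrow> ('k, 'a) gmodule \<Rightarrow> 'a amodule set" where
  "fmod K A = {M. graded_module A M \<and> vectorspace.fin_dim K (underlying_space A M)}"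

definition pmod :: "('k, 'a) gmodule \<Rightarrow> 'a amodule set" where
  "pmod A = {P. graded_module A P \<and> finitely_generated A P \<and> projective A P}"

definition direct_sum_nat :: "(nat \<Rightarrow> ('r, 'x) module) \<Rightarrow> ('r, nat \<Rightarrow> 'x) module" where
  "direct_sum_nat G = \<lparr>carrier = {x. (\<forall>n. x n \<in> carrier (G n)) \<and> finite {n. x n \<noteq> \<zero>\<^bsub>G n\<^esub>}},
     monoid.mult = undefined, one = undefined, zero = (\<lambda>n. \<zero>\<^bsub>G n\<^esub>), add = (\<lambda>x y n. x n \<oplus>\<^bsub>G n\<^esub> y n),
     smult = (\<lambda>c x n. c \<odot>\<^bsub>G n\<^esub> x n)\<rparr>"

definition summand :: "(nat \<Rightarrow> ('r, 'x) module) \<Rightarrow> nat \<Rightarrow> 'x \<Rightarrow> nat \<Rightarrow> 'x" where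
  "summand G n x = (\<lambda>m. if m = n then x else \<zero>\<^bsub>G m\<^esub>)"

type_synonym 'a kclass = "('a amodule \<Rightarrow>\<^sub>0 int) set"

abbreviation K_proj :: "(nat \<Rightarrow> ('k, 'a) gmodule) \<Rightarrow> nat \<Rightarrow> (laurent, 'a kclass) module" where
  "K_proj A n \<equiv> K0 (A n) (pmod (A n))"

abbreviation G_fin :: "'k ring \<Rightarrow> (nat \<Rightarrow> ('k, 'a) gmodule) \<Rightarrow> nat \<Rightarrow> (laurent, 'a kclass) module" where
  "G_fin K A n \<equiv> K0 (A n) (fmod K (A n))"

definition tower_K :: "(nat \<Rightarrow> ('k, 'a) gmodule) \<Rightarrow> (laurent, nat \<Rightarrow> 'a kclass) module" where
  "tower_K A = direct_sum_nat (K_proj A)"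

definition tower_G :: "'k ring \<Rightarrow> (nat \<Rightarrow> ('k, 'a) gmodule) \<Rightarrow> (laurent, nat \<Rightarrow> 'a kclass) module" where
  "tower_G K A = direct_sum_nat (G_fin K A)"


section \<open>The pairing\<close>

definition gdim :: "'k ring \<Rightarrow> ('k, 'v) gmodule \<Rightarrow> laurent" where
  "gdim K V = Abs_poly_mapping (\<lambda>i. int (vectorspace.dim K (V\<lparr>carrier := component V i\<rparr>)))"

definition twist :: "('a \<Rightarrow> 'a) \<Rightarrow> ('a, 'm) gmodule \<Rightarrow> ('a, 'm) gmodule" where
  "twist \<psi> P = P\<lparr>smult := \<lambda>a x. \<psi> a \<odot>\<^bsub>P\<^esub> x\<rparr>"

definition bilinear_pairing ::
    "(laurent, 'x) module \<Rightarrow> (laurent, 'y) module \<Rightarrow> ('x \<Rightarrow> 'y \<Rightarrow> laurent) \<Rightarrow> bool" where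
  "bilinear_pairing M N B \<longleftrightarrow>
     (\<forall>y\<in>carrier N. (\<lambda>x. B x y) \<in> LinearCombinations.module_hom laurent_ring M (regular_left laurent_ring)) \<and>
     (\<forall>x\<in>carrier M. B x \<in> LinearCombinations.module_hom laurent_ring N (regular_left laurent_ring))"

text \<open>
  As the classes of modules generate, this determines \<open>B\<close> on the carriers; its values elsewhere are
  arbitrary and irrelevant.
\<close>

definition tower_pairing ::
    "'k ring \<Rightarrow> (nat \<Rightarrow> ('k, 'a) gmodule) \<Rightarrow> (nat \<Rightarrow> 'a \<Rightarrow> 'a) \<Rightarrow>
     ((nat \<Rightarrow> 'a kclass) \<Rightarrow> (nat \<Rightarrow> 'a kclass) \<Rightarrow> laurent) \<Rightarrow> bool" where
  "tower_pairing K A \<psi> B \<longleftrightarrow> bilinear_pairing (tower_K A) (tower_G K A) B \<and>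
     (\<forall>n m. \<forall>P \<in> pmod (A n). \<forall>M \<in> fmod K (A m).
        B (summand (K_proj A) n (K0_class (A n) (pmod (A n)) P))
          (summand (G_fin K A) m (K0_class (A m) (fmod K (A m)) M)) =
        (if n = m then gdim K (tensor K (A n) (twist (\<psi> n) P) M) else 0))"

definition nondegenerate ::
    "(laurent, 'x) module \<Rightarrow> (laurent, 'y) module \<Rightarrow> ('x \<Rightarrow> 'y \<Rightarrow> laurent) \<Rightarrow> bool" where
  "nondegenerate M N B \<longleftrightarrow>
     (\<forall>x\<in>carrier M. (\<forall>y\<in>carrier N. B x y = 0) \<longrightarrow> x = \<zero>\<^bsub>M\<^esub>) \<and>
     (\<forall>y\<in>carrier N. (\<forall>x\<in>carrier M. B x y = 0) \<longrightarrow> y = \<zero>\<^bsub>N\<^esub>)"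

definition dual :: "(laurent, 'x) module \<Rightarrow> ('x \<Rightarrow> laurent) set" where
  "dual M = LinearCombinations.module_hom laurent_ring M (regular_left laurent_ring) \<inter> extensional (carrier M)"

text \<open>The two induced maps into the duals are linear as soon as \<open>B\<close> is bilinear.\<close>

definition perfect ::
    "(laurent, 'x) module \<Rightarrow> (laurent, 'y) module \<Rightarrow> ('x \<Rightarrow> 'y \<Rightarrow> laurent) \<Rightarrow> bool" where
  "perfect M N B \<longleftrightarrow>
     bij_betw (\<lambda>x. \<lambda>y\<in>carrier N. B x y) (carrier M) (dual N) \<and>
     bij_betw (\<lambda>y. \<lambda>x\<in>carrier M. B x y) (carrier N) (dual M)"

definition componentwise_perfect ::
    "'k ring \<Rightarrow> (nat \<Rightarrow> ('k, 'a) gmodule) \<Rightarrow>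
     ((nat \<Rightarrow> 'a kclass) \<Rightarrow> (nat \<Rightarrow> 'a kclass) \<Rightarrow> laurent) \<Rightarrow> bool" where
  "componentwise_perfect K A B \<longleftrightarrow> (\<forall>n. perfect (K_proj A n) (G_fin K A n)
     (\<lambda>x y. B (summand (K_proj A) n x) (summand (G_fin K A) n y)))"

end

theory Submission
  imports Defs
begin

text \<open>
  Modulo its nice ideal, \<open>A\<close> is finite-dimensional, so that the finite-dimensional algebra \<open>A\<^sub>0\<close> contains
  finitely many local idempotents \<open>r\<close> such that, up to shift, each graded simple module \<open>L\<close> satisfies
  \<open>r L \<noteq> 0\<close> for exactly one of them, say \<open>L = L\<^sub>r\<close>; moreover each \<open>L\<close> satisfies \<open>\<psi>(r) L \<noteq> 0\<close> for some \<open>r\<close>.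
  The pairing \<open>\<langle>P, M\<rangle>\<close> is additive in both variables, as \<open>P\<^sup>\<psi> \<otimes> M\<close> is the image of an idempotent on a
  power of \<open>M\<close>.  Composition series show that the \<open>L\<^sub>r\<close> generate \<open>G\<^sub>0\<^sup>f\<close>; splitting off summands
  \<open>A \<psi>(r)\<close>, which terminates as the total dimension of \<open>\<langle>P, \<Oplus>\<^sub>r L\<^sub>r\<rangle>\<close> decreases, shows that the \<open>A \<psi>(r)\<close>
  generate \<open>K\<^sub>\<oplus>\<close>.  Finally \<open>\<langle>A \<psi>(r), L\<^sub>s\<rangle>\<close> is the graded dimension of \<open>r L\<^sub>s\<close>: it is \<open>0\<close> for
  \<open>r \<noteq> s\<close>, nonzero for \<open>r = s\<close>, and \<open>1\<close> for \<open>r = s\<close> if the field is algebraically closed.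
\<close>

\<comment> \<open>\<open>A\<close> may be infinite-dimensional. Finiteness comes from the nice ideal
  lying in strictly positive or strictly negative degrees: it misses degree 0, so
  \<open>A\<^sub>0\<close> is finite-dimensional, and it kills graded simples, so they are too. In
  place of a radical and projective covers there is one tool: if \<open>e\<close> is local, an
  element of the corner \<open>e A\<^sub>0 e\<close> that fixes a nonzero vector is a unit of the
  corner. The tensor product is a quotient of a huge free space; a dual basis of \<open>P\<close>
  replaces it by explicit coordinate vectors, and only then can dimensions be compared. The twist
  explains why \<open>A \<psi>(r)\<close>, not \<open>A r\<close>, is paired with
  \<open>L\<^sub>r\<close>: moving \<open>\<psi>(r)\<close> across the tensor sign undoes
  \<open>\<psi>\<close>. Over a general field the diagonal entries are only nonzero Laurent
  polynomials. That is enough for non-degeneracy, because these have no zero divisors, but not for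
  dual bases. Over an algebraically closed field Schur's lemma turns the entries into 1, provided
  \<open>L\<^sub>r\<close> is shifted so that \<open>r\<close> fixes a nonzero vector of degree 0.
  All modules must share one type; quotients are therefore carried by chosen
  representatives.\<close>
syntax "_index" :: "logic \<Rightarrow> index"  (\<open>\<^sub>_\<close> [1000] 1000)

section \<open>Graded abelian groups\<close>

locale graded_grp = abelian_group M for M :: "('r, 'm, 'z) gmodule_scheme" (structure) +
 assumes component_subgroup: "subgroup (component M i) (add_monoid M)"
  and decomposition_ex1: "x \<in> carrier M ==> \<exists>!f. decomposition M x f"

lemma graded_grp_iff: "graded_group M \<longleftrightarrow> graded_grp M"
 unfolding graded_group_def graded_grp_def graded_grp_axioms_def by auto

context abelian_group
begin

lemma finsum_support:
 assumes "finite J" "{i. f i ~= \<zero>} \<subseteq> J" "!!i. f i \<in> carrier G"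
 shows "(\<Oplus>i\<in>{i. f i ~= \<zero>}. f i) = (\<Oplus>i\<in>J. f i)"
 by (rule add.finprod_mono_neutral_cong_left) (use assms in auto)

lemma finsum_delta:
 assumes "finite J" "x \<in> carrier G"
 shows "(\<Oplus>i\<in>J. if i = j then x else \<zero>) = (if j \<in> J then x else \<zero>)"
proof (cases "j \<in> J")
 case True
 have "(\<Oplus>i\<in>J. if i = j then x else \<zero>) = (\<Oplus>i\<in>{j}. x)"
  by (rule add.finprod_mono_neutral_cong_right) (use assms True in auto)
 then show ?thesis using assms True by simp
next
 case False
 then have "(\<Oplus>i\<in>J. if i = j then x else \<zero>) = (\<Oplus>i\<in>J. \<zero>)"
  by (intro finsum_cong') auto
 then show ?thesis using False by simp
qed

lemma minus_zero_iff: "x \<in> carrier G ==> y \<in> carrier G ==> x \<ominus> y = \<zero> \<longleftrightarrow> x = y"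
 by (metis a_minus_def add.inv_closed minus_equality minus_minus r_neg)

lemma minus_zero_r: "x \<in> carrier G ==> x \<ominus> \<zero> = x"
 by (simp add: a_minus_def)

lemma minus_add_cancel: "x \<in> carrier G ==> y \<in> carrier G ==> (x \<ominus> y) \<oplus> y = x"
 by (simp add: a_minus_def a_assoc l_neg)

lemma eq_minusI: "y \<in> carrier G ==> z \<in> carrier G ==> x = z \<oplus> y ==> x \<ominus> y = z"
 by (simp add: a_minus_def a_assoc r_neg)

lemma minus_trans:
 "x \<in> carrier G ==> y \<in> carrier G ==> z \<in> carrier G ==> (x \<ominus> y) \<oplus> (y \<ominus> z) = x \<ominus> z"
 by (simp add: a_minus_def a_assoc r_neg1)

lemma minus_minus_r:
 "x \<in> carrier G ==> y \<in> carrier G ==> z \<in> carrier G ==> (x \<ominus> z) \<ominus> (y \<ominus> z) = x \<ominus> y"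
 by (rule eq_minusI) (simp_all add: minus_trans)

lemma minus_minus_l:
 "x \<in> carrier G ==> y \<in> carrier G ==> z \<in> carrier G ==> (x \<ominus> z) \<ominus> (x \<ominus> y) = y \<ominus> z"
 by (rule eq_minusI) (simp_all add: minus_trans a_comm[of "y \<ominus> z"])

lemma add_minus_add:
 "x \<in> carrier G ==> y \<in> carrier G ==> x' \<in> carrier G ==> y' \<in> carrier G ==>
  (x \<ominus> x') \<oplus> (y \<ominus> y') = (x \<oplus> y) \<ominus> (x' \<oplus> y')"
 by (simp add: a_minus_def minus_add a_ac)

lemma subgroup_finsum:
 assumes "subgroup N (add_monoid G)" "!!i. i \<in> J ==> f i \<in> N"
 shows "(\<Oplus>i\<in>J. f i) \<in> N"
 using assms(2)
proof (induct J rule: infinite_finite_induct)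
 case (insert a J)
 have "N \<subseteq> carrier G" using subgroup.subset[OF assms(1)] by simp
 then have "(\<Oplus>i\<in>insert a J. f i) = f a \<oplus> (\<Oplus>i\<in>J. f i)"
  using insert by (intro finsum_insert) auto
 then show ?case using insert subgroup.m_closed[OF assms(1)] by simp
qed (use subgroup.one_closed[OF assms(1)] in auto)

end

context graded_grp
begin

lemma component_closed: "x \<in> component M i ==> x \<in> carrier M"
 using subgroup.subset[OF component_subgroup] by auto

lemma component_zero: "\<zero> \<in> component M i"
 using subgroup.one_closed[OF component_subgroup] by simp

lemma component_add: "x \<in> component M i ==> y \<in> component M i ==> x \<oplus> y \<in> component M i"
 using subgroup.m_closed[OF component_subgroup] by simp

lemma component_neg: "x \<in> component M i ==> \<ominus> x \<in> component M i"
 using subgroup.m_inv_closed[OF component_subgroup] by (simp add: a_inv_def)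

lemma component_minus: "x \<in> component M i ==> y \<in> component M i ==> x \<ominus> y \<in> component M i"
 by (simp add: a_minus_def component_add component_neg)

lemma component_finsum: "(!!i. i \<in> J ==> f i \<in> component M k) ==> (\<Oplus>i\<in>J. f i) \<in> component M k"
 by (rule subgroup_finsum[OF component_subgroup])

lemma decomposition_hcomp: "x \<in> carrier M ==> decomposition M x (hcomp M x)"
 unfolding hcomp_def using decomposition_ex1 by (rule theI')

lemma hcomp_component: "x \<in> carrier M ==> hcomp M x i \<in> component M i"
 using decomposition_hcomp by (auto simp: decomposition_def)

lemma hcomp_closed: "x \<in> carrier M ==> hcomp M x i \<in> carrier M"
 using hcomp_component component_closed by blast

lemma hcomp_finite: "x \<in> carrier M ==> finite {i. hcomp M x i ~= \<zero>}"
 using decomposition_hcomp by (auto simp: decomposition_def)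

lemma hcomp_sum:
 assumes "x \<in> carrier M" "finite J" "{i. hcomp M x i ~= \<zero>} \<subseteq> J"
 shows "x = (\<Oplus>i\<in>J. hcomp M x i)"
proof -
 have "x = (\<Oplus>i\<in>{i. hcomp M x i ~= \<zero>}. hcomp M x i)"
  using decomposition_hcomp[OF assms(1)] by (auto simp: decomposition_def)
 also have "\<dots> = (\<Oplus>i\<in>J. hcomp M x i)"
  by (rule finsum_support) (use assms hcomp_closed in auto)
 finally show ?thesis .
qed

text \<open>Uniqueness of decompositions does all the work: a finitely supported homogeneous family
  with the right sum must be the family of components. \<open>J\<close> may exceed the support, so
  any convenient finite index set can be supplied.\<close>

lemma hcomp_eqI:
 assumes f: "!!i. f i \<in> component M i" and J: "finite J" "!!i. i \<notin> J ==> f i = \<zero>"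
  and x: "x = (\<Oplus>i\<in>J. f i)"
 shows "hcomp M x = f"
proof -
 have fc: "f i \<in> carrier M" for i using f component_closed by blast
 have sub: "{i. f i ~= \<zero>} \<subseteq> J" using J by auto
 have "decomposition M x f"
  unfolding decomposition_def
  using f finite_subset[OF sub J(1)] finsum_support[OF J(1) sub fc] x by auto
 moreover have "x \<in> carrier M" using x fc by auto
 ultimately show ?thesis
  using decomposition_hcomp decomposition_ex1 by blast
qed

lemma hcomp_homogeneous:
 assumes "x \<in> component M j"
 shows "hcomp M x i = (if i = j then x else \<zero>)"
proof -
 have "hcomp M x = (%i. if i = j then x else \<zero>)"
  by (rule hcomp_eqI[where J = "{j}"]) (use assms component_zero component_closed in auto)
 then show ?thesis by simp
qed

lemma hcomp_add:
 assumes "x \<in> carrier M" "y \<in> carrier M"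
 shows "hcomp M (x \<oplus> y) i = hcomp M x i \<oplus> hcomp M y i"
proof -
 let ?J = "{i. hcomp M x i ~= \<zero>} \<union> {i. hcomp M y i ~= \<zero>}"
 have fin: "finite ?J" using assms hcomp_finite by auto
 have "hcomp M (x \<oplus> y) = (%i. hcomp M x i \<oplus> hcomp M y i)"
 proof (rule hcomp_eqI[OF _ fin])
  show "x \<oplus> y = (\<Oplus>i\<in>?J. hcomp M x i \<oplus> hcomp M y i)"
   using hcomp_sum[OF assms(1) fin] hcomp_sum[OF assms(2) fin] assms hcomp_closed
   by (subst finsum_addf) auto
 qed (use assms hcomp_component component_add in auto)
 then show ?thesis by simp
qed

lemma hcomp_zero: "hcomp M \<zero> i = \<zero>"
 using hcomp_homogeneous[OF component_zero, of i i] by simp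

lemma hcomp_neg:
 assumes "x \<in> carrier M"
 shows "hcomp M (\<ominus> x) i = \<ominus> hcomp M x i"
proof -
 have "hcomp M x i \<oplus> hcomp M (\<ominus> x) i = \<zero>"
  using hcomp_add[of x "\<ominus> x" i] assms by (simp add: r_neg hcomp_zero)
 then show ?thesis using assms hcomp_closed
  by (metis add.inv_closed add.inv_equality add.m_comm)
qed

lemma hcomp_minus:
 assumes "x \<in> carrier M" "y \<in> carrier M"
 shows "hcomp M (x \<ominus> y) i = hcomp M x i \<ominus> hcomp M y i"
 using assms by (simp add: a_minus_def hcomp_add hcomp_neg)

lemma hcomp_finsum:
 assumes "!!s. s \<in> S ==> f s \<in> carrier M"
 shows "hcomp M (\<Oplus>s\<in>S. f s) i = (\<Oplus>s\<in>S. hcomp M (f s) i)"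
 using assms
proof (induct S rule: infinite_finite_induct)
 case (insert a S)
 then have "(\<Oplus>s\<in>insert a S. f s) = f a \<oplus> (\<Oplus>s\<in>S. f s)"
  "(\<Oplus>s\<in>insert a S. hcomp M (f s) i) = hcomp M (f a) i \<oplus> (\<Oplus>s\<in>S. hcomp M (f s) i)"
  using hcomp_closed by (auto intro!: finsum_insert)
 moreover have "(\<Oplus>s\<in>S. f s) \<in> carrier M" using insert by auto
 ultimately show ?case using insert by (simp add: hcomp_add)
qed (auto simp: hcomp_zero)

lemma eq_zeroI: "x \<in> carrier M ==> (!!i. hcomp M x i = \<zero>) ==> x = \<zero>"
 using hcomp_sum[of x "{}"] by simp

lemma subgroup_hcompI:
 assumes "subgroup N (add_monoid M)" "x \<in> carrier M" "!!i. hcomp M x i \<in> N"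
 shows "x \<in> N"
 using hcomp_sum[OF assms(2) hcomp_finite[OF assms(2)] subset_refl]
  subgroup_finsum[OF assms(1), of _ "hcomp M x"] assms(3) by metis

text \<open>An element is a finite sum of its components, so an additive property needs to be
  checked on homogeneous elements only.\<close>

lemma homogeneous_induct [consumes 1, case_names zero homogeneous add]:
 assumes x: "x \<in> carrier M" and z: "P \<zero>"
  and hom: "!!i y. y \<in> component M i ==> P y"
  and add: "!!y z. y \<in> carrier M ==> z \<in> carrier M ==> P y ==> P z ==> P (y \<oplus> z)"
 shows "P x"
proof -
 have "P (\<Oplus>i\<in>J. hcomp M x i)" if "finite J" for J
  using that
 proof (induct J)
  case (insert a J)
  then have "(\<Oplus>i\<in>insert a J. hcomp M x i) = hcomp M x a \<oplus> (\<Oplus>i\<in>J. hcomp M x i)"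
   using x hcomp_closed by (intro finsum_insert) auto
  moreover have "(\<Oplus>i\<in>J. hcomp M x i) \<in> carrier M" using x hcomp_closed by (intro finsum_closed) auto
  ultimately show ?case
   using insert add[OF hcomp_closed[OF x, of a], of "\<Oplus>i\<in>J. hcomp M x i"] hom[OF hcomp_component[OF x, of a]]
   by simp
 qed (use z in auto)
 then show ?thesis
  using hcomp_sum[OF x hcomp_finite[OF x] subset_refl] hcomp_finite[OF x] by metis
qed

end

text \<open>A grading is recognised by candidate projections \<open>\<pi>\<close>. Their additivity
  and their values on homogeneous elements force every decomposition of \<open>x\<close> to be
  \<open>\<pi> x\<close>, so that uniqueness need not be argued again for submodules, shifts and
  quotients.\<close>

lemma graded_grpI:
 fixes M :: "('r, 'm, 'z) gmodule_scheme" (structure)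
 assumes ag: "abelian_group M" and sub: "!!i. subgroup (component M i) (add_monoid M)"
  and comp: "!!x i. x \<in> carrier M ==> \<pi> x i \<in> component M i"
  and fin: "!!x. x \<in> carrier M ==> finite {i. \<pi> x i ~= \<zero>}"
  and sum: "!!x. x \<in> carrier M ==> x = (\<Oplus>i\<in>{i. \<pi> x i ~= \<zero>}. \<pi> x i)"
  and add: "!!x y i. x \<in> carrier M ==> y \<in> carrier M ==> \<pi> (x \<oplus> y) i = \<pi> x i \<oplus> \<pi> y i"
  and hom: "!!x i j. x \<in> component M j ==> \<pi> x i = (if i = j then x else \<zero>)"
 shows "graded_grp M" and "!!x i. x \<in> carrier M ==> hcomp M x i = \<pi> x i"
proof -
 interpret abelian_group M by (rule ag)
 have cl: "x \<in> component M i ==> x \<in> carrier M" for x i using subgroup.subset[OF sub] by auto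
 have pz: "\<pi> \<zero> i = \<zero>" for i
  using hom[of \<zero> i i] subgroup.one_closed[OF sub, of i] by simp
 have ex: "decomposition M x (\<pi> x)" if "x \<in> carrier M" for x
  unfolding decomposition_def using comp fin sum that by auto
 have un: "f = \<pi> x" if x: "x \<in> carrier M" and d: "decomposition M x f" for x f
 proof
  fix k
  have f: "f i \<in> component M i" for i using d by (auto simp: decomposition_def)
  \<comment> \<open>Applying the \<open>k\<close>-th projection to a finite sum of homogeneous terms
    isolates the \<open>k\<close>-th term.\<close>
  have *: "\<pi> (\<Oplus>i\<in>J. f i) k = (if k \<in> J then f k else \<zero>)" if "finite J" for J
   using that
  proof (induct J)
   case (insert a J)
   have "(\<Oplus>i\<in>insert a J. f i) = f a \<oplus> (\<Oplus>i\<in>J. f i)"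
    using insert f cl by (intro finsum_insert) auto
   moreover have "(\<Oplus>i\<in>J. f i) \<in> carrier M" using f cl by (intro finsum_closed) auto
   moreover have "f i \<in> carrier M" for i using cl[OF f] .
   ultimately show ?case using insert add[of "f a" "\<Oplus>i\<in>J. f i" k] hom[OF f, of a k]
    by auto
  qed (simp add: pz)
  have "finite {i. f i ~= \<zero>}" "x = (\<Oplus>i\<in>{i. f i ~= \<zero>}. f i)"
   using d by (auto simp: decomposition_def)
  then show "f k = \<pi> x k" using *[of "{i. f i ~= \<zero>}"] by auto
 qed
 show g: "graded_grp M"
  by (intro graded_grp.intro ag graded_grp_axioms.intro sub) (use ex un in metis)
 show "hcomp M x i = \<pi> x i" if "x \<in> carrier M" for x i
  using un[OF that] graded_grp.decomposition_hcomp[OF g that] by metis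
qed

section \<open>Graded modules\<close>

context left_module
begin

lemma smult_zero_l: "x \<in> carrier M ==> \<zero>\<^sub>R \<odot>\<^sub>M x = \<zero>\<^sub>M"
 by (metis M.r_zero M.add.l_cancel R.l_zero R.zero_closed M.zero_closed smult_closed smult_l_distr)

lemma smult_zero_r: "a \<in> carrier R ==> a \<odot>\<^sub>M \<zero>\<^sub>M = \<zero>\<^sub>M"
 by (metis M.r_zero M.add.l_cancel M.l_zero M.zero_closed smult_closed smult_r_distr)

lemma smult_neg_l: "a \<in> carrier R ==> x \<in> carrier M ==> (\<ominus>\<^sub>R a) \<odot>\<^sub>M x = \<ominus>\<^sub>M (a \<odot>\<^sub>M x)"
 by (metis M.minus_equality R.a_inv_closed R.l_neg smult_closed smult_l_distr smult_zero_l)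

lemma smult_neg_r: "a \<in> carrier R ==> x \<in> carrier M ==> a \<odot>\<^sub>M (\<ominus>\<^sub>M x) = \<ominus>\<^sub>M (a \<odot>\<^sub>M x)"
 by (metis M.minus_equality M.a_inv_closed M.l_neg smult_closed smult_r_distr smult_zero_r)

lemma smult_minus_l:
 "a \<in> carrier R ==> b \<in> carrier R ==> x \<in> carrier M ==>
  (a \<ominus>\<^sub>R b) \<odot>\<^sub>M x = a \<odot>\<^sub>M x \<ominus>\<^sub>M b \<odot>\<^sub>M x"
 by (simp add: a_minus_def smult_l_distr smult_neg_l)

lemma smult_minus_r:
 "a \<in> carrier R ==> x \<in> carrier M ==> y \<in> carrier M ==>
  a \<odot>\<^sub>M (x \<ominus>\<^sub>M y) = a \<odot>\<^sub>M x \<ominus>\<^sub>M a \<odot>\<^sub>M y"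
 by (simp add: a_minus_def smult_r_distr smult_neg_r)

end

lemma additive_zero:
 assumes "abelian_group M" "abelian_group N" "h \<in> carrier M \<rightarrow> carrier N"
  "!!x y. x \<in> carrier M ==> y \<in> carrier M ==> h (x \<oplus>\<^sub>M y) = h x \<oplus>\<^sub>N h y"
 shows "h \<zero>\<^sub>M = \<zero>\<^sub>N"
proof -
 interpret M: abelian_group M by fact
 interpret N: abelian_group N by fact
 have "h \<zero>\<^sub>M \<oplus>\<^sub>N h \<zero>\<^sub>M = h \<zero>\<^sub>M" using assms(4)[of "\<zero>\<^sub>M" "\<zero>\<^sub>M"] by simp
 then show ?thesis using assms(3) by (auto simp: Pi_def)
qed

lemma additive_finsum:
 assumes M: "abelian_group M" and N: "abelian_group N" and h: "h \<in> carrier M \<rightarrow> carrier N"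
  and add: "!!x y. x \<in> carrier M ==> y \<in> carrier M ==> h (x \<oplus>\<^sub>M y) = h x \<oplus>\<^sub>N h y"
  and f: "!!i. i \<in> J ==> f i \<in> carrier M"
 shows "h (\<Oplus>\<^sub>M i\<in>J. f i) = (\<Oplus>\<^sub>N i\<in>J. h (f i))"
proof -
 interpret M: abelian_group M by fact
 interpret N: abelian_group N by fact
 show ?thesis using f
 proof (induct J rule: infinite_finite_induct)
  case (insert a J)
  then have "(\<Oplus>\<^sub>M i\<in>insert a J. f i) = f a \<oplus>\<^sub>M (\<Oplus>\<^sub>M i\<in>J. f i)"
   "(\<Oplus>\<^sub>N i\<in>insert a J. h (f i)) = h (f a) \<oplus>\<^sub>N (\<Oplus>\<^sub>N i\<in>J. h (f i))"
   using h by (auto intro!: M.finsum_insert N.finsum_insert)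
  then show ?case using insert add h by (simp add: Pi_def)
 qed (use additive_zero[OF M N h add] in auto)
qed

context left_module
begin

lemma smult_finsum_r:
 assumes "a \<in> carrier R" "!!i. i \<in> J ==> f i \<in> carrier M"
 shows "a \<odot>\<^sub>M (\<Oplus>\<^sub>M i\<in>J. f i) = (\<Oplus>\<^sub>M i\<in>J. a \<odot>\<^sub>M f i)"
 by (rule additive_finsum[OF M.abelian_group_axioms M.abelian_group_axioms])
  (use assms smult_closed smult_r_distr in auto)

lemma smult_finsum_l:
 assumes "x \<in> carrier M" "!!i. i \<in> J ==> f i \<in> carrier R"
 shows "(\<Oplus>\<^sub>R i\<in>J. f i) \<odot>\<^sub>M x = (\<Oplus>\<^sub>M i\<in>J. f i \<odot>\<^sub>M x)"
 by (rule additive_finsum[OF R.abelian_group_axioms M.abelian_group_axioms])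
  (use assms smult_closed smult_l_distr in auto)

end

lemma (in abelian_group) add_subgroupI:
 assumes "N \<subseteq> carrier G" "\<zero> \<in> N" "!!x y. x \<in> N ==> y \<in> N ==> x \<oplus> y \<in> N"
  "!!x. x \<in> N ==> \<ominus> x \<in> N"
 shows "subgroup N (add_monoid G)"
 using assms by (intro subgroup.intro) (auto simp: a_inv_def)

locale graded_alg =
 fixes K :: "'k ring" and A :: "('k, 'a) gmodule" (structure)
 assumes field_K: "field K" and graded_algebra: "graded_algebra K A"
begin

sublocale ring A
 using graded_algebra by (simp add: graded_algebra_def)

sublocale GA: graded_grp A
 using graded_algebra by (simp add: graded_algebra_def graded_grp_iff)

sublocale KA: vectorspace K A
 using graded_algebra by (simp add: graded_algebra_def)

lemma cring_K: "cring K"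
 using field_K by (simp add: field_def domain_def)

lemma smult_mult_l: "c \<in> carrier K ==> x \<in> carrier A ==> y \<in> carrier A ==>
  (c \<odot> x) \<otimes> y = c \<odot> (x \<otimes> y)"
 and smult_mult_r: "c \<in> carrier K ==> x \<in> carrier A ==> y \<in> carrier A ==>
  x \<otimes> (c \<odot> y) = c \<odot> (x \<otimes> y)"
 and smult_component: "c \<in> carrier K ==> x \<in> component A i ==> c \<odot> x \<in> component A i"
 and mult_component: "x \<in> component A i ==> y \<in> component A j ==> x \<otimes> y \<in> component A (i + j)"
 using graded_algebra unfolding graded_algebra_def by blast+

text \<open>The structure map from \<open>K\<close> to \<open>A\<close>. Through it \<open>K\<close>
  acts on every \<open>A\<close>-module, as in \<open>underlying_space\<close>, and its values are
  central of degree 0.\<close>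

definition scalar :: "'k => 'a" where
 "scalar c = c \<odot> \<one>"

end

locale graded_mod = graded_alg K A for K :: "'k ring" and A :: "('k, 'a) gmodule" (structure) +
 fixes M :: "('a, 'm) gmodule"
 assumes graded_module: "graded_module A M"
begin

sublocale M: left_module A M
 using graded_module by (simp add: graded_module_def)

sublocale M: graded_grp M
 using graded_module by (simp add: graded_module_def graded_grp_iff)

lemma smult_component_M: "a \<in> component A i ==> x \<in> component M j ==> a \<odot>\<^sub>M x \<in> component M (i + j)"
 using graded_module by (simp add: graded_module_def)

lemma hcomp_smult_l:
 assumes a: "a \<in> component A i" and x: "x \<in> carrier M"
 shows "hcomp M (a \<odot>\<^sub>M x) k = a \<odot>\<^sub>M hcomp M x (k - i)"
proof -
 have ac: "a \<in> carrier A" using a GA.component_closed by blast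
 let ?J = "{i. hcomp M x i ~= \<zero>\<^sub>M}"
 have fin: "finite ?J" using x M.hcomp_finite by blast
 have "hcomp M (a \<odot>\<^sub>M x) = (%k. a \<odot>\<^sub>M hcomp M x (k - i))"
 proof (rule M.hcomp_eqI[where J = "(%j. j + i) ` ?J"])
  fix k
  show "a \<odot>\<^sub>M hcomp M x (k - i) \<in> component M k"
   using smult_component_M[OF a M.hcomp_component[OF x, of "k - i"]] by simp
  show "a \<odot>\<^sub>M hcomp M x (k - i) = \<zero>\<^sub>M" if "k \<notin> (%j. j + i) ` ?J"
  proof -
   have "k - i \<notin> ?J" using that by (metis diff_add_cancel image_eqI)
   then show ?thesis using M.smult_zero_r[OF ac] by simp
  qed
 next
  have "a \<odot>\<^sub>M x = a \<odot>\<^sub>M (\<Oplus>\<^sub>M j\<in>?J. hcomp M x j)"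
   using M.hcomp_sum[OF x fin subset_refl] by simp
  also have "\<dots> = (\<Oplus>\<^sub>M j\<in>?J. a \<odot>\<^sub>M hcomp M x j)"
   using ac M.hcomp_closed[OF x] by (intro M.smult_finsum_r) auto
  also have "\<dots> = (\<Oplus>\<^sub>M j\<in>?J. a \<odot>\<^sub>M hcomp M x ((j + i) - i))" by simp
  also have "\<dots> = (\<Oplus>\<^sub>M k\<in>(%j. j + i) ` ?J. a \<odot>\<^sub>M hcomp M x (k - i))"
   using M.smult_closed[OF ac M.hcomp_closed[OF x]]
   by (intro M.finsum_reindex[symmetric]) (auto simp: inj_on_def)
  finally show "a \<odot>\<^sub>M x = (\<Oplus>\<^sub>M k\<in>(%j. j + i) ` ?J. a \<odot>\<^sub>M hcomp M x (k - i))" .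
 qed (use fin in auto)
 then show ?thesis by simp
qed

text \<open>With a homogeneous vector \<open>x\<close>, the components of \<open>a x\<close> come
  from those of \<open>a\<close>. This makes the cyclic submodule \<open>A x\<close> homogeneous and
  allows homogeneous coefficients to be extracted.\<close>

lemma hcomp_smult_r:
 assumes a: "a \<in> carrier A" and x: "x \<in> component M j"
 shows "hcomp M (a \<odot>\<^sub>M x) k = hcomp A a (k - j) \<odot>\<^sub>M x"
 using a
proof (induct rule: GA.homogeneous_induct)
 case (homogeneous i y)
 have "y \<in> carrier A" "x \<in> carrier M" using homogeneous x GA.component_closed M.component_closed by auto
 then show ?case
  using hcomp_smult_l[OF homogeneous, of x k] GA.hcomp_homogeneous[OF homogeneous, of "k - j"] M.hcomp_homogeneous[OF x, of "k - i"]
  by (auto simp: M.smult_zero_l M.smult_zero_r)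
next
 case (add y z)
 moreover have "x \<in> carrier M" using x M.component_closed by auto
 ultimately show ?case
  by (simp add: M.smult_l_distr M.smult_closed M.hcomp_add GA.hcomp_add GA.hcomp_closed)
qed (use x M.component_closed in \<open>auto simp: M.smult_zero_l GA.hcomp_zero M.hcomp_zero\<close>)

end

text \<open>Unlike \<open>regular_left\<close>, this record carries the grading, so that facts about
  graded modules apply to \<open>A\<close> itself.\<close>

definition graded_regular :: "('k, 'a) gmodule => ('a, 'a) gmodule" where
 "graded_regular A = \<lparr>carrier = carrier A, monoid.mult = monoid.mult A, one = \<one>\<^sub>A, zero = \<zero>\<^sub>A, add = add A,
   smult = monoid.mult A, component = component A\<rparr>"

lemma graded_regular_sel [simp]:
 "carrier (graded_regular A) = carrier A" "\<zero>\<^bsub>graded_regular A\<^esub> = \<zero>\<^sub>A"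
 "add (graded_regular A) = add A" "component (graded_regular A) = component A"
 "smult (graded_regular A) = monoid.mult A"
 by (auto simp: graded_regular_def)

text \<open>Sums, subgroups and components depend only on carrier, addition, zero and grading. This
  lemma and its companions move facts between records of different types that agree in these
  fields.\<close>

lemma finsum_cong_struct:
 assumes "carrier M = carrier N" "add M = add N" "\<zero>\<^sub>M = \<zero>\<^sub>N"
 shows "finsum M f J = finsum N f J"
 using assms by (simp add: finsum_def finprod_def)

lemma abelian_group_cong_struct:
 assumes "carrier M = carrier N" "add M = add N" "\<zero>\<^sub>M = \<zero>\<^sub>N" "abelian_group N"
 shows "abelian_group M"
proof -
 interpret N: abelian_group N by fact
 show ?thesis by (rule abelian_groupI) (use assms(1-3) N.a_assoc N.a_comm N.l_neg in auto)
qed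

lemma subgroup_cong_struct:
 assumes "carrier M = carrier N" "add M = add N" "\<zero>\<^sub>M = \<zero>\<^sub>N"
  "subgroup H (add_monoid N)"
 shows "subgroup H (add_monoid M)"
 using assms by (simp add: subgroup_def m_inv_def)

lemma hcomp_cong_struct:
 assumes "carrier M = carrier N" "add M = add N" "\<zero>\<^sub>M = \<zero>\<^sub>N" "component M = component N"
 shows "hcomp M = hcomp N"
 unfolding hcomp_def decomposition_def finsum_cong_struct[OF assms(1-3)] assms by (rule refl)

lemma graded_grp_cong_struct:
 assumes "carrier M = carrier N" "add M = add N" "\<zero>\<^sub>M = \<zero>\<^sub>N" "component M = component N"
  "graded_grp N"
 shows "graded_grp M"
 using assms(5) abelian_group_cong_struct[OF assms(1-3)] subgroup_cong_struct[OF assms(1-3)]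
 unfolding graded_grp_def graded_grp_axioms_def decomposition_def finsum_cong_struct[OF assms(1-3)]
  assms(2,3,4) assms(1)
 by metis

context graded_alg
begin

lemma graded_module_regular: "graded_module A (graded_regular A)"
proof -
 have "graded_grp (graded_regular A)"
  by (rule graded_grp_cong_struct[OF _ _ _ _ GA.graded_grp_axioms]) auto
 moreover have "left_module A (graded_regular A)"
  by (intro left_module.intro left_module_axioms.intro ring_axioms abelian_group_cong_struct[OF _ _ _ abelian_group_axioms])
   (auto simp: l_distr r_distr m_assoc)
 ultimately show ?thesis by (auto simp: graded_module_def graded_grp_iff mult_component)
qed

lemma hcomp_regular: "hcomp (graded_regular A) = hcomp A"
 by (rule hcomp_cong_struct) auto

lemma hcomp_mult_l:
 "a \<in> component A i ==> x \<in> carrier A ==> hcomp A (a \<otimes> x) k = a \<otimes> hcomp A x (k - i)"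
 using graded_mod.hcomp_smult_l[of K A "graded_regular A"]
 by (simp add: hcomp_regular graded_mod_def graded_mod_axioms_def graded_module_regular graded_alg_axioms)

lemma hcomp_mult_r:
 "a \<in> carrier A ==> x \<in> component A j ==> hcomp A (a \<otimes> x) k = hcomp A a (k - j) \<otimes> x"
 using graded_mod.hcomp_smult_r[of K A "graded_regular A"]
 by (simp add: hcomp_regular graded_mod_def graded_mod_axioms_def graded_module_regular graded_alg_axioms)

text \<open>The degree 0 component of 1 acts as a left unit on homogeneous elements, since
  multiplying by any other component changes the degree. Hence it is a left unit on all of
  \<open>A\<close> and equals 1.\<close>

lemma one_component: "\<one> \<in> component A 0"
proof -
 let ?e = "hcomp A \<one> 0"
 have e: "?e \<in> component A 0" "?e \<in> carrier A" by (auto intro: GA.hcomp_component GA.hcomp_closed)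
 have "?e \<otimes> x = x" if "x \<in> carrier A" for x
  using that
 proof (induct rule: GA.homogeneous_induct)
  case (homogeneous i y)
  then show ?case
   using hcomp_mult_r[OF one_closed homogeneous, of i] GA.component_closed[OF homogeneous] GA.hcomp_homogeneous[OF homogeneous, of i] by simp
 next
  case (add y z)
  then show ?case using e by (simp add: r_distr)
 qed (use e in auto)
 from this[OF one_closed] show ?thesis using e by simp
qed

lemma scalar_closed: "c \<in> carrier K ==> scalar c \<in> carrier A"
 by (simp add: scalar_def)

lemma scalar_component: "c \<in> carrier K ==> scalar c \<in> component A 0"
 by (simp add: scalar_def smult_component one_component)

lemma scalar_add: "c \<in> carrier K ==> d \<in> carrier K ==> scalar (c \<oplus>\<^sub>K d) = scalar c \<oplus> scalar d"
 by (simp add: scalar_def KA.smult_l_distr)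

lemma scalar_mult_l: "c \<in> carrier K ==> x \<in> carrier A ==> scalar c \<otimes> x = c \<odot> x"
 by (simp add: scalar_def smult_mult_l)

lemma scalar_mult_r: "c \<in> carrier K ==> x \<in> carrier A ==> x \<otimes> scalar c = c \<odot> x"
 by (simp add: scalar_def smult_mult_r)

lemma scalar_mult: "c \<in> carrier K ==> d \<in> carrier K ==> scalar (c \<otimes>\<^sub>K d) = scalar c \<otimes> scalar d"
 by (simp add: scalar_mult_l scalar_closed) (simp add: scalar_def KA.smult_assoc1)

lemma scalar_one: "scalar \<one>\<^sub>K = \<one>"
 by (simp add: scalar_def)

end

lemma underlying_sel [simp]:
 "carrier (underlying_space A M) = carrier M" "\<zero>\<^bsub>underlying_space A M\<^esub> = \<zero>\<^sub>M"
 "add (underlying_space A M) = add M" "smult (underlying_space A M) c x = (c \<odot>\<^sub>A \<one>\<^sub>A) \<odot>\<^sub>M x"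
 by (auto simp: underlying_space_def pullback_def)

context graded_mod
begin

lemma underlying_vectorspace: "vectorspace K (underlying_space A M)"
proof -
 have "Module.module K (underlying_space A M)"
 proof (rule moduleI)
  show "abelian_group (underlying_space A M)"
   by (rule abelian_group_cong_struct[OF _ _ _ M.abelian_group_axioms]) auto
 qed (simp_all add: scalar_def[symmetric] scalar_closed scalar_add scalar_mult scalar_one
   M.smult_closed M.smult_l_distr M.smult_r_distr M.smult_assoc M.smult_one cring_K)
 then show ?thesis using field_K by (simp add: vectorspace_def)
qed

sublocale KM: vectorspace K "underlying_space A M"
 by (rule underlying_vectorspace)

end

subsection \<open>Homomorphisms, submodules and quotients\<close>

lemma left_moduleI:
 assumes "ring R" "abelian_group M"
  "!!a x. a \<in> carrier R ==> x \<in> carrier M ==> a \<odot>\<^sub>M x \<in> carrier M"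
  "!!a b x. a \<in> carrier R ==> b \<in> carrier R ==> x \<in> carrier M ==>
   (a \<oplus>\<^sub>R b) \<odot>\<^sub>M x = a \<odot>\<^sub>M x \<oplus>\<^sub>M b \<odot>\<^sub>M x"
  "!!a x y. a \<in> carrier R ==> x \<in> carrier M ==> y \<in> carrier M ==>
   a \<odot>\<^sub>M (x \<oplus>\<^sub>M y) = a \<odot>\<^sub>M x \<oplus>\<^sub>M a \<odot>\<^sub>M y"
  "!!a b x. a \<in> carrier R ==> b \<in> carrier R ==> x \<in> carrier M ==>
   (a \<otimes>\<^sub>R b) \<odot>\<^sub>M x = a \<odot>\<^sub>M (b \<odot>\<^sub>M x)"
  "!!x. x \<in> carrier M ==> \<one>\<^sub>R \<odot>\<^sub>M x = x"
 shows "left_module R M"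
 using assms by (intro left_module.intro left_module_axioms.intro) auto

definition graded_submodule :: "('k, 'a) gmodule => 'm set => ('a, 'm) gmodule => bool" where
 "graded_submodule A N M \<longleftrightarrow> left_submodule A N M \<and> homogeneous_subset M N"

definition submod :: "('a, 'm) gmodule => 'm set => ('a, 'm) gmodule" where
 "submod M N = M\<lparr>carrier := N, component := (%i. component M i \<inter> N)\<rparr>"

lemma submod_sel [simp]:
 "carrier (submod M N) = N" "add (submod M N) = add M" "\<zero>\<^bsub>submod M N\<^esub> = \<zero>\<^sub>M"
 "smult (submod M N) = smult M" "component (submod M N) i = component M i \<inter> N"
 by (auto simp: submod_def)

text \<open>
  The module structure transported along a map \<open>\<rho>\<close> with kernel a submodule.  With \<open>\<rho>\<close> a choice of
  representatives this is a model of the quotient that stays within the same type; with \<open>\<rho>\<close>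
  injective it moves a module to another type.
\<close>

definition image_mod :: "('a, 'm) gmodule => ('m => 'n) => ('a, 'n) gmodule" where
 "image_mod M \<rho> = (let s = inv_into (carrier M) \<rho> in
   \<lparr>carrier = \<rho> ` carrier M, monoid.mult = undefined, one = undefined, zero = \<rho> \<zero>\<^sub>M,
   add = (%u v. \<rho> (s u \<oplus>\<^sub>M s v)), smult = (%a u. \<rho> (a \<odot>\<^sub>M s u)),
   component = (%i. \<rho> ` component M i)\<rparr>)"

lemma graded_homI:
 assumes "!!x. x \<in> carrier M ==> h x \<in> carrier N"
  "!!x y. x \<in> carrier M ==> y \<in> carrier M ==> h (x \<oplus>\<^sub>M y) = h x \<oplus>\<^sub>N h y"
  "!!a x. a \<in> carrier A ==> x \<in> carrier M ==> h (a \<odot>\<^sub>M x) = a \<odot>\<^sub>N h x"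
  "!!i x. x \<in> component M i ==> h x \<in> component N i"
 shows "h \<in> graded_hom A M N"
 using assms by (auto simp: graded_hom_def LinearCombinations.module_hom_def)

lemma graded_homD:
 assumes "h \<in> graded_hom A M N"
 shows "!!x. x \<in> carrier M ==> h x \<in> carrier N"
  "!!x y. x \<in> carrier M ==> y \<in> carrier M ==> h (x \<oplus>\<^sub>M y) = h x \<oplus>\<^sub>N h y"
  "!!a x. a \<in> carrier A ==> x \<in> carrier M ==> h (a \<odot>\<^sub>M x) = a \<odot>\<^sub>N h x"
  "!!i x. x \<in> component M i ==> h x \<in> component N i"
 using assms unfolding graded_hom_def LinearCombinations.module_hom_def by blast+

lemma graded_hom_compose:
 "h \<in> graded_hom A M N ==> g \<in> graded_hom A N L ==> (%x. g (h x)) \<in> graded_hom A M L"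
 by (intro graded_homI) (simp_all add: graded_homD)

lemma graded_hom_id: "(%x. x) \<in> graded_hom A M M"
 by (intro graded_homI) auto

lemma (in graded_grp) homogeneous_submod_grp:
 assumes N: "subgroup N (add_monoid M)" and hom: "homogeneous_subset M N"
  and P: "carrier P = N" "add P = add M" "\<zero>\<^sub>P = \<zero>" "!!i. component P i = component M i \<inter> N"
 shows "graded_grp P" "!!x i. x \<in> N ==> hcomp P x i = hcomp M x i" "!!x. x \<in> N ==> \<ominus>\<^sub>P x = \<ominus> x"
proof -
 have sub: "N \<subseteq> carrier M" using subgroup.subset[OF N] by simp
 have add: "x \<oplus> y \<in> N" if "x \<in> N" "y \<in> N" for x y using subgroup.m_closed[OF N] that by simp
 have neg: "\<ominus> x \<in> N" if "x \<in> N" for x using subgroup.m_inv_closed[OF N that] by (simp add: a_inv_def)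
 have z: "\<zero> \<in> N" using subgroup.one_closed[OF N] by simp
 have ag: "abelian_group P"
 proof (rule abelian_groupI)
  fix x assume "x \<in> carrier P"
  then have "\<ominus> x \<in> carrier P" "\<ominus> x \<oplus>\<^sub>P x = \<zero>\<^sub>P" using sub neg P by (auto simp: l_neg)
  then show "\<exists>y\<in>carrier P. y \<oplus>\<^sub>P x = \<zero>\<^sub>P" by blast
 qed (use sub add z P in \<open>auto simp: subset_iff a_ac\<close>)
 interpret P: abelian_group P by (rule ag)
 show ng: "\<ominus>\<^sub>P x = \<ominus> x" if "x \<in> N" for x
  using P.minus_equality[of "\<ominus> x" x] that neg sub P by (auto simp: l_neg)
 have fs: "finsum P f J = finsum M f J" if "!!i. i \<in> J ==> f i \<in> N" for f :: "int => _" and J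
  by (rule additive_finsum[OF ag abelian_group_axioms, of "%x. x"]) (use sub that P in auto)
 have h: "hcomp M x i \<in> N" if "x \<in> N" for x i using that hom by (auto simp: homogeneous_subset_def)
 have cs: "subgroup (component P i) (add_monoid P)" for i
  by (rule P.add_subgroupI) (use P z add neg ng component_add component_zero component_neg in auto)
 have sum: "x = (\<Oplus>\<^sub>P i\<in>{i. hcomp M x i ~= \<zero>\<^sub>P}. hcomp M x i)" if "x \<in> N" for x
 proof -
  have x: "x \<in> carrier M" using that sub by blast
  show ?thesis
   using hcomp_sum[OF x hcomp_finite[OF x] subset_refl] fs[of _ "hcomp M x"] h[OF that] by (simp add: P(3))
 qed
 have *: "x \<in> carrier P ==> hcomp M x i \<in> component P i" "x \<in> carrier P ==> finite {i. hcomp M x i ~= \<zero>\<^sub>P}"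
  "x \<in> carrier P ==> x = (\<Oplus>\<^sub>P i\<in>{i. hcomp M x i ~= \<zero>\<^sub>P}. hcomp M x i)"
  "x \<in> carrier P ==> y \<in> carrier P ==> hcomp M (x \<oplus>\<^sub>P y) i = hcomp M x i \<oplus>\<^sub>P hcomp M y i"
  "x \<in> component P j ==> hcomp M x i = (if i = j then x else \<zero>\<^sub>P)" for x y i j
  using sub h hcomp_component hcomp_finite hcomp_add[of x y i] hcomp_homogeneous[of x j i] sum
  unfolding P by (blast, blast, metis P(3), blast, blast)
 show "graded_grp P" by (rule graded_grpI(1)[where \<pi> = "hcomp M", OF ag cs *])
 show "hcomp P x i = hcomp M x i" if "x \<in> N" for x i
  by (rule graded_grpI(2)[where \<pi> = "hcomp M", OF ag cs *]) (use that P(1) in simp_all)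
qed

context graded_mod
begin

lemma graded_submoduleD:
 assumes "graded_submodule A N M"
 shows "subgroup N (add_monoid M)" "N \<subseteq> carrier M" "\<zero>\<^sub>M \<in> N"
  "!!x y. x \<in> N ==> y \<in> N ==> x \<oplus>\<^sub>M y \<in> N" "!!x. x \<in> N ==> \<ominus>\<^sub>M x \<in> N"
  "!!x y. x \<in> N ==> y \<in> N ==> x \<ominus>\<^sub>M y \<in> N"
  "!!a x. a \<in> carrier A ==> x \<in> N ==> a \<odot>\<^sub>M x \<in> N" "!!x i. x \<in> N ==> hcomp M x i \<in> N"
proof -
 show N: "subgroup N (add_monoid M)"
  using assms by (auto simp: graded_submodule_def left_submodule_def)
 show "N \<subseteq> carrier M" using subgroup.subset[OF N] by simp
 show "\<zero>\<^sub>M \<in> N" using subgroup.one_closed[OF N] by simp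
 show *: "x \<oplus>\<^sub>M y \<in> N" if "x \<in> N" "y \<in> N" for x y using subgroup.m_closed[OF N] that by simp
 show **: "\<ominus>\<^sub>M x \<in> N" if "x \<in> N" for x using subgroup.m_inv_closed[OF N that] by (simp add: a_inv_def)
 show "x \<ominus>\<^sub>M y \<in> N" if "x \<in> N" "y \<in> N" for x y using * ** that by (simp add: a_minus_def)
qed (use assms in \<open>auto simp: graded_submodule_def left_submodule_def homogeneous_subset_def\<close>)

lemma graded_submoduleI:
 assumes "N \<subseteq> carrier M" "\<zero>\<^sub>M \<in> N" "!!x y. x \<in> N ==> y \<in> N ==> x \<oplus>\<^sub>M y \<in> N"
  "!!a x. a \<in> carrier A ==> x \<in> N ==> a \<odot>\<^sub>M x \<in> N" "!!x i. x \<in> N ==> hcomp M x i \<in> N"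
 shows "graded_submodule A N M"
proof -
 have "\<ominus>\<^sub>M x \<in> N" if "x \<in> N" for x
 proof -
  have "\<ominus>\<^sub>M x = (\<ominus> \<one>) \<odot>\<^sub>M x"
   using that assms(1) M.smult_neg_l[OF one_closed, of x] M.smult_one[of x] by (auto simp: subset_iff)
  then show ?thesis using assms(4)[OF a_inv_closed[OF one_closed] that] by simp
 qed
 then show ?thesis
  unfolding graded_submodule_def left_submodule_def homogeneous_subset_def
  using assms by (auto intro!: M.add_subgroupI)
qed

lemma submod_graded_module:
 assumes "graded_submodule A N M"
 shows "graded_module A (submod M N)"
proof -
 note N = graded_submoduleD[OF assms]
 have g: "graded_grp (submod M N)"
  by (rule M.homogeneous_submod_grp[OF N(1)]) (use assms in \<open>auto simp: graded_submodule_def\<close>)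
 then interpret g: graded_grp "submod M N" .
 have "left_module A (submod M N)"
  by (rule left_moduleI[OF ring_axioms g.abelian_group_axioms])
   (use N in \<open>auto simp: subset_iff M.smult_l_distr M.smult_r_distr M.smult_assoc M.smult_one\<close>)
 then show ?thesis
  using g N M.component_closed GA.component_closed
  by (auto simp: graded_module_def graded_grp_iff smult_component_M)
qed

lemma submod_inclusion: "graded_submodule A N M ==> (%x. x) \<in> graded_hom A (submod M N) M"
 by (intro graded_homI) (use graded_submoduleD(2) in auto)

text \<open>The operations of \<open>image_mod\<close> work on preimages picked by
  \<open>inv_into\<close>. As \<open>\<rho>\<close> identifies exactly the elements congruent modulo
  \<open>N\<close>, and \<open>N\<close> is closed under all operations and under components, the
  pick is immaterial.\<close>

lemma image_mod:
 assumes N: "graded_submodule A N M"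
  and \<rho>: "!!x y. x \<in> carrier M ==> y \<in> carrier M ==> \<rho> x = \<rho> y \<longleftrightarrow> x \<ominus>\<^sub>M y \<in> N"
 shows "graded_module A (image_mod M \<rho>)" "\<rho> \<in> graded_hom A M (image_mod M \<rho>)"
  "\<rho> ` carrier M = carrier (image_mod M \<rho>)"
  "!!x. x \<in> carrier M ==> \<rho> x = \<zero>\<^bsub>image_mod M \<rho>\<^esub> \<longleftrightarrow> x \<in> N"
  "!!i. component (image_mod M \<rho>) i = \<rho> ` component M i"
proof -
 note Nd = graded_submoduleD[OF N]
 let ?Q = "image_mod M \<rho>"
 let ?s = "inv_into (carrier M) \<rho>"
 have s: "?s (\<rho> x) \<in> carrier M" "\<rho> (?s (\<rho> x)) = \<rho> x" if "x \<in> carrier M" for x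
  using that by (auto simp: inv_into_into f_inv_into_f)
 have Q: "carrier ?Q = \<rho> ` carrier M" "\<zero>\<^bsub>?Q\<^esub> = \<rho> \<zero>\<^sub>M" "component ?Q i = \<rho> ` component M i" for i
  by (auto simp: image_mod_def Let_def)
 have add: "\<rho> x \<oplus>\<^bsub>?Q\<^esub> \<rho> y = \<rho> (x \<oplus>\<^sub>M y)" if "x \<in> carrier M" "y \<in> carrier M" for x y
 proof -
  have "?s (\<rho> x) \<ominus>\<^sub>M x \<in> N" "?s (\<rho> y) \<ominus>\<^sub>M y \<in> N" using \<rho> s that by auto
  then have "(?s (\<rho> x) \<ominus>\<^sub>M x) \<oplus>\<^sub>M (?s (\<rho> y) \<ominus>\<^sub>M y) \<in> N" using Nd(4) by blast
  also have "(?s (\<rho> x) \<ominus>\<^sub>M x) \<oplus>\<^sub>M (?s (\<rho> y) \<ominus>\<^sub>M y) = (?s (\<rho> x) \<oplus>\<^sub>M ?s (\<rho> y)) \<ominus>\<^sub>M (x \<oplus>\<^sub>M y)"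
   using that s by (simp add: M.M.add_minus_add)
  finally show ?thesis using \<rho> s that by (simp add: image_mod_def Let_def)
 qed
 have sm: "a \<odot>\<^bsub>?Q\<^esub> \<rho> x = \<rho> (a \<odot>\<^sub>M x)" if "x \<in> carrier M" "a \<in> carrier A" for x a
 proof -
  have "?s (\<rho> x) \<ominus>\<^sub>M x \<in> N" using \<rho> s that by auto
  then have "a \<odot>\<^sub>M (?s (\<rho> x) \<ominus>\<^sub>M x) \<in> N" using Nd(7) that by blast
  also have "a \<odot>\<^sub>M (?s (\<rho> x) \<ominus>\<^sub>M x) = a \<odot>\<^sub>M ?s (\<rho> x) \<ominus>\<^sub>M a \<odot>\<^sub>M x"
   using that s by (simp add: M.smult_minus_r)
  finally show ?thesis using \<rho> s that M.smult_closed by (simp add: image_mod_def Let_def)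
 qed
 have ag: "abelian_group ?Q"
 proof (rule abelian_groupI)
  fix u assume "u \<in> carrier ?Q"
  then obtain x where x: "x \<in> carrier M" "u = \<rho> x" unfolding Q by blast
  then have "\<rho> (\<ominus>\<^sub>M x) \<in> carrier ?Q" "\<rho> (\<ominus>\<^sub>M x) \<oplus>\<^bsub>?Q\<^esub> u = \<zero>\<^bsub>?Q\<^esub>"
   unfolding Q by (auto simp: add M.M.l_neg)
  then show "\<exists>v\<in>carrier ?Q. v \<oplus>\<^bsub>?Q\<^esub> u = \<zero>\<^bsub>?Q\<^esub>" by blast
 qed (auto simp: Q add M.M.a_ac)
 interpret Q: abelian_group ?Q by (rule ag)
 have fs: "\<rho> (\<Oplus>\<^sub>M i\<in>J. f i) = (\<Oplus>\<^bsub>?Q\<^esub>i\<in>J. \<rho> (f i))" if "!!i. i \<in> J ==> f i \<in> carrier M" for f :: "int => _" and J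
  by (rule additive_finsum[OF M.M.abelian_group_axioms ag]) (use that add Q in auto)
 define \<pi> where "\<pi> u i = \<rho> (hcomp M (?s u) i)" for u i
 have \<pi>: "\<pi> (\<rho> x) i = \<rho> (hcomp M x i)" if "x \<in> carrier M" for x i
 proof -
  have "?s (\<rho> x) \<ominus>\<^sub>M x \<in> N" using \<rho> s that by auto
  then have "hcomp M (?s (\<rho> x) \<ominus>\<^sub>M x) i \<in> N" using Nd(8) by blast
  then show ?thesis unfolding \<pi>_def using \<rho> s that by (simp add: M.hcomp_minus M.hcomp_closed)
 qed
 have neg: "\<ominus>\<^bsub>?Q\<^esub> \<rho> x = \<rho> (\<ominus>\<^sub>M x)" if "x \<in> carrier M" for x
  using that by (intro Q.minus_equality) (auto simp: Q add M.M.l_neg)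
 have cs: "subgroup (component ?Q i) (add_monoid ?Q)" for i
 proof (rule Q.add_subgroupI)
  fix u v assume "u \<in> component ?Q i" "v \<in> component ?Q i"
  then obtain x y where "x \<in> component M i" "y \<in> component M i" "u = \<rho> x" "v = \<rho> y" unfolding Q by blast
  then show "u \<oplus>\<^bsub>?Q\<^esub> v \<in> component ?Q i"
   using M.component_add M.component_closed unfolding Q by (auto simp: add)
 next
  fix u assume "u \<in> component ?Q i"
  then obtain x where "x \<in> component M i" "u = \<rho> x" unfolding Q by blast
  then show "\<ominus>\<^bsub>?Q\<^esub> u \<in> component ?Q i"
   using M.component_neg M.component_closed unfolding Q by (auto simp: neg)
 qed (use M.component_closed M.component_zero in \<open>auto simp: Q\<close>)
 have supp: "{i. \<rho> (hcomp M x i) ~= \<zero>\<^bsub>?Q\<^esub>} \<subseteq> {i. hcomp M x i ~= \<zero>\<^sub>M}" for x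
  by (auto simp: Q)
 have g: "graded_grp ?Q"
 proof (rule graded_grpI(1)[where \<pi> = \<pi>, OF ag cs])
  fix u assume "u \<in> carrier ?Q"
  then obtain x where x: "x \<in> carrier M" "u = \<rho> x" unfolding Q by blast
  show "finite {i. \<pi> u i ~= \<zero>\<^bsub>?Q\<^esub>}"
   unfolding x \<pi>[OF x(1)] using finite_subset[OF supp M.hcomp_finite[OF x(1)]] .
  have "(\<Oplus>\<^bsub>?Q\<^esub>i\<in>{i. \<rho> (hcomp M x i) ~= \<zero>\<^bsub>?Q\<^esub>}. \<rho> (hcomp M x i))
   = (\<Oplus>\<^bsub>?Q\<^esub>i\<in>{i. hcomp M x i ~= \<zero>\<^sub>M}. \<rho> (hcomp M x i))"
   by (rule Q.finsum_support[OF M.hcomp_finite[OF x(1)] supp]) (use x M.hcomp_closed Q in auto)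
  also have "\<dots> = \<rho> (\<Oplus>\<^sub>M i\<in>{i. hcomp M x i ~= \<zero>\<^sub>M}. hcomp M x i)"
   by (rule fs[symmetric]) (use x M.hcomp_closed in auto)
  also have "\<dots> = \<rho> x" using M.hcomp_sum[OF x(1) M.hcomp_finite[OF x(1)] subset_refl] by simp
  finally show "u = (\<Oplus>\<^bsub>?Q\<^esub>i\<in>{i. \<pi> u i ~= \<zero>\<^bsub>?Q\<^esub>}. \<pi> u i)" unfolding x \<pi>[OF x(1)] by simp
 next
  fix u i assume "u \<in> carrier ?Q"
  then show "\<pi> u i \<in> component ?Q i" using M.hcomp_component unfolding Q by (auto simp: \<pi>)
 next
  fix u v i assume "u \<in> carrier ?Q" "v \<in> carrier ?Q"
  then show "\<pi> (u \<oplus>\<^bsub>?Q\<^esub> v) i = \<pi> u i \<oplus>\<^bsub>?Q\<^esub> \<pi> v i"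
   unfolding Q by (auto simp: \<pi> add M.hcomp_add M.hcomp_closed)
 next
  fix u i j assume "u \<in> component ?Q j"
  then show "\<pi> u i = (if i = j then u else \<zero>\<^bsub>?Q\<^esub>)"
   unfolding Q using M.component_closed M.hcomp_homogeneous by (auto simp: \<pi>)
 qed
 have "left_module A ?Q"
  by (rule left_moduleI[OF ring_axioms ag])
   (auto simp: Q add sm M.smult_closed M.smult_l_distr M.smult_r_distr M.smult_assoc M.smult_one)
 moreover have "a \<odot>\<^bsub>?Q\<^esub> u \<in> component ?Q (i + j)" if "a \<in> component A i" "u \<in> component ?Q j" for a u i j
  using that smult_component_M M.component_closed GA.component_closed unfolding Q by (auto simp: sm)
 ultimately show "graded_module A ?Q" using g by (auto simp: graded_module_def graded_grp_iff)
 show "\<rho> \<in> graded_hom A M ?Q"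
  by (rule graded_homI) (auto simp: Q add sm)
 show "\<rho> ` carrier M = carrier ?Q" by (simp add: Q)
 show "component ?Q i = \<rho> ` component M i" for i by (rule Q)
 show "\<rho> x = \<zero>\<^bsub>?Q\<^esub> \<longleftrightarrow> x \<in> N" if "x \<in> carrier M" for x
  using \<rho>[OF that M.M.zero_closed] that by (simp add: Q M.M.minus_zero_r)
qed

lemma quotient_exists:
 assumes N: "graded_submodule A N M"
 obtains \<rho> :: "'m => 'm" where "!!x y. x \<in> carrier M ==> y \<in> carrier M ==> \<rho> x = \<rho> y \<longleftrightarrow> x \<ominus>\<^sub>M y \<in> N"
proof
 note Nd = graded_submoduleD[OF N]
 define \<rho> where "\<rho> x = (SOME y. y \<in> carrier M \<and> x \<ominus>\<^sub>M y \<in> N)" for x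
 fix x y assume x: "x \<in> carrier M" and y: "y \<in> carrier M"
 have r: "\<rho> x \<in> carrier M \<and> x \<ominus>\<^sub>M \<rho> x \<in> N" if "x \<in> carrier M" for x
 proof -
  have "\<exists>y. y \<in> carrier M \<and> x \<ominus>\<^sub>M y \<in> N"
   using that Nd(3) by (intro exI[of _ x]) (simp add: a_minus_def M.M.r_neg)
  then show ?thesis unfolding \<rho>_def by (rule someI_ex)
 qed
 show "\<rho> x = \<rho> y \<longleftrightarrow> x \<ominus>\<^sub>M y \<in> N"
 proof
  assume "\<rho> x = \<rho> y"
  then have "(x \<ominus>\<^sub>M \<rho> x) \<ominus>\<^sub>M (y \<ominus>\<^sub>M \<rho> x) \<in> N" using r[OF x] r[OF y] Nd(6) by simp
  moreover have "(x \<ominus>\<^sub>M \<rho> x) \<ominus>\<^sub>M (y \<ominus>\<^sub>M \<rho> x) = x \<ominus>\<^sub>M y"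
   using x y r[OF x] by (simp add: M.M.minus_minus_r)
  ultimately show "x \<ominus>\<^sub>M y \<in> N" by simp
 next
  assume xy: "x \<ominus>\<^sub>M y \<in> N"
  have "x \<ominus>\<^sub>M z \<in> N \<longleftrightarrow> y \<ominus>\<^sub>M z \<in> N" if z: "z \<in> carrier M" for z
  proof
   assume "x \<ominus>\<^sub>M z \<in> N"
   from Nd(6)[OF this xy] show "y \<ominus>\<^sub>M z \<in> N" using x y z by (simp add: M.M.minus_minus_l)
  next
   assume "y \<ominus>\<^sub>M z \<in> N"
   from Nd(4)[OF xy this] show "x \<ominus>\<^sub>M z \<in> N" using x y z by (simp add: M.M.minus_trans)
  qed
  \<comment> \<open>Congruent elements yield literally the same predicate, so the choice operator
    returns the same representative for both.\<close>
  then have "(%z. z \<in> carrier M \<and> x \<ominus>\<^sub>M z \<in> N) = (%z. z \<in> carrier M \<and> y \<ominus>\<^sub>M z \<in> N)" by auto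
  then show "\<rho> x = \<rho> y" unfolding \<rho>_def by (rule arg_cong)
 qed
qed

end

section \<open>Graded homomorphisms: components, images, preimages, kernels\<close>

locale graded_map = M: graded_mod K A M + N: graded_mod K A N
 for K :: "'k ring" and A :: "('k, 'a) gmodule" (structure)
  and M :: "('a, 'm) gmodule" and N :: "('a, 'n) gmodule" +
 fixes h :: "'m => 'n"
 assumes hom: "h \<in> graded_hom A M N"
begin

lemmas closed = graded_homD(1)[OF hom] and add = graded_homD(2)[OF hom]
 and smult = graded_homD(3)[OF hom] and comp = graded_homD(4)[OF hom]

lemma zero: "h \<zero>\<^sub>M = \<zero>\<^sub>N"
 by (rule additive_zero[OF M.M.M.abelian_group_axioms N.M.M.abelian_group_axioms]) (auto simp: closed add)

lemma neg: "x \<in> carrier M ==> h (\<ominus>\<^sub>M x) = \<ominus>\<^sub>N h x"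
 using add[of "\<ominus>\<^sub>M x" x] by (simp add: M.M.M.l_neg zero N.M.M.minus_equality closed)

lemma minus: "x \<in> carrier M ==> y \<in> carrier M ==> h (x \<ominus>\<^sub>M y) = h x \<ominus>\<^sub>N h y"
 by (simp add: a_minus_def add neg)

lemma finsum: "(!!i. i \<in> J ==> f i \<in> carrier M) ==> h (\<Oplus>\<^sub>M i\<in>J. f i) = (\<Oplus>\<^sub>N i\<in>J. h (f i))"
 by (rule additive_finsum[OF M.M.M.abelian_group_axioms N.M.M.abelian_group_axioms]) (auto simp: closed add)

lemma hcomp:
 assumes x: "x \<in> carrier M"
 shows "h (hcomp M x i) = hcomp N (h x) i"
proof -
 have "hcomp N (h x) = (%i. h (hcomp M x i))"
 proof (rule N.M.hcomp_eqI[OF _ M.M.hcomp_finite[OF x]])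
  show "h x = (\<Oplus>\<^sub>N i\<in>{i. hcomp M x i ~= \<zero>\<^sub>M}. h (hcomp M x i))"
   using finsum[of _ "hcomp M x"] M.M.hcomp_sum[OF x M.M.hcomp_finite[OF x] subset_refl]
    M.M.hcomp_closed[OF x] by metis
 qed (use comp M.M.hcomp_component[OF x] zero in auto)
 then show ?thesis by simp
qed

lemma preimage:
 assumes "graded_submodule A L N"
 shows "graded_submodule A {x \<in> carrier M. h x \<in> L} M"
 using N.graded_submoduleD[OF assms]
 by (intro M.graded_submoduleI) (auto simp: zero add smult closed M.M.hcomp_closed hcomp M.M.smult_closed)

lemma image:
 assumes "graded_submodule A L M"
 shows "graded_submodule A (h ` L) N"
proof -
 note L = M.graded_submoduleD[OF assms]
 show ?thesis
 proof (rule N.graded_submoduleI)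
  show "\<zero>\<^sub>N \<in> h ` L" using imageI[OF L(3), of h] zero by simp
  fix u v assume "u \<in> h ` L" "v \<in> h ` L"
  then obtain x y where xy: "x \<in> L" "y \<in> L" "u = h x" "v = h y" "x \<in> carrier M" "y \<in> carrier M"
   using L(2) by blast
  then have "u \<oplus>\<^sub>N v = h (x \<oplus>\<^sub>M y)" by (simp add: add)
  then show "u \<oplus>\<^sub>N v \<in> h ` L" using L(4)[OF xy(1,2)] by simp
 next
  fix a u assume "a \<in> carrier A" "u \<in> h ` L"
  then obtain x where x: "x \<in> L" "u = h x" "x \<in> carrier M" using L(2) by blast
  then have "a \<odot>\<^sub>N u = h (a \<odot>\<^sub>M x)" using \<open>a \<in> carrier A\<close> by (simp add: smult)
  then show "a \<odot>\<^sub>N u \<in> h ` L" using L(7)[OF \<open>a \<in> carrier A\<close> x(1)] by simp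
 next
  fix u i assume "u \<in> h ` L"
  then obtain x where x: "x \<in> L" "u = h x" "x \<in> carrier M" using L(2) by blast
  then have "hcomp N u i = h (hcomp M x i)" by (simp add: hcomp)
  then show "hcomp N u i \<in> h ` L" using L(8)[OF x(1)] by simp
 qed (use L closed in auto)
qed

lemma zero_submodule: "graded_submodule A {\<zero>\<^sub>N} N"
 by (rule N.graded_submoduleI) (auto simp: N.M.smult_zero_r N.M.hcomp_zero)

lemma kernel: "graded_submodule A {x \<in> carrier M. h x = \<zero>\<^sub>N} M"
 using preimage[OF zero_submodule] by simp

lemma injI:
 assumes "!!x. x \<in> carrier M ==> h x = \<zero>\<^sub>N ==> x = \<zero>\<^sub>M"
 shows "inj_on h (carrier M)"
proof (rule inj_onI)
 fix x y assume xy: "x \<in> carrier M" "y \<in> carrier M" "h x = h y"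
 then have "h (x \<ominus>\<^sub>M y) = \<zero>\<^sub>N" using N.M.M.minus_zero_iff closed by (simp add: minus)
 then show "x = y" using assms[of "x \<ominus>\<^sub>M y"] xy M.M.M.minus_zero_iff by simp
qed

text \<open>Since \<open>h\<close> commutes with taking components, the degree \<open>i\<close>
  component of an arbitrary preimage is again a preimage.\<close>

lemma surj_component:
 assumes "h ` carrier M = carrier N" "y \<in> component N i"
 obtains x where "x \<in> component M i" "h x = y"
proof -
 have "y \<in> h ` carrier M" using assms(1) N.M.component_closed[OF assms(2)] by simp
 then obtain x where x: "x \<in> carrier M" "h x = y" by blast
 have "h (hcomp M x i) = y" using hcomp[OF x(1), of i] x(2) N.M.hcomp_homogeneous[OF assms(2), of i] by simp
 then show thesis using that M.M.hcomp_component[OF x(1)] by blast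
qed

end

lemma graded_mapI:
 "graded_alg K A ==> graded_module A M ==> graded_module A N ==> h \<in> graded_hom A M N ==> graded_map K A M N h"
 by (simp add: graded_map_def graded_map_axioms_def graded_mod_def graded_mod_axioms_def)

section \<open>Cyclic submodules and degree shifts\<close>

context graded_mod
begin

lemma zero_submodule: "graded_submodule A {\<zero>\<^sub>M} M"
 by (rule graded_submoduleI) (auto simp: M.smult_zero_r M.hcomp_zero)

lemma cyclic_submodule:
 assumes "x \<in> component M j"
 shows "graded_submodule A {a \<odot>\<^sub>M x |a. a \<in> carrier A} M"
proof (rule graded_submoduleI)
 have x: "x \<in> carrier M" using assms M.component_closed by blast
 show "{a \<odot>\<^sub>M x |a. a \<in> carrier A} \<subseteq> carrier M" using x M.smult_closed by auto
 show "\<zero>\<^sub>M \<in> {a \<odot>\<^sub>M x |a. a \<in> carrier A}" using M.smult_zero_l[OF x, symmetric] zero_closed by blast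
 fix u v assume "u \<in> {a \<odot>\<^sub>M x |a. a \<in> carrier A}" "v \<in> {a \<odot>\<^sub>M x |a. a \<in> carrier A}"
 then show "u \<oplus>\<^sub>M v \<in> {a \<odot>\<^sub>M x |a. a \<in> carrier A}"
  using M.smult_l_distr[OF _ _ x, symmetric] a_closed by blast
next
 have x: "x \<in> carrier M" using assms M.component_closed by blast
 fix b u assume "b \<in> carrier A" "u \<in> {a \<odot>\<^sub>M x |a. a \<in> carrier A}"
 then show "b \<odot>\<^sub>M u \<in> {a \<odot>\<^sub>M x |a. a \<in> carrier A}"
  using M.smult_assoc[OF _ _ x, symmetric] m_closed by blast
next
 fix u i assume "u \<in> {a \<odot>\<^sub>M x |a. a \<in> carrier A}"
 then show "hcomp M u i \<in> {a \<odot>\<^sub>M x |a. a \<in> carrier A}"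
  using hcomp_smult_r[OF _ assms] GA.hcomp_closed by auto
qed

lemma hcomp_shift:
 assumes x: "x \<in> carrier M"
 shows "hcomp (shift k M) x i = hcomp M x (i - k)" and "graded_grp (shift k M)"
proof -
 have f: "finsum (shift k M) f J = finsum M f J" for f :: "int => _" and J
  by (rule finsum_cong_struct) (auto simp: shift_def)
 have ag: "abelian_group (shift k M)"
  by (rule abelian_group_cong_struct[OF _ _ _ M.abelian_group_axioms]) (auto simp: shift_def)
 have cs: "subgroup (component (shift k M) i) (add_monoid (shift k M))" for i
  by (rule subgroup_cong_struct[where N = M]) (auto simp: shift_def M.component_subgroup)
 have sh: "{i. hcomp M x (i - k) ~= \<zero>\<^sub>M} = (%i. i + k) ` {i. hcomp M x i ~= \<zero>\<^sub>M}" for x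
  by (auto simp: image_iff) (metis diff_add_cancel)
 have sum: "x = (\<Oplus>\<^sub>M i\<in>{i. hcomp M x (i - k) ~= \<zero>\<^sub>M}. hcomp M x (i - k))" if "x \<in> carrier M" for x
 proof -
  have "(\<Oplus>\<^sub>M i\<in>{i. hcomp M x (i - k) ~= \<zero>\<^sub>M}. hcomp M x (i - k)) = (\<Oplus>\<^sub>M i\<in>{i. hcomp M x i ~= \<zero>\<^sub>M}. hcomp M x i)"
   unfolding sh using M.hcomp_closed[OF that] by (subst M.finsum_reindex) (auto simp: inj_on_def)
  then show ?thesis using M.hcomp_sum[OF that M.hcomp_finite[OF that] subset_refl] by simp
 qed
 have *: "x \<in> carrier (shift k M) ==> hcomp M x (i - k) \<in> component (shift k M) i"
  "x \<in> carrier (shift k M) ==> finite {i. hcomp M x (i - k) ~= \<zero>\<^bsub>shift k M\<^esub>}"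
  "x \<in> carrier (shift k M) ==> x = (\<Oplus>\<^bsub>shift k M\<^esub>i\<in>{i. hcomp M x (i - k) ~= \<zero>\<^bsub>shift k M\<^esub>}. hcomp M x (i - k))"
  "x \<in> carrier (shift k M) ==> y \<in> carrier (shift k M) ==>
   hcomp M (x \<oplus>\<^bsub>shift k M\<^esub> y) (i - k) = hcomp M x (i - k) \<oplus>\<^bsub>shift k M\<^esub> hcomp M y (i - k)"
  "x \<in> component (shift k M) j ==> hcomp M x (i - k) = (if i = j then x else \<zero>\<^bsub>shift k M\<^esub>)" for x y i j
 proof -
  assume "x \<in> carrier (shift k M)"
  then show "x = (\<Oplus>\<^bsub>shift k M\<^esub>i\<in>{i. hcomp M x (i - k) ~= \<zero>\<^bsub>shift k M\<^esub>}. hcomp M x (i - k))"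
   unfolding f using sum[of x] by (simp add: shift_def)
 next
  assume "x \<in> carrier (shift k M)"
  then show "finite {i. hcomp M x (i - k) ~= \<zero>\<^bsub>shift k M\<^esub>}"
   using sh[of x] M.hcomp_finite[of x] by (simp add: shift_def)
 qed (auto simp: shift_def M.hcomp_component M.hcomp_add M.hcomp_homogeneous)
 show "graded_grp (shift k M)"
  by (rule graded_grpI(1)[where \<pi> = "%x i. hcomp M x (i - k)", OF ag cs *])
 show "hcomp (shift k M) x i = hcomp M x (i - k)"
  by (rule graded_grpI(2)[where \<pi> = "%x i. hcomp M x (i - k)", OF ag cs *]) (use x in \<open>auto simp: shift_def\<close>)
qed

lemma shift_graded_module: "graded_module A (shift k M)"
proof -
 have g: "graded_grp (shift k M)" by (rule hcomp_shift(2)[OF M.M.zero_closed])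
 then interpret g: graded_grp "shift k M" .
 have "left_module A (shift k M)"
  by (rule left_moduleI[OF ring_axioms g.abelian_group_axioms])
   (auto simp: shift_def M.smult_closed M.smult_l_distr M.smult_r_distr M.smult_assoc M.smult_one)
 moreover have "a \<odot>\<^sub>M x \<in> component M (i + j - k)" if "a \<in> component A i" "x \<in> component M (j - k)" for a x i j
  using smult_component_M[OF that] by (simp add: algebra_simps)
 ultimately show ?thesis using g by (auto simp: graded_module_def graded_grp_iff shift_def)
qed

lemma graded_submodule_shift: "graded_submodule A N (shift k M) \<longleftrightarrow> graded_submodule A N M"
proof -
 have *: "subgroup N (add_monoid (shift k M)) \<longleftrightarrow> subgroup N (add_monoid M)"
  by (simp add: shift_def)
 have "(\<forall>x\<in>N. \<forall>i. hcomp (shift k M) x i \<in> N) \<longleftrightarrow> (\<forall>x\<in>N. \<forall>i. hcomp M x i \<in> N)" if "N \<subseteq> carrier M"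
  using that hcomp_shift(1) by (metis add_diff_cancel subsetD)
 then show ?thesis
  unfolding graded_submodule_def left_submodule_def homogeneous_subset_def *
  using subgroup.subset[of N "add_monoid M"] by (auto simp: shift_def)
qed

end

text \<open>Generation tested on graded submodules only. It follows both from finite generation over
  \<open>A\<close> and from finite dimension over \<open>K\<close>, and it is the form that Zorn's
  lemma consumes.\<close>

definition generates :: "('k, 'a) gmodule => 'm set => ('a, 'm) gmodule => bool" where
 "generates A G M \<longleftrightarrow> G \<subseteq> carrier M \<and> (\<forall>N. graded_submodule A N M --> G \<subseteq> N --> N = carrier M)"

context graded_mod
begin

lemma finitely_generated_generates:
 assumes "finitely_generated A M"
 obtains G where "finite G" "generates A G M"
proof -
 obtain S where S: "finite S" "S \<subseteq> carrier M"
  "\<forall>x\<in>carrier M. \<exists>c\<in>S \<rightarrow> carrier A. x = (\<Oplus>\<^sub>M s\<in>S. c s \<odot>\<^sub>M s)"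
  using assms by (auto simp: finitely_generated_def)
 have "N = carrier M" if N: "graded_submodule A N M" "S \<subseteq> N" for N
 proof -
  have "x \<in> N" if x: "x \<in> carrier M" for x
  proof -
   obtain c where c: "c \<in> S \<rightarrow> carrier A" "x = (\<Oplus>\<^sub>M s\<in>S. c s \<odot>\<^sub>M s)" using S(3) x by blast
   show ?thesis unfolding c(2)
    by (rule M.subgroup_finsum[OF graded_submoduleD(1)[OF N(1)]])
     (use c(1) N graded_submoduleD(7)[OF N(1)] in auto)
  qed
  then show ?thesis using graded_submoduleD(2)[OF N(1)] by blast
 qed
 then show thesis using that S unfolding generates_def by blast
qed

text \<open>Zorn's lemma for proper graded submodules; finiteness of \<open>G\<close> keeps unions
  of chains proper.\<close>

lemma maximal_submodule:
 assumes G: "finite G" "generates A G M" and nz: "carrier M ~= {\<zero>\<^sub>M}"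
 obtains N where "graded_submodule A N M" "N ~= carrier M"
  "!!N'. graded_submodule A N' M ==> N \<subseteq> N' ==> N' = N \<or> N' = carrier M"
proof -
 define F where "F = {N. graded_submodule A N M \<and> N ~= carrier M}"
 have "\<exists>N\<in>F. \<forall>V\<in>F. N \<subseteq> V --> V = N"
 proof (rule subset_Zorn_nonempty)
  show "F ~= {}" unfolding F_def using zero_submodule nz by blast
  fix C assume C: "C ~= {}" "subset.chain F C"
  have mem: "graded_submodule A V M" "V ~= carrier M" if "V \<in> C" for V
   using C(2) that by (auto simp: subset.chain_def F_def)
  have cmp: "V \<subseteq> Y \<or> Y \<subseteq> V" if "V \<in> C" "Y \<in> C" for V Y
   using C(2) that by (auto simp: subset.chain_def F_def)
  have "graded_submodule A (\<Union>C) M"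
  proof (rule graded_submoduleI)
   show "\<Union>C \<subseteq> carrier M" using mem graded_submoduleD(2) by blast
   show "\<zero>\<^sub>M \<in> \<Union>C" using C(1) mem graded_submoduleD(3) by blast
   fix x y assume "x \<in> \<Union>C" "y \<in> \<Union>C"
   then obtain V Y where VY: "V \<in> C" "Y \<in> C" "x \<in> V" "y \<in> Y" by blast
   then obtain Z where "Z \<in> C" "x \<in> Z" "y \<in> Z" using cmp by blast
   then show "x \<oplus>\<^sub>M y \<in> \<Union>C" using graded_submoduleD(4)[OF mem(1)] by blast
  qed (use graded_submoduleD(7,8)[OF mem(1)] in blast)+
  \<comment> \<open>If the union were everything, the finite set \<open>G\<close> would lie in a
    single member of the chain, and that member would not be proper.\<close>
  moreover have "\<Union>C ~= carrier M"
  proof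
   assume e: "\<Union>C = carrier M"
   then have "G \<subseteq> \<Union>C" using G(2) by (auto simp: generates_def)
   then obtain V where V: "V \<in> C" "G \<subseteq> V"
    using finite_subset_Union_chain[OF G(1) _ C] by metis
   show False using G(2) mem[OF V(1)] V(2) unfolding generates_def by blast
  qed
  ultimately show "\<Union>C \<in> F" by (simp add: F_def)
 qed
 then show thesis using that unfolding F_def by blast
qed

text \<open>\<open>N\<close> maximal, with \<open>\<rho>\<close> a choice of representatives modulo \<open>N\<close>.\<close>

lemma simple_quotient:
 assumes N: "graded_submodule A N M" "N ~= carrier M"
  and max: "!!N'. graded_submodule A N' M ==> N \<subseteq> N' ==> N' = N \<or> N' = carrier M"
  and \<rho>: "!!x y. x \<in> carrier M ==> y \<in> carrier M ==> \<rho> x = \<rho> y \<longleftrightarrow> x \<ominus>\<^sub>M y \<in> N"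
 shows "graded_simple A (image_mod M \<rho>)"
proof -
 let ?Q = "image_mod M \<rho>"
 note im = image_mod[OF N(1) \<rho>]
 interpret r: graded_map K A M ?Q \<rho>
  by (rule graded_mapI[OF graded_alg_axioms graded_module im(1,2)])
 have "carrier ?Q ~= {\<zero>\<^bsub>?Q\<^esub>}"
 proof
  assume "carrier ?Q = {\<zero>\<^bsub>?Q\<^esub>}"
  then have "x \<in> N" if "x \<in> carrier M" for x using that im(4) r.closed by auto
  then show False using N graded_submoduleD(2)[OF N(1)] by blast
 qed
 moreover have "L = {\<zero>\<^bsub>?Q\<^esub>} \<or> L = carrier ?Q" if L: "graded_submodule A L ?Q" for L
 proof -
  let ?P = "{x \<in> carrier M. \<rho> x \<in> L}"
  note Ld = r.N.graded_submoduleD[OF L]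
  have "L \<subseteq> \<rho> ` carrier M" using Ld(2) im(3) by simp
  then have eq: "L = \<rho> ` ?P" by blast
  have "N \<subseteq> ?P"
  proof
   fix x assume "x \<in> N"
   then show "x \<in> ?P" using im(4)[of x] Ld(3) graded_submoduleD(2)[OF N(1)] by auto
  qed
  then consider "?P = N" | "?P = carrier M" using max[OF r.preimage[OF L]] by blast
  then show ?thesis
  proof cases
   case 1
   then have "L \<subseteq> {\<zero>\<^bsub>?Q\<^esub>}" using eq im(4) graded_submoduleD(2)[OF N(1)] by auto
   then show ?thesis using Ld(3) by blast
  next
   case 2
   then show ?thesis using eq im(3) by auto
  qed
 qed
 ultimately show ?thesis using im(1) by (auto simp: graded_simple_def graded_submodule_def)
qed

end

section \<open>Finite-dimensional vector spaces\<close>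

lemma linear_mapI:
 assumes "vectorspace K V" "vectorspace K W" "!!x. x \<in> carrier V ==> T x \<in> carrier W"
  "!!x y. x \<in> carrier V ==> y \<in> carrier V ==> T (x \<oplus>\<^sub>V y) = T x \<oplus>\<^sub>W T y"
  "!!c x. c \<in> carrier K ==> x \<in> carrier V ==> T (c \<odot>\<^sub>V x) = c \<odot>\<^sub>W T x"
 shows "linear_map K V W T"
proof -
 have "T \<in> LinearCombinations.module_hom K V W"
  using assms by (auto simp: LinearCombinations.module_hom_def)
 then show ?thesis
  using assms(1,2) by (simp add: linear_map_def mod_hom_def mod_hom_axioms_def vectorspace_def)
qed

context vectorspace
begin

lemma submoduleI':
 assumes "W \<subseteq> carrier V" "\<zero>\<^sub>V \<in> W" "!!x y. x \<in> W ==> y \<in> W ==> x \<oplus>\<^sub>V y \<in> W"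
  "!!c x. c \<in> carrier K ==> x \<in> W ==> c \<odot>\<^sub>V x \<in> W"
 shows "submodule K W V"
 using assms module_axioms by (simp add: submodule_def)

lemma submodule_vectorspace: "submodule K W V ==> vectorspace K (V\<lparr>carrier := W\<rparr>)"
 by (rule subspace_is_vs) (simp add: VectorSpace.subspace_def vectorspace_axioms)

lemma submodule_finsum:
 assumes "submodule K W V" "!!i. i \<in> J ==> f i \<in> W"
 shows "(\<Oplus>\<^sub>V i\<in>J. f i) \<in> W"
 using assms(2)
proof (induct J rule: infinite_finite_induct)
 case (insert a J)
 have "W \<subseteq> carrier V" using assms(1) by (simp add: submodule_def)
 then have "(\<Oplus>\<^sub>V i\<in>insert a J. f i) = f a \<oplus>\<^sub>V (\<Oplus>\<^sub>V i\<in>J. f i)"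
  using insert by (intro finsum_insert) auto
 then show ?case using insert assms(1) by (simp add: submodule_def)
qed (use assms(1) in \<open>auto simp: submodule_def\<close>)

text \<open>Testing subspaces that contain \<open>G\<close> avoids coefficients: spanning sets are
  transported along linear maps by taking preimages of subspaces.\<close>

lemma fin_dim_spanI:
 assumes "finite G" "G \<subseteq> carrier V" "!!W. submodule K W V ==> G \<subseteq> W ==> carrier V \<subseteq> W"
 shows fin_dim
proof -
 have "carrier V \<subseteq> span G"
  using assms(3)[OF span_is_submodule[OF assms(2)] in_own_span[OF assms(2)]] .
 then have "span G = carrier V" using span_is_subset2[OF assms(2)] by blast
 then show ?thesis using assms by (auto simp: fin_dim_def)
qed

lemma fin_dim_generators:
 assumes fin_dim
 obtains G where "finite G" "G \<subseteq> carrier V" "!!W. submodule K W V ==> G \<subseteq> W ==> W = carrier V"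
proof -
 obtain G where G: "finite G" "G \<subseteq> carrier V" "span G = carrier V"
  using assms by (auto simp: fin_dim_def)
 have "W = carrier V" if "submodule K W V" "G \<subseteq> W" for W
  using span_is_subset[OF that(2,1)] G(3) that(1) by (auto simp: submodule_def)
 then show thesis using that G by blast
qed

text \<open>Independent subsets of \<open>W\<close> have at most \<open>dim\<close> elements, so a
  maximal one exists and is a basis of \<open>W\<close>. If it has \<open>dim\<close> elements, it
  is also a basis of the whole space.\<close>

lemma subspace_fin_dim:
 assumes fd: fin_dim and W: "submodule K W V"
 shows "vectorspace.fin_dim K (V\<lparr>carrier := W\<rparr>)" "vectorspace.dim K (V\<lparr>carrier := W\<rparr>) \<le> dim"
  "vectorspace.dim K (V\<lparr>carrier := W\<rparr>) = dim ==> W = carrier V"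
proof -
 interpret W: vectorspace K "V\<lparr>carrier := W\<rparr>" by (rule submodule_vectorspace[OF W])
 have sub: "W \<subseteq> carrier V" using W by (simp add: submodule_def)
 have li: "lin_indpt B" if "B \<subseteq> W" "W.lin_indpt B" for B
  using span_li_not_depend(2)[OF that(1) W] that(2) by simp
 have small: "finite B \<and> card B \<le> dim" if "B \<subseteq> W \<and> W.lin_indpt B" for B
  using li_le_dim[OF fd, of B] li[of B] that sub by auto
 have "\<exists>B. finite B \<and> maximal B (%B. B \<subseteq> W \<and> W.lin_indpt B)"
 proof (rule maximal_exists[where N = dim and B = "{}"])
  show "{} \<subseteq> W \<and> W.lin_indpt {}" by (simp add: W.lin_dep_def)
 qed (rule small)
 then obtain B where B: "finite B" "maximal B (%B. B \<subseteq> W \<and> W.lin_indpt B)" by blast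
 then have bas: "W.basis B" using W.max_li_is_basis[of B] by simp
 then have Bs: "B \<subseteq> W" "W.lin_indpt B" "W.span B = W" by (auto simp: W.basis_def)
 show "W.fin_dim" using B(1) Bs by (auto simp: W.fin_dim_def)
 have d: "W.dim = card B" by (rule W.dim_basis[OF B(1) bas])
 then show "W.dim \<le> dim" using small Bs by auto
 assume "W.dim = dim"
 then have "basis B" using dim_li_is_basis[OF fd B(1)] Bs li sub d by auto
 then have "span B = carrier V" by (simp add: basis_def)
 then show "W = carrier V" using span_li_not_depend(1)[OF Bs(1) W] Bs(3) by simp
qed

lemma fin_dim_if_zero: "carrier V = {\<zero>\<^sub>V} ==> fin_dim \<and> dim = 0"
proof -
 assume z: "carrier V = {\<zero>\<^sub>V}"
 have "span {} = carrier V" using z by (simp add: span_empty)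
 then show ?thesis
  using gen_ge_dim[of "{}"] by (auto simp: fin_dim_def)
qed

lemma dim_zeroD:
 assumes fin_dim "dim = 0"
 shows "carrier V = {\<zero>\<^sub>V}"
proof -
 obtain B where B: "finite B" "basis B" using finite_basis_exists assms(1) by blast
 then have "B = {}" using dim_basis[OF B] assms(2) by simp
 then show ?thesis using B by (simp add: basis_def span_empty)
qed

text \<open>Coefficients are indexed by \<open>I\<close> and not by vectors, because the family
  \<open>v\<close> may repeat vectors; powers of an element, for instance, need not be
  distinct.\<close>

lemma span_image_finsum:
 assumes v: "!!i. i \<in> I ==> v i \<in> carrier V" and I: "finite I" and x: "x \<in> span (v ` I)"
 obtains c where "c \<in> I \<rightarrow> carrier K" "x = (\<Oplus>\<^sub>V i\<in>I. c i \<odot>\<^sub>V v i)"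
proof -
 let ?W = "{(\<Oplus>\<^sub>V i\<in>I. c i \<odot>\<^sub>V v i) |c. c \<in> I \<rightarrow> carrier K}"
 have cl: "(%i. c i \<odot>\<^sub>V v i) \<in> I \<rightarrow> carrier V" if "c \<in> I \<rightarrow> carrier K" for c
  using that v by auto
 have "submodule K ?W V"
 proof (rule submoduleI')
  show "?W \<subseteq> carrier V" using cl by auto
  have "(\<Oplus>\<^sub>V i\<in>I. \<zero>\<^sub>K \<odot>\<^sub>V v i) = (\<Oplus>\<^sub>V i\<in>I. \<zero>\<^sub>V)" using v by (intro finsum_cong') auto
  then have "\<zero>\<^sub>V = (\<Oplus>\<^sub>V i\<in>I. \<zero>\<^sub>K \<odot>\<^sub>V v i)" by simp
  then show "\<zero>\<^sub>V \<in> ?W" by (intro CollectI exI[of _ "%i. \<zero>\<^sub>K"]) auto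
 next
  fix x y assume "x \<in> ?W" "y \<in> ?W"
  then obtain c d where cd: "c \<in> I \<rightarrow> carrier K" "d \<in> I \<rightarrow> carrier K"
   "x = (\<Oplus>\<^sub>V i\<in>I. c i \<odot>\<^sub>V v i)" "y = (\<Oplus>\<^sub>V i\<in>I. d i \<odot>\<^sub>V v i)" by blast
  have "x \<oplus>\<^sub>V y = (\<Oplus>\<^sub>V i\<in>I. c i \<odot>\<^sub>V v i \<oplus>\<^sub>V d i \<odot>\<^sub>V v i)"
   using cd cl by (simp add: finsum_addf)
  also have "\<dots> = (\<Oplus>\<^sub>V i\<in>I. (c i \<oplus>\<^sub>K d i) \<odot>\<^sub>V v i)"
   using cd v by (intro finsum_cong') (auto simp: smult_l_distr Pi_iff)
  finally show "x \<oplus>\<^sub>V y \<in> ?W" using cd by (intro CollectI exI[of _ "%i. c i \<oplus>\<^sub>K d i"]) auto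
 next
  fix b x assume b: "b \<in> carrier K" and "x \<in> ?W"
  then obtain c where c: "c \<in> I \<rightarrow> carrier K" "x = (\<Oplus>\<^sub>V i\<in>I. c i \<odot>\<^sub>V v i)" by blast
  have "b \<odot>\<^sub>V x = (\<Oplus>\<^sub>V i\<in>I. b \<odot>\<^sub>V (c i \<odot>\<^sub>V v i))"
   unfolding c(2) using cl[OF c(1)] b I by (intro finsum_smult_ldistr) auto
  also have "\<dots> = (\<Oplus>\<^sub>V i\<in>I. (b \<otimes>\<^sub>K c i) \<odot>\<^sub>V v i)"
   using b c v by (intro finsum_cong') (auto simp: smult_assoc1 Pi_iff)
  finally show "b \<odot>\<^sub>V x \<in> ?W" using b c by (intro CollectI exI[of _ "%i. b \<otimes>\<^sub>K c i"]) auto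
 qed
 moreover have "v ` I \<subseteq> ?W"
 proof
  fix y assume "y \<in> v ` I"
  then obtain j where j: "j \<in> I" "y = v j" by blast
  have "(\<Oplus>\<^sub>V i\<in>I. (if i = j then \<one>\<^sub>K else \<zero>\<^sub>K) \<odot>\<^sub>V v i) = (\<Oplus>\<^sub>V i\<in>I. if i = j then v j else \<zero>\<^sub>V)"
   using v by (intro finsum_cong') auto
  also have "\<dots> = y" using M.finsum_delta[OF I v[OF j(1)]] j by simp
  finally show "y \<in> ?W" by (intro CollectI exI[of _ "%i. if i = j then \<one>\<^sub>K else \<zero>\<^sub>K"]) auto
 qed
 ultimately have "span (v ` I) \<subseteq> ?W" by (intro span_is_subset)
 then show thesis using x that by blast
qed

text \<open>Otherwise the first \<open>Suc dim\<close> terms would be distinct and independent.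
  Applied to powers of an element or iterates of an operator, this produces polynomial
  relations.\<close>

lemma sequence_dependent:
 fixes v :: "nat => _"
 assumes fd: fin_dim and v: "!!i. v i \<in> carrier V"
 obtains m where "m \<le> dim" "v m \<in> span (v ` {..<m})"
proof -
 have "\<exists>m\<le>dim. v m \<in> span (v ` {..<m})"
 proof (rule ccontr)
  assume no: "\<not> (\<exists>m\<le>dim. v m \<in> span (v ` {..<m}))"
  have "lin_indpt (v ` {..<m}) \<and> card (v ` {..<m}) = m" if "m \<le> Suc dim" for m
   using that
  proof (induct m)
   case 0
   then show ?case by (auto simp: lin_dep_def)
  next
   case (Suc m)
   have sub: "v ` {..<m} \<subseteq> carrier V" using v by auto
   have ns: "v m \<notin> span (v ` {..<m})" using no Suc by auto
   then have nm: "v m \<notin> v ` {..<m}" using in_own_span[OF sub] by blast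
   have "lin_indpt (v ` {..<m} \<union> {v m})"
    using lin_dep_iff_in_span[OF sub _ v nm] Suc ns by simp
   moreover have "v ` {..<Suc m} = v ` {..<m} \<union> {v m}" by (auto simp: less_Suc_eq)
   ultimately show ?case using Suc nm by simp
  qed
  from this[of "Suc dim"] show False using li_le_dim(2)[OF fd, of "v ` {..<Suc dim}"] v by auto
 qed
 then show thesis using that by blast
qed

end

lemma linear_bij_dim:
 assumes T: "linear_map K V W T" and bij: "bij_betw T (carrier V) (carrier W)"
  and fd: "vectorspace.fin_dim K W"
 shows "vectorspace.fin_dim K V" "vectorspace.dim K V = vectorspace.dim K W"
proof -
 interpret T: linear_map K V W T by (rule T)
 let ?S = "inv_into (carrier V) T"
 have S: "?S y \<in> carrier V" "T (?S y) = y" if "y \<in> carrier W" for y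
  using that bij by (auto simp: bij_betw_def inv_into_into f_inv_into_f)
 have inj: "x = y" if "x \<in> carrier V" "y \<in> carrier V" "T x = T y" for x y
  using that bij by (auto simp: bij_betw_def inj_on_def)
 have lm: "linear_map K W V ?S"
 proof (rule linear_mapI[OF T.W.vectorspace_axioms T.V.vectorspace_axioms])
  show "?S (x \<oplus>\<^sub>W y) = ?S x \<oplus>\<^sub>V ?S y" if "x \<in> carrier W" "y \<in> carrier W" for x y
   by (rule inj) (use that S in auto)
  show "?S (c \<odot>\<^sub>W x) = c \<odot>\<^sub>V ?S x" if "c \<in> carrier K" "x \<in> carrier W" for c x
   by (rule inj) (use that S in auto)
 qed (use S in auto)
 interpret S: linear_map K W V ?S by (rule lm)
 have bij': "bij_betw ?S (carrier W) (carrier V)" by (rule bij_betw_inv_into[OF bij])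
 show "vectorspace.fin_dim K V" using S.surj_fin_dim[OF fd] bij' by (simp add: bij_betw_def)
 show "vectorspace.dim K V = vectorspace.dim K W"
  using S.dim_eq[OF fd] bij' by (simp add: bij_betw_def)
qed

lemma linear_inj_dim:
 assumes T: "linear_map K V W T" and inj: "inj_on T (carrier V)" and fd: "vectorspace.fin_dim K W"
 shows "vectorspace.fin_dim K V" "vectorspace.dim K V = vectorspace.dim K (W\<lparr>carrier := T ` carrier V\<rparr>)"
proof -
 interpret T: linear_map K V W T by (rule T)
 have sm: "submodule K (T ` carrier V) W" using T.im_is_submodule by (simp add: T.im_def)
 have fd': "vectorspace.fin_dim K (W\<lparr>carrier := T ` carrier V\<rparr>)"
  by (rule T.W.subspace_fin_dim(1)[OF fd sm])
 have "linear_map K V (W\<lparr>carrier := T ` carrier V\<rparr>) T"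
  by (rule linear_mapI[OF T.V.vectorspace_axioms T.W.submodule_vectorspace[OF sm]]) auto
 note * = linear_bij_dim[OF this _ fd']
 show "vectorspace.fin_dim K V" "vectorspace.dim K V = vectorspace.dim K (W\<lparr>carrier := T ` carrier V\<rparr>)"
  using * inj by (simp_all add: bij_betw_def)
qed

text \<open>Rank-nullity; applied in each degree, it is the source of additivity of the pairing in
  both variables.\<close>

lemma dim_exact:
 assumes f: "linear_map K U V f" and g: "linear_map K V W g" and inj: "inj_on f (carrier U)"
  and ex: "f ` carrier U = {x \<in> carrier V. g x = \<zero>\<^sub>W}" and surj: "g ` carrier V = carrier W"
  and fd: "vectorspace.fin_dim K V"
 shows "vectorspace.dim K V = vectorspace.dim K U + vectorspace.dim K W"
proof -
 interpret g: linear_map K V W g by (rule g)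
 have "g.ker = f ` carrier U" using ex by (simp add: g.ker_def)
 then have "vectorspace.dim K (V\<lparr>carrier := g.ker\<rparr>) = vectorspace.dim K U"
  using linear_inj_dim(2)[OF f inj fd] by simp
 moreover have "W\<lparr>carrier := g.im\<rparr> = W" using surj by (simp add: g.im_def)
 ultimately show ?thesis using g.rank_nullity[OF fd] by simp
qed

section \<open>Quotients by submodules\<close>

text \<open>One treatment of \<open>quotient_module\<close> serves \<open>A\<close> modulo the nice
  ideal, the tensor product over \<open>K\<close>, and Grothendieck groups over Laurent
  polynomials.\<close>

locale coset_quotient = left_module R M
 for R :: "('r, 'y) ring_scheme" (structure) and M :: "('r, 'm, 'z) module_scheme" (structure) +
 fixes N :: "'m set"
 assumes left_submodule: "left_submodule R N M"
begin

lemma N: "subgroup N (add_monoid M)" "N \<subseteq> carrier M" "\<zero>\<^sub>M \<in> N"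
 "x \<in> N ==> y \<in> N ==> x \<oplus>\<^sub>M y \<in> N" "x \<in> N ==> \<ominus>\<^sub>M x \<in> N"
 "x \<in> N ==> y \<in> N ==> x \<ominus>\<^sub>M y \<in> N" "a \<in> carrier R ==> x \<in> N ==> a \<odot>\<^sub>M x \<in> N"
proof -
 show N: "subgroup N (add_monoid M)" using left_submodule by (simp add: left_submodule_def)
 show "N \<subseteq> carrier M" "\<zero>\<^sub>M \<in> N" using subgroup.subset[OF N] subgroup.one_closed[OF N] by simp_all
 show *: "x \<oplus>\<^sub>M y \<in> N" if "x \<in> N" "y \<in> N" for x y using subgroup.m_closed[OF N] that by simp
 show **: "\<ominus>\<^sub>M x \<in> N" if "x \<in> N" for x using subgroup.m_inv_closed[OF N that] by (simp add: a_inv_def)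
 show "x \<in> N ==> y \<in> N ==> x \<ominus>\<^sub>M y \<in> N" using * ** by (simp add: a_minus_def)
 show "a \<in> carrier R ==> x \<in> N ==> a \<odot>\<^sub>M x \<in> N" using left_submodule by (simp add: left_submodule_def)
qed

lemma coset_def': "N +>\<^sub>M x = {n \<oplus>\<^sub>M x |n. n \<in> N}"
 by (auto simp: a_r_coset_def r_coset_def)

lemma in_coset: "x \<in> carrier M ==> z \<in> N +>\<^sub>M x \<longleftrightarrow> z \<in> carrier M \<and> z \<ominus>\<^sub>M x \<in> N"
proof
 assume x: "x \<in> carrier M"
 assume "z \<in> N +>\<^sub>M x"
 then obtain n where n: "n \<in> N" "z = n \<oplus>\<^sub>M x" unfolding coset_def' by blast
 then have "n \<in> carrier M" using N(2) by blast
 then show "z \<in> carrier M \<and> z \<ominus>\<^sub>M x \<in> N" using x n M.eq_minusI[of x n z] by simp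
next
 assume x: "x \<in> carrier M"
 assume z: "z \<in> carrier M \<and> z \<ominus>\<^sub>M x \<in> N"
 then have "z = (z \<ominus>\<^sub>M x) \<oplus>\<^sub>M x" using M.minus_add_cancel x by simp
 then show "z \<in> N +>\<^sub>M x" unfolding coset_def' using z by blast
qed

lemma self_coset: "x \<in> carrier M ==> x \<in> N +>\<^sub>M x"
 by (simp add: in_coset N(3) a_minus_def M.r_neg)

lemma coset_eq_iff:
 assumes x: "x \<in> carrier M" and y: "y \<in> carrier M"
 shows "N +>\<^sub>M x = N +>\<^sub>M y \<longleftrightarrow> x \<ominus>\<^sub>M y \<in> N"
proof
 assume "N +>\<^sub>M x = N +>\<^sub>M y"
 then have "x \<in> N +>\<^sub>M y" using self_coset[OF x] by simp
 then show "x \<ominus>\<^sub>M y \<in> N" using in_coset[OF y] by simp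
next
 assume xy: "x \<ominus>\<^sub>M y \<in> N"
 have "z \<ominus>\<^sub>M x \<in> N \<longleftrightarrow> z \<ominus>\<^sub>M y \<in> N" if z: "z \<in> carrier M" for z
 proof
  assume "z \<ominus>\<^sub>M x \<in> N"
  from N(4)[OF this xy] show "z \<ominus>\<^sub>M y \<in> N" using x y z by (simp add: M.minus_trans)
 next
  assume "z \<ominus>\<^sub>M y \<in> N"
  from N(6)[OF this xy] show "z \<ominus>\<^sub>M x \<in> N" using x y z by (simp add: M.minus_minus_r)
 qed
 then show "N +>\<^sub>M x = N +>\<^sub>M y" using in_coset[OF x] in_coset[OF y] by blast
qed

lemma quotient_carrier: "carrier (quotient_module M N) = {N +>\<^sub>M x |x. x \<in> carrier M}"
 by (auto simp: quotient_module_def A_RCOSETS_def RCOSETS_def a_r_coset_def)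

lemma quotient_carrierE:
 assumes "u \<in> carrier (quotient_module M N)"
 obtains x where "x \<in> carrier M" "u = N +>\<^sub>M x"
 using assms quotient_carrier by auto

lemma quotient_zero: "\<zero>\<^bsub>quotient_module M N\<^esub> = N +>\<^sub>M \<zero>\<^sub>M"
proof -
 have e: "n \<oplus>\<^sub>M \<zero>\<^sub>M = n" if "n \<in> N" for n using N(2) that by auto
 have "N \<subseteq> {n \<oplus>\<^sub>M \<zero>\<^sub>M |n. n \<in> N}" using e[symmetric] by blast
 moreover have "{n \<oplus>\<^sub>M \<zero>\<^sub>M |n. n \<in> N} \<subseteq> N" using e by auto
 ultimately show ?thesis by (simp add: quotient_module_def coset_def')
qed

lemma quotient_add:
 assumes x: "x \<in> carrier M" and y: "y \<in> carrier M"
 shows "(N +>\<^sub>M x) \<oplus>\<^bsub>quotient_module M N\<^esub> (N +>\<^sub>M y) = N +>\<^sub>M (x \<oplus>\<^sub>M y)"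
proof -
 have "set_add M (N +>\<^sub>M x) (N +>\<^sub>M y) = {u \<oplus>\<^sub>M v |u v. u \<in> N +>\<^sub>M x \<and> v \<in> N +>\<^sub>M y}"
  by (auto simp: set_add_def set_mult_def)
 also have "\<dots> = N +>\<^sub>M (x \<oplus>\<^sub>M y)"
 proof (intro equalityI subsetI)
  fix z assume "z \<in> {u \<oplus>\<^sub>M v |u v. u \<in> N +>\<^sub>M x \<and> v \<in> N +>\<^sub>M y}"
  then obtain u v where uv: "z = u \<oplus>\<^sub>M v" "u \<in> N +>\<^sub>M x" "v \<in> N +>\<^sub>M y" by blast
  then have uvc: "u \<in> carrier M" "v \<in> carrier M" and d: "u \<ominus>\<^sub>M x \<in> N" "v \<ominus>\<^sub>M y \<in> N"
   using in_coset x y by auto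
  from N(4)[OF d] show "z \<in> N +>\<^sub>M (x \<oplus>\<^sub>M y)"
   using uvc x y uv(1) by (simp add: in_coset M.add_minus_add)
 next
  fix z assume "z \<in> N +>\<^sub>M (x \<oplus>\<^sub>M y)"
  then obtain n where n: "n \<in> N" "z = n \<oplus>\<^sub>M (x \<oplus>\<^sub>M y)" unfolding coset_def' by blast
  then have "z = (n \<oplus>\<^sub>M x) \<oplus>\<^sub>M y" using N(2) x y M.a_assoc[of n x y] by auto
  moreover have "n \<oplus>\<^sub>M x \<in> N +>\<^sub>M x" using n coset_def' by blast
  ultimately show "z \<in> {u \<oplus>\<^sub>M v |u v. u \<in> N +>\<^sub>M x \<and> v \<in> N +>\<^sub>M y}"
   using self_coset[OF y] by blast
 qed
 finally show ?thesis by (simp add: quotient_module_def)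
qed

lemma quotient_smult:
 assumes a: "a \<in> carrier R" and x: "x \<in> carrier M"
 shows "a \<odot>\<^bsub>quotient_module M N\<^esub> (N +>\<^sub>M x) = N +>\<^sub>M (a \<odot>\<^sub>M x)"
proof -
 have "N +>\<^sub>M (a \<odot>\<^sub>M z) = N +>\<^sub>M (a \<odot>\<^sub>M x)" if "z \<in> N +>\<^sub>M x" for z
 proof -
  have z: "z \<in> carrier M" "z \<ominus>\<^sub>M x \<in> N" using that in_coset[OF x] by auto
  from N(7)[OF a z(2)] show ?thesis
   using z(1) x a by (simp add: coset_eq_iff smult_closed smult_minus_r)
 qed
 then have "(\<Union>z\<in>N +>\<^sub>M x. N +>\<^sub>M (a \<odot>\<^sub>M z)) = N +>\<^sub>M (a \<odot>\<^sub>M x)"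
  using self_coset[OF x] by blast
 then show ?thesis by (simp add: quotient_module_def)
qed

lemma quotient_left_module: "left_module R (quotient_module M N)"
proof (rule left_moduleI[OF R.ring_axioms])
 show "abelian_group (quotient_module M N)"
 proof (rule abelian_groupI)
  fix u assume "u \<in> carrier (quotient_module M N)"
  then obtain x where x: "x \<in> carrier M" "u = N +>\<^sub>M x" by (rule quotient_carrierE)
  then have "(N +>\<^sub>M (\<ominus>\<^sub>M x)) \<oplus>\<^bsub>quotient_module M N\<^esub> u = \<zero>\<^bsub>quotient_module M N\<^esub>"
   by (simp add: quotient_add quotient_zero M.l_neg)
  then show "\<exists>v\<in>carrier (quotient_module M N). v \<oplus>\<^bsub>quotient_module M N\<^esub> u = \<zero>\<^bsub>quotient_module M N\<^esub>"
   using x unfolding quotient_carrier by blast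
 next
  show "\<zero>\<^bsub>quotient_module M N\<^esub> \<in> carrier (quotient_module M N)"
   unfolding quotient_carrier quotient_zero by blast
  fix u v assume uv: "u \<in> carrier (quotient_module M N)" "v \<in> carrier (quotient_module M N)"
  obtain x where x: "x \<in> carrier M" "u = N +>\<^sub>M x" using uv(1) by (rule quotient_carrierE)
  obtain y where y: "y \<in> carrier M" "v = N +>\<^sub>M y" using uv(2) by (rule quotient_carrierE)
  have xy: "x \<oplus>\<^sub>M y \<in> carrier M" using x y by simp
  show "u \<oplus>\<^bsub>quotient_module M N\<^esub> v \<in> carrier (quotient_module M N)"
   unfolding x(2) y(2) quotient_add[OF x(1) y(1)] quotient_carrier using xy by blast
  show "u \<oplus>\<^bsub>quotient_module M N\<^esub> v = v \<oplus>\<^bsub>quotient_module M N\<^esub> u"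
   using x y by (simp add: quotient_add M.a_comm)
  fix w assume w: "w \<in> carrier (quotient_module M N)"
  obtain z where z: "z \<in> carrier M" "w = N +>\<^sub>M z" using w by (rule quotient_carrierE)
  show "u \<oplus>\<^bsub>quotient_module M N\<^esub> v \<oplus>\<^bsub>quotient_module M N\<^esub> w =
   u \<oplus>\<^bsub>quotient_module M N\<^esub> (v \<oplus>\<^bsub>quotient_module M N\<^esub> w)"
   using x y z by (simp add: quotient_add M.a_assoc)
 next
  fix u assume "u \<in> carrier (quotient_module M N)"
  then obtain x where x: "x \<in> carrier M" "u = N +>\<^sub>M x" by (rule quotient_carrierE)
  then show "\<zero>\<^bsub>quotient_module M N\<^esub> \<oplus>\<^bsub>quotient_module M N\<^esub> u = u"
   by (simp add: quotient_zero quotient_add)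
 qed
next
 fix a u assume a: "a \<in> carrier R" and u: "u \<in> carrier (quotient_module M N)"
 obtain x where x: "x \<in> carrier M" "u = N +>\<^sub>M x" using u by (rule quotient_carrierE)
 have ax: "a \<odot>\<^sub>M x \<in> carrier M" using a x smult_closed by simp
 show "a \<odot>\<^bsub>quotient_module M N\<^esub> u \<in> carrier (quotient_module M N)"
  unfolding x(2) quotient_smult[OF a x(1)] quotient_carrier using ax by blast
 fix b assume b: "b \<in> carrier R"
 show "(a \<oplus> b) \<odot>\<^bsub>quotient_module M N\<^esub> u =
   a \<odot>\<^bsub>quotient_module M N\<^esub> u \<oplus>\<^bsub>quotient_module M N\<^esub> b \<odot>\<^bsub>quotient_module M N\<^esub> u"
  using a b x by (simp add: quotient_smult quotient_add smult_closed smult_l_distr)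
 show "(a \<otimes> b) \<odot>\<^bsub>quotient_module M N\<^esub> u = a \<odot>\<^bsub>quotient_module M N\<^esub> (b \<odot>\<^bsub>quotient_module M N\<^esub> u)"
  using a b x by (simp add: quotient_smult smult_closed smult_assoc)
next
 fix u assume u: "u \<in> carrier (quotient_module M N)"
 obtain x where x: "x \<in> carrier M" "u = N +>\<^sub>M x" using u by (rule quotient_carrierE)
 show "\<one> \<odot>\<^bsub>quotient_module M N\<^esub> u = u" using x by (simp add: quotient_smult smult_one)
next
 fix a u v assume a: "a \<in> carrier R" and uv: "u \<in> carrier (quotient_module M N)" "v \<in> carrier (quotient_module M N)"
 obtain x where x: "x \<in> carrier M" "u = N +>\<^sub>M x" using uv(1) by (rule quotient_carrierE)
 obtain y where y: "y \<in> carrier M" "v = N +>\<^sub>M y" using uv(2) by (rule quotient_carrierE)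
 show "a \<odot>\<^bsub>quotient_module M N\<^esub> (u \<oplus>\<^bsub>quotient_module M N\<^esub> v) =
   a \<odot>\<^bsub>quotient_module M N\<^esub> u \<oplus>\<^bsub>quotient_module M N\<^esub> a \<odot>\<^bsub>quotient_module M N\<^esub> v"
  using a x y by (simp add: quotient_smult quotient_add smult_closed smult_r_distr)
qed

end

lemma left_module_if_module:
 assumes "Module.module R M"
 shows "left_module R M"
proof -
 interpret Module.module R M by (rule assms)
 show ?thesis
  by (rule left_moduleI[OF R.ring_axioms M.abelian_group_axioms])
   (simp_all add: smult_l_distr smult_r_distr smult_assoc1)
qed

lemma module_if_left_module:
 assumes "cring R" "left_module R M"
 shows "Module.module R M"
proof -
 interpret left_module R M by (rule assms)
 show ?thesis
  by (rule moduleI[OF assms(1) M.abelian_group_axioms])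
   (simp_all add: smult_closed smult_l_distr smult_r_distr smult_assoc smult_one)
qed

context vectorspace
begin

lemma left_submodule_if_submodule:
 assumes "submodule K W V"
 shows "left_submodule K W V"
proof -
 have "\<ominus>\<^sub>V x \<in> W" if "x \<in> W" for x
 proof -
  have "x \<in> carrier V" using that assms by (auto simp: submodule_def)
  then have "\<ominus>\<^sub>V x = (\<ominus>\<^sub>K \<one>\<^sub>K) \<odot>\<^sub>V x" by (simp add: smult_minus_1)
  then show ?thesis using assms that by (simp add: submodule_def)
 qed
 then show ?thesis
  using assms unfolding left_submodule_def by (auto simp: submodule_def intro!: M.add_subgroupI)
qed

lemma quotient_vectorspace:
 assumes "left_submodule K W V"
 shows "vectorspace K (quotient_module V W)" "coset_quotient K V W"
proof -
 show "coset_quotient K V W"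
  using assms left_module_if_module[OF module_axioms]
  by (simp add: coset_quotient_def coset_quotient_axioms_def)
 then have "left_module K (quotient_module V W)" by (rule coset_quotient.quotient_left_module)
 then have "Module.module K (quotient_module V W)" by (rule module_if_left_module[OF R.cring_axioms])
 then show "vectorspace K (quotient_module V W)" by (simp add: vectorspace_def field_axioms)
qed

end

section \<open>Nice graded algebras\<close>

context graded_alg
begin

lemma graded_simpleD:
 assumes "graded_simple A S"
 shows "graded_mod K A S" "carrier S ~= {\<zero>\<^sub>S}"
  "!!N. graded_submodule A N S ==> N = {\<zero>\<^sub>S} \<or> N = carrier S"
 using assms graded_alg_axioms
 by (auto simp: graded_simple_def graded_mod_def graded_mod_axioms_def graded_submodule_def)

lemma graded_simple_cyclic:
 assumes S: "graded_simple A S" and x: "x \<in> component S j" "x ~= \<zero>\<^sub>S" and y: "y \<in> carrier S"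
 obtains a where "a \<in> carrier A" "y = a \<odot>\<^sub>S x"
proof -
 interpret S: graded_mod K A S using graded_simpleD(1)[OF S] .
 let ?C = "{a \<odot>\<^sub>S x |a. a \<in> carrier A}"
 have "x = \<one> \<odot>\<^sub>S x" using S.M.smult_one S.M.component_closed[OF x(1)] by simp
 then have "x \<in> ?C" by blast
 then have "?C = carrier S" using graded_simpleD(3)[OF S S.cyclic_submodule[OF x(1)]] x(2) by blast
 then have "y \<in> ?C" using y by simp
 then show thesis using that by blast
qed

text \<open>\<open>A x\<close> is a nonzero graded submodule, hence everything. Taking the degree
  \<open>k\<close> component of \<open>y = a x\<close> replaces \<open>a\<close> by its component of
  degree \<open>k - j\<close>.\<close>

lemma graded_simple_cyclic_homogeneous:
 assumes S: "graded_simple A S" and x: "x \<in> component S j" "x ~= \<zero>\<^sub>S" and y: "y \<in> component S k"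
 obtains a where "a \<in> component A (k - j)" "y = a \<odot>\<^sub>S x"
proof -
 interpret S: graded_mod K A S using graded_simpleD(1)[OF S] .
 obtain a where a: "a \<in> carrier A" "y = a \<odot>\<^sub>S x"
  using graded_simple_cyclic[OF S x S.M.component_closed[OF y]] .
 have "y = hcomp S y k" using S.M.hcomp_homogeneous[OF y, of k] by simp
 also have "\<dots> = hcomp A a (k - j) \<odot>\<^sub>S x" unfolding a(2) by (rule S.hcomp_smult_r[OF a(1) x(1)])
 finally show thesis using that GA.hcomp_component[OF a(1)] by blast
qed

lemma graded_simple_nonzero:
 assumes S: "graded_simple A S"
 obtains x j where "x \<in> component S j" "x ~= \<zero>\<^sub>S"
proof -
 interpret S: graded_mod K A S using graded_simpleD(1)[OF S] .
 obtain y where "y \<in> carrier S" "y ~= \<zero>\<^sub>S" using graded_simpleD(2)[OF S] S.M.M.zero_closed by blast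
 then obtain j where "hcomp S y j ~= \<zero>\<^sub>S" using S.M.eq_zeroI by blast
 then show thesis using that S.M.hcomp_component \<open>y \<in> carrier S\<close> by blast
qed

lemma left_submodule_ideal:
 assumes "ideal I A"
 shows "left_submodule K I A"
proof -
 interpret I: ideal I A by (rule assms)
 have "c \<odot> x \<in> I" if "c \<in> carrier K" "x \<in> I" for c x
  using I.I_l_closed[OF that(2) scalar_closed[OF that(1)]] scalar_mult_l[OF that(1) I.a_Hcarr[OF that(2)]] by simp
 then show ?thesis unfolding left_submodule_def using I.a_subgroup by (simp add: additive_subgroup_def)
qed

end

locale nice_alg = graded_alg K A for K :: "'k ring" and A :: "('k, 'a) gmodule" (structure) +
 assumes nice: "nice_graded_algebra K A"
begin

text \<open>
  Finite-dimensionality of \<open>A/I\<close>, in the form: finitely many elements together with \<open>I\<close> span \<open>A\<close>.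
\<close>

lemma spanned_modulo_ideal:
 "\<exists>I G. I \<subseteq> carrier A \<and> (\<forall>x\<in>I. hcomp A x 0 = \<zero>) \<and>
  (\<forall>S :: 'a amodule. graded_simple A S --> (\<forall>a\<in>I. \<forall>x\<in>carrier S. a \<odot>\<^sub>S x = \<zero>\<^sub>S)) \<and>
  finite G \<and> G \<subseteq> carrier A \<and> (\<forall>W. submodule K W A --> I \<subseteq> W --> G \<subseteq> W --> W = carrier A)"
proof -
 obtain I where I: "ideal I A" "homogeneous_subset A I"
  "I \<subseteq> {x \<in> carrier A. \<forall>i\<le>0. hcomp A x i = \<zero>} \<or> I \<subseteq> {x \<in> carrier A. \<forall>i\<ge>0. hcomp A x i = \<zero>}"
  "\<forall>S :: 'a amodule. graded_simple A S --> (\<forall>a\<in>I. \<forall>x\<in>carrier S. a \<odot>\<^sub>S x = \<zero>\<^sub>S)"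
  "vectorspace.fin_dim K (quotient_module A I)"
  using nice unfolding nice_graded_algebra_def by blast
 have IA: "left_submodule K I A" by (rule left_submodule_ideal[OF I(1)])
 interpret Q: vectorspace K "quotient_module A I" by (rule KA.quotient_vectorspace[OF IA])
 interpret C: coset_quotient K A I by (rule KA.quotient_vectorspace[OF IA])
 obtain H where H: "finite H" "H \<subseteq> carrier (quotient_module A I)"
  "!!W. submodule K W (quotient_module A I) ==> H \<subseteq> W ==> W = carrier (quotient_module A I)"
  by (rule Q.fin_dim_generators[OF I(5)]) (rule that; blast)
 have "\<forall>u\<in>H. \<exists>x\<in>carrier A. u = I +>\<^sub>A x" using H(2) C.quotient_carrier by auto
 then obtain r where r: "!!u. u \<in> H ==> r u \<in> carrier A \<and> u = I +>\<^sub>A r u" by metis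
 \<comment> \<open>The image of \<open>W\<close> in the quotient by \<open>I\<close> is a subspace
   containing the generators \<open>H\<close>, hence everything. So each \<open>a\<close> is
   congruent to an element of \<open>W\<close>, and \<open>I\<close> is contained in
   \<open>W\<close>.\<close>
 have "W = carrier A" if W: "submodule K W A" "I \<subseteq> W" "r ` H \<subseteq> W" for W
 proof -
  have Wc: "W \<subseteq> carrier A" using W(1) by (simp add: submodule_def)
  let ?W = "{I +>\<^sub>A x |x. x \<in> W}"
  have "submodule K ?W (quotient_module A I)"
  proof (rule Q.submoduleI')
   show "?W \<subseteq> carrier (quotient_module A I)" using Wc C.quotient_carrier by blast
   have "\<zero> \<in> W" using W(1) by (simp add: submodule_def)
   then show "\<zero>\<^bsub>quotient_module A I\<^esub> \<in> ?W" unfolding C.quotient_zero by blast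
  next
   fix u v assume "u \<in> ?W" "v \<in> ?W"
   then obtain x y where xy: "x \<in> W" "y \<in> W" "u = I +>\<^sub>A x" "v = I +>\<^sub>A y" by blast
   moreover have "x \<oplus> y \<in> W" using xy W(1) by (simp add: submodule_def)
   moreover have "u \<oplus>\<^bsub>quotient_module A I\<^esub> v = I +>\<^sub>A (x \<oplus> y)"
    unfolding xy(3,4) using xy(1,2) Wc by (intro C.quotient_add) auto
   ultimately show "u \<oplus>\<^bsub>quotient_module A I\<^esub> v \<in> ?W" by blast
  next
   fix c u assume c: "c \<in> carrier K" and "u \<in> ?W"
   then obtain x where x: "x \<in> W" "u = I +>\<^sub>A x" by blast
   moreover have "c \<odot> x \<in> W" using c x W(1) by (simp add: submodule_def)
   moreover have "c \<odot>\<^bsub>quotient_module A I\<^esub> u = I +>\<^sub>A (c \<odot> x)"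
    unfolding x(2) using x(1) c Wc by (intro C.quotient_smult) auto
   ultimately show "c \<odot>\<^bsub>quotient_module A I\<^esub> u \<in> ?W" by blast
  qed
  moreover have "H \<subseteq> ?W" using r W(3) by blast
  ultimately have full: "?W = carrier (quotient_module A I)" by (rule H(3))
  have "a \<in> W" if a: "a \<in> carrier A" for a
  proof -
   have "I +>\<^sub>A a \<in> ?W" unfolding full C.quotient_carrier using a by blast
   then obtain x where x: "x \<in> W" "I +>\<^sub>A a = I +>\<^sub>A x" by blast
   then have xc: "x \<in> carrier A" using Wc by blast
   have "a \<ominus> x \<in> W" using C.coset_eq_iff[OF a xc] x(2) W(2) by blast
   then have "(a \<ominus> x) \<oplus> x \<in> W" using x(1) W(1) by (simp add: submodule_def)
   then show ?thesis using minus_add_cancel[OF a xc] by simp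
  qed
  then show ?thesis using Wc by blast
 qed
 moreover have "I \<subseteq> carrier A" "\<forall>x\<in>I. hcomp A x 0 = \<zero>" using I(3) by auto
 moreover have "finite (r ` H)" "r ` H \<subseteq> carrier A" using H(1) r by auto
 ultimately show ?thesis using I(4) by (intro exI[of _ I] exI[of _ "r ` H"]) simp
qed

lemma component_submodule: "submodule K (component A i) A"
 by (rule KA.submoduleI')
  (use GA.component_closed GA.component_zero GA.component_add smult_component in auto)

lemma hcomp_smult: "c \<in> carrier K ==> x \<in> carrier A ==> hcomp A (c \<odot> x) i = c \<odot> hcomp A x i"
 using hcomp_mult_l[OF scalar_component, of c x i]
 by (simp add: scalar_mult_l GA.hcomp_closed)

text \<open>The ideal \<open>I\<close> has no component in degree 0, so the projection to degree 0
  kills it, and the projections of the finitely many remaining generators span.\<close>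

lemma degree_zero_fin_dim: "vectorspace.fin_dim K (A\<lparr>carrier := component A 0\<rparr>)"
proof -
 obtain I G where I: "I \<subseteq> carrier A" "\<forall>x\<in>I. hcomp A x 0 = \<zero>" and
  G: "finite G" "G \<subseteq> carrier A" "\<forall>W. submodule K W A --> I \<subseteq> W --> G \<subseteq> W --> W = carrier A"
  using spanned_modulo_ideal by metis
 interpret V: vectorspace K "A\<lparr>carrier := component A 0\<rparr>"
  by (rule KA.submodule_vectorspace[OF component_submodule])
 show ?thesis
 proof (rule V.fin_dim_spanI)
  show "finite ((%g. hcomp A g 0) ` G)" using G(1) by simp
  show "(%g. hcomp A g 0) ` G \<subseteq> carrier (A\<lparr>carrier := component A 0\<rparr>)"
   using G(2) GA.hcomp_component by auto
  fix W assume W: "submodule K W (A\<lparr>carrier := component A 0\<rparr>)" "(%g. hcomp A g 0) ` G \<subseteq> W"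
  let ?W = "{a \<in> carrier A. hcomp A a 0 \<in> W}"
  have Wd: "\<zero> \<in> W" "!!x y. x \<in> W ==> y \<in> W ==> x \<oplus> y \<in> W"
   "!!c x. c \<in> carrier K ==> x \<in> W ==> c \<odot> x \<in> W"
   using W(1) by (auto simp: submodule_def)
  have "submodule K ?W A"
   by (rule KA.submoduleI') (use Wd in \<open>auto simp: GA.hcomp_zero GA.hcomp_add hcomp_smult\<close>)
  moreover have "I \<subseteq> ?W" using I Wd(1) by auto
  moreover have "G \<subseteq> ?W" using G(2) W(2) by auto
  ultimately have "?W = carrier A" by (rule G(3)[rule_format])
  show "carrier (A\<lparr>carrier := component A 0\<rparr>) \<subseteq> W"
  proof
   fix a assume "a \<in> carrier (A\<lparr>carrier := component A 0\<rparr>)"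
   then have a: "a \<in> component A 0" by simp
   then have "hcomp A a 0 \<in> W" using \<open>?W = carrier A\<close> GA.component_closed[OF a] by blast
   then show "a \<in> W" using GA.hcomp_homogeneous[OF a, of 0] by simp
  qed
 qed
qed

text \<open>\<open>S = A x\<close> for a homogeneous \<open>x\<close>, and \<open>I\<close>
  annihilates \<open>x\<close>; hence the finitely many \<open>g x\<close> with \<open>g\<close> in
  \<open>G\<close> span \<open>S\<close>.\<close>

lemma graded_simple_fin_dim:
 fixes S :: "'a amodule"
 assumes S: "graded_simple A S"
 shows "S \<in> fmod K A"
proof -
 obtain I G where I: "I \<subseteq> carrier A"
  "\<forall>S :: 'a amodule. graded_simple A S --> (\<forall>a\<in>I. \<forall>x\<in>carrier S. a \<odot>\<^sub>S x = \<zero>\<^sub>S)" and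
  G: "finite G" "G \<subseteq> carrier A" "\<forall>W. submodule K W A --> I \<subseteq> W --> G \<subseteq> W --> W = carrier A"
  using spanned_modulo_ideal by metis
 interpret S: graded_mod K A S using graded_simpleD(1)[OF S] .
 obtain x j where x: "x \<in> component S j" "x ~= \<zero>\<^sub>S" using graded_simple_nonzero[OF S] .
 have xc: "x \<in> carrier S" using S.M.component_closed[OF x(1)] .
 have "vectorspace.fin_dim K (underlying_space A S)"
 proof (rule S.KM.fin_dim_spanI)
  show "finite ((%g. g \<odot>\<^sub>S x) ` G)" using G(1) by simp
  show "(%g. g \<odot>\<^sub>S x) ` G \<subseteq> carrier (underlying_space A S)"
   using G(2) xc S.M.smult_closed by auto
  fix W assume W: "submodule K W (underlying_space A S)" "(%g. g \<odot>\<^sub>S x) ` G \<subseteq> W"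
  let ?W = "{a \<in> carrier A. a \<odot>\<^sub>S x \<in> W}"
  have Wd: "\<zero>\<^sub>S \<in> W" "!!x y. x \<in> W ==> y \<in> W ==> x \<oplus>\<^sub>S y \<in> W"
   "!!c x. c \<in> carrier K ==> x \<in> W ==> scalar c \<odot>\<^sub>S x \<in> W"
   using W(1) by (auto simp: submodule_def scalar_def)
  have "submodule K ?W A"
  proof (rule KA.submoduleI')
   fix c a assume c: "c \<in> carrier K" and a: "a \<in> ?W"
   then have "(c \<odot> a) \<odot>\<^sub>S x = scalar c \<odot>\<^sub>S (a \<odot>\<^sub>S x)"
    using S.M.smult_assoc[OF scalar_closed[OF c] _ xc, of a] scalar_mult_l[OF c] by simp
   then show "c \<odot> a \<in> ?W" using Wd(3)[OF c, of "a \<odot>\<^sub>S x"] a c by simp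
  qed (use Wd xc in \<open>auto simp: S.M.smult_zero_l S.M.smult_l_distr\<close>)
  moreover have "I \<subseteq> ?W"
  proof
   fix a assume a: "a \<in> I"
   then have "a \<odot>\<^sub>S x = \<zero>\<^sub>S" using I(2) S xc by simp
   then show "a \<in> ?W" using a I(1) Wd(1) by auto
  qed
  moreover have "G \<subseteq> ?W" using G(2) W(2) by auto
  ultimately have full: "?W = carrier A" by (rule G(3)[rule_format])
  show "carrier (underlying_space A S) \<subseteq> W"
  proof
   fix y assume "y \<in> carrier (underlying_space A S)"
   then obtain a where "a \<in> carrier A" "y = a \<odot>\<^sub>S x" using graded_simple_cyclic[OF S x] by auto
   then show "y \<in> W" using full by blast
  qed
 qed
 then show ?thesis using S.graded_module by (simp add: fmod_def)
qed

end

section \<open>Local idempotents and graded simple modules\<close>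

lemma (in vectorspace) submodule_dim_less:
 assumes fd: fin_dim and U: "submodule K U V" and W: "submodule K W V" and UW: "U \<subset> W"
 shows "vectorspace.dim K (V\<lparr>carrier := U\<rparr>) < vectorspace.dim K (V\<lparr>carrier := W\<rparr>)"
proof -
 interpret W: vectorspace K "V\<lparr>carrier := W\<rparr>" by (rule submodule_vectorspace[OF W])
 have fdW: "W.fin_dim" by (rule subspace_fin_dim(1)[OF fd W])
 have UW': "submodule K U (V\<lparr>carrier := W\<rparr>)"
  by (rule W.submoduleI') (use U UW in \<open>auto simp: submodule_def\<close>)
 have "vectorspace.dim K (V\<lparr>carrier := U\<rparr>) \<le> W.dim" "vectorspace.dim K (V\<lparr>carrier := U\<rparr>) ~= W.dim"
  using W.subspace_fin_dim(2,3)[OF fdW UW'] UW by auto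
 then show ?thesis by simp
qed

context graded_alg
begin

lemma mult_component0: "x \<in> component A 0 ==> y \<in> component A i ==> x \<otimes> y \<in> component A i"
 "x \<in> component A i ==> y \<in> component A 0 ==> x \<otimes> y \<in> component A i"
 using mult_component[of x 0 y i] mult_component[of x i y 0] by auto

lemma pow_component0: "x \<in> component A 0 ==> x [^] (n::nat) \<in> component A 0"
 by (induct n) (auto simp: one_component mult_component0)

text \<open>The corner ring \<open>e A\<^sub>0 e\<close> is local, phrased by elements: each one is
  nilpotent or a unit with respect to \<open>e\<close>.\<close>

definition local_idempotent :: "'a => bool" where
 "local_idempotent e \<longleftrightarrow> e \<in> component A 0 \<and> e \<otimes> e = e \<and> e ~= \<zero> \<and>
   (\<forall>b\<in>component A 0. e \<otimes> b = b --> b \<otimes> e = b -->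
    (\<exists>n::nat. b [^] n = \<zero>) \<or> (\<exists>c\<in>component A 0. c \<otimes> b = e \<and> b \<otimes> c = e))"

definition primitive_idempotent :: "'a => bool" where
 "primitive_idempotent e \<longleftrightarrow> e \<in> component A 0 \<and> e \<otimes> e = e \<and> e ~= \<zero> \<and>
   (\<forall>g\<in>component A 0. g \<otimes> g = g --> e \<otimes> g = g --> g \<otimes> e = g --> g = \<zero> \<or> g = e)"

text \<open>For an idempotent \<open>e\<close> of degree 0 this says that the graded space
  \<open>e S\<close> is nonzero.\<close>

definition hits :: "'a => ('a, 'm) gmodule => bool" where
 "hits e S \<longleftrightarrow> (\<exists>j. \<exists>x\<in>component S j. x ~= \<zero>\<^sub>S \<and> e \<odot>\<^sub>S x = x)"

text \<open>For idempotents this expresses that \<open>A e\<close> is, up to a shift, a direct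
  summand of \<open>A f\<close>. The condition is preserved under reversal of products, so an
  anti-automorphism transports it.\<close>

definition factors :: "'a => 'a => bool" where
 "factors e f \<longleftrightarrow> (\<exists>k. \<exists>u\<in>component A k. \<exists>v\<in>component A (- k). u \<otimes> f \<otimes> v = e)"

lemma component_submodule: "submodule K (component A i) A"
 by (rule KA.submoduleI')
  (use GA.component_closed GA.component_zero GA.component_add smult_component in auto)

end

context nice_alg
begin

text \<open>The Fitting relation for an element of a finite-dimensional algebra: descending powers
  of \<open>b\<close> stabilise, and the witness \<open>z\<close> is a polynomial in
  \<open>b\<close>, hence commutes with it.\<close>

lemma power_relation:
 assumes b: "b \<in> component A 0"
 obtains k z where "k > 0" "z \<in> component A 0" "z \<otimes> b = b \<otimes> z" "b [^] k = b [^] Suc k \<otimes> z"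
proof -
 note [simp] = GA.component_closed[OF b]
 let ?V = "A\<lparr>carrier := component A 0\<rparr>"
 interpret V: vectorspace K ?V by (rule KA.submodule_vectorspace[OF graded_alg.component_submodule[OF graded_alg_axioms]])
 let ?N = V.dim
 \<comment> \<open>Exponents decrease, so a dependency expresses one power through strictly higher
   ones, from which \<open>b [^] Suc k\<close> can be factored out. As \<open>m\<close> is at most
   \<open>?N\<close>, the exponent \<open>k = Suc ?N - m\<close> is positive.\<close>
 define w where "w i = b [^] (Suc ?N - i)" for i
 have w: "w i \<in> component A 0" for i unfolding w_def by (rule pow_component0[OF b])
 have wc: "w i \<in> carrier A" for i using GA.component_closed[OF w] .
 obtain m where m: "m \<le> ?N" "w m \<in> V.span (w ` {..<m})"
  using V.sequence_dependent[OF degree_zero_fin_dim, of w] w by auto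
 have "V.span (w ` {..<m}) = KA.span (w ` {..<m})"
  by (rule KA.span_li_not_depend(1)[OF _ graded_alg.component_submodule[OF graded_alg_axioms]]) (use w in auto)
 then have "w m \<in> KA.span (w ` {..<m})" using m(2) by simp
 then obtain c where c: "c \<in> {..<m} \<rightarrow> carrier K" "w m = (\<Oplus>i\<in>{..<m}. c i \<odot> w i)"
  using KA.span_image_finsum[of "{..<m}" w "w m"] wc finite_lessThan by metis
 define z where "z = (\<Oplus>i\<in>{..<m}. c i \<odot> b [^] (m - i - 1))"
 have t: "c i \<odot> b [^] (m - i - 1) \<in> {y \<in> component A 0. y \<otimes> b = b \<otimes> y}" if "i \<in> {..<m}" for i
 proof -
  have ci: "c i \<in> carrier K" using c(1) that by auto
  have "b [^] (m - i - 1) \<otimes> b = b \<otimes> b [^] (m - i - 1)"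
   using nat_pow_Suc2[of b "m - i - 1"] by simp
  then show ?thesis
   using ci smult_component[OF ci pow_component0[OF b]] by (simp add: smult_mult_l smult_mult_r)
 qed
 have "submodule K {y \<in> component A 0. y \<otimes> b = b \<otimes> y} A"
  by (rule KA.submoduleI')
   (use GA.component_closed GA.component_zero GA.component_add smult_component in
    \<open>auto simp: l_distr r_distr smult_mult_l smult_mult_r\<close>)
 from KA.submodule_finsum[OF this t, of "{..<m}" "%i. i"]
 have z: "z \<in> component A 0" "z \<otimes> b = b \<otimes> z" unfolding z_def by auto
 let ?k = "Suc ?N - m"
 have "b [^] Suc ?k \<otimes> z = (\<Oplus>i\<in>{..<m}. b [^] Suc ?k \<otimes> (c i \<odot> b [^] (m - i - 1)))"
  unfolding z_def by (rule finsum_rdistr) (use c(1) in auto)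
 also have "\<dots> = (\<Oplus>i\<in>{..<m}. c i \<odot> w i)"
 proof (rule finsum_cong')
  fix i assume i: "i \<in> {..<m}"
  have "Suc ?k + (m - i - 1) = Suc ?N - i" using m(1) i by auto
  then have "b [^] Suc ?k \<otimes> b [^] (m - i - 1) = w i"
   using nat_pow_mult[of b "Suc ?k" "m - i - 1"] GA.component_closed[OF b] unfolding w_def by presburger
  then show "b [^] Suc ?k \<otimes> (c i \<odot> b [^] (m - i - 1)) = c i \<odot> w i"
   using c(1) i by (subst smult_mult_r) auto
 qed (use c(1) wc in auto)
 also have "\<dots> = b [^] ?k" using c(2) by (simp add: w_def)
 finally show thesis using that[of ?k z] z m(1) by simp
qed

text \<open>Fitting's lemma: each \<open>b\<close> in the corner determines an idempotent
  \<open>g\<close> of the corner with \<open>b [^] k \<otimes> g = b [^] k\<close>. Primitivity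
  leaves \<open>g = 0\<close>, where \<open>b\<close> is nilpotent, or \<open>g = e\<close>, where
  \<open>b\<close> is a unit.\<close>

lemma primitive_local:
 assumes e: "primitive_idempotent e"
 shows "local_idempotent e"
 unfolding local_idempotent_def
proof (intro conjI ballI impI)
 show "e \<in> component A 0" "e \<otimes> e = e" "e ~= \<zero>" using e by (auto simp: primitive_idempotent_def)
 then have ec [simp]: "e \<in> carrier A" using GA.component_closed by blast
 fix b assume b: "b \<in> component A 0" and eb: "e \<otimes> b = b" and be: "b \<otimes> e = b"
 have bc [simp]: "b \<in> carrier A" using b GA.component_closed by blast
 obtain k z where k: "k > 0" and z: "z \<in> component A 0" "z \<otimes> b = b \<otimes> z"
  and rel: "b [^] k = b [^] Suc k \<otimes> z" using power_relation[OF b] .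
 have zc [simp]: "z \<in> carrier A" using z GA.component_closed by blast
 define y where "y = b \<otimes> z"
 have yc [simp]: "y \<in> carrier A" by (simp add: y_def)
 have "b [^] k \<otimes> y = b [^] k" using rel by (simp add: y_def m_assoc)
 then have iter: "b [^] k \<otimes> y [^] n = b [^] k" for n :: nat
 proof (induct n)
  case (Suc n)
  have "b [^] k \<otimes> y [^] Suc n = (b [^] k \<otimes> y [^] n) \<otimes> y" by (simp add: m_assoc)
  then show ?case using Suc by simp
 qed simp
 \<comment> \<open>\<open>g\<close> is the \<open>k\<close>-th power of \<open>b z\<close>. It
   equals both \<open>b [^] k \<otimes> z [^] k\<close> and the product in the other order; since
   \<open>k > 0\<close>, the two forms show \<open>e g = g\<close> and \<open>g e = g\<close>,
   although \<open>z\<close> need not lie in the corner.\<close>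
 define g where "g = y [^] k"
 have g1: "g = b [^] k \<otimes> z [^] k"
  unfolding g_def y_def by (rule pow_mult_distrib) (use z in auto)
 have zb: "z \<otimes> b [^] n = b [^] n \<otimes> z" for n :: nat
 proof (induct n)
  case (Suc n)
  have "z \<otimes> b [^] Suc n = (z \<otimes> b [^] n) \<otimes> b" by (simp add: m_assoc)
  also have "\<dots> = b [^] n \<otimes> (z \<otimes> b)" by (simp add: Suc m_assoc)
  also have "\<dots> = b [^] Suc n \<otimes> z" by (simp add: z(2) m_assoc)
  finally show ?case .
 qed simp
 have zkb: "z [^] l \<otimes> b [^] n = b [^] n \<otimes> z [^] l" for n l :: nat
 proof (induct l)
  case (Suc l)
  have "z [^] Suc l \<otimes> b [^] n = z [^] l \<otimes> (b [^] n \<otimes> z)" by (simp add: m_assoc zb)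
  also have "\<dots> = (z [^] l \<otimes> b [^] n) \<otimes> z" by (simp add: m_assoc)
  also have "\<dots> = b [^] n \<otimes> z [^] Suc l" by (simp add: Suc m_assoc)
  finally show ?case .
 qed simp
 have g2: "g = z [^] k \<otimes> b [^] k" unfolding g1 zkb ..
 have gc [simp]: "g \<in> carrier A" by (simp add: g_def)
 have bg: "b [^] k \<otimes> g = b [^] k" unfolding g_def by (rule iter)
 have gg: "g \<otimes> g = g"
 proof -
  have "g \<otimes> g = z [^] k \<otimes> (b [^] k \<otimes> g)" by (subst (1) g2) (simp add: m_assoc)
  then show ?thesis using bg g2 by simp
 qed
 obtain k' where k': "k = Suc k'" using k by (cases k) auto
 have bk: "b [^] k = b \<otimes> b [^] k'" "b [^] k = b [^] k' \<otimes> b"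
  unfolding k' using nat_pow_Suc2[OF bc] by auto
 have eg: "e \<otimes> g = g" unfolding g1 bk(1) using eb by (simp add: m_assoc[symmetric])
 have ge: "g \<otimes> e = g" unfolding g2 bk(2) using be by (simp add: m_assoc)
 have g0: "g \<in> component A 0"
  unfolding g1 using pow_component0[OF b] pow_component0[OF z(1)] mult_component0(1) by blast
 then consider "g = \<zero>" | "g = e" using e gg eg ge unfolding primitive_idempotent_def by blast
 then show "(\<exists>n::nat. b [^] n = \<zero>) \<or> (\<exists>c\<in>component A 0. c \<otimes> b = e \<and> b \<otimes> c = e)"
 proof cases
  case 1
  then show ?thesis using bg by (auto intro!: exI[of _ k])
 next
  case 2
  \<comment> \<open>Splitting one factor \<open>b\<close> off \<open>g = e\<close> leaves the
    inverse of \<open>b\<close>.\<close>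
  let ?c = "b [^] k' \<otimes> z [^] k"
  have c0: "?c \<in> component A 0" using pow_component0[OF b] pow_component0[OF z(1)] mult_component0(1) by blast
  have "b \<otimes> ?c = e" using 2 g1 bk(1) by (simp add: m_assoc)
  moreover have "?c \<otimes> b = e"
  proof -
   have "?c \<otimes> b = b [^] k' \<otimes> (b \<otimes> z [^] k)" using zkb[of k 1] by (simp add: m_assoc)
   also have "\<dots> = g" unfolding g1 bk(2) by (simp add: m_assoc)
   finally show ?thesis using 2 by simp
  qed
  ultimately show ?thesis using c0 by blast
 qed
qed

text \<open>Induction on the dimension of \<open>A\<^sub>0 f\<close>. A non-primitive
  \<open>f\<close> splits as \<open>g + h\<close> with smaller left ideals; a vector killed by the
  primitive idempotents found for \<open>g\<close> and for \<open>h\<close> is killed by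
  \<open>f\<close>.\<close>

lemma idempotent_covered:
 assumes "f \<in> component A 0" "f \<otimes> f = f"
 shows "\<exists>E. finite E \<and> (\<forall>e\<in>E. primitive_idempotent e) \<and>
  (\<forall>(S :: 'a amodule) x. graded_module A S --> x \<in> carrier S --> (\<forall>e\<in>E. e \<odot>\<^sub>S x = \<zero>\<^sub>S) --> f \<odot>\<^sub>S x = \<zero>\<^sub>S)"
  (is "?P f")
 using assms
proof (induct "vectorspace.dim K (A\<lparr>carrier := {a \<otimes> f |a. a \<in> component A 0}\<rparr>)" arbitrary: f rule: less_induct)
 case less
 let ?V = "A\<lparr>carrier := component A 0\<rparr>"
 interpret V: vectorspace K ?V by (rule KA.submodule_vectorspace[OF graded_alg.component_submodule[OF graded_alg_axioms]])
 let ?L = "%f. {a \<otimes> f |a. a \<in> component A 0}"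
 have L: "submodule K (?L f) ?V" if f: "f \<in> component A 0" for f
 proof (rule V.submoduleI')
  note fc = GA.component_closed[OF f]
  show "?L f \<subseteq> carrier ?V" using f mult_component0(1) by auto
  have "\<zero> = \<zero> \<otimes> f" using fc by simp
  then show "\<zero>\<^bsub>?V\<^esub> \<in> ?L f" using GA.component_zero by auto
  fix x y assume "x \<in> ?L f" "y \<in> ?L f"
  then obtain a b where ab: "a \<in> component A 0" "b \<in> component A 0" "x = a \<otimes> f" "y = b \<otimes> f" by blast
  then have "x \<oplus> y = (a \<oplus> b) \<otimes> f" using fc GA.component_closed l_distr by simp
  then show "x \<oplus>\<^bsub>?V\<^esub> y \<in> ?L f" using GA.component_add[OF ab(1,2)] by auto
 next
  note fc = GA.component_closed[OF f]
  fix c x assume c: "c \<in> carrier K" and "x \<in> ?L f"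
  then obtain a where a: "a \<in> component A 0" "x = a \<otimes> f" by blast
  then have "c \<odot> x = (c \<odot> a) \<otimes> f" using fc GA.component_closed[OF a(1)] c by (simp add: smult_mult_l)
  then show "c \<odot>\<^bsub>?V\<^esub> x \<in> ?L f" using smult_component[OF c a(1)] by auto
 qed
 note fc [simp] = GA.component_closed[OF less.prems(1)]
 \<comment> \<open>For an idempotent \<open>g\<close> below \<open>f\<close>, the left ideal of
   \<open>g\<close> lies in that of \<open>f\<close> but cannot contain \<open>f\<close>: otherwise
   \<open>f g = f\<close>, whereas \<open>f g = g\<close>.\<close>
 have smaller: "vectorspace.dim K (A\<lparr>carrier := ?L g\<rparr>) < vectorspace.dim K (A\<lparr>carrier := ?L f\<rparr>)"
  if g: "g \<in> component A 0" "g \<otimes> f = g" "f \<otimes> g = g" "g ~= f" "g \<otimes> g = g" for g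
 proof -
  note gc [simp] = GA.component_closed[OF g(1)]
  have "?L g \<subseteq> ?L f"
  proof
   fix x assume "x \<in> ?L g"
   then obtain a where a: "a \<in> component A 0" "x = a \<otimes> g" by blast
   then have "x = (a \<otimes> g) \<otimes> f" using g(2) GA.component_closed[OF a(1)] by (simp add: m_assoc)
   then show "x \<in> ?L f" using mult_component0(1)[OF a(1) g(1)] by blast
  qed
  moreover have "f \<notin> ?L g"
  proof
   assume "f \<in> ?L g"
   then obtain a where a: "a \<in> component A 0" "f = a \<otimes> g" by blast
   then have "f \<otimes> g = f" using g(5) GA.component_closed[OF a(1)] by (simp add: m_assoc)
   then show False using g(3,4) by simp
  qed
  moreover have "f \<in> ?L f" using less.prems by (auto intro!: exI[of _ f])
  ultimately have "?L g \<subset> ?L f" by blast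
  from V.submodule_dim_less[OF degree_zero_fin_dim L[OF g(1)] L[OF less.prems(1)] this] show ?thesis by simp
 qed
 show ?case
 proof (cases "f = \<zero> \<or> primitive_idempotent f")
  case True
  then show ?thesis
  proof
   assume f: "f = \<zero>"
   have "f \<odot>\<^sub>S x = \<zero>\<^sub>S" if "graded_module A S" "x \<in> carrier S" for S :: "'a amodule" and x
   proof -
    interpret S: graded_mod K A S using that graded_alg_axioms by (simp add: graded_mod_def graded_mod_axioms_def)
    show ?thesis using f S.M.smult_zero_l[OF that(2)] by simp
   qed
   then show ?thesis by (intro exI[of _ "{}"]) simp
  next
   assume "primitive_idempotent f"
   then show ?thesis by (intro exI[of _ "{f}"]) simp
  qed
 next
  case False
  then obtain g where g: "g \<in> component A 0" "g \<otimes> g = g" "f \<otimes> g = g" "g \<otimes> f = g" "g ~= \<zero>" "g ~= f"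
   using less.prems unfolding primitive_idempotent_def by blast
  note gc [simp] = GA.component_closed[OF g(1)]
  define h where "h = f \<ominus> g"
  have h: "h \<in> component A 0" "f \<otimes> h = h" "h \<otimes> f = h" "h \<otimes> h = h"
   using less.prems g GA.component_minus
   by (auto simp: h_def a_minus_def l_distr r_distr l_minus r_minus minus_add r_neg a_assoc)
  note hc [simp] = GA.component_closed[OF h(1)]
  have hf: "h ~= f"
  proof
   assume "h = f"
   then have "f \<ominus> g \<oplus> g = f \<oplus> g" by (simp add: h_def)
   then have "f = f \<oplus> g" by (simp add: minus_add_cancel)
   then have "f \<oplus> g = f \<oplus> \<zero>" by simp
   then have "g = \<zero>" using add.l_cancel[of f g \<zero>] by simp
   then show False using g by simp
  qed
  define Q where "Q g E \<longleftrightarrow> finite E \<and> (\<forall>e\<in>E. primitive_idempotent e) \<and>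
   (\<forall>(S :: 'a amodule) x. graded_module A S --> x \<in> carrier S --> (\<forall>e\<in>E. e \<odot>\<^sub>S x = \<zero>\<^sub>S) --> g \<odot>\<^sub>S x = \<zero>\<^sub>S)" for g E
  obtain E1 where "Q g E1"
   using less.hyps[OF smaller[OF g(1,4,3,6,2)] g(1,2)] unfolding Q_def[symmetric] by blast
  moreover obtain E2 where "Q h E2"
   using less.hyps[OF smaller[OF h(1,3,2) hf h(4)] h(1,4)] unfolding Q_def[symmetric] by blast
  ultimately have
   E1: "finite E1" "\<forall>e\<in>E1. primitive_idempotent e"
   "\<forall>(S :: 'a amodule) x. graded_module A S --> x \<in> carrier S --> (\<forall>e\<in>E1. e \<odot>\<^sub>S x = \<zero>\<^sub>S) --> g \<odot>\<^sub>S x = \<zero>\<^sub>S" and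
   E2: "finite E2" "\<forall>e\<in>E2. primitive_idempotent e"
   "\<forall>(S :: 'a amodule) x. graded_module A S --> x \<in> carrier S --> (\<forall>e\<in>E2. e \<odot>\<^sub>S x = \<zero>\<^sub>S) --> h \<odot>\<^sub>S x = \<zero>\<^sub>S"
   unfolding Q_def by blast+
  have "f \<odot>\<^sub>S x = \<zero>\<^sub>S" if S: "graded_module A S" and x: "x \<in> carrier S"
   and z: "\<forall>e\<in>E1 \<union> E2. e \<odot>\<^sub>S x = \<zero>\<^sub>S" for S :: "'a amodule" and x
  proof -
   interpret S: graded_mod K A S using S graded_alg_axioms by (simp add: graded_mod_def graded_mod_axioms_def)
   have "g \<odot>\<^sub>S x = \<zero>\<^sub>S" "h \<odot>\<^sub>S x = \<zero>\<^sub>S"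
    using E1(3)[rule_format, OF S x] E2(3)[rule_format, OF S x] z by auto
   moreover have "f = h \<oplus> g" by (simp add: h_def minus_add_cancel)
   ultimately show ?thesis using x by (simp add: S.M.smult_l_distr)
  qed
  then show ?thesis using E1(1,2) E2(1,2) by (intro exI[of _ "E1 \<union> E2"]) blast
 qed
qed

end

section \<open>Comparing graded simple modules through local idempotents\<close>

lemma (in graded_mod) shift_simple:
 assumes "graded_simple A M"
 shows "graded_simple A (shift k M)"
proof -
 have "N = {\<zero>\<^sub>M} \<or> N = carrier M" if "graded_submodule A N (shift k M)" for N
  using that assms graded_submodule_shift[of N k] by (auto simp: graded_simple_def graded_submodule_def)
 then show ?thesis
  using assms shift_graded_module[of k] by (auto simp: graded_simple_def graded_submodule_def shift_def)
qed

context graded_alg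
begin

lemma graded_modI: "graded_module A M ==> graded_mod K A M"
 using graded_alg_axioms by (simp add: graded_mod_def graded_mod_axioms_def)

lemma hits_shift [simp]: "hits e (shift k S) \<longleftrightarrow> hits e S"
 unfolding hits_def shift_def by (auto simp: Bex_def) (metis add_diff_cancel)

text \<open>If \<open>e x = x\<close> and \<open>u f v = e\<close>, then \<open>u\<close> sends
  \<open>f v x\<close> back to \<open>x\<close>, so \<open>f v x\<close> is a nonzero vector fixed
  by \<open>f\<close>.\<close>

lemma hits_factors:
 assumes f: "f \<in> component A 0" "f \<otimes> f = f" and S: "graded_module A S"
  and ef: "factors e f" and hit: "hits e S"
 shows "hits f S"
proof -
 interpret S: graded_mod K A S by (rule graded_modI[OF S])
 obtain k u v where u: "u \<in> component A k" and v: "v \<in> component A (- k)" and uv: "u \<otimes> f \<otimes> v = e"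
  using ef by (auto simp: factors_def)
 obtain j x where x: "x \<in> component S j" "x ~= \<zero>\<^sub>S" "e \<odot>\<^sub>S x = x"
  using hit by (auto simp: hits_def)
 note [simp] = GA.component_closed[OF u] GA.component_closed[OF v] GA.component_closed[OF f(1)]
  S.M.component_closed[OF x(1)]
 let ?y = "(f \<otimes> v) \<odot>\<^sub>S x"
 have "u \<odot>\<^sub>S ?y = x" using uv x(3) by (simp add: S.M.smult_assoc[symmetric] m_assoc[symmetric])
 then have "?y ~= \<zero>\<^sub>S" using x(2) S.M.smult_zero_r[of u] by auto
 moreover have "f \<odot>\<^sub>S ?y = ?y" using f by (simp add: S.M.smult_assoc[symmetric] m_assoc[symmetric])
 moreover have "?y \<in> component S (- k + j)"
  by (rule S.smult_component_M[OF mult_component0(1)[OF f(1) v] x(1)])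
 ultimately show ?thesis unfolding hits_def by blast
qed

text \<open>All powers of \<open>t\<close> fix the nonzero vector \<open>x\<close>, so
  \<open>t\<close> is not nilpotent, and locality of \<open>e\<close> makes it a unit of the corner.
  This is how locality enters in everything that follows.\<close>

lemma corner_unit:
 assumes e: "local_idempotent e" and S: "left_module A S" and x: "x \<in> carrier S" "x ~= \<zero>\<^sub>S"
  and t: "t \<in> component A 0" "e \<otimes> t = t" "t \<otimes> e = t" "t \<odot>\<^sub>S x = x"
 obtains c where "c \<in> component A 0" "c \<otimes> t = e" "t \<otimes> c = e"
proof -
 interpret S: left_module A S by (rule S)
 note tc [simp] = GA.component_closed[OF t(1)]
 have "t [^] n \<odot>\<^sub>S x = x" for n :: nat
 proof (induct n)
  case (Suc n)
  then show ?case using x t by (simp add: S.smult_assoc)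
 qed (use x in \<open>simp add: S.smult_one\<close>)
 then have "t [^] n ~= \<zero>" for n :: nat using x S.smult_zero_l by metis
 then show thesis using e t that unfolding local_idempotent_def by blast
qed

text \<open>Simplicity provides \<open>a\<close> from \<open>x\<close> to \<open>y\<close> and
  \<open>b\<close> back. The loop \<open>e b f a e\<close> fixes \<open>x\<close>, hence is a unit
  of the corner at \<open>e\<close>, and its inverse yields the factorization of \<open>e\<close>
  through \<open>f\<close>.\<close>

lemma simple_factors:
 assumes e: "local_idempotent e" and f: "f \<in> component A 0" and S: "graded_simple A S"
  and hit: "hits e S" "hits f S"
 shows "factors e f"
proof -
 interpret S: graded_mod K A S by (rule graded_simpleD(1)[OF S])
 obtain j x where x: "x \<in> component S j" "x ~= \<zero>\<^sub>S" "e \<odot>\<^sub>S x = x"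
  using hit(1) by (auto simp: hits_def)
 obtain k y where y: "y \<in> component S k" "y ~= \<zero>\<^sub>S" "f \<odot>\<^sub>S y = y"
  using hit(2) by (auto simp: hits_def)
 obtain a where a: "a \<in> component A (k - j)" "y = a \<odot>\<^sub>S x"
  using graded_simple_cyclic_homogeneous[OF S x(1,2) y(1)] .
 obtain b where b: "b \<in> component A (j - k)" "x = b \<odot>\<^sub>S y"
  using graded_simple_cyclic_homogeneous[OF S y(1,2) x(1)] .
 have e0: "e \<in> component A 0" "e \<otimes> e = e" using e by (auto simp: local_idempotent_def)
 note cl [simp] = GA.component_closed[OF a(1)] GA.component_closed[OF b(1)] GA.component_closed[OF e0(1)]
  GA.component_closed[OF f(1)] S.M.component_closed[OF x(1)] S.M.component_closed[OF y(1)]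
 let ?t = "e \<otimes> b \<otimes> f \<otimes> a \<otimes> e"
 have "f \<otimes> a \<in> component A (k - j)" "b \<otimes> (f \<otimes> a) \<in> component A 0"
  using mult_component0(1)[OF f a(1)] mult_component[OF b(1) mult_component0(1)[OF f a(1)]] by auto
 then have "e \<otimes> (b \<otimes> (f \<otimes> a)) \<otimes> e \<in> component A 0" using e0 mult_component0(1) by blast
 then have t0: "?t \<in> component A 0" by (simp add: m_assoc)
 have et: "e \<otimes> ?t = ?t" "?t \<otimes> e = ?t"
  using e0(2) by (simp_all add: m_assoc[symmetric]) (simp add: m_assoc)
 have "?t \<odot>\<^sub>S x = e \<odot>\<^sub>S (b \<odot>\<^sub>S (f \<odot>\<^sub>S (a \<odot>\<^sub>S x)))"
  using x(3) by (simp add: S.M.smult_assoc S.M.smult_closed)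
 also have "\<dots> = x" using a(2) b(2) y(3) x(3) by simp
 finally obtain c where c: "c \<in> component A 0" "c \<otimes> ?t = e"
  using corner_unit[OF e S.M.left_module_axioms _ x(2) t0 et] by auto
 note [simp] = GA.component_closed[OF c(1)]
 have "(c \<otimes> e \<otimes> b) \<otimes> f \<otimes> (a \<otimes> e) = e" using c(2) by (simp add: m_assoc)
 moreover have "c \<otimes> e \<otimes> b \<in> component A (j - k)" "a \<otimes> e \<in> component A (- (j - k))"
  using mult_component0(1)[OF mult_component0(1)[OF c(1) e0(1)] b(1)] mult_component0(2)[OF a(1) e0(1)] by simp_all
 ultimately show ?thesis unfolding factors_def by blast
qed

text \<open>Suppose a homogeneous \<open>a\<close> kills \<open>x\<close> but not \<open>y\<close>.
  Some \<open>b\<close> brings \<open>a y\<close> back to \<open>y\<close>, so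
  \<open>e b a e\<close> is a unit of the corner; on the other module it kills \<open>x\<close>,
  contradicting \<open>x = e x\<close> with \<open>x\<close> nonzero.\<close>

lemma annihilator_transfer:
 assumes e: "local_idempotent e" and S: "graded_simple A S" and S': "graded_simple A S'"
  and x: "x \<in> component S j" "e \<odot>\<^sub>S x = x"
  and y: "y \<in> component S' k" "y ~= \<zero>\<^sub>S'" "e \<odot>\<^sub>S' y = y" and xnz: "x ~= \<zero>\<^sub>S"
  and a: "a \<in> carrier A" "a \<odot>\<^sub>S x = \<zero>\<^sub>S"
 shows "a \<odot>\<^sub>S' y = \<zero>\<^sub>S'"
proof -
 interpret S: graded_mod K A S by (rule graded_simpleD(1)[OF S])
 interpret S': graded_mod K A S' by (rule graded_simpleD(1)[OF S'])
 have e0: "e \<in> component A 0" "e \<otimes> e = e" using e by (auto simp: local_idempotent_def)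
 note cl [simp] = GA.component_closed[OF e0(1)] S.M.component_closed[OF x(1)] S'.M.component_closed[OF y(1)]
 have *: "a \<odot>\<^sub>S' y = \<zero>\<^sub>S'" if a: "a \<in> component A i" "a \<odot>\<^sub>S x = \<zero>\<^sub>S" for a i
 proof (rule ccontr)
  assume nz: "a \<odot>\<^sub>S' y ~= \<zero>\<^sub>S'"
  obtain b where b: "b \<in> component A (k - (i + k))" "y = b \<odot>\<^sub>S' (a \<odot>\<^sub>S' y)"
   using graded_simple_cyclic_homogeneous[OF S' S'.smult_component_M[OF a(1) y(1)] nz y(1)] .
  note [simp] = GA.component_closed[OF a(1)] GA.component_closed[OF b(1)]
  let ?t = "e \<otimes> b \<otimes> a \<otimes> e"
  have "b \<otimes> a \<in> component A 0" using mult_component[OF b(1) a(1)] by simp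
  then have "e \<otimes> (b \<otimes> a) \<otimes> e \<in> component A 0" using e0 mult_component0(1) by blast
  then have t0: "?t \<in> component A 0" by (simp add: m_assoc)
  have et: "e \<otimes> ?t = ?t" "?t \<otimes> e = ?t"
   using e0(2) by (simp_all add: m_assoc[symmetric]) (simp add: m_assoc)
  have "?t \<odot>\<^sub>S' y = e \<odot>\<^sub>S' (b \<odot>\<^sub>S' (a \<odot>\<^sub>S' y))"
   using y(3) by (simp add: S'.M.smult_assoc S'.M.smult_closed)
  also have "\<dots> = y" using b(2) y(3) by simp
  finally obtain c where c: "c \<in> component A 0" "c \<otimes> ?t = e"
   using corner_unit[OF e S'.M.left_module_axioms _ y(2) t0 et] by auto
  note [simp] = GA.component_closed[OF c(1)]
  have "x = (c \<otimes> ?t) \<odot>\<^sub>S x" using c(2) x(2) by simp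
  also have "\<dots> = c \<odot>\<^sub>S (e \<odot>\<^sub>S (b \<odot>\<^sub>S (a \<odot>\<^sub>S x)))"
   using x(2) by (simp add: S.M.smult_assoc S.M.smult_closed)
  also have "\<dots> = \<zero>\<^sub>S" using a(2) by (simp add: S.M.smult_zero_r)
  finally show False using xnz by simp
 qed
 \<comment> \<open>An arbitrary \<open>a\<close> reduces to its components, because \<open>x\<close>
   and \<open>y\<close> are homogeneous: \<open>a x = 0\<close> forces every component of
   \<open>a\<close> to kill \<open>x\<close>.\<close>
 show ?thesis
 proof (rule S'.M.eq_zeroI)
  show "a \<odot>\<^sub>S' y \<in> carrier S'" using a(1) by (simp add: S'.M.smult_closed)
  fix i
  have "hcomp A a (i - k) \<odot>\<^sub>S x = hcomp S (a \<odot>\<^sub>S x) (i - k + j)"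
   using S.hcomp_smult_r[OF a(1) x(1), of "i - k + j"] by simp
  then have "hcomp A a (i - k) \<odot>\<^sub>S x = \<zero>\<^sub>S" using a(2) by (simp add: S.M.hcomp_zero)
  then have "hcomp A a (i - k) \<odot>\<^sub>S' y = \<zero>\<^sub>S'" using *[OF GA.hcomp_component[OF a(1)]] by blast
  then show "hcomp S' (a \<odot>\<^sub>S' y) i = \<zero>\<^sub>S'" using S'.hcomp_smult_r[OF a(1) y(1), of i] by simp
 qed
qed

text \<open>Vectors fixed by the same local idempotent have the same annihilator, so sending
  \<open>a x\<close> to \<open>a y\<close> is well defined and injective. A local idempotent thus
  determines a graded simple up to shift.\<close>

lemma simple_iso:
 assumes e: "local_idempotent e" and S: "graded_simple A S" and S': "graded_simple A S'"
  and hit: "hits e S" "hits e S'"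
 obtains k h where "h \<in> graded_hom A S (shift k S')" "bij_betw h (carrier S) (carrier S')"
proof -
 interpret S: graded_mod K A S by (rule graded_simpleD(1)[OF S])
 interpret S': graded_mod K A S' by (rule graded_simpleD(1)[OF S'])
 obtain j x where x: "x \<in> component S j" "x ~= \<zero>\<^sub>S" "e \<odot>\<^sub>S x = x"
  using hit(1) by (auto simp: hits_def)
 obtain k y where y: "y \<in> component S' k" "y ~= \<zero>\<^sub>S'" "e \<odot>\<^sub>S' y = y"
  using hit(2) by (auto simp: hits_def)
 note cl [simp] = S.M.component_closed[OF x(1)] S'.M.component_closed[OF y(1)]
 have tr: "a \<odot>\<^sub>S x = \<zero>\<^sub>S \<longleftrightarrow> a \<odot>\<^sub>S' y = \<zero>\<^sub>S'" if "a \<in> carrier A" for a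
  using annihilator_transfer[OF e S S' x(1,3) y x(2) that] annihilator_transfer[OF e S' S y(1,3) x y(2) that] by blast
 have eq: "a \<odot>\<^sub>S x = b \<odot>\<^sub>S x \<longleftrightarrow> a \<odot>\<^sub>S' y = b \<odot>\<^sub>S' y" if "a \<in> carrier A" "b \<in> carrier A" for a b
  using tr[of "a \<ominus> b"] that
   S.M.minus_zero_iff[of "a \<odot>\<^sub>S x" "b \<odot>\<^sub>S x"] S'.M.minus_zero_iff[of "a \<odot>\<^sub>S' y" "b \<odot>\<^sub>S' y"]
  by (simp add: S.M.smult_minus_l S'.M.smult_minus_l S.M.smult_closed S'.M.smult_closed)
 define h where "h z = (SOME a. a \<in> carrier A \<and> z = a \<odot>\<^sub>S x) \<odot>\<^sub>S' y" for z
 have h: "h (a \<odot>\<^sub>S x) = a \<odot>\<^sub>S' y" if a: "a \<in> carrier A" for a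
 proof -
  let ?b = "SOME b. b \<in> carrier A \<and> a \<odot>\<^sub>S x = b \<odot>\<^sub>S x"
  have "?b \<in> carrier A \<and> a \<odot>\<^sub>S x = ?b \<odot>\<^sub>S x" by (rule someI_ex) (use a in blast)
  then show ?thesis unfolding h_def using eq[OF a, of ?b] by simp
 qed
 have ex: "\<exists>a\<in>carrier A. z = a \<odot>\<^sub>S x" if "z \<in> carrier S" for z
  using graded_simple_cyclic[OF S x(1,2) that] by blast
 \<comment> \<open>The generator \<open>x\<close> has degree \<open>j\<close> and its image
   \<open>y\<close> has degree \<open>k\<close> in \<open>S'\<close>; the shift compensates the
   difference.\<close>
 have "h \<in> graded_hom A S (shift (j - k) S')"
 proof (rule graded_homI)
  fix z assume "z \<in> carrier S"
  then obtain a where "a \<in> carrier A" "z = a \<odot>\<^sub>S x" using ex by blast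
  then show "h z \<in> carrier (shift (j - k) S')" by (simp add: h shift_def S'.M.smult_closed)
 next
  fix z w assume "z \<in> carrier S" "w \<in> carrier S"
  then obtain a b where ab: "a \<in> carrier A" "z = a \<odot>\<^sub>S x" "b \<in> carrier A" "w = b \<odot>\<^sub>S x" using ex by metis
  then have "z \<oplus>\<^sub>S w = (a \<oplus> b) \<odot>\<^sub>S x" by (simp add: S.M.smult_l_distr)
  then show "h (z \<oplus>\<^sub>S w) = h z \<oplus>\<^bsub>shift (j - k) S'\<^esub> h w"
   using ab by (simp add: h shift_def S'.M.smult_l_distr)
 next
  fix b z assume b: "b \<in> carrier A" and "z \<in> carrier S"
  then obtain a where a: "a \<in> carrier A" "z = a \<odot>\<^sub>S x" using ex by blast
  then have "b \<odot>\<^sub>S z = (b \<otimes> a) \<odot>\<^sub>S x" using b by (simp add: S.M.smult_assoc)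
  then show "h (b \<odot>\<^sub>S z) = b \<odot>\<^bsub>shift (j - k) S'\<^esub> h z"
   using a b by (simp add: h shift_def S'.M.smult_assoc)
 next
  fix i z assume z: "z \<in> component S i"
  obtain a where a: "a \<in> component A (i - j)" "z = a \<odot>\<^sub>S x"
   using graded_simple_cyclic_homogeneous[OF S x(1,2) z] .
  then show "h z \<in> component (shift (j - k) S') i"
   using S'.smult_component_M[OF a(1) y(1)] GA.component_closed[OF a(1)]
   by (simp add: h shift_def algebra_simps)
 qed
 moreover have "inj_on h (carrier S)"
 proof (rule inj_onI)
  fix z w assume "z \<in> carrier S" "w \<in> carrier S" and hzw: "h z = h w"
  then obtain a b where ab: "a \<in> carrier A" "z = a \<odot>\<^sub>S x" "b \<in> carrier A" "w = b \<odot>\<^sub>S x" using ex by metis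
  then show "z = w" using hzw eq[OF ab(1,3)] by (simp add: h)
 qed
 moreover have "h ` carrier S = carrier S'"
 proof (intro equalityI subsetI)
  fix w assume "w \<in> h ` carrier S"
  then obtain z where "z \<in> carrier S" "w = h z" by blast
  moreover obtain a where "a \<in> carrier A" "z = a \<odot>\<^sub>S x" using ex[OF \<open>z \<in> carrier S\<close>] by blast
  ultimately show "w \<in> carrier S'" by (simp add: h S'.M.smult_closed)
 next
  fix w assume "w \<in> carrier S'"
  then obtain a where a: "a \<in> carrier A" "w = a \<odot>\<^sub>S' y" using graded_simple_cyclic[OF S' y(1,2)] by blast
  then have "w = h (a \<odot>\<^sub>S x)" "a \<odot>\<^sub>S x \<in> carrier S" by (simp_all add: h S.M.smult_closed)
  then show "w \<in> h ` carrier S" by blast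
 qed
 ultimately show thesis using that by (simp add: bij_betw_def)
qed

end

context nice_alg
begin

text \<open>The idempotent 1 kills no nonzero vector, so some primitive idempotent of its cover acts
  nontrivially on each simple module.\<close>

lemma primitive_cover:
 obtains E where "finite E" "!!e. e \<in> E ==> primitive_idempotent e"
  "!!S :: 'a amodule. graded_simple A S ==> \<exists>e\<in>E. hits e S"
proof -
 obtain E where E: "finite E" "\<forall>e\<in>E. primitive_idempotent e"
  "\<forall>(S :: 'a amodule) x. graded_module A S --> x \<in> carrier S --> (\<forall>e\<in>E. e \<odot>\<^sub>S x = \<zero>\<^sub>S) --> \<one> \<odot>\<^sub>S x = \<zero>\<^sub>S"
  using idempotent_covered[OF one_component] by auto
 have "\<exists>e\<in>E. hits e S" if S: "graded_simple A S" for S :: "'a amodule"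
 proof -
  interpret S: graded_mod K A S by (rule graded_simpleD(1)[OF S])
  obtain x j where x: "x \<in> component S j" "x ~= \<zero>\<^sub>S" using graded_simple_nonzero[OF S] .
  note xc = S.M.component_closed[OF x(1)]
  obtain e where e: "e \<in> E" "e \<odot>\<^sub>S x ~= \<zero>\<^sub>S"
   using E(3)[rule_format, OF S.graded_module xc] x(2) S.M.smult_one[OF xc] by auto
  have e0: "e \<in> component A 0" "e \<otimes> e = e" using E(2) e(1) by (auto simp: primitive_idempotent_def)
  have "e \<odot>\<^sub>S (e \<odot>\<^sub>S x) = e \<odot>\<^sub>S x"
   using e0(2) S.M.smult_assoc[OF GA.component_closed[OF e0(1)] GA.component_closed[OF e0(1)] xc] by simp
  then have "hits e S" using e(2) S.smult_component_M[OF e0(1) x(1)] unfolding hits_def by blast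
  then show ?thesis using e(1) by blast
 qed
 then show thesis using that[of E] E(1,2) by blast
qed

end

section \<open>Principal projective modules and the anti-automorphism\<close>

context graded_mod
begin

lemma image_mod_ball:
 assumes N: "graded_submodule A N M"
  and \<rho>: "\<forall>x\<in>carrier M. \<forall>y\<in>carrier M. \<rho> x = \<rho> y \<longleftrightarrow> x \<ominus>\<^sub>M y \<in> N"
 shows "graded_module A (image_mod M \<rho>)" "\<rho> \<in> graded_hom A M (image_mod M \<rho>)"
  "carrier (image_mod M \<rho>) = \<rho> ` carrier M"
  "\<forall>x\<in>carrier M. \<rho> x = \<zero>\<^bsub>image_mod M \<rho>\<^esub> \<longleftrightarrow> x \<in> N"
  "component (image_mod M \<rho>) i = \<rho> ` component M i"
  "N ~= carrier M ==> \<forall>N'. graded_submodule A N' M --> N \<subseteq> N' --> N' = N \<or> N' = carrier M ==>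
   graded_simple A (image_mod M \<rho>)"
proof -
 have r: "\<rho> x = \<rho> y \<longleftrightarrow> x \<ominus>\<^sub>M y \<in> N" if "x \<in> carrier M" "y \<in> carrier M" for x y
  using \<rho> that by blast
 show "graded_module A (image_mod M \<rho>)" by (rule image_mod(1)[OF N]) (rule r)
 show "\<rho> \<in> graded_hom A M (image_mod M \<rho>)" by (rule image_mod(2)[OF N]) (rule r)
 show "carrier (image_mod M \<rho>) = \<rho> ` carrier M" by (rule image_mod(3)[OF N, symmetric]) (rule r)
 have "\<rho> x = \<zero>\<^bsub>image_mod M \<rho>\<^esub> \<longleftrightarrow> x \<in> N" if "x \<in> carrier M" for x
  by (rule image_mod(4)[OF N _ that]) (rule r)
 then show "\<forall>x\<in>carrier M. \<rho> x = \<zero>\<^bsub>image_mod M \<rho>\<^esub> \<longleftrightarrow> x \<in> N" by blast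
 show "component (image_mod M \<rho>) i = \<rho> ` component M i" by (rule image_mod(5)[OF N]) (rule r)
 assume ne: "N ~= carrier M" and max: "\<forall>N'. graded_submodule A N' M --> N \<subseteq> N' --> N' = N \<or> N' = carrier M"
 show "graded_simple A (image_mod M \<rho>)"
 proof (rule simple_quotient[OF N ne])
  show "N' = N \<or> N' = carrier M" if "graded_submodule A N' M" "N \<subseteq> N'" for N'
   using max that by blast
 qed (rule r)
qed

lemma quotient:
 assumes N: "graded_submodule A N M"
 obtains Q :: "('a, 'm) gmodule" and \<rho> where "graded_module A Q" "\<rho> \<in> graded_hom A M Q" "carrier Q = \<rho> ` carrier M"
  "\<forall>x\<in>carrier M. \<rho> x = \<zero>\<^sub>Q \<longleftrightarrow> x \<in> N"
  "N ~= carrier M --> (\<forall>N'. graded_submodule A N' M --> N \<subseteq> N' --> N' = N \<or> N' = carrier M) --> graded_simple A Q"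
proof -
 obtain \<rho> :: "'m => 'm" where r: "!!x y. x \<in> carrier M ==> y \<in> carrier M ==> \<rho> x = \<rho> y \<longleftrightarrow> x \<ominus>\<^sub>M y \<in> N"
  using quotient_exists[OF N] by metis
 have "\<forall>x\<in>carrier M. \<forall>y\<in>carrier M. \<rho> x = \<rho> y \<longleftrightarrow> x \<ominus>\<^sub>M y \<in> N" using r by simp
 note im = image_mod_ball[OF N this]
 show thesis by (rule that[OF im(1,2,3,4)]) (use im(6) in simp)
qed

lemma exists_simple_quotient:
 assumes "finite G" "generates A G M" "carrier M ~= {\<zero>\<^sub>M}"
 obtains Q :: "('a, 'm) gmodule" and \<rho> where "graded_simple A Q" "\<rho> \<in> graded_hom A M Q" "carrier Q = \<rho> ` carrier M"
proof -
 obtain N where N: "graded_submodule A N M" "N ~= carrier M"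
  "!!N'. graded_submodule A N' M ==> N \<subseteq> N' ==> N' = N \<or> N' = carrier M"
  using maximal_submodule[OF assms] by metis
 obtain Q :: "('a, 'm) gmodule" and \<rho> where Q: "graded_module A Q" "\<rho> \<in> graded_hom A M Q" "carrier Q = \<rho> ` carrier M"
  "N ~= carrier M --> (\<forall>N'. graded_submodule A N' M --> N \<subseteq> N' --> N' = N \<or> N' = carrier M) --> graded_simple A Q"
  using quotient[OF N(1)] by metis
 have "graded_simple A Q" using Q(4) N(2,3) by blast
 then show thesis using that Q(2,3) by blast
qed

end

context graded_alg
begin

text \<open>The left ideal \<open>A e\<close>, transported to the type of \<open>'a amodule\<close> along \<open>a \<mapsto> (\<lambda>_. a)\<close>.\<close>

definition principal :: "'a => 'a amodule" where
 "principal e = image_mod (submod (graded_regular A) {a \<in> carrier A. a \<otimes> e = a}) (%a _. a)"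

lemma principal:
 assumes e: "e \<in> component A 0" "e \<otimes> e = e"
 shows "graded_module A (principal e)"
  and "carrier (principal e) = {(%_. a) |a. a \<in> carrier A \<and> a \<otimes> e = a}"
  and "component (principal e) i = {(%_. a) |a. a \<in> component A i \<and> a \<otimes> e = a}"
  and "a \<in> carrier A ==> b \<in> carrier A ==> b \<otimes> e = b ==> a \<odot>\<^bsub>principal e\<^esub> (%_. b) = (%_. a \<otimes> b)"
  and "a \<in> carrier A ==> a \<otimes> e = a ==> b \<in> carrier A ==> b \<otimes> e = b ==>
   (%_. a) \<oplus>\<^bsub>principal e\<^esub> (%_. b) = (%_. a \<oplus> b)"
  and "\<zero>\<^bsub>principal e\<^esub> = (%_. \<zero>)"
proof -
 note ec [simp] = GA.component_closed[OF e(1)]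
 let ?N = "{a \<in> carrier A. a \<otimes> e = a}"
 let ?M = "submod (graded_regular A) ?N"
 interpret R: graded_mod K A "graded_regular A" by (rule graded_modI[OF graded_module_regular])
 have N: "graded_submodule A ?N (graded_regular A)"
 proof (rule R.graded_submoduleI)
  fix x i assume "x \<in> ?N"
  then show "hcomp (graded_regular A) x i \<in> ?N"
   using hcomp_mult_r[of x e 0 i] e(1) by (simp add: hcomp_regular GA.hcomp_closed)
 qed (auto simp: l_distr m_assoc)
 interpret M: graded_mod K A ?M by (rule graded_modI[OF R.submod_graded_module[OF N]])
 have z: "graded_submodule A {\<zero>} ?M" using M.zero_submodule by simp
 let ?\<rho> = "%a::'a. (%_::nat. a)"
 have r: "\<forall>x\<in>carrier ?M. \<forall>y\<in>carrier ?M. ?\<rho> x = ?\<rho> y \<longleftrightarrow> x \<ominus>\<^bsub>?M\<^esub> y \<in> {\<zero>}"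
  using M.M.M.minus_zero_iff by (auto simp: fun_eq_iff)
 note im = M.image_mod_ball[OF z r]
 show "graded_module A (principal e)" unfolding principal_def by (rule im(1))
 show "carrier (principal e) = {(%_. a) |a. a \<in> carrier A \<and> a \<otimes> e = a}"
 proof -
  have "carrier (principal e) = ?\<rho> ` carrier ?M" unfolding principal_def by (rule im(3))
  then show ?thesis by auto
 qed
 show "component (principal e) i = {(%_. a) |a. a \<in> component A i \<and> a \<otimes> e = a}" for i
 proof -
  have "component (principal e) i = ?\<rho> ` component ?M i" unfolding principal_def by (rule im(5))
  then show ?thesis using GA.component_closed by auto
 qed
 show "a \<odot>\<^bsub>principal e\<^esub> (%_. b) = (%_. a \<otimes> b)" if "a \<in> carrier A" "b \<in> carrier A" "b \<otimes> e = b" for a b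
  using graded_homD(3)[OF im(2), of a b] that unfolding principal_def by simp
 show "(%_. a) \<oplus>\<^bsub>principal e\<^esub> (%_. b) = (%_. a \<oplus> b)"
  if "a \<in> carrier A" "a \<otimes> e = a" "b \<in> carrier A" "b \<otimes> e = b" for a b
  using graded_homD(2)[OF im(2), of a b] that unfolding principal_def by simp
 show "\<zero>\<^bsub>principal e\<^esub> = (%_. \<zero>)"
  unfolding principal_def by (simp add: image_mod_def Let_def)
qed

lemma principal_smult_generator:
 assumes e: "e \<in> component A 0" "e \<otimes> e = e"
 shows "(%_. e) \<in> component (principal e) 0"
  "x \<in> carrier (principal e) ==> x 0 \<in> carrier A \<and> x 0 \<otimes> e = x 0 \<and> x = (%_. x 0) \<and> x 0 \<odot>\<^bsub>principal e\<^esub> (%_. e) = x"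
  "x \<in> component (principal e) i ==> x 0 \<in> component A i"
 using e principal[OF e] GA.component_closed[OF e(1)] by auto

lemma principal_generates:
 assumes e: "e \<in> component A 0" "e \<otimes> e = e"
 shows "generates A {%_. e} (principal e)"
proof -
 interpret P: graded_mod K A "principal e" by (rule graded_modI[OF principal(1)[OF e]])
 have "N = carrier (principal e)" if N: "graded_submodule A N (principal e)" "(%_. e) \<in> N" for N
 proof -
  have "x \<in> N" if "x \<in> carrier (principal e)" for x
   using principal_smult_generator(2)[OF e that] P.graded_submoduleD(7)[OF N(1) _ N(2), of "x 0"] by simp
  then show ?thesis using P.graded_submoduleD(2)[OF N(1)] by blast
 qed
 then show ?thesis
  unfolding generates_def using P.M.component_closed[OF principal_smult_generator(1)[OF e]] by blast
qed

text \<open>The nonzero cyclic module \<open>A e\<close> has a simple quotient. The image of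
  \<open>e\<close> there is fixed by \<open>e\<close>, and it is nonzero because otherwise the
  quotient map would vanish on a generator.\<close>

lemma exists_simple_hit:
 assumes e: "e \<in> component A 0" "e \<otimes> e = e" "e ~= \<zero>"
 obtains S :: "'a amodule" where "graded_simple A S" "hits e S"
proof -
 interpret P: graded_mod K A "principal e" by (rule graded_modI[OF principal(1)[OF e(1,2)]])
 note p = principal_smult_generator(1)[OF e(1,2)]
 note pc = P.M.component_closed[OF p]
 have "carrier (principal e) ~= {\<zero>\<^bsub>principal e\<^esub>}"
  using pc e(3) principal(6)[OF e(1,2)] by (auto simp: fun_eq_iff)
 then obtain S :: "'a amodule" and \<rho> where S: "graded_simple A S" "\<rho> \<in> graded_hom A (principal e) S"
  "carrier S = \<rho> ` carrier (principal e)"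
  using P.exists_simple_quotient[OF _ principal_generates[OF e(1,2)]] by (metis finite.emptyI finite.insertI)
 interpret S: graded_mod K A S by (rule graded_simpleD(1)[OF S(1)])
 interpret r: graded_map K A "principal e" S \<rho>
  by (rule graded_mapI[OF graded_alg_axioms P.graded_module S.graded_module S(2)])
 have "\<rho> (%_. e) ~= \<zero>\<^sub>S"
 proof
  assume "\<rho> (%_. e) = \<zero>\<^sub>S"
  then have "{x \<in> carrier (principal e). \<rho> x = \<zero>\<^sub>S} = carrier (principal e)"
   using principal_generates[OF e(1,2)] r.kernel pc unfolding generates_def by blast
  then have "\<forall>x\<in>carrier (principal e). \<rho> x = \<zero>\<^sub>S" by blast
  then have "carrier S \<subseteq> {\<zero>\<^sub>S}" unfolding S(3) by blast
  then have "carrier S = {\<zero>\<^sub>S}" using S.M.M.zero_closed by blast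
  then show False using graded_simpleD(2)[OF S(1)] by blast
 qed
 moreover have "e \<odot>\<^sub>S \<rho> (%_. e) = \<rho> (%_. e)"
  using r.smult[OF GA.component_closed[OF e(1)] pc] principal(4)[OF e(1,2), of e e] e
   GA.component_closed[OF e(1)] by simp
 moreover have "\<rho> (%_. e) \<in> component S 0" using r.comp[OF p] .
 ultimately have "hits e S" unfolding hits_def by blast
 then show thesis using that S(1) by blast
qed

end

section \<open>The anti-automorphism and a minimal set of idempotents\<close>

locale anti_alg = nice_alg K A for K :: "'k ring" and A :: "('k, 'a) gmodule" (structure) +
 fixes \<psi> :: "'a => 'a"
 assumes anti: "graded_anti_automorphism K A \<psi>"
begin

text \<open>\<open>\<psi>\<close> is not assumed to be an involution, so its inverse gets a name; it
  appears when a coefficient of \<open>P\<close> moves to \<open>M\<close> across the tensor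
  sign.\<close>

definition \<phi> :: "'a => 'a" where
 "\<phi> = inv_into (carrier A) \<psi>"

lemma psi:
 shows psi_closed: "a \<in> carrier A ==> \<psi> a \<in> carrier A"
  and psi_add: "a \<in> carrier A ==> b \<in> carrier A ==> \<psi> (a \<oplus> b) = \<psi> a \<oplus> \<psi> b"
  and psi_mult: "a \<in> carrier A ==> b \<in> carrier A ==> \<psi> (a \<otimes> b) = \<psi> b \<otimes> \<psi> a"
  and psi_one: "\<psi> \<one> = \<one>"
  and psi_smult: "c \<in> carrier K ==> a \<in> carrier A ==> \<psi> (c \<odot> a) = c \<odot> \<psi> a"
  and psi_component: "a \<in> component A i ==> \<psi> a \<in> component A i"
  and psi_bij: "bij_betw \<psi> (carrier A) (carrier A)"
proof -
 have h: "\<psi> \<in> Ring.ring_hom A (opposite A)" "\<psi> \<in> LinearCombinations.module_hom K A A"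
  "bij_betw \<psi> (carrier A) (carrier A)" "\<forall>i. \<psi> ` component A i \<subseteq> component A i"
  using anti by (auto simp: graded_anti_automorphism_def)
 show "a \<in> carrier A ==> \<psi> a \<in> carrier A" using h(3) by (auto simp: bij_betw_def)
 show "a \<in> carrier A ==> b \<in> carrier A ==> \<psi> (a \<oplus> b) = \<psi> a \<oplus> \<psi> b"
  using h(2) by (simp add: LinearCombinations.module_hom_def)
 show "a \<in> carrier A ==> b \<in> carrier A ==> \<psi> (a \<otimes> b) = \<psi> b \<otimes> \<psi> a" "\<psi> \<one> = \<one>"
  using h(1) by (simp_all add: Ring.ring_hom_def opposite_def)
 show "c \<in> carrier K ==> a \<in> carrier A ==> \<psi> (c \<odot> a) = c \<odot> \<psi> a"
  using h(2) by (simp add: LinearCombinations.module_hom_def)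
 show "a \<in> component A i ==> \<psi> a \<in> component A i" using h(4) by blast
 show "bij_betw \<psi> (carrier A) (carrier A)" by (rule h(3))
qed

lemma psi_zero: "\<psi> \<zero> = \<zero>"
 by (rule additive_zero[OF abelian_group_axioms abelian_group_axioms]) (auto simp: psi_closed psi_add)

lemma psi_inj: "a \<in> carrier A ==> b \<in> carrier A ==> \<psi> a = \<psi> b \<longleftrightarrow> a = b"
 using psi_bij by (auto simp: bij_betw_def inj_on_def)

lemma psi_hcomp: "a \<in> carrier A ==> hcomp A (\<psi> a) i = \<psi> (hcomp A a i)"
proof (induct rule: GA.homogeneous_induct)
 case (homogeneous j y)
 then show ?case
  using GA.hcomp_homogeneous[OF homogeneous, of i] GA.hcomp_homogeneous[OF psi_component[OF homogeneous], of i]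
  by (simp add: psi_zero)
next
 case (add y z)
 then show ?case by (simp add: psi_add psi_closed GA.hcomp_add GA.hcomp_closed)
qed (simp add: psi_zero GA.hcomp_zero)

lemma phi_closed: "a \<in> carrier A ==> \<phi> a \<in> carrier A"
 and psi_phi [simp]: "a \<in> carrier A ==> \<psi> (\<phi> a) = a"
 and phi_psi [simp]: "a \<in> carrier A ==> \<phi> (\<psi> a) = a"
 using psi_bij unfolding \<phi>_def bij_betw_def
 by (auto intro: inv_into_into simp: f_inv_into_f)

lemma phi_add: "a \<in> carrier A ==> b \<in> carrier A ==> \<phi> (a \<oplus> b) = \<phi> a \<oplus> \<phi> b"
 by (subst psi_inj[symmetric]) (simp_all add: phi_closed psi_add)

lemma phi_mult: "a \<in> carrier A ==> b \<in> carrier A ==> \<phi> (a \<otimes> b) = \<phi> b \<otimes> \<phi> a"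
 by (subst psi_inj[symmetric]) (simp_all add: phi_closed psi_mult)

text \<open>Degree preservation is known for \<open>\<psi>\<close> only. As \<open>\<psi>\<close>
  commutes with taking components, its injectivity carries it over to the inverse.\<close>

lemma phi_component:
 assumes "a \<in> component A i"
 shows "\<phi> a \<in> component A i"
proof -
 note ac [simp] = GA.component_closed[OF assms]
 have "\<psi> (hcomp A (\<phi> a) i) = hcomp A a i" using psi_hcomp[OF phi_closed[OF ac], of i] by simp
 also have "\<dots> = \<psi> (\<phi> a)" using GA.hcomp_homogeneous[OF assms, of i] by simp
 finally have "hcomp A (\<phi> a) i = \<phi> a" by (subst (asm) psi_inj) (simp_all add: phi_closed GA.hcomp_closed)
 then show ?thesis using GA.hcomp_component[OF phi_closed[OF ac], of i] by simp
qed

lemma psi_pow: "a \<in> carrier A ==> \<psi> (a [^] (n::nat)) = \<psi> a [^] n"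
proof (induct n)
 case (Suc n)
 then show ?case using nat_pow_Suc2[OF psi_closed[OF Suc(2)]] by (simp add: psi_mult)
qed (simp add: psi_one)

text \<open>The definition of locality is symmetric in left and right, so reversing products does no
  harm; nilpotency and inverses are pulled back through \<open>\<psi>\<close>.\<close>

lemma local_idempotent_phi:
 assumes r: "local_idempotent r"
 shows "local_idempotent (\<phi> r)"
proof -
 have r0: "r \<in> component A 0" "r \<otimes> r = r" "r ~= \<zero>" using r by (auto simp: local_idempotent_def)
 note rc [simp] = GA.component_closed[OF r0(1)]
 show ?thesis unfolding local_idempotent_def
 proof (intro conjI ballI impI)
  show "\<phi> r \<in> component A 0" by (rule phi_component[OF r0(1)])
  show "\<phi> r \<otimes> \<phi> r = \<phi> r" using phi_mult[of r r] r0 by simp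
  show "\<phi> r ~= \<zero>" using r0(3) psi_phi[OF rc] psi_zero by metis
  fix b assume b: "b \<in> component A 0" "\<phi> r \<otimes> b = b" "b \<otimes> \<phi> r = b"
  note bc [simp] = GA.component_closed[OF b(1)]
  have "\<psi> b \<otimes> r = \<psi> b" "r \<otimes> \<psi> b = \<psi> b"
   using psi_mult[of "\<phi> r" b] psi_mult[of b "\<phi> r"] b by (simp_all add: phi_closed)
  then consider n where "\<psi> b [^] (n::nat) = \<zero>" |
   c where "c \<in> component A 0" "c \<otimes> \<psi> b = r" "\<psi> b \<otimes> c = r"
   using r psi_component[OF b(1)] unfolding local_idempotent_def by blast
  then show "(\<exists>n::nat. b [^] n = \<zero>) \<or> (\<exists>c\<in>component A 0. c \<otimes> b = \<phi> r \<and> b \<otimes> c = \<phi> r)"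
  proof cases
   case 1
   then have "\<psi> (b [^] n) = \<psi> \<zero>" by (simp add: psi_pow psi_zero)
   then have "b [^] n = \<zero>" by (subst (asm) psi_inj) simp_all
   then show ?thesis by blast
  next
   case 2
   note [simp] = GA.component_closed[OF 2(1)]
   have "b \<otimes> \<phi> c = \<phi> r" "\<phi> c \<otimes> b = \<phi> r"
    using phi_mult[of c "\<psi> b"] phi_mult[of "\<psi> b" c] 2 by (simp_all add: psi_closed)
   then show ?thesis using phi_component[OF 2(1)] by blast
  qed
 qed
qed

lemma factors_psi:
 assumes "factors e f" "e \<in> component A 0" "f \<in> component A 0"
 shows "factors (\<psi> e) (\<psi> f)"
proof -
 obtain k u v where u: "u \<in> component A k" and v: "v \<in> component A (- k)" and uv: "u \<otimes> f \<otimes> v = e"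
  using assms(1) by (auto simp: factors_def)
 note [simp] = GA.component_closed[OF u] GA.component_closed[OF v] GA.component_closed[OF assms(3)]
 have "\<psi> v \<otimes> \<psi> f \<otimes> \<psi> u = \<psi> e" by (simp add: uv[symmetric] psi_mult psi_closed m_assoc)
 then show ?thesis
  using psi_component[OF u] psi_component[OF v] unfolding factors_def by (intro exI[of _ "- k"]) auto
qed

text \<open>
  A minimal set \<open>R\<close> of idempotents meeting every simple module: by minimality, each \<open>r \<in> R\<close> is the only
  member of \<open>R\<close> that does not annihilate some simple \<open>L r\<close>.
\<close>

lemma representatives:
 obtains R and L :: "'a => 'a amodule" where "finite R" "!!r. r \<in> R ==> local_idempotent r"
  "!!S :: 'a amodule. graded_simple A S ==> \<exists>r\<in>R. hits r S"
  "!!S :: 'a amodule. graded_simple A S ==> \<exists>r\<in>R. hits (\<psi> r) S"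
  "!!r. r \<in> R ==> graded_simple A (L r)"
  "!!r. r \<in> R ==> \<exists>x\<in>component (L r) 0. x ~= \<zero>\<^bsub>L r\<^esub> \<and> r \<odot>\<^bsub>L r\<^esub> x = x"
  "!!r r'. r \<in> R ==> r' \<in> R ==> hits r' (L r) ==> r' = r"
proof -
 obtain E where E: "finite E" "!!e. e \<in> E ==> primitive_idempotent e"
  "!!S :: 'a amodule. graded_simple A S ==> \<exists>e\<in>E. hits e S" using primitive_cover by metis
 define cover where "cover R \<longleftrightarrow> R \<subseteq> E \<and> (\<forall>S :: 'a amodule. graded_simple A S --> (\<exists>r\<in>R. hits r S))" for R
 have "cover E" using E(3) by (simp add: cover_def)
 then obtain R where R: "cover R" "!!R'. cover R' ==> card R \<le> card R'"
  using ex_has_least_nat[of cover E card] by blast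
 have fin: "finite R" using R(1) E(1) finite_subset unfolding cover_def by blast
 have loc: "local_idempotent r" if "r \<in> R" for r
  using that R(1) E(2) primitive_local unfolding cover_def by blast
 have cov: "\<exists>r\<in>R. hits r S" if "graded_simple A S" for S :: "'a amodule"
  using R(1) that unfolding cover_def by blast
 have "\<exists>L :: 'a amodule. graded_simple A L \<and> (\<exists>x\<in>component L 0. x ~= \<zero>\<^sub>L \<and> r \<odot>\<^sub>L x = x) \<and>
   (\<forall>r'\<in>R. hits r' L --> r' = r)" if r: "r \<in> R" for r
 proof -
  have "card (R - {r}) < card R" using r fin by (meson card_Diff1_less)
  then have "\<not> cover (R - {r})" using R(2) by fastforce
  then obtain S :: "'a amodule" where S: "graded_simple A S" "\<forall>r'\<in>R - {r}. \<not> hits r' S"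
   using R(1) unfolding cover_def by blast
  then have "hits r S" using cov[OF S(1)] by blast
  then obtain j x where x: "x \<in> component S j" "x ~= \<zero>\<^sub>S" "r \<odot>\<^sub>S x = x" by (auto simp: hits_def)
  \<comment> \<open>Normalisation: the vector fixed by \<open>r\<close> is moved to degree 0, so
    that the diagonal pairing will be 1 and not a power of \<open>q\<close>.\<close>
  let ?L = "shift (- j) S"
  have "graded_simple A ?L" by (rule graded_mod.shift_simple[OF graded_simpleD(1)[OF S(1)] S(1)])
  moreover have "x \<in> component ?L 0" "x ~= \<zero>\<^bsub>?L\<^esub>" "r \<odot>\<^bsub>?L\<^esub> x = x" using x by (auto simp: shift_def)
  moreover have "\<forall>r'\<in>R. hits r' ?L --> r' = r" using S(2) by auto
  ultimately show ?thesis by blast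
 qed
 then obtain L :: "'a => 'a amodule" where L: "!!r. r \<in> R ==> graded_simple A (L r) \<and>
   (\<exists>x\<in>component (L r) 0. x ~= \<zero>\<^bsub>L r\<^esub> \<and> r \<odot>\<^bsub>L r\<^esub> x = x) \<and> (\<forall>r'\<in>R. hits r' (L r) --> r' = r)" by metis
 \<comment> \<open>Let \<open>r0\<close> hit \<open>S\<close>. The local idempotent
   \<open>\<phi> r0\<close> hits some simple \<open>T\<close>, and some \<open>r\<close> in
   \<open>R\<close> hits \<open>T\<close> as well; so \<open>\<phi> r0\<close> factors through
   \<open>r\<close>. Applying \<open>\<psi>\<close>, \<open>r0\<close> factors through
   \<open>\<psi> r\<close>, which therefore hits \<open>S\<close>.\<close>
 have psicov: "\<exists>r\<in>R. hits (\<psi> r) S" if S: "graded_simple A S" for S :: "'a amodule"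
 proof -
  obtain r0 where r0: "r0 \<in> R" "hits r0 S" using cov[OF S] by blast
  have r0i: "r0 \<in> component A 0" "r0 \<in> carrier A" using loc[OF r0(1)] GA.component_closed by (auto simp: local_idempotent_def)
  have f: "local_idempotent (\<phi> r0)" by (rule local_idempotent_phi[OF loc[OF r0(1)]])
  then have f0: "\<phi> r0 \<in> component A 0" "\<phi> r0 \<otimes> \<phi> r0 = \<phi> r0" "\<phi> r0 ~= \<zero>" by (auto simp: local_idempotent_def)
  obtain T :: "'a amodule" where T: "graded_simple A T" "hits (\<phi> r0) T" using exists_simple_hit[OF f0] .
  obtain r where r: "r \<in> R" "hits r T" using cov[OF T(1)] by blast
  have ri: "r \<in> component A 0" "r \<otimes> r = r" using loc[OF r(1)] by (auto simp: local_idempotent_def)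
  have "factors (\<phi> r0) r" by (rule simple_factors[OF f ri(1) T(1,2) r(2)])
  then have "factors r0 (\<psi> r)" using factors_psi[OF _ f0(1) ri(1)] r0i(2) by simp
  moreover have "\<psi> r \<in> component A 0" "\<psi> r \<otimes> \<psi> r = \<psi> r"
   using psi_component[OF ri(1)] psi_mult[of r r] ri GA.component_closed[OF ri(1)] by simp_all
  moreover have "graded_module A S" using S by (simp add: graded_simple_def)
  ultimately have "hits (\<psi> r) S" using hits_factors r0(2) by blast
  then show ?thesis using r(1) by blast
 qed
 show thesis using that[of R L] fin loc cov psicov L by blast
qed

end

section \<open>Free modules\<close>

lemma free_module_sel [simp]:
 "f \<in> carrier (free_module R S) \<longleftrightarrow> (\<forall>s. f s \<in> carrier R) \<and> (\<forall>s. s \<notin> S --> f s = \<zero>\<^sub>R) \<and> finite {s. f s ~= \<zero>\<^sub>R}"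
 "\<zero>\<^bsub>free_module R S\<^esub> = (%s. \<zero>\<^sub>R)" "f \<oplus>\<^bsub>free_module R S\<^esub> g = (%s. f s \<oplus>\<^sub>R g s)"
 "a \<odot>\<^bsub>free_module R S\<^esub> f = (%s. a \<otimes>\<^sub>R f s)"
 by (auto simp: free_module_def)

context ring
begin

lemma free_left_module: "left_module R (free_module R S)"
proof -
 have fin: "finite {s. f s \<oplus> g s ~= \<zero>}" if "finite {s. f s ~= \<zero>}" "finite {s. g s ~= \<zero>}" for f g :: "'c => 'a"
  by (rule finite_subset[of _ "{s. f s ~= \<zero>} \<union> {s. g s ~= \<zero>}"]) (use that in auto)
 have fin2: "finite {s. a \<otimes> f s ~= \<zero>}" if "finite {s. f s ~= \<zero>}" "a \<in> carrier R" for a and f :: "'c => 'a"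
  by (rule finite_subset[of _ "{s. f s ~= \<zero>}"]) (use that in auto)
 have fin3: "finite {s. \<ominus> f s ~= \<zero>}" if "finite {s. f s ~= \<zero>}" for f :: "'c => 'a"
  by (rule finite_subset[of _ "{s. f s ~= \<zero>}"]) (use that in auto)
 have ag: "abelian_group (free_module R S)"
 proof (rule abelian_groupI)
  fix f assume f: "f \<in> carrier (free_module R S)"
  then have "(%s. \<ominus> f s) \<in> carrier (free_module R S)" using fin3[of f] by auto
  moreover have "(%s. \<ominus> f s) \<oplus>\<^bsub>free_module R S\<^esub> f = \<zero>\<^bsub>free_module R S\<^esub>" using f by (auto simp: l_neg)
  ultimately show "\<exists>g\<in>carrier (free_module R S). g \<oplus>\<^bsub>free_module R S\<^esub> f = \<zero>\<^bsub>free_module R S\<^esub>" by blast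
 qed (use fin in \<open>auto simp: a_ac\<close>)
 show ?thesis
  by (rule left_moduleI[OF ring_axioms ag]) (use fin2 in \<open>auto simp: l_distr r_distr m_assoc\<close>)
qed

lemma basis_vector_closed: "s \<in> S ==> basis_vector R s \<in> carrier (free_module R S)"
 by (auto simp: basis_vector_def intro: finite_subset[of _ "{s}"])

lemma free_module_induct [consumes 1, case_names zero step]:
 assumes f: "f \<in> carrier (free_module R S)" and z: "P (%s. \<zero>)"
  and step: "!!f s a. f \<in> carrier (free_module R S) ==> s \<in> S ==> a \<in> carrier R ==> P f ==>
   P (f \<oplus>\<^bsub>free_module R S\<^esub> a \<odot>\<^bsub>free_module R S\<^esub> basis_vector R s)"
 shows "P f"
 using f
proof (induct "card {s. f s ~= \<zero>}" arbitrary: f)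
 case 0
 then have "f = (%s. \<zero>)" by auto
 then show ?case using z by simp
next
 case (Suc n)
 then have fin: "finite {s. f s ~= \<zero>}" by simp
 obtain s where s: "f s ~= \<zero>" using Suc(2) by (metis (mono_tags) card_eq_0_iff empty_Collect_eq nat.distinct(1))
 let ?g = "f(s := \<zero>)"
 have sup: "{t. ?g t ~= \<zero>} = {t. f t ~= \<zero>} - {s}" by auto
 have g: "?g \<in> carrier (free_module R S)" using Suc(3) sup by auto
 moreover have "n = card {t. ?g t ~= \<zero>}" unfolding sup using Suc(2) fin s by simp
 ultimately have "P ?g" using Suc(1) by blast
 moreover have "s \<in> S" "f s \<in> carrier R" using s Suc(3) by auto
 ultimately have "P (?g \<oplus>\<^bsub>free_module R S\<^esub> f s \<odot>\<^bsub>free_module R S\<^esub> basis_vector R s)" using step g by blast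
 moreover have "?g \<oplus>\<^bsub>free_module R S\<^esub> f s \<odot>\<^bsub>free_module R S\<^esub> basis_vector R s = f"
  using Suc(3) by (auto simp: basis_vector_def fun_eq_iff)
 ultimately show ?case by simp
qed

end

text \<open>The homomorphism out of a free module given by its universal property: basis vector
  \<open>s\<close> goes to \<open>v s\<close>.\<close>

definition free_lift :: "('r, 'y) ring_scheme => ('r, 'm, 'z) module_scheme => ('s => 'm) => ('s => 'r) => 'm" where
 "free_lift R M v f = (\<Oplus>\<^sub>M s\<in>{s. f s ~= \<zero>\<^sub>R}. f s \<odot>\<^sub>M v s)"

context left_module
begin

lemma free_lift_superset:
 assumes v: "v \<in> S \<rightarrow> carrier M" and f: "f \<in> carrier (free_module R S)"
  and J: "finite J" "{s. f s ~= \<zero>} \<subseteq> J" "J \<subseteq> S"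
 shows "free_lift R M v f = (\<Oplus>\<^sub>M s\<in>J. f s \<odot>\<^sub>M v s)"
 unfolding free_lift_def
 by (rule M.add.finprod_mono_neutral_cong_left)
  (use J f v in \<open>auto simp: smult_zero_l subset_iff smult_closed Pi_iff\<close>)

lemma free_lift_hom:
 assumes v: "v \<in> S \<rightarrow> carrier M"
 shows "free_lift R M v \<in> LinearCombinations.module_hom R (free_module R S) M"
proof -
 have sub: "{s. f s ~= \<zero>} \<subseteq> S" if "f \<in> carrier (free_module R S)" for f using that by auto
 have c: "free_lift R M v f \<in> carrier M" if "f \<in> carrier (free_module R S)" for f
  unfolding free_lift_def using that v sub[OF that] by (intro M.finsum_closed) (auto simp: smult_closed Pi_iff)
 have add: "free_lift R M v (f \<oplus>\<^bsub>free_module R S\<^esub> g) = free_lift R M v f \<oplus>\<^sub>M free_lift R M v g"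
  if f: "f \<in> carrier (free_module R S)" and g: "g \<in> carrier (free_module R S)" for f g
 proof -
  let ?J = "{s. f s ~= \<zero>} \<union> {s. g s ~= \<zero>}"
  have J: "finite ?J" "?J \<subseteq> S" using f g by auto
  have cl: "(%s. f s \<odot>\<^sub>M v s) \<in> ?J \<rightarrow> carrier M" "(%s. g s \<odot>\<^sub>M v s) \<in> ?J \<rightarrow> carrier M"
   using f g v J(2) by (auto simp: smult_closed Pi_iff)
  have fg: "f \<oplus>\<^bsub>free_module R S\<^esub> g \<in> carrier (free_module R S)"
   by (rule left_module.axioms(2)[OF R.free_left_module, THEN abelian_groupE(1)]) (use f g in auto)
  have "free_lift R M v (f \<oplus>\<^bsub>free_module R S\<^esub> g) = (\<Oplus>\<^sub>M s\<in>?J. (f s \<oplus> g s) \<odot>\<^sub>M v s)"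
  proof -
   have "{s. (f \<oplus>\<^bsub>free_module R S\<^esub> g) s ~= \<zero>} \<subseteq> ?J" by auto
   from free_lift_superset[OF v fg J(1) this J(2)] show ?thesis by simp
  qed
  also have "\<dots> = (\<Oplus>\<^sub>M s\<in>?J. f s \<odot>\<^sub>M v s \<oplus>\<^sub>M g s \<odot>\<^sub>M v s)"
   by (rule M.finsum_cong') (use f g v J(2) in \<open>auto simp: smult_l_distr smult_closed Pi_iff\<close>)
  also have "\<dots> = (\<Oplus>\<^sub>M s\<in>?J. f s \<odot>\<^sub>M v s) \<oplus>\<^sub>M (\<Oplus>\<^sub>M s\<in>?J. g s \<odot>\<^sub>M v s)"
   using cl by (rule M.finsum_addf)
  also have "(\<Oplus>\<^sub>M s\<in>?J. f s \<odot>\<^sub>M v s) = free_lift R M v f"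
   by (rule free_lift_superset[OF v f J(1) _ J(2), symmetric]) auto
  also have "(\<Oplus>\<^sub>M s\<in>?J. g s \<odot>\<^sub>M v s) = free_lift R M v g"
   by (rule free_lift_superset[OF v g J(1) _ J(2), symmetric]) auto
  finally show ?thesis .
 qed
 have sm: "free_lift R M v (a \<odot>\<^bsub>free_module R S\<^esub> f) = a \<odot>\<^sub>M free_lift R M v f"
  if f: "f \<in> carrier (free_module R S)" and a: "a \<in> carrier R" for f a
 proof -
  let ?J = "{s. f s ~= \<zero>}"
  have J: "finite ?J" "?J \<subseteq> S" using f by auto
  have af: "a \<odot>\<^bsub>free_module R S\<^esub> f \<in> carrier (free_module R S)"
   by (rule left_module.smult_closed[OF R.free_left_module a f])
  have "free_lift R M v (a \<odot>\<^bsub>free_module R S\<^esub> f) = (\<Oplus>\<^sub>M s\<in>?J. (a \<otimes> f s) \<odot>\<^sub>M v s)"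
  proof -
   have "{s. (a \<odot>\<^bsub>free_module R S\<^esub> f) s ~= \<zero>} \<subseteq> ?J" using a by auto
   from free_lift_superset[OF v af J(1) this J(2)] show ?thesis by simp
  qed
  also have "\<dots> = (\<Oplus>\<^sub>M s\<in>?J. a \<odot>\<^sub>M (f s \<odot>\<^sub>M v s))"
   by (rule M.finsum_cong') (use a f v J(2) in \<open>auto simp: smult_assoc smult_closed Pi_iff\<close>)
  also have "\<dots> = a \<odot>\<^sub>M free_lift R M v f"
   unfolding free_lift_def by (rule smult_finsum_r[symmetric]) (use a f v J(2) in \<open>auto simp: smult_closed Pi_iff\<close>)
  finally show ?thesis .
 qed
 show ?thesis unfolding LinearCombinations.module_hom_def using c add sm by blast
qed

lemma free_lift_basis:
 assumes "v s \<in> carrier M"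
 shows "free_lift R M v (basis_vector R s) = v s"
\<comment> \<open>Over the zero ring a basis vector has empty support, so the lift is an empty sum;
  \<open>M\<close> is then trivial and the claim still holds.\<close>
proof (cases "\<one> = \<zero>")
 case True
 then have "carrier M = {\<zero>\<^sub>M}" using smult_one smult_zero_l by auto
 then show ?thesis using assms True by (simp add: free_lift_def basis_vector_def)
next
 case False
 then have "{t. basis_vector R s t ~= \<zero>} = {s}" by (auto simp: basis_vector_def)
 then show ?thesis using assms by (simp add: free_lift_def basis_vector_def smult_one)
qed

lemma free_hom_eqI:
 assumes h: "h \<in> LinearCombinations.module_hom R (free_module R S) M" "h' \<in> LinearCombinations.module_hom R (free_module R S) M"
  and eq: "!!s. s \<in> S ==> h (basis_vector R s) = h' (basis_vector R s)"
  and f: "f \<in> carrier (free_module R S)"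
 shows "h f = h' f"
 using f
proof (induct rule: R.free_module_induct)
 interpret F: left_module R "free_module R S" by (rule R.free_left_module)
 case zero
 have "g \<zero>\<^bsub>free_module R S\<^esub> = \<zero>\<^sub>M" if "g \<in> LinearCombinations.module_hom R (free_module R S) M" for g
  by (rule additive_zero[OF F.M.abelian_group_axioms M.abelian_group_axioms])
   (use that in \<open>auto simp only: LinearCombinations.module_hom_def\<close>)
 from this[OF h(1)] this[OF h(2)] show ?case by simp
next
 interpret F: left_module R "free_module R S" by (rule R.free_left_module)
 case (step f s a)
 have b: "basis_vector R s \<in> carrier (free_module R S)" by (rule R.basis_vector_closed[OF step(2)])
 then have "a \<odot>\<^bsub>free_module R S\<^esub> basis_vector R s \<in> carrier (free_module R S)" using step(3) by (rule F.smult_closed[rotated])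
 then show ?case
  using LinearCombinations.module_hom_add[OF h(1) step(1)] LinearCombinations.module_hom_add[OF h(2) step(1)]
   LinearCombinations.module_hom_smult[OF h(1) step(3) b] LinearCombinations.module_hom_smult[OF h(2) step(3) b]
   step(4) eq[OF step(2)] by simp
qed

lemma combinations_submodule:
 assumes S: "finite S" and x: "!!s. s \<in> S ==> x s \<in> carrier M"
 defines "W \<equiv> {(\<Oplus>\<^sub>M s\<in>S. c s \<odot>\<^sub>M x s) |c. c \<in> S \<rightarrow> carrier R}"
 shows "left_submodule R W M" "!!s. s \<in> S ==> x s \<in> W"
proof -
 have cl: "(%s. c s \<odot>\<^sub>M x s) \<in> S \<rightarrow> carrier M" if "c \<in> S \<rightarrow> carrier R" for c
  using that x by (auto simp: smult_closed Pi_iff)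
 have sm: "a \<odot>\<^sub>M y \<in> W" if a: "a \<in> carrier R" and "y \<in> W" for a y
 proof -
  obtain c where c: "c \<in> S \<rightarrow> carrier R" "y = (\<Oplus>\<^sub>M s\<in>S. c s \<odot>\<^sub>M x s)" using \<open>y \<in> W\<close> W_def by blast
  have "a \<odot>\<^sub>M y = (\<Oplus>\<^sub>M s\<in>S. a \<odot>\<^sub>M (c s \<odot>\<^sub>M x s))"
   unfolding c(2) using a cl[OF c(1)] by (intro smult_finsum_r) auto
  also have "\<dots> = (\<Oplus>\<^sub>M s\<in>S. (a \<otimes> c s) \<odot>\<^sub>M x s)"
   by (rule M.finsum_cong') (use a c(1) x in \<open>auto simp: smult_assoc smult_closed Pi_iff\<close>)
  finally show ?thesis unfolding W_def using a c(1) by (intro CollectI exI[of _ "%s. a \<otimes> c s"]) auto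
 qed
 have wc: "W \<subseteq> carrier M" unfolding W_def using cl by auto
 have "\<ominus>\<^sub>M y = (\<ominus> \<one>) \<odot>\<^sub>M y" if "y \<in> W" for y
  using that wc by (auto simp: smult_neg_l smult_one subset_iff)
 then have neg: "\<ominus>\<^sub>M y \<in> W" if "y \<in> W" for y using sm[of "\<ominus> \<one>" y] that by simp
 have "subgroup W (add_monoid M)"
 proof (rule M.add_subgroupI[OF wc _ _ neg])
  have "(\<Oplus>\<^sub>M s\<in>S. \<zero> \<odot>\<^sub>M x s) = (\<Oplus>\<^sub>M s\<in>S. \<zero>\<^sub>M)"
   by (rule M.finsum_cong') (use x in \<open>auto simp: smult_zero_l\<close>)
  then have "\<zero>\<^sub>M = (\<Oplus>\<^sub>M s\<in>S. \<zero> \<odot>\<^sub>M x s)" by simp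
  then show "\<zero>\<^sub>M \<in> W" unfolding W_def by (intro CollectI exI[of _ "%s. \<zero>"]) auto
  fix y z assume "y \<in> W" "z \<in> W"
  then obtain c d where cd: "c \<in> S \<rightarrow> carrier R" "d \<in> S \<rightarrow> carrier R"
   "y = (\<Oplus>\<^sub>M s\<in>S. c s \<odot>\<^sub>M x s)" "z = (\<Oplus>\<^sub>M s\<in>S. d s \<odot>\<^sub>M x s)" unfolding W_def by blast
  have "y \<oplus>\<^sub>M z = (\<Oplus>\<^sub>M s\<in>S. c s \<odot>\<^sub>M x s \<oplus>\<^sub>M d s \<odot>\<^sub>M x s)"
   unfolding cd(3,4) using cl cd(1,2) by (intro M.finsum_addf[symmetric]) auto
  also have "\<dots> = (\<Oplus>\<^sub>M s\<in>S. (c s \<oplus> d s) \<odot>\<^sub>M x s)"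
   by (rule M.finsum_cong') (use cd x in \<open>auto simp: smult_l_distr smult_closed Pi_iff\<close>)
  finally show "y \<oplus>\<^sub>M z \<in> W" unfolding W_def using cd by (intro CollectI exI[of _ "%s. c s \<oplus> d s"]) auto
 qed
 then show "left_submodule R W M" using sm by (auto simp: left_submodule_def)
 fix t assume t: "t \<in> S"
 have "(\<Oplus>\<^sub>M s\<in>S. (if s = t then \<one> else \<zero>) \<odot>\<^sub>M x s) = (\<Oplus>\<^sub>M s\<in>S. if s = t then x t else \<zero>\<^sub>M)"
  by (rule M.finsum_cong') (use x in \<open>auto simp: smult_one smult_zero_l\<close>)
 also have "\<dots> = x t" using M.finsum_delta[OF S x[OF t]] t by simp
 finally show "x t \<in> W" unfolding W_def by (intro CollectI exI[of _ "%s. if s = t then \<one> else \<zero>"]) auto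
qed

end

section \<open>Projective modules and dual bases\<close>

text \<open>The graded dual basis lemma as a definition: homogeneous generators with homogeneous
  coordinate functions exhibit \<open>P\<close> as a direct summand of a finite sum of shifts of
  \<open>A\<close>. The index type is free, so that bases can be transferred between
  modules.\<close>

definition dual_basis ::
  "('k, 'a) gmodule => ('a, 'm) gmodule => 'i set => ('i => 'm) => ('i => int) => ('i => 'm => 'a) => bool" where
 "dual_basis A P S x k \<xi> \<longleftrightarrow> finite S \<and> (\<forall>s\<in>S. x s \<in> component P (k s)) \<and>
   (\<forall>s\<in>S. \<xi> s \<in> graded_hom A P (shift (k s) (graded_regular A))) \<and>
   (\<forall>y\<in>carrier P. y = (\<Oplus>\<^sub>P s\<in>S. \<xi> s y \<odot>\<^sub>P x s))"

lemma dual_basisD: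
 assumes "dual_basis A P S x k \<xi>"
 shows "finite S" "!!s. s \<in> S ==> x s \<in> component P (k s)"
  "!!s y. s \<in> S ==> y \<in> carrier P ==> \<xi> s y \<in> carrier A"
  "!!s y z. s \<in> S ==> y \<in> carrier P ==> z \<in> carrier P ==> \<xi> s (y \<oplus>\<^sub>P z) = \<xi> s y \<oplus>\<^sub>A \<xi> s z"
  "!!s a y. s \<in> S ==> a \<in> carrier A ==> y \<in> carrier P ==> \<xi> s (a \<odot>\<^sub>P y) = a \<otimes>\<^sub>A \<xi> s y"
  "!!s y j. s \<in> S ==> y \<in> component P j ==> \<xi> s y \<in> component A (j - k s)"
  "!!y. y \<in> carrier P ==> (\<Oplus>\<^sub>P s\<in>S. \<xi> s y \<odot>\<^sub>P x s) = y"
proof -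
 show "finite S" "!!s. s \<in> S ==> x s \<in> component P (k s)" using assms by (auto simp: dual_basis_def)
 show "!!y. y \<in> carrier P ==> (\<Oplus>\<^sub>P s\<in>S. \<xi> s y \<odot>\<^sub>P x s) = y" using assms unfolding dual_basis_def by metis
 have h: "\<xi> s \<in> graded_hom A P (shift (k s) (graded_regular A))" if "s \<in> S" for s
  using assms that by (auto simp: dual_basis_def)
 show "\<xi> s y \<in> carrier A" if "s \<in> S" "y \<in> carrier P" for s y
  using graded_homD(1)[OF h[OF that(1)] that(2)] by (simp add: shift_def)
 show "\<xi> s (y \<oplus>\<^sub>P z) = \<xi> s y \<oplus>\<^sub>A \<xi> s z" if "s \<in> S" "y \<in> carrier P" "z \<in> carrier P" for s y z
  using graded_homD(2)[OF h[OF that(1)] that(2,3)] by (simp add: shift_def)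
 show "\<xi> s (a \<odot>\<^sub>P y) = a \<otimes>\<^sub>A \<xi> s y" if "s \<in> S" "a \<in> carrier A" "y \<in> carrier P" for s a y
  using graded_homD(3)[OF h[OF that(1)] that(2,3)] by (simp add: shift_def)
 show "\<xi> s y \<in> component A (j - k s)" if "s \<in> S" "y \<in> component P j" for s y j
  using graded_homD(4)[OF h[OF that(1)] that(2)] by (simp add: shift_def)
qed

lemma dual_basisI:
 assumes "finite S" "!!s. s \<in> S ==> x s \<in> component P (k s)"
  "!!s y. s \<in> S ==> y \<in> carrier P ==> \<xi> s y \<in> carrier A"
  "!!s y z. s \<in> S ==> y \<in> carrier P ==> z \<in> carrier P ==> \<xi> s (y \<oplus>\<^sub>P z) = \<xi> s y \<oplus>\<^sub>A \<xi> s z"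
  "!!s a y. s \<in> S ==> a \<in> carrier A ==> y \<in> carrier P ==> \<xi> s (a \<odot>\<^sub>P y) = a \<otimes>\<^sub>A \<xi> s y"
  "!!s y j. s \<in> S ==> y \<in> component P j ==> \<xi> s y \<in> component A (j - k s)"
  "!!y. y \<in> carrier P ==> (\<Oplus>\<^sub>P s\<in>S. \<xi> s y \<odot>\<^sub>P x s) = y"
 shows "dual_basis A P S x k \<xi>"
 unfolding dual_basis_def using assms(1,2,7)
 by (auto intro!: graded_homI simp: shift_def assms(3-6))

context graded_mod
begin

text \<open>The degree \<open>- k\<close> part of an ungraded homomorphism into \<open>A\<close>: on
  degree \<open>j\<close> take the component of degree \<open>j - k\<close>, and extend
  additively.\<close>

lemma homogenize:
 assumes \<eta>: "\<eta> \<in> LinearCombinations.module_hom A M (graded_regular A)"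
 obtains \<xi> where "!!y. y \<in> carrier M ==> \<xi> y \<in> carrier A"
  "!!y z. y \<in> carrier M ==> z \<in> carrier M ==> \<xi> (y \<oplus>\<^sub>M z) = \<xi> y \<oplus> \<xi> z"
  "!!a y. a \<in> carrier A ==> y \<in> carrier M ==> \<xi> (a \<odot>\<^sub>M y) = a \<otimes> \<xi> y"
  "!!y j. y \<in> component M j ==> \<xi> y = hcomp A (\<eta> y) (j - k)"
proof -
 have \<eta>c: "\<eta> y \<in> carrier A" if "y \<in> carrier M" for y
  using \<eta> that by (auto simp: LinearCombinations.module_hom_def)
 have \<eta>a: "\<eta> (y \<oplus>\<^sub>M z) = \<eta> y \<oplus> \<eta> z" if "y \<in> carrier M" "z \<in> carrier M" for y z
  using \<eta> that by (auto simp: LinearCombinations.module_hom_def)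
 have \<eta>s: "\<eta> (a \<odot>\<^sub>M y) = a \<otimes> \<eta> y" if "a \<in> carrier A" "y \<in> carrier M" for a y
  using \<eta> that by (auto simp: LinearCombinations.module_hom_def)
 have \<eta>0: "\<eta> \<zero>\<^sub>M = \<zero>"
  by (rule additive_zero[OF M.M.abelian_group_axioms abelian_group_axioms]) (auto simp: \<eta>c \<eta>a)
 define \<xi> where "\<xi> y = (\<Oplus>j\<in>{j. hcomp M y j ~= \<zero>\<^sub>M}. hcomp A (\<eta> (hcomp M y j)) (j - k))" for y
 have cl: "hcomp A (\<eta> (hcomp M y j)) i \<in> carrier A" if "y \<in> carrier M" for y i j
  using that by (simp add: GA.hcomp_closed \<eta>c M.hcomp_closed)
 have sup: "\<xi> y = (\<Oplus>j\<in>J. hcomp A (\<eta> (hcomp M y j)) (j - k))"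
  if "y \<in> carrier M" "finite J" "{j. hcomp M y j ~= \<zero>\<^sub>M} \<subseteq> J" for y J
  unfolding \<xi>_def
  by (rule add.finprod_mono_neutral_cong_left) (use that cl \<eta>0 GA.hcomp_zero in auto)
 have c: "\<xi> y \<in> carrier A" if "y \<in> carrier M" for y
  unfolding \<xi>_def using cl[OF that] by (intro finsum_closed) auto
 have add: "\<xi> (y \<oplus>\<^sub>M z) = \<xi> y \<oplus> \<xi> z" if y: "y \<in> carrier M" and z: "z \<in> carrier M" for y z
 proof -
  let ?J = "{j. hcomp M y j ~= \<zero>\<^sub>M} \<union> {j. hcomp M z j ~= \<zero>\<^sub>M}"
  have J: "finite ?J" using y z M.hcomp_finite by auto
  have "\<xi> (y \<oplus>\<^sub>M z) = (\<Oplus>j\<in>?J. hcomp A (\<eta> (hcomp M (y \<oplus>\<^sub>M z) j)) (j - k))"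
   by (rule sup) (use y z J in \<open>auto simp: M.hcomp_add\<close>)
  also have "\<dots> = (\<Oplus>j\<in>?J. hcomp A (\<eta> (hcomp M y j)) (j - k) \<oplus> hcomp A (\<eta> (hcomp M z j)) (j - k))"
   by (rule finsum_cong') (use y z cl in \<open>auto simp: M.hcomp_add \<eta>a M.hcomp_closed GA.hcomp_add \<eta>c\<close>)
  also have "\<dots> = \<xi> y \<oplus> \<xi> z"
   unfolding sup[OF y J Un_upper1] sup[OF z J Un_upper2] by (rule finsum_addf) (use y z cl in auto)
  finally show ?thesis .
 qed
 have hom: "\<xi> y = hcomp A (\<eta> y) (j - k)" if y: "y \<in> component M j" for y j
 proof -
  have yc: "y \<in> carrier M" using y M.component_closed by blast
  have "{i. hcomp M y i ~= \<zero>\<^sub>M} \<subseteq> {j}" using M.hcomp_homogeneous[OF y] by auto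
  from sup[OF yc _ this] show ?thesis using M.hcomp_homogeneous[OF y, of j] cl[OF yc, of j "j - k"] by simp
 qed
 \<comment> \<open>By additivity both \<open>y\<close> and \<open>a\<close> may be taken
   homogeneous; then both sides are one and the same component of
   \<open>a \<otimes> \<eta> y\<close>.\<close>
 have sm: "\<xi> (a \<odot>\<^sub>M y) = a \<otimes> \<xi> y" if a: "a \<in> carrier A" and y: "y \<in> carrier M" for a y
  using y
 proof (induct rule: M.homogeneous_induct)
  case zero
  have "\<xi> \<zero>\<^sub>M = \<zero>" using hom[OF M.component_zero, of 0] by (simp add: \<eta>0 GA.hcomp_zero)
  then show ?case using a by (simp add: M.smult_zero_r)
 next
  case (homogeneous j y)
  note yc = M.component_closed[OF homogeneous]
  show ?case using a
  proof (induct rule: GA.homogeneous_induct)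
   case zero
   have "\<xi> \<zero>\<^sub>M = \<zero>" using hom[OF M.component_zero, of 0] by (simp add: \<eta>0 GA.hcomp_zero)
   then show ?case using yc c by (simp add: M.smult_zero_l)
  next
   case (homogeneous i a)
   have "\<xi> (a \<odot>\<^sub>M y) = hcomp A (a \<otimes> \<eta> y) (i + j - k)"
    using hom[OF smult_component_M[OF homogeneous \<open>y \<in> component M j\<close>]] \<eta>s yc GA.component_closed[OF homogeneous] by simp
   also have "\<dots> = a \<otimes> hcomp A (\<eta> y) (j - k)"
    using hcomp_mult_l[OF homogeneous \<eta>c[OF yc], of "i + j - k"] by (simp add: algebra_simps)
   finally show ?case using hom[OF \<open>y \<in> component M j\<close>] by simp
  next
   case (add b d)
   then show ?case using yc c[OF yc] \<open>!!y z. y \<in> carrier M ==> z \<in> carrier M ==> \<xi> (y \<oplus>\<^sub>M z) = \<xi> y \<oplus> \<xi> z\<close>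
    by (simp add: M.smult_l_distr l_distr M.smult_closed)
  qed
 next
  case (add y z)
  then show ?case using a c \<open>!!y z. y \<in> carrier M ==> z \<in> carrier M ==> \<xi> (y \<oplus>\<^sub>M z) = \<xi> y \<oplus> \<xi> z\<close>
   by (simp add: M.smult_r_distr r_distr M.smult_closed)
 qed
 show thesis by (rule that[of \<xi>]) (fact c add sm hom)+
qed

text \<open>Projectivity is an ungraded notion, so the given splitting need not respect degrees.
  Coordinates with respect to homogeneous generators are read off first; replacing them by their
  parts of the right degree keeps the reconstruction formula.\<close>

lemma dual_basis_exists:
 assumes fg: "finitely_generated A M" and pr: "projective A M"
 obtains S :: "('m \<times> int) set" and x k \<xi> where "dual_basis A M S x k \<xi>"
proof -
 obtain G where G: "finite G" "G \<subseteq> carrier M"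
  "\<forall>y\<in>carrier M. \<exists>c\<in>G \<rightarrow> carrier A. y = (\<Oplus>\<^sub>M s\<in>G. c s \<odot>\<^sub>M s)"
  using fg unfolding finitely_generated_def by blast
 \<comment> \<open>Generators are split into their nonzero components. Indexing by pairs keeps the
   set finite and tolerates equal components of different generators.\<close>
 define S where "S = Sigma G (%g. {j. hcomp M g j ~= \<zero>\<^sub>M})"
 define x where "x = (%(g, j). hcomp M g j)"
 define k where "k = (%(g :: 'm, j :: int). j)"
 have S: "finite S" unfolding S_def using G(1,2) M.hcomp_finite by (intro finite_SigmaI) auto
 have x: "x s \<in> component M (k s)" "x s \<in> carrier M" if "s \<in> S" for s
  using that G(2) M.hcomp_component M.hcomp_closed unfolding S_def x_def k_def by auto
 let ?W = "{(\<Oplus>\<^sub>M s\<in>S. c s \<odot>\<^sub>M x s) |c. c \<in> S \<rightarrow> carrier A}"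
 have W1: "left_submodule A ?W M" by (rule M.combinations_submodule(1)[OF S]) (rule x(2))
 have W2: "x s \<in> ?W" if s: "s \<in> S" for s by (rule M.combinations_submodule(2)[OF S _ s]) (rule x(2))
 have Wsub: "subgroup ?W (add_monoid M)" and Wsm: "a \<in> carrier A ==> y \<in> ?W ==> a \<odot>\<^sub>M y \<in> ?W" for a y
  using W1 by (auto simp only: left_submodule_def)
 have GW: "g \<in> ?W" if g: "g \<in> G" for g
 proof (rule M.subgroup_hcompI[OF Wsub])
  show "g \<in> carrier M" using g G(2) by blast
  show "hcomp M g i \<in> ?W" for i
  proof (cases "hcomp M g i = \<zero>\<^sub>M")
   case True
   have "\<zero>\<^sub>M \<in> ?W" using subgroup.one_closed[OF Wsub] by (simp only: monoid.simps)
   then show ?thesis using True by simp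
  next
   case False
   then have "(g, i) \<in> S" using g by (simp add: S_def)
   from W2[OF this] show ?thesis by (simp add: x_def)
  qed
 qed
 have gen: "\<exists>c\<in>S \<rightarrow> carrier A. y = (\<Oplus>\<^sub>M s\<in>S. c s \<odot>\<^sub>M x s)" if y: "y \<in> carrier M" for y
 proof -
  obtain c where c: "c \<in> G \<rightarrow> carrier A" "y = (\<Oplus>\<^sub>M s\<in>G. c s \<odot>\<^sub>M s)" using bspec[OF G(3) y] by blast
  have "y \<in> ?W" unfolding c(2)
  proof (rule M.subgroup_finsum[OF Wsub], rule Wsm)
   show "c g \<in> carrier A" if "g \<in> G" for g using c(1) that by blast
  qed (rule GW)
  then show ?thesis by blast
 qed
 obtain T :: "'m set" and i p where ip: "i \<in> LinearCombinations.module_hom A M (free_module A T)"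
  "p \<in> LinearCombinations.module_hom A (free_module A T) M" "\<forall>y\<in>carrier M. p (i y) = y"
  using pr unfolding projective_def by blast
 have pb: "p (basis_vector A t) \<in> carrier M" if "t \<in> T" for t
  using LinearCombinations.module_hom_closed[OF ip(2)] basis_vector_closed[OF that] by blast
 have "\<forall>t\<in>T. \<exists>c. c \<in> S \<rightarrow> carrier A \<and> p (basis_vector A t) = (\<Oplus>\<^sub>M s\<in>S. c s \<odot>\<^sub>M x s)"
  using gen pb by blast
 then obtain c where c: "!!t. t \<in> T ==> c t \<in> S \<rightarrow> carrier A"
  "!!t. t \<in> T ==> p (basis_vector A t) = (\<Oplus>\<^sub>M s\<in>S. c t s \<odot>\<^sub>M x s)" by metis
 interpret R: graded_mod K A "graded_regular A" by (rule graded_modI[OF graded_module_regular])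
 \<comment> \<open>\<open>T\<close> may be infinite, so the coordinates of \<open>p\<close> on the
   free module are built from coefficients \<open>c t\<close> chosen for each basis vector; then
   \<open>p\<close> is the combination of the \<open>x s\<close> with coefficients
   \<open>l s\<close>.\<close>
 define l where "l s = free_lift A (graded_regular A) (%t. c t s)" for s
 have l: "l s \<in> LinearCombinations.module_hom A (free_module A T) (graded_regular A)" if s: "s \<in> S" for s
  unfolding l_def by (rule R.M.free_lift_hom) (use c(1) s in auto)
 have lc: "l s f \<in> carrier A" if "s \<in> S" "f \<in> carrier (free_module A T)" for s f
  using LinearCombinations.module_hom_closed[OF l[OF that(1)]] that(2) by auto
 define p' where "p' f = (\<Oplus>\<^sub>M s\<in>S. l s f \<odot>\<^sub>M x s)" for f
 have p': "p' \<in> LinearCombinations.module_hom A (free_module A T) M"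
  unfolding LinearCombinations.module_hom_def
 proof (intro CollectI conjI allI impI)
  show "p' \<in> carrier (free_module A T) \<rightarrow> carrier M"
   unfolding p'_def using lc x(2) by (auto simp del: free_module_sel intro!: M.M.finsum_closed M.smult_closed)
  fix f g assume "f \<in> carrier (free_module A T) \<and> g \<in> carrier (free_module A T)"
  then have f: "f \<in> carrier (free_module A T)" and g: "g \<in> carrier (free_module A T)" by auto
  have "p' (f \<oplus>\<^bsub>free_module A T\<^esub> g) = (\<Oplus>\<^sub>M s\<in>S. l s f \<odot>\<^sub>M x s \<oplus>\<^sub>M l s g \<odot>\<^sub>M x s)"
   unfolding p'_def
  proof (rule M.M.finsum_cong')
   fix s assume s: "s \<in> S"
   have "l s (f \<oplus>\<^bsub>free_module A T\<^esub> g) = l s f \<oplus> l s g"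
    using LinearCombinations.module_hom_add[OF l[OF s] f g] by simp
   then show "l s (f \<oplus>\<^bsub>free_module A T\<^esub> g) \<odot>\<^sub>M x s = l s f \<odot>\<^sub>M x s \<oplus>\<^sub>M l s g \<odot>\<^sub>M x s"
    using lc[OF s f] lc[OF s g] x(2)[OF s] by (simp add: M.smult_l_distr del: free_module_sel)
  qed (use lc f g x(2) in \<open>auto simp del: free_module_sel intro!: M.smult_closed M.M.a_closed\<close>)
  also have "\<dots> = p' f \<oplus>\<^sub>M p' g" unfolding p'_def
   by (rule M.M.finsum_addf) (use lc f g x(2) in \<open>auto simp del: free_module_sel intro!: M.smult_closed\<close>)
  finally show "p' (f \<oplus>\<^bsub>free_module A T\<^esub> g) = p' f \<oplus>\<^sub>M p' g" .
 next
  fix a f assume "a \<in> carrier A \<and> f \<in> carrier (free_module A T)"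
  then have a: "a \<in> carrier A" and f: "f \<in> carrier (free_module A T)" by auto
  have "p' (a \<odot>\<^bsub>free_module A T\<^esub> f) = (\<Oplus>\<^sub>M s\<in>S. a \<odot>\<^sub>M (l s f \<odot>\<^sub>M x s))"
   unfolding p'_def
  proof (rule M.M.finsum_cong')
   fix s assume s: "s \<in> S"
   have "l s (a \<odot>\<^bsub>free_module A T\<^esub> f) = a \<otimes> l s f"
    using LinearCombinations.module_hom_smult[OF l[OF s] a f] by simp
   then show "l s (a \<odot>\<^bsub>free_module A T\<^esub> f) \<odot>\<^sub>M x s = a \<odot>\<^sub>M (l s f \<odot>\<^sub>M x s)"
    using lc[OF s f] x(2)[OF s] a by (simp add: M.smult_assoc del: free_module_sel)
  qed (use lc f a x(2) in \<open>auto simp del: free_module_sel intro!: M.smult_closed\<close>)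
  also have "\<dots> = a \<odot>\<^sub>M p' f" unfolding p'_def
   by (rule M.smult_finsum_r[symmetric]) (use lc f a x(2) in \<open>auto simp del: free_module_sel intro!: M.smult_closed\<close>)
  finally show "p' (a \<odot>\<^bsub>free_module A T\<^esub> f) = a \<odot>\<^sub>M p' f" .
 qed
 have pp': "p f = p' f" if f: "f \<in> carrier (free_module A T)" for f
 proof (rule M.free_hom_eqI[OF ip(2) p' _ f])
  fix t assume t: "t \<in> T"
  have "l s (basis_vector A t) = c t s" if "s \<in> S" for s
   unfolding l_def using R.M.free_lift_basis[of "%t. c t s" t] c(1)[OF t] that by auto
  then show "p (basis_vector A t) = p' (basis_vector A t)"
   unfolding c(2)[OF t] p'_def using c(1)[OF t] x(2) by (intro M.M.finsum_cong') (auto intro!: M.smult_closed)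
 qed
 define \<eta> where "\<eta> s y = l s (i y)" for s y
 have ic: "i y \<in> carrier (free_module A T)" if "y \<in> carrier M" for y
  using LinearCombinations.module_hom_closed[OF ip(1)] that by blast
 have \<eta>: "\<eta> s \<in> LinearCombinations.module_hom A M (graded_regular A)" if s: "s \<in> S" for s
  unfolding LinearCombinations.module_hom_def
 proof (intro CollectI conjI allI impI)
  show "\<eta> s \<in> carrier M \<rightarrow> carrier (graded_regular A)" unfolding \<eta>_def using lc[OF s ic] by simp
  show "\<eta> s (y \<oplus>\<^sub>M z) = \<eta> s y \<oplus>\<^bsub>graded_regular A\<^esub> \<eta> s z" if "y \<in> carrier M \<and> z \<in> carrier M" for y z
   using LinearCombinations.module_hom_add[OF ip(1), of y z] LinearCombinations.module_hom_add[OF l[OF s] ic ic, of y z] that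
   by (simp add: \<eta>_def del: free_module_sel)
  show "\<eta> s (a \<odot>\<^sub>M y) = a \<odot>\<^bsub>graded_regular A\<^esub> \<eta> s y" if "a \<in> carrier A \<and> y \<in> carrier M" for a y
   using LinearCombinations.module_hom_smult[OF ip(1), of a y] LinearCombinations.module_hom_smult[OF l[OF s] _ ic, of a y] that
   by (simp add: \<eta>_def del: free_module_sel)
 qed
 have sum: "(\<Oplus>\<^sub>M s\<in>S. \<eta> s y \<odot>\<^sub>M x s) = y" if "y \<in> carrier M" for y
  using bspec[OF ip(3) that] pp'[OF ic[OF that]] by (simp add: p'_def \<eta>_def)
 define good where "good s \<xi> \<longleftrightarrow> (\<forall>y\<in>carrier M. \<xi> y \<in> carrier A) \<and>
  (\<forall>y\<in>carrier M. \<forall>z\<in>carrier M. \<xi> (y \<oplus>\<^sub>M z) = \<xi> y \<oplus> \<xi> z) \<and>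
  (\<forall>a\<in>carrier A. \<forall>y\<in>carrier M. \<xi> (a \<odot>\<^sub>M y) = a \<otimes> \<xi> y) \<and>
  (\<forall>j. \<forall>y\<in>component M j. \<xi> y = hcomp A (\<eta> s y) (j - k s))" for s \<xi>
 have "\<forall>s\<in>S. \<exists>\<xi>. good s \<xi>"
 proof
  fix s assume "s \<in> S"
  show "\<exists>\<xi>. good s \<xi>"
  proof (rule homogenize[OF \<eta>[OF \<open>s \<in> S\<close>], where k = "k s"])
   fix \<xi> assume "!!y. y \<in> carrier M ==> \<xi> y \<in> carrier A"
    "!!y z. y \<in> carrier M ==> z \<in> carrier M ==> \<xi> (y \<oplus>\<^sub>M z) = \<xi> y \<oplus> \<xi> z"
    "!!a y. a \<in> carrier A ==> y \<in> carrier M ==> \<xi> (a \<odot>\<^sub>M y) = a \<otimes> \<xi> y"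
    "!!y j. y \<in> component M j ==> \<xi> y = hcomp A (\<eta> s y) (j - k s)"
   then have "good s \<xi>" unfolding good_def by simp
   then show ?thesis by blast
  qed
 qed
 then obtain \<xi> where "!!s. s \<in> S ==> good s (\<xi> s)" by metis
 then have \<xi>: "\<xi> s y \<in> carrier A" "\<xi> s (y \<oplus>\<^sub>M z) = \<xi> s y \<oplus> \<xi> s z" "\<xi> s (a \<odot>\<^sub>M y) = a \<otimes> \<xi> s y"
  if "s \<in> S" "y \<in> carrier M" "z \<in> carrier M" "a \<in> carrier A" for s y z a
  using that unfolding good_def by blast+
 have \<xi>h: "\<xi> s y = hcomp A (\<eta> s y) (j - k s)" if "s \<in> S" "y \<in> component M j" for s y j
  using \<open>!!s. s \<in> S ==> good s (\<xi> s)\<close> that unfolding good_def by blast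
 have \<eta>c: "\<eta> s y \<in> carrier A" if "s \<in> S" "y \<in> carrier M" for s y
  unfolding \<eta>_def by (rule lc[OF that(1) ic[OF that(2)]])
 have "dual_basis A M S x k \<xi>"
 proof (rule dual_basisI[OF S x(1)])
  show "\<xi> s y \<in> component A (j - k s)" if "s \<in> S" "y \<in> component M j" for s y j
   unfolding \<xi>h[OF that] by (rule GA.hcomp_component[OF \<eta>c[OF that(1) M.component_closed[OF that(2)]]])
  have tm: "(%s. \<xi> s y \<odot>\<^sub>M x s) \<in> S \<rightarrow> carrier M" if "y \<in> carrier M" for y
   using \<xi>(1)[OF _ that that zero_closed] x(2) by (auto intro!: M.smult_closed)
  show "(\<Oplus>\<^sub>M s\<in>S. \<xi> s y \<odot>\<^sub>M x s) = y" if "y \<in> carrier M" for y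
   using that
  proof (induct rule: M.homogeneous_induct)
   \<comment> \<open>Additivity of the coordinates shows that this sum \<open>z\<close> satisfies
     \<open>z + z = z\<close>.\<close>
   case zero
   have "(\<Oplus>\<^sub>M s\<in>S. \<xi> s \<zero>\<^sub>M \<odot>\<^sub>M x s) \<oplus>\<^sub>M (\<Oplus>\<^sub>M s\<in>S. \<xi> s \<zero>\<^sub>M \<odot>\<^sub>M x s)
    = (\<Oplus>\<^sub>M s\<in>S. \<xi> s \<zero>\<^sub>M \<odot>\<^sub>M x s \<oplus>\<^sub>M \<xi> s \<zero>\<^sub>M \<odot>\<^sub>M x s)"
    by (rule M.M.finsum_addf[symmetric]) (use tm[OF M.M.zero_closed] in auto)
   also have "\<dots> = (\<Oplus>\<^sub>M s\<in>S. \<xi> s \<zero>\<^sub>M \<odot>\<^sub>M x s)"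
   proof (rule M.M.finsum_cong')
    fix s assume s: "s \<in> S"
    have "\<xi> s \<zero>\<^sub>M \<oplus> \<xi> s \<zero>\<^sub>M = \<xi> s \<zero>\<^sub>M"
     using \<xi>(2)[OF s M.M.zero_closed M.M.zero_closed zero_closed] by simp
    then show "\<xi> s \<zero>\<^sub>M \<odot>\<^sub>M x s \<oplus>\<^sub>M \<xi> s \<zero>\<^sub>M \<odot>\<^sub>M x s = \<xi> s \<zero>\<^sub>M \<odot>\<^sub>M x s"
     using M.smult_l_distr[of "\<xi> s \<zero>\<^sub>M" "\<xi> s \<zero>\<^sub>M" "x s"] \<xi>(1)[OF s M.M.zero_closed M.M.zero_closed zero_closed] x(2)[OF s] by simp
   qed (use tm[OF M.M.zero_closed] in auto)
   finally show ?case using tm[OF M.M.zero_closed] by simp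
  next
   \<comment> \<open>Degree \<open>j\<close> part of the ungraded formula: since \<open>x s\<close>
     is homogeneous, it replaces each coefficient \<open>\<eta> s y\<close> by its component of
     degree \<open>j - k s\<close>, which is \<open>\<xi> s y\<close>.\<close>
   case (homogeneous j y)
   note yc = M.component_closed[OF homogeneous]
   have "(\<Oplus>\<^sub>M s\<in>S. \<xi> s y \<odot>\<^sub>M x s) = (\<Oplus>\<^sub>M s\<in>S. hcomp M (\<eta> s y \<odot>\<^sub>M x s) j)"
   proof (rule M.M.finsum_cong')
    fix s assume s: "s \<in> S"
    show "\<xi> s y \<odot>\<^sub>M x s = hcomp M (\<eta> s y \<odot>\<^sub>M x s) j"
     unfolding \<xi>h[OF s homogeneous] by (rule hcomp_smult_r[OF \<eta>c[OF s yc] x(1)[OF s], symmetric])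
   qed (use \<eta>c yc x(2) in \<open>auto intro!: M.hcomp_closed M.smult_closed\<close>)
   also have "\<dots> = hcomp M (\<Oplus>\<^sub>M s\<in>S. \<eta> s y \<odot>\<^sub>M x s) j"
    by (rule M.hcomp_finsum[symmetric]) (use \<eta>c yc x(2) in \<open>auto intro!: M.smult_closed\<close>)
   also have "\<dots> = y" using sum[OF yc] M.hcomp_homogeneous[OF homogeneous, of j] by simp
   finally show ?case .
  next
   case (add y z)
   have "(\<Oplus>\<^sub>M s\<in>S. \<xi> s (y \<oplus>\<^sub>M z) \<odot>\<^sub>M x s) = (\<Oplus>\<^sub>M s\<in>S. \<xi> s y \<odot>\<^sub>M x s \<oplus>\<^sub>M \<xi> s z \<odot>\<^sub>M x s)"
   proof (rule M.M.finsum_cong')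
    fix s assume s: "s \<in> S"
    show "\<xi> s (y \<oplus>\<^sub>M z) \<odot>\<^sub>M x s = \<xi> s y \<odot>\<^sub>M x s \<oplus>\<^sub>M \<xi> s z \<odot>\<^sub>M x s"
     using \<xi>(2)[OF s add(1,2) zero_closed] \<xi>(1)[OF s add(1,1) zero_closed] \<xi>(1)[OF s add(2,2) zero_closed]
      x(2)[OF s] by (simp add: M.smult_l_distr)
   qed (use tm[OF add(1)] tm[OF add(2)] in \<open>auto simp: Pi_iff\<close>)
   also have "\<dots> = (\<Oplus>\<^sub>M s\<in>S. \<xi> s y \<odot>\<^sub>M x s) \<oplus>\<^sub>M (\<Oplus>\<^sub>M s\<in>S. \<xi> s z \<odot>\<^sub>M x s)"
    by (rule M.M.finsum_addf) (use tm add(1,2) in auto)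
   finally show ?case using add(3,4) by simp
  qed
  show "\<xi> s y \<in> carrier A" if "s \<in> S" "y \<in> carrier M" for s y
   by (rule \<xi>(1)[OF that(1,2) that(2) zero_closed])
  show "\<xi> s (y \<oplus>\<^sub>M z) = \<xi> s y \<oplus> \<xi> s z" if "s \<in> S" "y \<in> carrier M" "z \<in> carrier M" for s y z
   by (rule \<xi>(2)[OF that zero_closed])
  show "\<xi> s (a \<odot>\<^sub>M y) = a \<otimes> \<xi> s y" if "s \<in> S" "a \<in> carrier A" "y \<in> carrier M" for s a y
   by (rule \<xi>(3)[OF that(1,3) that(3,2)])
 qed
 then show thesis by (rule that)
qed

end

section \<open>Projectivity, lifting, retracts and shifts from dual bases\<close>

context graded_mod
begin

text \<open>\<open>projective\<close> demands an index set inside the type of module elements;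
  \<open>\<tau>\<close> embeds the given index set there.\<close>

lemma dual_basis_projective:
 assumes db: "dual_basis A M S x k \<xi>" and \<tau>: "inj_on (\<tau> :: 'i => 'm) S"
 shows "projective A M"
proof -
 note d = dual_basisD[OF db]
 let ?T = "\<tau> ` S"
 let ?r = "inv_into S \<tau>"
 have r: "?r (\<tau> s) = s" if "s \<in> S" for s using \<tau> that by simp
 have rS: "?r t \<in> S" if "t \<in> ?T" for t using that by (rule inv_into_into)
 define i where "i y = (%t. if t \<in> ?T then \<xi> (?r t) y else \<zero>)" for y
 define p where "p = free_lift A M (%t. x (?r t))"
 have xv: "(%t. x (?r t)) \<in> ?T \<rightarrow> carrier M" using d(2) rS M.component_closed by blast
 have ic: "i y \<in> carrier (free_module A ?T)" if "y \<in> carrier M" for y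
  using d(1) d(3)[OF rS that] by (auto simp: i_def intro: finite_subset[of _ ?T])
 have "i \<in> LinearCombinations.module_hom A M (free_module A ?T)"
  unfolding LinearCombinations.module_hom_def
 proof (intro CollectI conjI allI impI)
  show "i \<in> carrier M \<rightarrow> carrier (free_module A ?T)" using ic by blast
  show "i (y \<oplus>\<^sub>M z) = i y \<oplus>\<^bsub>free_module A ?T\<^esub> i z" if "y \<in> carrier M \<and> z \<in> carrier M" for y z
   using that d(4)[OF rS] by (auto simp: i_def fun_eq_iff)
  show "i (a \<odot>\<^sub>M y) = a \<odot>\<^bsub>free_module A ?T\<^esub> i y" if "a \<in> carrier A \<and> y \<in> carrier M" for a y
   using that d(5)[OF rS] by (auto simp: i_def fun_eq_iff)
 qed
 moreover have "p \<in> LinearCombinations.module_hom A (free_module A ?T) M"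
  unfolding p_def by (rule M.free_lift_hom[OF xv])
 moreover have "\<forall>y\<in>carrier M. p (i y) = y"
 proof
  fix y assume y: "y \<in> carrier M"
  have xsc: "\<xi> s y \<odot>\<^sub>M x s \<in> carrier M" if "s \<in> S" for s
   using d(2,3) that y M.component_closed M.smult_closed by metis
  have "{t. i y t ~= \<zero>} \<subseteq> ?T" by (auto simp: i_def)
  then have "p (i y) = (\<Oplus>\<^sub>M t\<in>?T. i y t \<odot>\<^sub>M x (?r t))"
   unfolding p_def using M.free_lift_superset[OF xv ic[OF y] _ _ subset_refl] d(1) by blast
  also have "\<dots> = (\<Oplus>\<^sub>M s\<in>S. i y (\<tau> s) \<odot>\<^sub>M x (?r (\<tau> s)))"
   by (rule M.M.finsum_reindex[OF _ \<tau>]) (use xsc r in \<open>auto simp: i_def\<close>)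
  also have "\<dots> = (\<Oplus>\<^sub>M s\<in>S. \<xi> s y \<odot>\<^sub>M x s)"
   by (rule M.M.finsum_cong') (use xsc r in \<open>auto simp: i_def\<close>)
  finally show "p (i y) = y" using d(7)[OF y] by simp
 qed
 ultimately show ?thesis unfolding projective_def by blast
qed

lemma dual_basis_finitely_generated:
 assumes db: "dual_basis A M S x k \<xi>"
 shows "finitely_generated A M"
proof -
 note d = dual_basisD[OF db]
 let ?G = "x ` S"
 let ?W = "{(\<Oplus>\<^sub>M y\<in>?G. c y \<odot>\<^sub>M y) |c. c \<in> ?G \<rightarrow> carrier A}"
 have Gc: "y \<in> carrier M" if "y \<in> ?G" for y using that d(2) M.component_closed by blast
 have fin: "finite ?G" using d(1) by simp
 have W: "left_submodule A ?W M" by (rule M.combinations_submodule(1)[OF fin Gc])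
 have GW: "y \<in> ?W" if "y \<in> ?G" for y by (rule M.combinations_submodule(2)[OF fin Gc that])
 have sg: "subgroup ?W (add_monoid M)" and sm: "a \<in> carrier A ==> y \<in> ?W ==> a \<odot>\<^sub>M y \<in> ?W" for a y
  using W by (auto simp only: left_submodule_def)
 have "y \<in> ?W" if y: "y \<in> carrier M" for y
 proof -
  have "(\<Oplus>\<^sub>M s\<in>S. \<xi> s y \<odot>\<^sub>M x s) \<in> ?W"
  proof (rule M.subgroup_finsum[OF sg])
   fix s assume s: "s \<in> S"
   show "\<xi> s y \<odot>\<^sub>M x s \<in> ?W" by (rule sm[OF d(3)[OF s y] GW]) (use s in blast)
  qed
  then show ?thesis using d(7)[OF y] by simp
 qed
 then have "\<forall>y\<in>carrier M. \<exists>c\<in>?G \<rightarrow> carrier A. y = (\<Oplus>\<^sub>M s\<in>?G. c s \<odot>\<^sub>M s)" by blast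
 then show ?thesis unfolding finitely_generated_def using fin Gc by blast
qed

text \<open>Each \<open>f (x s)\<close> has a preimage \<open>z s\<close> of the same degree, and
  the coordinate functions extend this choice linearly to the required lift.\<close>

lemma graded_lift:
 assumes db: "dual_basis A P S x k \<xi>" and P: "graded_module A P" and N: "graded_module A N"
  and g: "g \<in> graded_hom A M N" "g ` carrier M = carrier N" and f: "f \<in> graded_hom A P N"
 obtains \<sigma> where "\<sigma> \<in> graded_hom A P M" "\<forall>y\<in>carrier P. g (\<sigma> y) = f y"
proof -
 interpret P: graded_mod K A P by (rule graded_modI[OF P])
 interpret f: graded_map K A P N f by (rule graded_mapI[OF graded_alg_axioms P N f])
 interpret g: graded_map K A M N g by (rule graded_mapI[OF graded_alg_axioms graded_module N g(1)])
 note d = dual_basisD[OF db]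
 have "\<forall>s\<in>S. \<exists>z. z \<in> component M (k s) \<and> g z = f (x s)"
 proof
  fix s assume "s \<in> S"
  then show "\<exists>z. z \<in> component M (k s) \<and> g z = f (x s)" using g.surj_component[OF g(2) f.comp[OF d(2)]] by metis
 qed
 then obtain z where z: "!!s. s \<in> S ==> z s \<in> component M (k s) \<and> g (z s) = f (x s)" by metis
 have zc: "z s \<in> carrier M" if "s \<in> S" for s using z[OF that] M.component_closed by blast
 define \<sigma> where "\<sigma> y = (\<Oplus>\<^sub>M s\<in>S. \<xi> s y \<odot>\<^sub>M z s)" for y
 have t: "\<xi> s y \<odot>\<^sub>M z s \<in> carrier M" if "s \<in> S" "y \<in> carrier P" for s y
  using d(3)[OF that] zc[OF that(1)] by (rule M.smult_closed)
 have "\<sigma> \<in> graded_hom A P M"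
 proof (rule graded_homI)
  show "\<sigma> y \<in> carrier M" if "y \<in> carrier P" for y
   unfolding \<sigma>_def using t that by (intro M.M.finsum_closed) auto
  show "\<sigma> (y \<oplus>\<^sub>P w) = \<sigma> y \<oplus>\<^sub>M \<sigma> w" if "y \<in> carrier P" "w \<in> carrier P" for y w
  proof -
   have "\<sigma> (y \<oplus>\<^sub>P w) = (\<Oplus>\<^sub>M s\<in>S. \<xi> s y \<odot>\<^sub>M z s \<oplus>\<^sub>M \<xi> s w \<odot>\<^sub>M z s)"
    unfolding \<sigma>_def
   proof (rule M.M.finsum_cong')
    fix s assume s: "s \<in> S"
    show "\<xi> s (y \<oplus>\<^sub>P w) \<odot>\<^sub>M z s = \<xi> s y \<odot>\<^sub>M z s \<oplus>\<^sub>M \<xi> s w \<odot>\<^sub>M z s"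
     using d(4)[OF s that] M.smult_l_distr[OF d(3)[OF s that(1)] d(3)[OF s that(2)] zc[OF s]] by simp
   qed (use t that in auto)
   also have "\<dots> = \<sigma> y \<oplus>\<^sub>M \<sigma> w" unfolding \<sigma>_def by (rule M.M.finsum_addf) (use t that in auto)
   finally show ?thesis .
  qed
  show "\<sigma> (a \<odot>\<^sub>P y) = a \<odot>\<^sub>M \<sigma> y" if "a \<in> carrier A" "y \<in> carrier P" for a y
  proof -
   have "\<sigma> (a \<odot>\<^sub>P y) = (\<Oplus>\<^sub>M s\<in>S. a \<odot>\<^sub>M (\<xi> s y \<odot>\<^sub>M z s))"
    unfolding \<sigma>_def
   proof (rule M.M.finsum_cong')
    fix s assume s: "s \<in> S"
    show "\<xi> s (a \<odot>\<^sub>P y) \<odot>\<^sub>M z s = a \<odot>\<^sub>M (\<xi> s y \<odot>\<^sub>M z s)"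
     using d(5)[OF s that] M.smult_assoc[OF that(1) d(3)[OF s that(2)] zc[OF s]] by simp
   qed (use t that M.smult_closed in auto)
   also have "\<dots> = a \<odot>\<^sub>M \<sigma> y" unfolding \<sigma>_def by (rule M.smult_finsum_r[symmetric]) (use t that in auto)
   finally show ?thesis .
  qed
  show "\<sigma> y \<in> component M j" if "y \<in> component P j" for j y
   unfolding \<sigma>_def
  proof (rule M.component_finsum)
   fix s assume s: "s \<in> S"
   show "\<xi> s y \<odot>\<^sub>M z s \<in> component M j"
    using smult_component_M[OF d(6)[OF s that]] z[OF s] by fastforce
  qed
 qed
 moreover have "\<forall>y\<in>carrier P. g (\<sigma> y) = f y"
 proof
  fix y assume y: "y \<in> carrier P"
  note xc = P.M.component_closed[OF d(2)] and c = d(3)[OF _ y]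
  have "g (\<sigma> y) = (\<Oplus>\<^sub>N s\<in>S. g (\<xi> s y \<odot>\<^sub>M z s))"
   unfolding \<sigma>_def by (rule g.finsum) (use t y in auto)
  also have "\<dots> = (\<Oplus>\<^sub>N s\<in>S. f (\<xi> s y \<odot>\<^sub>P x s))"
  proof (rule f.N.M.M.finsum_cong')
   fix s assume s: "s \<in> S"
   show "g (\<xi> s y \<odot>\<^sub>M z s) = f (\<xi> s y \<odot>\<^sub>P x s)"
    using g.smult[OF c[OF s] zc[OF s]] z[OF s] f.smult[OF c[OF s] xc[OF s]] by simp
  qed (use c xc P.M.smult_closed f.closed in auto)
  also have "\<dots> = f y"
   using f.finsum[of S "%s. \<xi> s y \<odot>\<^sub>P x s"] c xc P.M.smult_closed d(7)[OF y] by simp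
  finally show "g (\<sigma> y) = f y" .
 qed
 ultimately show thesis by (rule that)
qed

lemma graded_surjection_splits:
 assumes db: "dual_basis A P S x k \<xi>" and P: "graded_module A P"
  and g: "g \<in> graded_hom A M P" "g ` carrier M = carrier P"
 obtains \<sigma> where "\<sigma> \<in> graded_hom A P M" "\<forall>y\<in>carrier P. g (\<sigma> y) = y"
 by (rule graded_lift[OF db P P g graded_hom_id])

text \<open>The index set and the degrees stay the same. Hence a module and its retracts can be
  described inside the same power of \<open>M\<close> after tensoring.\<close>

lemma dual_basis_retract:
 assumes db: "dual_basis A M S x k \<xi>" and P: "graded_module A P"
  and i: "i \<in> graded_hom A P M" and r: "r \<in> graded_hom A M P" "!!y. y \<in> carrier P ==> r (i y) = y"
 shows "dual_basis A P S (%s. r (x s)) k (%s y. \<xi> s (i y))"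
proof -
 note d = dual_basisD[OF db]
 note ih = graded_homD[OF i] and rh = graded_homD[OF r(1)]
 interpret P: graded_mod K A P by (rule graded_modI[OF P])
 interpret r: graded_map K A M P r by (rule graded_mapI[OF graded_alg_axioms graded_module P r(1)])
 show ?thesis
 proof (rule dual_basisI[OF d(1)])
  fix y assume y: "y \<in> carrier P"
  have "(\<Oplus>\<^sub>P s\<in>S. \<xi> s (i y) \<odot>\<^sub>P r (x s)) = (\<Oplus>\<^sub>P s\<in>S. r (\<xi> s (i y) \<odot>\<^sub>M x s))"
  proof (rule P.M.M.finsum_cong')
   fix s assume s: "s \<in> S"
   have xs: "x s \<in> carrier M" using d(2)[OF s] M.component_closed by blast
   show "\<xi> s (i y) \<odot>\<^sub>P r (x s) = r (\<xi> s (i y) \<odot>\<^sub>M x s)"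
    using rh(3)[OF d(3)[OF s ih(1)[OF y]] xs] by simp
  qed (use d(3)[OF _ ih(1)[OF y]] rh(1)[OF M.component_closed[OF d(2)]]
    rh(1)[OF M.smult_closed[OF _ M.component_closed[OF d(2)]]] P.M.smult_closed in blast)+
  also have "\<dots> = r (\<Oplus>\<^sub>M s\<in>S. \<xi> s (i y) \<odot>\<^sub>M x s)"
   by (rule r.finsum[symmetric]) (use d(3)[OF _ ih(1)[OF y]] M.component_closed[OF d(2)] M.smult_closed in blast)
  also have "\<dots> = y" using d(7)[OF ih(1)[OF y]] r(2)[OF y] by simp
  finally show "(\<Oplus>\<^sub>P s\<in>S. \<xi> s (i y) \<odot>\<^sub>P r (x s)) = y" .
 qed (use d(2-6) ih rh in auto)
qed

lemma dual_basis_shift: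
 assumes db: "dual_basis A M S x k \<xi>"
 shows "dual_basis A (shift n M) S x (%s. k s + n) \<xi>"
proof -
 note d = dual_basisD[OF db]
 have f: "finsum (shift n M) f J = finsum M f J" for f :: "_ => 'm" and J
  by (rule finsum_cong_struct) (auto simp: shift_def)
 show ?thesis
 proof (rule dual_basisI[OF d(1)])
  show "\<xi> s y \<in> component A (j - (k s + n))" if "s \<in> S" "y \<in> component (shift n M) j" for s y j
   using d(6)[OF that(1), of y "j - n"] that(2) by (simp add: shift_def algebra_simps)
  show "(\<Oplus>\<^bsub>shift n M\<^esub>s\<in>S. \<xi> s y \<odot>\<^bsub>shift n M\<^esub> x s) = y" if "y \<in> carrier (shift n M)" for y
   unfolding f using d(7)[of y] that by (simp add: shift_def)
 qed (use d(2-5) in \<open>auto simp: shift_def\<close>)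
qed

end

context graded_alg
begin

text \<open>It remains to embed the finite index set into \<open>nat => 'a\<close>. That type is
  infinite once \<open>'a\<close> has two elements; if it has only one, \<open>A\<close> is the zero
  ring, so \<open>P\<close> is zero and the empty index set suffices.\<close>

lemma pmodI:
 fixes P :: "'a amodule"
 assumes P: "graded_module A P" and db: "dual_basis A P (S :: 'i set) x k \<xi>"
 shows "P \<in> Defs.pmod A"
proof -
 interpret P: graded_mod K A P by (rule graded_modI[OF P])
 have "projective A P"
 proof (cases "\<exists>a b :: 'a. a ~= b")
  case True
  then obtain a b :: 'a where ab: "a ~= b" by blast
  have "inj (%n::nat. (%m::nat. if m = n then a else b))"
  proof (rule injI)
   fix n m :: nat assume "(%i. if i = n then a else b) = (%i. if i = m then a else b)"
   from fun_cong[OF this, of n] show "n = m" using ab by (auto split: if_splits)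
  qed
  then have "infinite (range (%n::nat. (%m::nat. if m = n then a else b)))" by (rule range_inj_infinite)
  then obtain B :: "(nat => 'a) set" where B: "finite B" "card B = card S"
   using infinite_arbitrarily_large by metis
  then obtain \<tau> where "bij_betw \<tau> S B"
   using finite_same_card_bij[OF dual_basisD(1)[OF db] B(1)] by auto
  then have "inj_on \<tau> S" by (rule bij_betw_imp_inj_on)
  then show ?thesis by (rule P.dual_basis_projective[OF db])
 next
  case False
  have z: "y = \<zero>\<^sub>P" if "y \<in> carrier P" for y
  proof -
   have "\<one> = \<zero>" using False by blast
   then show ?thesis using P.M.smult_one[OF that] P.M.smult_zero_l[OF that] by simp
  qed
  have "dual_basis A P ({} :: 'i set) x k \<xi>" by (rule dual_basisI) (use z in auto)
  from P.dual_basis_projective[OF this inj_on_empty] show ?thesis .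
 qed
 then show ?thesis using P P.dual_basis_finitely_generated[OF db] by (simp add: Defs.pmod_def)
qed

lemma pmod_dual_basis:
 assumes "P \<in> Defs.pmod A"
 obtains S :: "((nat => 'a) \<times> int) set" and x k \<xi> where "dual_basis A P S x k \<xi>"
proof -
 have P: "graded_module A P" "finitely_generated A P" "projective A P" using assms by (auto simp: Defs.pmod_def)
 interpret P: graded_mod K A P by (rule graded_modI[OF P(1)])
 show thesis by (rule P.dual_basis_exists[OF P(2,3)]) (rule that)
qed

lemma principal_dual_basis:
 assumes e: "e \<in> component A 0" "e \<otimes> e = e"
 shows "dual_basis A (principal e) {()} (%_ _. e) (%_. 0) (%_ u. u 0)"
proof -
 interpret P: graded_mod K A "principal e" by (rule graded_modI[OF principal(1)[OF e]])
 note g = principal_smult_generator[OF e]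
 note ec = P.M.component_closed[OF g(1)]
 show ?thesis
 proof (rule dual_basisI)
  show "u 0 \<in> carrier A" if "u \<in> carrier (principal e)" for u using g(2)[OF that] by simp
  show "(u \<oplus>\<^bsub>principal e\<^esub> v) 0 = u 0 \<oplus> v 0" if "u \<in> carrier (principal e)" "v \<in> carrier (principal e)" for u v
   using that principal(5)[OF e] unfolding principal(2)[OF e] by auto
  show "(a \<odot>\<^bsub>principal e\<^esub> u) 0 = a \<otimes> u 0" if "a \<in> carrier A" "u \<in> carrier (principal e)" for a u
   using that principal(4)[OF e] unfolding principal(2)[OF e] by auto
  show "u 0 \<in> component A (j - 0)" if "u \<in> component (principal e) j" for u j
   using g(3)[OF that] by simp
  show "(\<Oplus>\<^bsub>principal e\<^esub>s\<in>{()}. u 0 \<odot>\<^bsub>principal e\<^esub> (%_. e)) = u" if "u \<in> carrier (principal e)" for u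
   using g(2)[OF that] that by simp
 qed (use g(1) in auto)
qed

lemma shift_pmod:
 assumes "P \<in> Defs.pmod A"
 shows "shift n P \<in> Defs.pmod A"
proof -
 obtain S :: "((nat => 'a) \<times> int) set" and x k \<xi> where db: "dual_basis A P S x k \<xi>" using pmod_dual_basis[OF assms] .
 have "graded_module A P" using assms by (simp add: Defs.pmod_def)
 then interpret P: graded_mod K A P by (rule graded_modI)
 show ?thesis by (rule pmodI[OF P.shift_graded_module P.dual_basis_shift[OF db]])
qed

lemma principal_pmod: "e \<in> component A 0 ==> e \<otimes> e = e ==> principal e \<in> Defs.pmod A"
 by (rule pmodI[OF principal(1) principal_dual_basis])

end

section \<open>Tensor products with projective modules\<close>

lemma vectorspace_cong_struct:
 assumes "carrier V = carrier W" "add V = add W" "\<zero>\<^sub>V = \<zero>\<^sub>W" "smult V = smult W" and W: "vectorspace K W"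
 shows "vectorspace K V"
proof -
 interpret W: vectorspace K W by (rule W)
 have "Module.module K V"
 proof (rule moduleI[OF W.R.cring_axioms])
  show "abelian_group V" by (rule abelian_group_cong_struct[OF assms(1-3) W.M.abelian_group_axioms])
 qed (use assms(1-4) W.smult_l_distr W.smult_r_distr W.smult_assoc1 in auto)
 then show ?thesis by (simp add: vectorspace_def W.field_axioms)
qed

text \<open>The power of \<open>V\<close> indexed by \<open>S\<close>. Members take the value zero
  outside \<open>S\<close>, which makes equality of functions agree with equality of coordinates;
  scaling keeps that default explicitly.\<close>

definition power_space :: "'i set => ('k, 'm, 'z) module_scheme => ('k, 'i => 'm) module" where
 "power_space S V = \<lparr>carrier = {m. (\<forall>s\<in>S. m s \<in> carrier V) \<and> (\<forall>s. s \<notin> S --> m s = \<zero>\<^sub>V)},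
   monoid.mult = undefined, one = undefined, zero = (%s. \<zero>\<^sub>V), add = (%f g s. f s \<oplus>\<^sub>V g s),
   smult = (%c f s. if s \<in> S then c \<odot>\<^sub>V f s else \<zero>\<^sub>V)\<rparr>"

lemma power_space_sel [simp]:
 "m \<in> carrier (power_space S V) \<longleftrightarrow> (\<forall>s\<in>S. m s \<in> carrier V) \<and> (\<forall>s. s \<notin> S --> m s = \<zero>\<^sub>V)"
 "\<zero>\<^bsub>power_space S V\<^esub> = (%s. \<zero>\<^sub>V)" "f \<oplus>\<^bsub>power_space S V\<^esub> g = (%s. f s \<oplus>\<^sub>V g s)"
 "c \<odot>\<^bsub>power_space S V\<^esub> f = (%s. if s \<in> S then c \<odot>\<^sub>V f s else \<zero>\<^sub>V)"
 by (auto simp: power_space_def)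

context vectorspace
begin

lemma power_space_vectorspace: "vectorspace K (power_space S V)"
proof -
 have cl: "f s \<in> carrier V" if "f \<in> carrier (power_space S V)" for f s
  using that by (cases "s \<in> S") auto
 have "Module.module K (power_space S V)"
 proof (rule moduleI[OF R.cring_axioms])
  show "abelian_group (power_space S V)"
  proof (rule abelian_groupI)
   fix f assume f: "f \<in> carrier (power_space S V)"
   have "(%s. \<ominus>\<^sub>V f s) \<in> carrier (power_space S V)" using f by auto
   moreover have "(%s. \<ominus>\<^sub>V f s) \<oplus>\<^bsub>power_space S V\<^esub> f = \<zero>\<^bsub>power_space S V\<^esub>"
    using cl[OF f] by (auto simp: M.l_neg)
   ultimately show "\<exists>g\<in>carrier (power_space S V). g \<oplus>\<^bsub>power_space S V\<^esub> f = \<zero>\<^bsub>power_space S V\<^esub>" by blast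
  next
   fix f g h assume "f \<in> carrier (power_space S V)" "g \<in> carrier (power_space S V)" "h \<in> carrier (power_space S V)"
   note cl[OF this(1)] cl[OF this(2)] cl[OF this(3)]
   then show "f \<oplus>\<^bsub>power_space S V\<^esub> g \<oplus>\<^bsub>power_space S V\<^esub> h = f \<oplus>\<^bsub>power_space S V\<^esub> (g \<oplus>\<^bsub>power_space S V\<^esub> h)"
    by (simp add: M.a_assoc)
  next
   fix f g assume "f \<in> carrier (power_space S V)" "g \<in> carrier (power_space S V)"
   note cl[OF this(1)] cl[OF this(2)]
   then show "f \<oplus>\<^bsub>power_space S V\<^esub> g = g \<oplus>\<^bsub>power_space S V\<^esub> f" by (simp add: M.a_comm)
  next
   fix f assume "f \<in> carrier (power_space S V)"
   note cl[OF this]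
   then show "\<zero>\<^bsub>power_space S V\<^esub> \<oplus>\<^bsub>power_space S V\<^esub> f = f" by simp
  qed auto
 qed (auto simp: fun_eq_iff smult_l_distr smult_r_distr smult_assoc1)
 then show ?thesis by (simp add: vectorspace_def field_axioms)
qed

lemma power_space_finsum:
 assumes "!!i. i \<in> J ==> f i \<in> carrier (power_space S V)"
 shows "(\<Oplus>\<^bsub>power_space S V\<^esub>i\<in>J. f i) t = (\<Oplus>\<^sub>V i\<in>J. f i t)"
proof -
 interpret W: vectorspace K "power_space S V" by (rule power_space_vectorspace)
 show ?thesis
 proof (rule additive_finsum[OF W.M.abelian_group_axioms M.abelian_group_axioms, of "%m. m t"])
  show "(%m. m t) \<in> carrier (power_space S V) \<rightarrow> carrier V" by (cases "t \<in> S") auto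
 qed (use assms in auto)
qed

lemma power_space_fin_dim:
 fixes S :: "'i set"
 assumes S: "finite S" and fd: fin_dim
 shows "vectorspace.fin_dim K (power_space S V)"
proof -
 interpret W: vectorspace K "power_space S V" by (rule power_space_vectorspace)
 obtain G where G: "finite G" "G \<subseteq> carrier V" "span G = carrier V"
  using fd by (auto simp: fin_dim_def)
 define \<delta> where "\<delta> s m = (%t. if t = s then m else \<zero>\<^sub>V)" for s :: 'i and m
 have \<delta>c: "\<delta> s m \<in> carrier (power_space S V)" if "s \<in> S" "m \<in> carrier V" for s m using that by (auto simp: \<delta>_def)
 show ?thesis
 proof (rule W.fin_dim_spanI)
  show "finite ((%(s, g). \<delta> s g) ` (S \<times> G))" using S G(1) by simp
  show "(%(s, g). \<delta> s g) ` (S \<times> G) \<subseteq> carrier (power_space S V)"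
  proof
   fix u assume "u \<in> (%(s, g). \<delta> s g) ` (S \<times> G)"
   then obtain s g where "s \<in> S" "g \<in> G" "u = \<delta> s g" by auto
   then show "u \<in> carrier (power_space S V)" using \<delta>c[of s g] G(2) by blast
  qed
  fix U assume U: "submodule K U (power_space S V)" "(%(s, g). \<delta> s g) ` (S \<times> G) \<subseteq> U"
  have Uz: "\<zero>\<^bsub>power_space S V\<^esub> \<in> U" and Ua: "!!f g. f \<in> U ==> g \<in> U ==> f \<oplus>\<^bsub>power_space S V\<^esub> g \<in> U"
   and Us: "!!c f. c \<in> carrier K ==> f \<in> U ==> c \<odot>\<^bsub>power_space S V\<^esub> f \<in> U"
   using U(1) by (auto simp only: submodule_def)
  have \<delta>U: "\<delta> s m \<in> U" if s: "s \<in> S" and m: "m \<in> carrier V" for s m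
  proof -
   have "submodule K {m \<in> carrier V. \<delta> s m \<in> U} V"
   proof (rule submoduleI')
    have "\<delta> s \<zero>\<^sub>V = \<zero>\<^bsub>power_space S V\<^esub>" by (auto simp: \<delta>_def)
    then show "\<zero>\<^sub>V \<in> {m \<in> carrier V. \<delta> s m \<in> U}" using Uz by (simp del: power_space_sel)
    fix a b assume ab: "a \<in> {m \<in> carrier V. \<delta> s m \<in> U}" "b \<in> {m \<in> carrier V. \<delta> s m \<in> U}"
    have "\<delta> s (a \<oplus>\<^sub>V b) = \<delta> s a \<oplus>\<^bsub>power_space S V\<^esub> \<delta> s b" by (auto simp: \<delta>_def)
    then show "a \<oplus>\<^sub>V b \<in> {m \<in> carrier V. \<delta> s m \<in> U}" using ab Ua by (simp del: power_space_sel)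
   next
    fix c a assume ca: "c \<in> carrier K" "a \<in> {m \<in> carrier V. \<delta> s m \<in> U}"
    have "\<delta> s (c \<odot>\<^sub>V a) = c \<odot>\<^bsub>power_space S V\<^esub> \<delta> s a" using s ca by (auto simp: \<delta>_def)
    then show "c \<odot>\<^sub>V a \<in> {m \<in> carrier V. \<delta> s m \<in> U}" using ca Us by (simp del: power_space_sel)
   qed auto
   moreover have "G \<subseteq> {m \<in> carrier V. \<delta> s m \<in> U}" using G(2) U(2) s by auto
   ultimately have "span G \<subseteq> {m \<in> carrier V. \<delta> s m \<in> U}" by (intro span_is_subset)
   then have "carrier V \<subseteq> {m \<in> carrier V. \<delta> s m \<in> U}" by (simp only: G(3))
   then show ?thesis using m by blast
  qed
  show "carrier (power_space S V) \<subseteq> U"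
  proof
   fix m assume m: "m \<in> carrier (power_space S V)"
   have mc: "m t \<in> carrier V" for t using m by (cases "t \<in> S") auto
   have "(\<Oplus>\<^bsub>power_space S V\<^esub>s\<in>S. \<delta> s (m s)) = m"
   proof
    fix t
    have "(\<Oplus>\<^bsub>power_space S V\<^esub>s\<in>S. \<delta> s (m s)) t = (\<Oplus>\<^sub>V s\<in>S. \<delta> s (m s) t)"
     by (rule power_space_finsum) (use \<delta>c mc in blast)
    also have "\<dots> = (\<Oplus>\<^sub>V s\<in>S. if s = t then m t else \<zero>\<^sub>V)"
     by (rule finsum_cong') (use mc in \<open>auto simp: \<delta>_def\<close>)
    also have "\<dots> = m t" using M.finsum_delta[OF S mc] m by auto
    finally show "(\<Oplus>\<^bsub>power_space S V\<^esub>s\<in>S. \<delta> s (m s)) t = m t" .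
   qed
   moreover have "(\<Oplus>\<^bsub>power_space S V\<^esub>s\<in>S. \<delta> s (m s)) \<in> U"
    by (rule W.submodule_finsum[OF U(1)]) (use \<delta>U mc in blast)
   ultimately show "m \<in> U" by simp
  qed
 qed
qed

end

locale tensor_setup = anti_alg K A \<psi> for K :: "'k ring" and A :: "('k, 'a) gmodule" (structure) and \<psi> +
 fixes P :: "('a, 'p) gmodule" and M :: "('a, 'm) gmodule"
  and S :: "'i set" and x :: "'i => 'p" and k :: "'i => int" and \<xi> :: "'i => 'p => 'a"
 assumes P: "graded_module A P" and M: "graded_module A M" and db: "dual_basis A P S x k \<xi>"
begin

sublocale P: graded_mod K A P by (rule graded_modI[OF P])
sublocale M: graded_mod K A M by (rule graded_modI[OF M])

lemmas d = dual_basisD[OF db]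

abbreviation "W \<equiv> power_space S (underlying_space A M)"

text \<open>
  \<open>P\<^sup>\<psi> \<otimes> M\<close> is realised as the image of the idempotent \<open>(m\<^sub>s) \<mapsto> (\<Sum>\<^sub>s \<phi>(\<xi>\<^sub>t x\<^sub>s) m\<^sub>s)\<^sub>t\<close> on \<open>M\<^sup>S\<close>,
  where \<open>\<phi> = \<psi>\<inverse>\<close>: the element \<open>(m\<^sub>s)\<close> of the image corresponds to \<open>\<Sum>\<^sub>s x\<^sub>s \<otimes> m\<^sub>s\<close>.
\<close>

definition fixed :: "('i => 'm) set" where
 "fixed = {m \<in> carrier W. \<forall>t\<in>S. (\<Oplus>\<^sub>M s\<in>S. \<phi> (\<xi> t (x s)) \<odot>\<^sub>M m s) = m t}"

text \<open>Since \<open>x s\<close> has degree \<open>k s\<close>, the tensor of \<open>x s\<close>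
  with \<open>m s\<close> has degree \<open>j\<close> when \<open>m s\<close> has degree
  \<open>j - k s\<close>.\<close>

definition fixed_component :: "int => ('i => 'm) set" where
 "fixed_component j = {m \<in> fixed. \<forall>s\<in>S. m s \<in> component M (j - k s)}"

sublocale W: vectorspace K W by (rule M.KM.power_space_vectorspace)

lemma xc: "s \<in> S ==> x s \<in> carrier P"
 using d(2) P.M.component_closed by blast

lemma \<phi>\<xi>: "s \<in> S ==> p \<in> carrier P ==> \<phi> (\<xi> s p) \<in> carrier A"
 using d(3) phi_closed by blast

lemma W_closed: "m \<in> carrier W ==> m s \<in> carrier M"
 by (cases "s \<in> S") auto

lemma coefficient_closed: "m \<in> carrier W ==> t \<in> S ==> s \<in> S ==> \<phi> (\<xi> t (x s)) \<odot>\<^sub>M m s \<in> carrier M"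
 by (rule M.M.smult_closed[OF \<phi>\<xi>[OF _ xc] W_closed])

lemma fixed_submodule: "submodule K fixed W"
proof (rule W.submoduleI')
 show "fixed \<subseteq> carrier W" by (auto simp: fixed_def)
 have "(\<Oplus>\<^sub>M s\<in>S. \<phi> (\<xi> t (x s)) \<odot>\<^sub>M \<zero>\<^sub>M) = \<zero>\<^sub>M" if "t \<in> S" for t
 proof -
  have "(\<Oplus>\<^sub>M s\<in>S. \<phi> (\<xi> t (x s)) \<odot>\<^sub>M \<zero>\<^sub>M) = (\<Oplus>\<^sub>M s\<in>S. \<zero>\<^sub>M)"
   by (rule M.M.M.finsum_cong') (use \<phi>\<xi>[OF that xc] in \<open>auto simp: M.M.smult_zero_r\<close>)
  then show ?thesis by simp
 qed
 then show "\<zero>\<^sub>W \<in> fixed" by (auto simp: fixed_def)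
next
 fix f g assume "f \<in> fixed" "g \<in> fixed"
 then have fg: "f \<in> carrier W" "g \<in> carrier W"
  "!!t. t \<in> S ==> (\<Oplus>\<^sub>M s\<in>S. \<phi> (\<xi> t (x s)) \<odot>\<^sub>M f s) = f t" "!!t. t \<in> S ==> (\<Oplus>\<^sub>M s\<in>S. \<phi> (\<xi> t (x s)) \<odot>\<^sub>M g s) = g t"
  by (auto simp: fixed_def)
 have "(\<Oplus>\<^sub>M s\<in>S. \<phi> (\<xi> t (x s)) \<odot>\<^sub>M (f s \<oplus>\<^sub>M g s)) = f t \<oplus>\<^sub>M g t" if t: "t \<in> S" for t
 proof -
  have "(\<Oplus>\<^sub>M s\<in>S. \<phi> (\<xi> t (x s)) \<odot>\<^sub>M (f s \<oplus>\<^sub>M g s)) =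
   (\<Oplus>\<^sub>M s\<in>S. \<phi> (\<xi> t (x s)) \<odot>\<^sub>M f s \<oplus>\<^sub>M \<phi> (\<xi> t (x s)) \<odot>\<^sub>M g s)"
  proof (rule M.M.M.finsum_cong')
   fix s assume s: "s \<in> S"
   show "\<phi> (\<xi> t (x s)) \<odot>\<^sub>M (f s \<oplus>\<^sub>M g s) = \<phi> (\<xi> t (x s)) \<odot>\<^sub>M f s \<oplus>\<^sub>M \<phi> (\<xi> t (x s)) \<odot>\<^sub>M g s"
    by (rule M.M.smult_r_distr[OF \<phi>\<xi>[OF t xc[OF s]] W_closed[OF fg(1)] W_closed[OF fg(2)]])
  qed (use coefficient_closed[OF fg(1) t] coefficient_closed[OF fg(2) t] in auto)
  also have "\<dots> = f t \<oplus>\<^sub>M g t"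
   unfolding fg(3)[OF t, symmetric] fg(4)[OF t, symmetric]
   by (rule M.M.M.finsum_addf) (use coefficient_closed[OF fg(1) t] coefficient_closed[OF fg(2) t] in auto)
  finally show ?thesis .
 qed
 then show "f \<oplus>\<^sub>W g \<in> fixed" using fg(1,2) by (auto simp: fixed_def)
next
 fix c f assume c: "c \<in> carrier K" and "f \<in> fixed"
 then have f: "f \<in> carrier W" "!!t. t \<in> S ==> (\<Oplus>\<^sub>M s\<in>S. \<phi> (\<xi> t (x s)) \<odot>\<^sub>M f s) = f t"
  by (auto simp: fixed_def)
 have "(\<Oplus>\<^sub>M s\<in>S. \<phi> (\<xi> t (x s)) \<odot>\<^sub>M (if s \<in> S then (c \<odot> \<one>) \<odot>\<^sub>M f s else \<zero>\<^sub>M)) = (c \<odot> \<one>) \<odot>\<^sub>M f t" if t: "t \<in> S" for t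
 proof -
  have "(\<Oplus>\<^sub>M s\<in>S. \<phi> (\<xi> t (x s)) \<odot>\<^sub>M (if s \<in> S then (c \<odot> \<one>) \<odot>\<^sub>M f s else \<zero>\<^sub>M)) =
   (\<Oplus>\<^sub>M s\<in>S. scalar c \<odot>\<^sub>M (\<phi> (\<xi> t (x s)) \<odot>\<^sub>M f s))"
  proof (rule M.M.M.finsum_cong')
   fix s assume s: "s \<in> S"
   note a = \<phi>\<xi>[OF t xc[OF s]] and fs = W_closed[OF f(1)]
   show "\<phi> (\<xi> t (x s)) \<odot>\<^sub>M (if s \<in> S then (c \<odot> \<one>) \<odot>\<^sub>M f s else \<zero>\<^sub>M) = scalar c \<odot>\<^sub>M (\<phi> (\<xi> t (x s)) \<odot>\<^sub>M f s)"
    using M.M.smult_assoc[OF a scalar_closed[OF c] fs, symmetric] M.M.smult_assoc[OF scalar_closed[OF c] a fs, symmetric] s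
    by (simp add: scalar_mult_l[OF c a] scalar_mult_r[OF c a] scalar_def[symmetric])
  qed (use coefficient_closed[OF f(1) t] M.M.smult_closed[OF scalar_closed[OF c]] in auto)
  also have "\<dots> = scalar c \<odot>\<^sub>M f t"
   unfolding f(2)[OF t, symmetric]
   by (rule M.M.smult_finsum_r[symmetric]) (use coefficient_closed[OF f(1) t] scalar_closed[OF c] in auto)
  finally show ?thesis by (simp add: scalar_def)
 qed
 moreover have "c \<odot>\<^sub>W f = (%s. if s \<in> S then (c \<odot> \<one>) \<odot>\<^sub>M f s else \<zero>\<^sub>M)"
  by (simp add: fun_eq_iff)
 moreover have "c \<odot>\<^sub>W f \<in> carrier W" by (rule W.smult_closed[OF c f(1)])
 ultimately show "c \<odot>\<^sub>W f \<in> fixed" by (simp add: fixed_def del: power_space_sel)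
qed

lemma fixed_component_submodule: "submodule K (fixed_component j) W"
proof -
 have s: "submodule K {m \<in> carrier W. \<forall>s\<in>S. m s \<in> component M (j - k s)} W"
 proof (rule W.submoduleI')
  fix c m assume c: "c \<in> carrier K" and m: "m \<in> {m \<in> carrier W. \<forall>s\<in>S. m s \<in> component M (j - k s)}"
  have "scalar c \<odot>\<^sub>M m s \<in> component M (j - k s)" if "s \<in> S" for s
   using M.smult_component_M[OF scalar_component[OF c], of "m s" "j - k s"] m that by simp
  then show "c \<odot>\<^sub>W m \<in> {m \<in> carrier W. \<forall>s\<in>S. m s \<in> component M (j - k s)}"
   using M.M.component_closed by (auto simp: scalar_def)
 qed (auto simp: M.M.component_zero M.M.component_add)
 then show ?thesis
  using fixed_submodule unfolding submodule_def fixed_component_def by (auto simp: fixed_def simp del: power_space_sel)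
qed

text \<open>Coordinates of the pure tensor of \<open>p\<close> and \<open>m\<close>: write
  \<open>p\<close> through the dual basis and move each coefficient to the other side, where it
  arrives as its image under \<open>\<phi>\<close> because \<open>A\<close> acts on \<open>P\<close>
  through \<open>\<psi>\<close>.\<close>

definition \<theta> :: "'p => 'm => 'i => 'm" where
 "\<theta> p m = (%s. if s \<in> S then \<phi> (\<xi> s p) \<odot>\<^sub>M m else \<zero>\<^sub>M)"

lemma theta_closed: "p \<in> carrier P ==> m \<in> carrier M ==> \<theta> p m \<in> carrier W"
 by (auto simp: \<theta>_def \<phi>\<xi> M.M.smult_closed)

text \<open>Apply \<open>\<xi> t\<close> to the expansion of \<open>p\<close> in the dual basis. The
  order of factors is reversed by \<open>\<phi>\<close>, which matches the order in which the matrix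
  entry and the coordinate act on \<open>m\<close>.\<close>

lemma theta_fixed:
 assumes p: "p \<in> carrier P" and m: "m \<in> carrier M"
 shows "\<theta> p m \<in> fixed"
proof -
 have "(\<Oplus>\<^sub>M s\<in>S. \<phi> (\<xi> t (x s)) \<odot>\<^sub>M \<theta> p m s) = \<theta> p m t" if t: "t \<in> S" for t
 proof -
  have "(\<Oplus>\<^sub>M s\<in>S. \<phi> (\<xi> t (x s)) \<odot>\<^sub>M \<theta> p m s) = (\<Oplus>\<^sub>M s\<in>S. \<phi> (\<xi> t (\<xi> s p \<odot>\<^sub>P x s)) \<odot>\<^sub>M m)"
  proof (rule M.M.M.finsum_cong')
   fix s assume s: "s \<in> S"
   have "\<phi> (\<xi> t (\<xi> s p \<odot>\<^sub>P x s)) = \<phi> (\<xi> t (x s)) \<otimes> \<phi> (\<xi> s p)"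
    unfolding d(5)[OF t d(3)[OF s p] xc[OF s]] by (rule phi_mult[OF d(3)[OF s p] d(3)[OF t xc[OF s]]])
   then show "\<phi> (\<xi> t (x s)) \<odot>\<^sub>M \<theta> p m s = \<phi> (\<xi> t (\<xi> s p \<odot>\<^sub>P x s)) \<odot>\<^sub>M m"
    using M.M.smult_assoc[OF \<phi>\<xi>[OF t xc[OF s]] \<phi>\<xi>[OF s p] m] s by (simp add: \<theta>_def)
  qed (use \<phi>\<xi>[OF t P.M.smult_closed[OF d(3)[OF _ p] xc]] m in \<open>auto intro!: M.M.smult_closed\<close>)
  also have "\<dots> = (\<Oplus>s\<in>S. \<phi> (\<xi> t (\<xi> s p \<odot>\<^sub>P x s))) \<odot>\<^sub>M m"
   by (rule M.M.smult_finsum_l[symmetric, OF m]) (rule \<phi>\<xi>[OF t P.M.smult_closed[OF d(3)[OF _ p] xc]])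
  also have "(\<Oplus>s\<in>S. \<phi> (\<xi> t (\<xi> s p \<odot>\<^sub>P x s))) = \<phi> (\<xi> t (\<Oplus>\<^sub>P s\<in>S. \<xi> s p \<odot>\<^sub>P x s))"
   by (rule additive_finsum[OF P.M.M.abelian_group_axioms abelian_group_axioms, of "%y. \<phi> (\<xi> t y)", symmetric])
    (use \<phi>\<xi>[OF t] d(4)[OF t] d(3)[OF t] phi_add P.M.smult_closed[OF d(3)[OF _ p] xc] in auto)
  also have "\<dots> = \<phi> (\<xi> t p)" by (simp add: d(7)[OF p])
  finally show ?thesis using t by (simp add: \<theta>_def)
 qed
 then show ?thesis using theta_closed[OF p m] by (simp add: fixed_def del: power_space_sel)
qed

lemma theta_component:
 assumes "p \<in> component P i" "m \<in> component M (j - i)"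
 shows "\<theta> p m \<in> fixed_component j"
proof -
 have "\<phi> (\<xi> s p) \<odot>\<^sub>M m \<in> component M (j - k s)" if "s \<in> S" for s
  using M.smult_component_M[OF phi_component[OF d(6)[OF that assms(1)]] assms(2)] by (simp add: algebra_simps)
 then show ?thesis
  using theta_fixed[OF P.M.component_closed[OF assms(1)] M.M.component_closed[OF assms(2)]]
  by (auto simp: fixed_component_def \<theta>_def)
qed

end

lemma twist_sel [simp]:
 "carrier (twist \<psi> P) = carrier P" "add (twist \<psi> P) = add P" "\<zero>\<^bsub>twist \<psi> P\<^esub> = \<zero>\<^sub>P"
 "component (twist \<psi> P) = component P" "a \<odot>\<^bsub>twist \<psi> P\<^esub> p = \<psi> a \<odot>\<^sub>P p"
 by (auto simp: twist_def)

section \<open>Comparing the tensor product with the fixed coordinate vectors\<close>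

context tensor_setup
begin

abbreviation "F \<equiv> free_module K (carrier P \<times> carrier M)"
abbreviation "null \<equiv> tensor_null K A (twist \<psi> P) M"
abbreviation "T \<equiv> tensor_space K A (twist \<psi> P) M"
abbreviation "e \<equiv> basis_vector K"
abbreviation "pt \<equiv> pure_tensor K A (twist \<psi> P) M"

lemma ring_K: "ring K"
 using cring_K by (simp add: cring_def)

sublocale F: vectorspace K F
 using module_if_left_module[OF cring_K ring.free_left_module[OF ring_K]] field_K
 by (simp add: vectorspace_def)

lemma e_closed: "p \<in> carrier P ==> m \<in> carrier M ==> e (p, m) \<in> carrier F"
 by (rule ring.basis_vector_closed[OF ring_K]) simp

lemma relations_cases:
 assumes "r \<in> tensor_relations K A (twist \<psi> P) M"
 obtains p p' m where "p \<in> carrier P" "p' \<in> carrier P" "m \<in> carrier M"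
   "r = e (p \<oplus>\<^sub>P p', m) \<ominus>\<^sub>F (e (p, m) \<oplus>\<^sub>F e (p', m))"
 | p m m' where "p \<in> carrier P" "m \<in> carrier M" "m' \<in> carrier M"
   "r = e (p, m \<oplus>\<^sub>M m') \<ominus>\<^sub>F (e (p, m) \<oplus>\<^sub>F e (p, m'))"
 | a p m where "a \<in> carrier A" "p \<in> carrier P" "m \<in> carrier M"
   "r = e (\<psi> a \<odot>\<^sub>P p, m) \<ominus>\<^sub>F e (p, a \<odot>\<^sub>M m)"
 | c p m where "c \<in> carrier K" "p \<in> carrier P" "m \<in> carrier M"
   "r = e (\<psi> (c \<odot> \<one>) \<odot>\<^sub>P p, m) \<ominus>\<^sub>F c \<odot>\<^sub>F e (p, m)"
proof -
 from assms show thesis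
  unfolding tensor_relations_def Let_def twist_sel Un_iff mem_Collect_eq
 proof (elim disjE exE conjE)
  fix p p' m assume "r = e (p \<oplus>\<^sub>P p', m) \<ominus>\<^sub>F (e (p, m) \<oplus>\<^sub>F e (p', m))"
   "p \<in> carrier P" "p' \<in> carrier P" "m \<in> carrier M"
  then show thesis by (intro that(1))
 next
  fix p m m' assume "r = e (p, m \<oplus>\<^sub>M m') \<ominus>\<^sub>F (e (p, m) \<oplus>\<^sub>F e (p, m'))"
   "p \<in> carrier P" "m \<in> carrier M" "m' \<in> carrier M"
  then show thesis by (intro that(2))
 next
  fix a p m assume "r = e (\<psi> a \<odot>\<^sub>P p, m) \<ominus>\<^sub>F e (p, a \<odot>\<^sub>M m)"
   "a \<in> carrier A" "p \<in> carrier P" "m \<in> carrier M"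
  then show thesis by (intro that(3))
 next
  fix c p m assume "r = e (\<psi> (c \<odot> \<one>) \<odot>\<^sub>P p, m) \<ominus>\<^sub>F c \<odot>\<^sub>F e (p, m)"
   "c \<in> carrier K" "p \<in> carrier P" "m \<in> carrier M"
  then show thesis by (intro that(4))
 qed
qed

lemma relations_intro:
 "p \<in> carrier P ==> p' \<in> carrier P ==> m \<in> carrier M ==>
  e (p \<oplus>\<^sub>P p', m) \<ominus>\<^sub>F (e (p, m) \<oplus>\<^sub>F e (p', m)) \<in> tensor_relations K A (twist \<psi> P) M"
 "p \<in> carrier P ==> m \<in> carrier M ==> m' \<in> carrier M ==>
  e (p, m \<oplus>\<^sub>M m') \<ominus>\<^sub>F (e (p, m) \<oplus>\<^sub>F e (p, m')) \<in> tensor_relations K A (twist \<psi> P) M"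
 "a \<in> carrier A ==> p \<in> carrier P ==> m \<in> carrier M ==>
  e (\<psi> a \<odot>\<^sub>P p, m) \<ominus>\<^sub>F e (p, a \<odot>\<^sub>M m) \<in> tensor_relations K A (twist \<psi> P) M"
 "c \<in> carrier K ==> p \<in> carrier P ==> m \<in> carrier M ==>
  e (\<psi> (c \<odot> \<one>) \<odot>\<^sub>P p, m) \<ominus>\<^sub>F c \<odot>\<^sub>F e (p, m) \<in> tensor_relations K A (twist \<psi> P) M"
 unfolding tensor_relations_def Let_def twist_sel Un_iff mem_Collect_eq by blast+

lemma relations_closed: "tensor_relations K A (twist \<psi> P) M \<subseteq> carrier F"
proof
 fix r assume "r \<in> tensor_relations K A (twist \<psi> P) M"
 then show "r \<in> carrier F"
 proof (cases rule: relations_cases)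
  case (1 p p' m)
  then show ?thesis unfolding 1(4) by (intro F.M.minus_closed F.M.a_closed e_closed P.M.M.a_closed) auto
 next
  case (2 p m m')
  then show ?thesis unfolding 2(4) by (intro F.M.minus_closed F.M.a_closed e_closed M.M.M.a_closed) auto
 next
  case (3 a p m)
  then show ?thesis unfolding 3(4) by (intro F.M.minus_closed e_closed M.M.smult_closed P.M.smult_closed psi_closed) auto
 next
  case (4 c p m)
  then show ?thesis unfolding 4(4)
   by (intro F.M.minus_closed e_closed F.smult_closed P.M.smult_closed psi_closed KA.smult_closed) auto
 qed
qed

lemma null_submodule: "submodule K null F"
 unfolding tensor_null_def twist_sel by (rule F.span_is_submodule[OF relations_closed])

lemma relations_null: "tensor_relations K A (twist \<psi> P) M \<subseteq> null"
 unfolding tensor_null_def twist_sel by (rule F.in_own_span[OF relations_closed])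

sublocale T: vectorspace K T
 unfolding tensor_space_def twist_sel
 by (rule F.quotient_vectorspace(1)[OF F.left_submodule_if_submodule[OF null_submodule]])

sublocale C: coset_quotient K F null
 by (rule F.quotient_vectorspace(2)[OF F.left_submodule_if_submodule[OF null_submodule]])

lemma T_eq: "T = quotient_module F null"
 by (simp add: tensor_space_def)

lemma pt_eq: "pt p m = null +>\<^sub>F e (p, m)"
 by (simp add: pure_tensor_def)

lemma coset_closed: "f \<in> carrier F ==> null +>\<^sub>F f \<in> carrier T"
 unfolding T_eq C.quotient_carrier by blast

lemma pt_closed: "p \<in> carrier P ==> m \<in> carrier M ==> pt p m \<in> carrier T"
 unfolding pt_eq by (intro coset_closed e_closed)

lemma coset_eqI: "f \<in> carrier F ==> g \<in> carrier F ==> f \<ominus>\<^sub>F g \<in> tensor_relations K A (twist \<psi> P) M ==>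
  null +>\<^sub>F f = null +>\<^sub>F g"
 using C.coset_eq_iff relations_null by blast

lemma pt_add_l:
 assumes "p \<in> carrier P" "p' \<in> carrier P" "m \<in> carrier M"
 shows "pt (p \<oplus>\<^sub>P p') m = pt p m \<oplus>\<^sub>T pt p' m"
 unfolding pt_eq T_eq C.quotient_add[OF e_closed[OF assms(1,3)] e_closed[OF assms(2,3)]]
 by (rule coset_eqI[OF _ _ relations_intro(1)[OF assms]]) (intro e_closed F.M.a_closed P.M.M.a_closed assms)+

lemma pt_add_r:
 assumes "p \<in> carrier P" "m \<in> carrier M" "m' \<in> carrier M"
 shows "pt p (m \<oplus>\<^sub>M m') = pt p m \<oplus>\<^sub>T pt p m'"
 unfolding pt_eq T_eq C.quotient_add[OF e_closed[OF assms(1,2)] e_closed[OF assms(1,3)]]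
 by (rule coset_eqI[OF _ _ relations_intro(2)[OF assms]]) (intro e_closed F.M.a_closed M.M.M.a_closed assms)+

lemma pt_balanced:
 assumes "a \<in> carrier A" "p \<in> carrier P" "m \<in> carrier M"
 shows "pt (\<psi> a \<odot>\<^sub>P p) m = pt p (a \<odot>\<^sub>M m)"
 unfolding pt_eq
 by (rule coset_eqI[OF _ _ relations_intro(3)[OF assms]])
  (intro e_closed M.M.smult_closed P.M.smult_closed psi_closed assms)+

lemma pt_scalar:
 assumes "c \<in> carrier K" "p \<in> carrier P" "m \<in> carrier M"
 shows "pt p (scalar c \<odot>\<^sub>M m) = c \<odot>\<^sub>T pt p m"
proof -
 have "pt (\<psi> (c \<odot> \<one>) \<odot>\<^sub>P p) m = c \<odot>\<^sub>T pt p m"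
  unfolding pt_eq T_eq C.quotient_smult[OF assms(1) e_closed[OF assms(2,3)]]
  by (rule coset_eqI[OF _ _ relations_intro(4)[OF assms]])
   (intro e_closed F.smult_closed P.M.smult_closed psi_closed KA.smult_closed one_closed assms)+
 then show ?thesis
  using pt_balanced[OF scalar_closed[OF assms(1)] assms(2,3)] by (simp add: scalar_def)
qed

lemma theta_add_l:
 assumes "p \<in> carrier P" "p' \<in> carrier P" "m \<in> carrier M"
 shows "\<theta> (p \<oplus>\<^sub>P p') m = \<theta> p m \<oplus>\<^sub>W \<theta> p' m"
proof
 fix s
 show "\<theta> (p \<oplus>\<^sub>P p') m s = (\<theta> p m \<oplus>\<^sub>W \<theta> p' m) s"
 proof (cases "s \<in> S")
  case True
  then show ?thesis
   using assms d(4)[OF True assms(1,2)] phi_add[OF d(3)[OF True assms(1)] d(3)[OF True assms(2)]]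
    M.M.smult_l_distr[OF \<phi>\<xi>[OF True assms(1)] \<phi>\<xi>[OF True assms(2)] assms(3)]
   by (simp add: \<theta>_def)
 qed (simp add: \<theta>_def)
qed

lemma theta_add_r:
 assumes "p \<in> carrier P" "m \<in> carrier M" "m' \<in> carrier M"
 shows "\<theta> p (m \<oplus>\<^sub>M m') = \<theta> p m \<oplus>\<^sub>W \<theta> p m'"
 by (auto simp: \<theta>_def fun_eq_iff M.M.smult_r_distr \<phi>\<xi> assms)

lemma theta_balanced:
 assumes "a \<in> carrier A" "p \<in> carrier P" "m \<in> carrier M"
 shows "\<theta> (\<psi> a \<odot>\<^sub>P p) m = \<theta> p (a \<odot>\<^sub>M m)"
proof
 fix s
 show "\<theta> (\<psi> a \<odot>\<^sub>P p) m s = \<theta> p (a \<odot>\<^sub>M m) s"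
 proof (cases "s \<in> S")
  case True
  then show ?thesis
   using d(5)[OF True psi_closed[OF assms(1)] assms(2)] phi_mult[OF psi_closed[OF assms(1)] d(3)[OF True assms(2)]]
    M.M.smult_assoc[OF \<phi>\<xi>[OF True assms(2)] assms(1,3)] assms(1)
   by (simp add: \<theta>_def)
 qed (simp add: \<theta>_def)
qed

lemma theta_scalar:
 assumes "c \<in> carrier K" "p \<in> carrier P" "m \<in> carrier M"
 shows "\<theta> p (scalar c \<odot>\<^sub>M m) = c \<odot>\<^sub>W \<theta> p m"
proof
 fix s
 show "\<theta> p (scalar c \<odot>\<^sub>M m) s = (c \<odot>\<^sub>W \<theta> p m) s"
 proof (cases "s \<in> S")
  case True
  note a = \<phi>\<xi>[OF True assms(2)] and sc = scalar_closed[OF assms(1)]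
  show ?thesis
   using M.M.smult_assoc[OF a sc assms(3), symmetric] M.M.smult_assoc[OF sc a assms(3), symmetric] True
   by (simp add: \<theta>_def scalar_mult_l[OF assms(1) a] scalar_mult_r[OF assms(1) a] scalar_def[symmetric])
 qed (simp add: \<theta>_def)
qed

text \<open>The linear extension of \<open>\<theta>\<close> to the free space, before passing to the
  quotient; being zero on \<open>null\<close> is all that is needed of it there.\<close>

definition \<Phi> :: "('p \<times> 'm => 'k) => 'i => 'm" where
 "\<Phi> = free_lift K W (%(p, m). \<theta> p m)"

lemma W_left_module: "left_module K W"
 by (rule left_module_if_module[OF W.module_axioms])

lemma Phi_linear: "linear_map K F W \<Phi>"
proof -
 have "\<Phi> \<in> LinearCombinations.module_hom K F W"
  unfolding \<Phi>_def by (rule left_module.free_lift_hom[OF W_left_module]) (use theta_closed in fast)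
 then show ?thesis using F.vectorspace_axioms W.vectorspace_axioms
  by (simp add: linear_map_def mod_hom_def mod_hom_axioms_def F.module_axioms W.module_axioms)
qed

sublocale Phi: linear_map K F W \<Phi> by (rule Phi_linear)

lemma Phi_e: "p \<in> carrier P ==> m \<in> carrier M ==> \<Phi> (e (p, m)) = \<theta> p m"
 unfolding \<Phi>_def
 using left_module.free_lift_basis[OF W_left_module, of "%(p, m). \<theta> p m" "(p, m)"] theta_closed by simp

lemma Phi_diff_zero: "f \<in> carrier F ==> g \<in> carrier F ==> \<Phi> f = \<Phi> g ==> \<Phi> (f \<ominus>\<^sub>F g) = \<zero>\<^sub>W"
 using Phi.f_minus[of f g] W.M.minus_zero_iff[of "\<Phi> g" "\<Phi> g"] Phi.f_im by metis

text \<open>\<open>\<theta>\<close> is biadditive, balanced and linear over \<open>K\<close>, so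
  each of the four kinds of relations is sent to zero.\<close>

lemma Phi_null: "f \<in> null ==> \<Phi> f = \<zero>\<^sub>W"
proof -
 have "tensor_relations K A (twist \<psi> P) M \<subseteq> Phi.ker"
 proof
  fix r assume r: "r \<in> tensor_relations K A (twist \<psi> P) M"
  then have "\<Phi> r = \<zero>\<^sub>W"
  proof (cases rule: relations_cases)
   case (1 p p' m)
   have "\<Phi> (e (p \<oplus>\<^sub>P p', m)) = \<Phi> (e (p, m) \<oplus>\<^sub>F e (p', m))"
    unfolding Phi.f_add[OF e_closed[OF 1(1,3)] e_closed[OF 1(2,3)]] Phi_e[OF 1(1,3)] Phi_e[OF 1(2,3)]
     Phi_e[OF P.M.M.a_closed[OF 1(1,2)] 1(3)] by (rule theta_add_l[OF 1(1-3)])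
   then show ?thesis unfolding 1(4)
    by (intro Phi_diff_zero e_closed F.M.a_closed P.M.M.a_closed 1)
  next
   case (2 p m m')
   have "\<Phi> (e (p, m \<oplus>\<^sub>M m')) = \<Phi> (e (p, m) \<oplus>\<^sub>F e (p, m'))"
    unfolding Phi.f_add[OF e_closed[OF 2(1,2)] e_closed[OF 2(1,3)]] Phi_e[OF 2(1,2)] Phi_e[OF 2(1,3)]
     Phi_e[OF 2(1) M.M.M.a_closed[OF 2(2,3)]] by (rule theta_add_r[OF 2(1-3)])
   then show ?thesis unfolding 2(4)
    by (intro Phi_diff_zero e_closed F.M.a_closed M.M.M.a_closed 2)
  next
   case (3 a p m)
   have "\<Phi> (e (\<psi> a \<odot>\<^sub>P p, m)) = \<Phi> (e (p, a \<odot>\<^sub>M m))"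
    unfolding Phi_e[OF 3(2) M.M.smult_closed[OF 3(1,3)]] Phi_e[OF P.M.smult_closed[OF psi_closed[OF 3(1)] 3(2)] 3(3)]
    by (rule theta_balanced[OF 3(1-3)])
   then show ?thesis unfolding 3(4)
    by (intro Phi_diff_zero e_closed M.M.smult_closed P.M.smult_closed psi_closed 3)
  next
   case (4 c p m)
   have "\<Phi> (e (\<psi> (c \<odot> \<one>) \<odot>\<^sub>P p, m)) = \<Phi> (c \<odot>\<^sub>F e (p, m))"
    unfolding Phi.f_smult[OF 4(1) e_closed[OF 4(2,3)]] Phi_e[OF 4(2,3)]
     Phi_e[OF P.M.smult_closed[OF psi_closed[OF KA.smult_closed[OF 4(1) one_closed]] 4(2)] 4(3)]
     theta_balanced[OF KA.smult_closed[OF 4(1) one_closed] 4(2,3)]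
    using theta_scalar[OF 4(1-3)] by (simp only: scalar_def)
   then show ?thesis unfolding 4(4)
    by (intro Phi_diff_zero e_closed F.smult_closed P.M.smult_closed psi_closed KA.smult_closed one_closed 4)
  qed
  then show "r \<in> Phi.ker" using relations_closed r unfolding Phi.ker_def by blast
 qed
 then have "null \<subseteq> Phi.ker"
  unfolding tensor_null_def twist_sel by (rule F.span_is_subset[OF _ Phi.ker_is_submodule])
 then show "f \<in> null ==> \<Phi> f = \<zero>\<^sub>W" unfolding Phi.ker_def by blast
qed

definition \<Theta> :: "('i => 'm) => ('p \<times> 'm => 'k) set" where
 "\<Theta> m = (\<Oplus>\<^sub>T s\<in>S. pt (x s) (m s))"

lemma pt_x_closed: "m \<in> carrier W ==> s \<in> S ==> pt (x s) (m s) \<in> carrier T"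
 by (intro pt_closed xc W_closed)

lemma Theta_linear: "linear_map K W T \<Theta>"
proof (rule linear_mapI[OF W.vectorspace_axioms T.vectorspace_axioms])
 show "\<Theta> m \<in> carrier T" if "m \<in> carrier W" for m
  unfolding \<Theta>_def using pt_x_closed[OF that] by (intro T.M.finsum_closed) auto
 show "\<Theta> (m \<oplus>\<^sub>W m') = \<Theta> m \<oplus>\<^sub>T \<Theta> m'" if m: "m \<in> carrier W" "m' \<in> carrier W" for m m'
 proof -
  have "\<Theta> (m \<oplus>\<^sub>W m') = (\<Oplus>\<^sub>T s\<in>S. pt (x s) (m s) \<oplus>\<^sub>T pt (x s) (m' s))"
   unfolding \<Theta>_def
  proof (rule T.M.finsum_cong')
   fix s assume s: "s \<in> S"
   show "pt (x s) ((m \<oplus>\<^sub>W m') s) = pt (x s) (m s) \<oplus>\<^sub>T pt (x s) (m' s)"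
    using pt_add_r[OF xc[OF s] W_closed[OF m(1)] W_closed[OF m(2)]] by simp
  qed (use pt_x_closed[OF m(1)] pt_x_closed[OF m(2)] in auto)
  also have "\<dots> = \<Theta> m \<oplus>\<^sub>T \<Theta> m'"
   unfolding \<Theta>_def by (rule T.M.finsum_addf) (use pt_x_closed[OF m(1)] pt_x_closed[OF m(2)] in auto)
  finally show ?thesis .
 qed
 show "\<Theta> (c \<odot>\<^sub>W m) = c \<odot>\<^sub>T \<Theta> m" if c: "c \<in> carrier K" and m: "m \<in> carrier W" for c m
 proof -
  have "\<Theta> (c \<odot>\<^sub>W m) = (\<Oplus>\<^sub>T s\<in>S. c \<odot>\<^sub>T pt (x s) (m s))"
   unfolding \<Theta>_def
  proof (rule T.M.finsum_cong')
   fix s assume s: "s \<in> S"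
   show "pt (x s) ((c \<odot>\<^sub>W m) s) = c \<odot>\<^sub>T pt (x s) (m s)"
    using pt_scalar[OF c xc[OF s] W_closed[OF m]] s by (simp add: scalar_def)
  qed (use pt_x_closed[OF m] c in auto)
  also have "\<dots> = c \<odot>\<^sub>T \<Theta> m"
   unfolding \<Theta>_def
   by (rule left_module.smult_finsum_r[OF left_module_if_module[OF T.module_axioms] c, symmetric])
    (rule pt_x_closed[OF m])
  finally show ?thesis .
 qed
qed

sublocale Theta: linear_map K W T \<Theta> by (rule Theta_linear)

text \<open>Moving the coefficients back across the tensor sign reassembles \<open>p\<close> from
  its dual basis expansion.\<close>

lemma Theta_theta:
 assumes p: "p \<in> carrier P" and m: "m \<in> carrier M"
 shows "\<Theta> (\<theta> p m) = pt p m"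
proof -
 have "\<Theta> (\<theta> p m) = (\<Oplus>\<^sub>T s\<in>S. pt (\<xi> s p \<odot>\<^sub>P x s) m)"
  unfolding \<Theta>_def
 proof (rule T.M.finsum_cong')
  fix s assume s: "s \<in> S"
  show "pt (x s) (\<theta> p m s) = pt (\<xi> s p \<odot>\<^sub>P x s) m"
   using pt_balanced[OF \<phi>\<xi>[OF s p] xc[OF s] m] d(3)[OF s p] s by (simp add: \<theta>_def)
 qed (use pt_closed[OF P.M.smult_closed[OF d(3)[OF _ p] xc] m] in auto)
 also have "\<dots> = pt (\<Oplus>\<^sub>P s\<in>S. \<xi> s p \<odot>\<^sub>P x s) m"
  by (rule additive_finsum[OF P.M.M.abelian_group_axioms T.M.abelian_group_axioms, of "%p. pt p m", symmetric])
   (use pt_closed[OF _ m] pt_add_l[OF _ _ m] P.M.smult_closed[OF d(3)[OF _ p] xc] in auto)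
 finally show ?thesis by (simp add: d(7)[OF p])
qed

lemma Theta_coset:
 assumes m: "m \<in> carrier W"
 shows "\<Theta> m = null +>\<^sub>F (\<Oplus>\<^sub>F s\<in>S. e (x s, m s))"
 unfolding \<Theta>_def pt_eq
 by (rule additive_finsum[OF F.M.abelian_group_axioms T.M.abelian_group_axioms, symmetric])
  (use coset_closed C.quotient_add e_closed xc W_closed[OF m] in \<open>auto simp: T_eq simp del: free_module_sel\<close>)

text \<open>If \<open>\<Theta> m\<close> vanishes, the formal sum of the pairs
  \<open>(x s, m s)\<close> lies in \<open>null\<close>, so \<open>\<Phi>\<close> kills it. But
  \<open>\<Phi>\<close> of that sum is the idempotent matrix applied to \<open>m\<close>, which is
  \<open>m\<close> itself.\<close>

lemma Theta_injective:
 assumes m: "m \<in> fixed" and z: "\<Theta> m = \<zero>\<^sub>T"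
 shows "m = \<zero>\<^sub>W"
proof -
 have mW: "m \<in> carrier W" using m by (simp add: fixed_def del: power_space_sel)
 have ec: "e (x s, m s) \<in> carrier F" if "s \<in> S" for s by (rule e_closed[OF xc[OF that] W_closed[OF mW]])
 then have fc: "(\<Oplus>\<^sub>F s\<in>S. e (x s, m s)) \<in> carrier F" by (intro F.M.finsum_closed) blast
 have "null +>\<^sub>F (\<Oplus>\<^sub>F s\<in>S. e (x s, m s)) = null +>\<^sub>F \<zero>\<^sub>F"
  using z Theta_coset[OF mW] unfolding T_eq C.quotient_zero by metis
 then have "(\<Oplus>\<^sub>F s\<in>S. e (x s, m s)) \<ominus>\<^sub>F \<zero>\<^sub>F \<in> null"
  using C.coset_eq_iff[OF fc F.M.zero_closed] by blast
 then have "(\<Oplus>\<^sub>F s\<in>S. e (x s, m s)) \<in> null" using F.M.minus_zero_r[OF fc] by metis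
 then have "\<Phi> (\<Oplus>\<^sub>F s\<in>S. e (x s, m s)) = \<zero>\<^sub>W" by (rule Phi_null)
 moreover have "\<Phi> (\<Oplus>\<^sub>F s\<in>S. e (x s, m s)) = (\<Oplus>\<^sub>W s\<in>S. \<Phi> (e (x s, m s)))"
  by (rule additive_finsum[OF F.M.abelian_group_axioms W.M.abelian_group_axioms _ Phi.f_add ec])
   (use Phi.f_im in blast)
 ultimately have zero: "(\<Oplus>\<^sub>W s\<in>S. \<Phi> (e (x s, m s))) = \<zero>\<^sub>W" by simp
 have "m t = \<zero>\<^sub>M" for t
 proof (cases "t \<in> S")
  case True
  have "\<zero>\<^sub>M = (\<Oplus>\<^sub>W s\<in>S. \<Phi> (e (x s, m s))) t" unfolding zero by simp
  also have "\<dots> = (\<Oplus>\<^bsub>underlying_space A M\<^esub>s\<in>S. \<Phi> (e (x s, m s)) t)"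
   by (rule M.KM.power_space_finsum) (rule Phi.f_im[OF ec])
  also have "\<dots> = (\<Oplus>\<^sub>M s\<in>S. \<Phi> (e (x s, m s)) t)"
   by (rule finsum_cong_struct) auto
  also have "\<dots> = (\<Oplus>\<^sub>M s\<in>S. \<phi> (\<xi> t (x s)) \<odot>\<^sub>M m s)"
  proof (rule M.M.M.finsum_cong')
   fix s assume s: "s \<in> S"
   show "\<Phi> (e (x s, m s)) t = \<phi> (\<xi> t (x s)) \<odot>\<^sub>M m s"
    using Phi_e[OF xc[OF s] W_closed[OF mW]] True by (simp add: \<theta>_def)
  qed (use coefficient_closed[OF mW True] in auto)
  also have "\<dots> = m t" using m True by (simp add: fixed_def)
  finally show ?thesis by simp
 qed (use mW in auto)
 then show ?thesis by auto
qed

lemma Theta_image_submodule: "submodule K U W ==> submodule K (\<Theta> ` U) T"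
proof (rule T.submoduleI')
 assume U: "submodule K U W"
 have Uc: "U \<subseteq> carrier W" and Uz: "\<zero>\<^sub>W \<in> U" and Ua: "!!f g. f \<in> U ==> g \<in> U ==> f \<oplus>\<^sub>W g \<in> U"
  and Us: "!!c f. c \<in> carrier K ==> f \<in> U ==> c \<odot>\<^sub>W f \<in> U"
  using U by (auto simp only: submodule_def)
 show "\<Theta> ` U \<subseteq> carrier T" using Uc Theta.f_im by blast
 show "\<zero>\<^sub>T \<in> \<Theta> ` U" using Uz Theta.f0_is_0 by (metis imageI)
 fix u v assume "u \<in> \<Theta> ` U" "v \<in> \<Theta> ` U"
 then obtain f g where fg: "f \<in> U" "g \<in> U" "u = \<Theta> f" "v = \<Theta> g" by blast
 then have "u \<oplus>\<^sub>T v = \<Theta> (f \<oplus>\<^sub>W g)" using Uc Theta.f_add[of f g] by (metis subsetD)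
 then show "u \<oplus>\<^sub>T v \<in> \<Theta> ` U" using Ua[OF fg(1,2)] by blast
next
 assume U: "submodule K U W"
 fix c u assume c: "c \<in> carrier K" and "u \<in> \<Theta> ` U"
 then obtain f where f: "f \<in> U" "u = \<Theta> f" by blast
 have "f \<in> carrier W" "c \<odot>\<^sub>W f \<in> U" using U f c by (auto simp only: submodule_def)
 then show "c \<odot>\<^sub>T u \<in> \<Theta> ` U" using Theta.f_smult[OF c, of f] f(2) by (metis imageI)
qed

text \<open>The image is a subspace that contains all pure tensors, by \<open>Theta_theta\<close>;
  induction on a representative in the free space finishes.\<close>

lemma Theta_surjective: "\<Theta> ` fixed = carrier T"
proof
 have fW: "fixed \<subseteq> carrier W" by (auto simp only: fixed_def)
 then show "\<Theta> ` fixed \<subseteq> carrier T" using Theta.f_im by blast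
 have sub: "submodule K (\<Theta> ` fixed) T" by (rule Theta_image_submodule[OF fixed_submodule])
 have add: "u \<oplus>\<^sub>T v \<in> \<Theta> ` fixed" if "u \<in> \<Theta> ` fixed" "v \<in> \<Theta> ` fixed" for u v
  using sub that by (simp only: submodule_def)
 have sm: "c \<odot>\<^sub>T u \<in> \<Theta> ` fixed" if "c \<in> carrier K" "u \<in> \<Theta> ` fixed" for u c
  using sub that by (simp only: submodule_def)
 show "carrier T \<subseteq> \<Theta> ` fixed"
 proof
  fix u assume "u \<in> carrier T"
  then obtain f where f: "f \<in> carrier F" "u = null +>\<^sub>F f" unfolding T_eq by (rule C.quotient_carrierE)
  have "null +>\<^sub>F f \<in> \<Theta> ` fixed" using f(1)
  proof (induct rule: ring.free_module_induct[OF ring_K, consumes 1, case_names zero step])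
   case zero
   have "\<zero>\<^sub>T \<in> \<Theta> ` fixed" using sub by (simp only: submodule_def)
   then show ?case using C.quotient_zero by (simp add: T_eq)
  next
   case (step f s a)
   obtain p m where s: "s = (p, m)" "p \<in> carrier P" "m \<in> carrier M" using step(2) by blast
   have "pt p m \<in> \<Theta> ` fixed" using Theta_theta[OF s(2,3)] theta_fixed[OF s(2,3)] by (metis imageI)
   then have "(null +>\<^sub>F f) \<oplus>\<^sub>T a \<odot>\<^sub>T pt p m \<in> \<Theta> ` fixed" by (intro add sm step)
   moreover have "(null +>\<^sub>F f) \<oplus>\<^sub>T a \<odot>\<^sub>T pt p m = null +>\<^sub>F (f \<oplus>\<^sub>F a \<odot>\<^sub>F e s)"
    unfolding pt_eq T_eq s(1) C.quotient_smult[OF step(3) e_closed[OF s(2,3)]]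
    by (rule C.quotient_add[OF step(1) F.smult_closed[OF step(3) e_closed[OF s(2,3)]]])
   ultimately show ?case by simp
  qed
  then show "u \<in> \<Theta> ` fixed" using f(2) by simp
 qed
qed

text \<open>The grading of the tensor product is defined by spans of homogeneous pure tensors. These
  are images of vectors \<open>\<theta> p m\<close> of the right degree, and conversely each summand
  of \<open>\<Theta> m\<close> is such a tensor.\<close>

lemma tensor_component: "component (tensor K A (twist \<psi> P) M) j = \<Theta> ` fixed_component j"
proof -
 let ?G = "{pt p m |p m i. p \<in> component P i \<and> m \<in> component M (j - i)}"
 have c: "component (tensor K A (twist \<psi> P) M) j = T.span ?G"
  by (simp add: tensor_def module.extend_def)
 have G: "?G \<subseteq> \<Theta> ` fixed_component j"
 proof
  fix u assume "u \<in> ?G"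
  then obtain p m i where pm: "p \<in> component P i" "m \<in> component M (j - i)" "u = pt p m" by blast
  have "u = \<Theta> (\<theta> p m)"
   using Theta_theta[OF P.M.component_closed[OF pm(1)] M.M.component_closed[OF pm(2)]] pm(3) by simp
  then show "u \<in> \<Theta> ` fixed_component j" using theta_component[OF pm(1,2)] by blast
 qed
 have Gc: "?G \<subseteq> carrier T" using pt_closed P.M.component_closed M.M.component_closed by blast
 have "T.span ?G \<subseteq> \<Theta> ` fixed_component j"
  by (rule T.span_is_subset[OF G Theta_image_submodule[OF fixed_component_submodule]])
 moreover have "\<Theta> ` fixed_component j \<subseteq> T.span ?G"
 proof
  fix u assume "u \<in> \<Theta> ` fixed_component j"
  then obtain m where m: "m \<in> fixed_component j" "u = \<Theta> m" by blast
  show "u \<in> T.span ?G" unfolding m(2) \<Theta>_def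
  proof (rule T.submodule_finsum[OF T.span_is_submodule[OF Gc]])
   fix s assume s: "s \<in> S"
   have "pt (x s) (m s) \<in> ?G" using d(2)[OF s] m(1) s unfolding fixed_component_def by blast
   then show "pt (x s) (m s) \<in> T.span ?G" using T.in_own_span[OF Gc] by blast
  qed
 qed
 ultimately show ?thesis using c by simp
qed

end

section \<open>Graded dimensions of tensor products\<close>

lemma module_record_update [simp]:
 "carrier (V\<lparr>carrier := C\<rparr>) = C" "add (V\<lparr>carrier := C\<rparr>) = add V" "\<zero>\<^bsub>V\<lparr>carrier := C\<rparr>\<^esub> = \<zero>\<^sub>V"
 "smult (V\<lparr>carrier := C\<rparr>) = smult V" for V :: "('k, 'v, 'z) module_scheme"
 by simp_all

context tensor_setup
begin

abbreviation "Ten \<equiv> tensor K A (twist \<psi> P) M"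

lemma tensor_sel:
 "carrier Ten = carrier T" "add Ten = add T" "\<zero>\<^bsub>Ten\<^esub> = \<zero>\<^sub>T" "smult Ten = smult T"
 by (simp_all add: tensor_def module.extend_def)

lemma tensor_vectorspace: "vectorspace K Ten"
 by (rule vectorspace_cong_struct[OF _ _ _ _ T.vectorspace_axioms]) (simp_all add: tensor_sel)

lemma Theta_inj_on: "inj_on \<Theta> fixed"
proof (rule inj_onI)
 fix f g assume fg: "f \<in> fixed" "g \<in> fixed" "\<Theta> f = \<Theta> g"
 have c: "f \<in> carrier W" "g \<in> carrier W" using fg(1,2) by (auto simp only: fixed_def)
 have "\<Theta> (f \<ominus>\<^sub>W g) = \<zero>\<^sub>T"
  using Theta.f_minus[OF c] fg(3) T.M.minus_zero_iff[of "\<Theta> g" "\<Theta> g"] Theta.f_im[OF c(2)] by simp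
 moreover have "f \<ominus>\<^sub>W g \<in> fixed"
 proof -
  have "\<ominus>\<^sub>W g \<in> fixed"
   using W.left_submodule_if_submodule[OF fixed_submodule] subgroup.m_inv_closed[of fixed "add_monoid W" g] fg(2)
   by (simp add: left_submodule_def a_inv_def)
  then show ?thesis using fixed_submodule fg(1) unfolding submodule_def by (simp only: a_minus_def)
 qed
 ultimately have "f \<ominus>\<^sub>W g = \<zero>\<^sub>W" by (intro Theta_injective)
 then show "f = g" using W.M.minus_zero_iff[OF c] by blast
qed

lemma W_fin_dim:
 assumes "vectorspace.fin_dim K (underlying_space A M)"
 shows "W.fin_dim"
 by (rule M.KM.power_space_fin_dim[OF d(1) assms])

lemma tensor_fin_dim:
 assumes fd: "vectorspace.fin_dim K (underlying_space A M)"
 shows "vectorspace.fin_dim K Ten"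
proof -
 have "linear_map K (W\<lparr>carrier := fixed\<rparr>) Ten \<Theta>"
 proof (rule linear_mapI[OF W.submodule_vectorspace[OF fixed_submodule] tensor_vectorspace])
  have fW: "m \<in> carrier W" if "m \<in> carrier (W\<lparr>carrier := fixed\<rparr>)" for m using that by (simp add: fixed_def)
  show "\<Theta> m \<in> carrier Ten" if "m \<in> carrier (W\<lparr>carrier := fixed\<rparr>)" for m
   unfolding tensor_sel by (rule Theta.f_im[OF fW[OF that]])
  show "\<Theta> (m \<oplus>\<^bsub>W\<lparr>carrier := fixed\<rparr>\<^esub> m') = \<Theta> m \<oplus>\<^bsub>Ten\<^esub> \<Theta> m'"
   if "m \<in> carrier (W\<lparr>carrier := fixed\<rparr>)" "m' \<in> carrier (W\<lparr>carrier := fixed\<rparr>)" for m m'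
   unfolding tensor_sel module_record_update by (rule Theta.f_add[OF fW[OF that(1)] fW[OF that(2)]])
  show "\<Theta> (c \<odot>\<^bsub>W\<lparr>carrier := fixed\<rparr>\<^esub> m) = c \<odot>\<^bsub>Ten\<^esub> \<Theta> m"
   if "c \<in> carrier K" "m \<in> carrier (W\<lparr>carrier := fixed\<rparr>)" for c m
   unfolding tensor_sel module_record_update by (rule Theta.f_smult[OF that(1) fW[OF that(2)]])
 qed
 then interpret L: linear_map K "W\<lparr>carrier := fixed\<rparr>" Ten \<Theta> .
 show ?thesis
  by (rule L.surj_fin_dim[OF W.subspace_fin_dim(1)[OF W_fin_dim[OF fd] fixed_submodule]])
   (simp add: tensor_sel Theta_surjective)
qed

lemma tensor_dim:
 assumes fd: "vectorspace.fin_dim K (underlying_space A M)"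
 shows "vectorspace.dim K (Ten\<lparr>carrier := component Ten j\<rparr>) = vectorspace.dim K (W\<lparr>carrier := fixed_component j\<rparr>)"
proof -
 let ?U = "W\<lparr>carrier := fixed_component j\<rparr>"
 let ?V = "Ten\<lparr>carrier := component Ten j\<rparr>"
 have sub: "submodule K (component Ten j) Ten"
 proof -
  have "submodule K (component Ten j) T"
   unfolding tensor_component by (rule Theta_image_submodule[OF fixed_component_submodule])
  then show ?thesis
   using tensor_vectorspace by (simp add: submodule_def tensor_sel vectorspace_def)
 qed
 have V: "vectorspace K ?V" by (rule vectorspace.submodule_vectorspace[OF tensor_vectorspace sub])
 have fc: "fixed_component j \<subseteq> fixed" "fixed_component j \<subseteq> carrier W"
  by (auto simp only: fixed_component_def fixed_def)
 have "linear_map K ?U ?V \<Theta>"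
 proof (rule linear_mapI[OF W.submodule_vectorspace[OF fixed_component_submodule] V])
  have fW: "m \<in> carrier W" if "m \<in> carrier ?U" for m using that fc by auto
  show "\<Theta> m \<in> carrier ?V" if "m \<in> carrier ?U" for m
   using that by (simp add: tensor_component)
  show "\<Theta> (m \<oplus>\<^bsub>?U\<^esub> m') = \<Theta> m \<oplus>\<^bsub>?V\<^esub> \<Theta> m'" if "m \<in> carrier ?U" "m' \<in> carrier ?U" for m m'
   using Theta.f_add[OF fW[OF that(1)] fW[OF that(2)]] by (simp add: tensor_sel)
  show "\<Theta> (c \<odot>\<^bsub>?U\<^esub> m) = c \<odot>\<^bsub>?V\<^esub> \<Theta> m" if "c \<in> carrier K" "m \<in> carrier ?U" for c m
   using Theta.f_smult[OF that(1) fW[OF that(2)]] by (simp add: tensor_sel)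
 qed
 then interpret L: linear_map K ?U ?V \<Theta> .
 have "inj_on \<Theta> (carrier ?U)" using Theta_inj_on fc(1) inj_on_subset by auto
 then show ?thesis
  using L.dim_eq[OF W.subspace_fin_dim(1)[OF W_fin_dim[OF fd] fixed_component_submodule]]
  by (simp add: tensor_component)
qed

end

text \<open>The elements supported in the degrees that occur in a finite spanning set form a
  subspace, and it contains that set.\<close>

lemma (in graded_mod) finite_degrees:
 assumes fd: "vectorspace.fin_dim K (underlying_space A M)"
 shows "finite {j. component M j ~= {\<zero>\<^sub>M}}"
proof -
 obtain G where G: "finite G" "G \<subseteq> carrier M" "KM.span G = carrier M"
  using fd by (auto simp: KM.fin_dim_def)
 let ?J = "\<Union>g\<in>G. {j. hcomp M g j ~= \<zero>\<^sub>M}"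
 have fin: "finite ?J" using G M.hcomp_finite by auto
 let ?U = "{m \<in> carrier M. \<forall>j. j \<notin> ?J --> hcomp M m j = \<zero>\<^sub>M}"
 have "submodule K ?U (underlying_space A M)"
 proof (rule KM.submoduleI')
  fix c m assume c: "c \<in> carrier K" and m: "m \<in> ?U"
  have "hcomp M (scalar c \<odot>\<^sub>M m) j = scalar c \<odot>\<^sub>M hcomp M m j" for j
   using hcomp_smult_l[OF scalar_component[OF c], of m j] m by simp
  then show "c \<odot>\<^bsub>underlying_space A M\<^esub> m \<in> ?U"
   using m M.smult_closed[OF scalar_closed[OF c]] M.smult_zero_r[OF scalar_closed[OF c]]
   by (simp add: scalar_def[symmetric])
 qed (auto simp: M.hcomp_zero M.hcomp_add)
 moreover have "G \<subseteq> ?U" using G(2) by blast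
 ultimately have "KM.span G \<subseteq> ?U" by (intro KM.span_is_subset)
 then have sub: "carrier M \<subseteq> ?U" by (simp only: G(3))
 have "component M j = {\<zero>\<^sub>M}" if "j \<notin> ?J" for j
 proof -
  have "x = \<zero>\<^sub>M" if x: "x \<in> component M j" for x
  proof -
   have "hcomp M x j = \<zero>\<^sub>M" using subsetD[OF sub M.component_closed[OF x]] \<open>j \<notin> ?J\<close> by blast
   then show ?thesis using M.hcomp_homogeneous[OF x, of j] by simp
  qed
  then show ?thesis using M.component_zero by blast
 qed
 then have "{j. component M j ~= {\<zero>\<^sub>M}} \<subseteq> ?J" by blast
 then show ?thesis using fin finite_subset by blast
qed

context tensor_setup
begin

lemma fixed_component_zero:
 assumes "!!s. s \<in> S ==> component M (j - k s) = {\<zero>\<^sub>M}"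
 shows "fixed_component j = {\<zero>\<^sub>W}"
proof
 show "fixed_component j \<subseteq> {\<zero>\<^sub>W}"
 proof
  fix m assume m: "m \<in> fixed_component j"
  have "m s = \<zero>\<^sub>M" for s
   using m assms[of s] by (cases "s \<in> S") (auto simp: fixed_component_def fixed_def)
  then show "m \<in> {\<zero>\<^sub>W}" by auto
 qed
 show "{\<zero>\<^sub>W} \<subseteq> fixed_component j" using fixed_component_submodule by (simp only: submodule_def) blast
qed

lemma dim_fixed_component_zero:
 assumes "fixed_component j = {\<zero>\<^sub>W}"
 shows "vectorspace.dim K (W\<lparr>carrier := fixed_component j\<rparr>) = 0"
 using vectorspace.fin_dim_if_zero[OF W.submodule_vectorspace[OF fixed_component_submodule[of j]]] assms by simp

text \<open>\<open>gdim\<close> goes through \<open>Abs_poly_mapping\<close>, so its coefficients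
  are meaningful only after finite support is known; here that follows from the finitely many
  degrees of \<open>M\<close>, moved by the finitely many \<open>k s\<close>.\<close>

lemma lookup_gdim:
 assumes fd: "vectorspace.fin_dim K (underlying_space A M)"
 shows "Poly_Mapping.lookup (gdim K Ten) j = int (vectorspace.dim K (W\<lparr>carrier := fixed_component j\<rparr>))"
proof -
 let ?f = "%j. int (vectorspace.dim K (Ten\<lparr>carrier := component Ten j\<rparr>))"
 have "{j. ?f j ~= 0} \<subseteq> (\<Union>s\<in>S. (%i. i + k s) ` {i. component M i ~= {\<zero>\<^sub>M}})"
 proof
  fix j assume j: "j \<in> {j. ?f j ~= 0}"
  show "j \<in> (\<Union>s\<in>S. (%i. i + k s) ` {i. component M i ~= {\<zero>\<^sub>M}})"
  proof (rule ccontr)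
   assume n: "j \<notin> (\<Union>s\<in>S. (%i. i + k s) ` {i. component M i ~= {\<zero>\<^sub>M}})"
   have "component M (j - k s) = {\<zero>\<^sub>M}" if s: "s \<in> S" for s
   proof (rule ccontr)
    assume "component M (j - k s) ~= {\<zero>\<^sub>M}"
    then have "j \<in> (%i. i + k s) ` {i. component M i ~= {\<zero>\<^sub>M}}"
     by (intro image_eqI[of _ _ "j - k s"]) auto
    then show False using n s by blast
   qed
   then have "?f j = 0"
    unfolding tensor_dim[OF fd] by (simp add: dim_fixed_component_zero[OF fixed_component_zero])
   then show False using j by simp
  qed
 qed
 then have "finite {j. ?f j ~= 0}"
  by (rule finite_subset) (intro finite_UN_I finite_imageI d(1) M.finite_degrees[OF fd])
 then have "Poly_Mapping.lookup (gdim K Ten) j = ?f j"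
  unfolding gdim_def by (simp add: Abs_poly_mapping_inverse)
 then show ?thesis by (simp only: tensor_dim[OF fd])
qed

text \<open>The map induced on coordinates by \<open>h\<close> on the first tensor factor, as a
  matrix that reads \<open>h\<close> on the generators only. The identity yields the idempotent
  defining \<open>fixed\<close>.\<close>

definition endo :: "('p => 'p) => ('i => 'm) => 'i => 'm" where
 "endo h m = (%t. if t \<in> S then (\<Oplus>\<^sub>M s\<in>S. \<phi> (\<xi> t (h (x s))) \<odot>\<^sub>M m s) else \<zero>\<^sub>M)"

lemma fixed_endo: "fixed = {m \<in> carrier W. endo (%p. p) m = m}"
 by (auto simp: fixed_def endo_def fun_eq_iff)

lemma endo_theta_sum:
 assumes h: "h \<in> carrier P \<rightarrow> carrier P" and m: "m \<in> carrier W"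
 shows "endo h m = (\<Oplus>\<^sub>W s\<in>S. \<theta> (h (x s)) (m s))"
proof
 fix t
 have tc: "\<theta> (h (x s)) (m s) \<in> carrier W" if "s \<in> S" for s by (rule theta_closed[OF funcset_mem[OF h xc[OF that]] W_closed[OF m]])
 have "(\<Oplus>\<^sub>W s\<in>S. \<theta> (h (x s)) (m s)) t = (\<Oplus>\<^bsub>underlying_space A M\<^esub>s\<in>S. \<theta> (h (x s)) (m s) t)"
  by (rule M.KM.power_space_finsum[OF tc])
 also have "\<dots> = (\<Oplus>\<^sub>M s\<in>S. \<theta> (h (x s)) (m s) t)" by (rule finsum_cong_struct) auto
 also have "\<dots> = endo h m t"
 proof (cases "t \<in> S")
  case True
  then show ?thesis by (simp add: endo_def \<theta>_def)
 next
  case False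
  then have "(\<Oplus>\<^sub>M s\<in>S. \<theta> (h (x s)) (m s) t) = (\<Oplus>\<^sub>M s\<in>S. \<zero>\<^sub>M)"
   by (intro M.M.M.finsum_cong') (auto simp: \<theta>_def)
  then show ?thesis using False by (simp add: endo_def)
 qed
 finally show "endo h m t = (\<Oplus>\<^sub>W s\<in>S. \<theta> (h (x s)) (m s)) t" by simp
qed

lemma endo_closed:
 assumes h: "h \<in> carrier P \<rightarrow> carrier P" and m: "m \<in> carrier W"
 shows "endo h m \<in> carrier W"
 unfolding endo_theta_sum[OF assms]
 by (intro W.M.finsum_closed funcsetI) (rule theta_closed[OF funcset_mem[OF h xc] W_closed[OF m]])

lemma endo_component:
 assumes h: "!!p i. p \<in> component P i ==> h p \<in> component P i" and hc: "h \<in> carrier P \<rightarrow> carrier P"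
  and m: "m \<in> carrier W" "!!s. s \<in> S ==> m s \<in> component M (j - k s)"
 shows "endo h m \<in> fixed_component j"
 unfolding endo_theta_sum[OF hc m(1)]
proof (rule W.submodule_finsum[OF fixed_component_submodule])
 fix s assume s: "s \<in> S"
 show "\<theta> (h (x s)) (m s) \<in> fixed_component j" by (rule theta_component[OF h[OF d(2)[OF s]] m(2)[OF s]])
qed

lemma endo_add:
 assumes h: "h \<in> carrier P \<rightarrow> carrier P" and m: "m \<in> carrier W" "m' \<in> carrier W"
 shows "endo h (m \<oplus>\<^sub>W m') = endo h m \<oplus>\<^sub>W endo h m'"
proof -
 have "endo h (m \<oplus>\<^sub>W m') = (\<Oplus>\<^sub>W s\<in>S. \<theta> (h (x s)) (m s) \<oplus>\<^sub>W \<theta> (h (x s)) (m' s))"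
  unfolding endo_theta_sum[OF h W.M.a_closed[OF m]]
 proof (rule W.M.finsum_cong')
  fix s assume s: "s \<in> S"
  show "\<theta> (h (x s)) ((m \<oplus>\<^sub>W m') s) = \<theta> (h (x s)) (m s) \<oplus>\<^sub>W \<theta> (h (x s)) (m' s)"
   using theta_add_r[OF funcset_mem[OF h xc[OF s]] W_closed[OF m(1)] W_closed[OF m(2)]] by simp
 qed (intro refl funcsetI W.M.a_closed theta_closed funcset_mem[OF h] xc W_closed m | assumption)+
 also have "\<dots> = endo h m \<oplus>\<^sub>W endo h m'"
  unfolding endo_theta_sum[OF h m(1)] endo_theta_sum[OF h m(2)]
  by (rule W.M.finsum_addf) (intro funcsetI theta_closed funcset_mem[OF h] xc W_closed m, assumption)+
 finally show ?thesis .
qed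

lemma endo_theta:
 assumes h: "h \<in> graded_hom A P P" and p: "p \<in> carrier P" and m: "m \<in> carrier M"
 shows "endo h (\<theta> p m) = \<theta> (h p) m"
proof
 fix t
 note hh = graded_homD[OF h]
 interpret h: graded_map K A P P h by (rule graded_mapI[OF graded_alg_axioms P P h])
 show "endo h (\<theta> p m) t = \<theta> (h p) m t"
 proof (cases "t \<in> S")
  case t: True
  have xp: "\<xi> s p \<odot>\<^sub>P x s \<in> carrier P" if "s \<in> S" for s by (rule P.M.smult_closed[OF d(3)[OF that p] xc[OF that]])
  have "endo h (\<theta> p m) t = (\<Oplus>\<^sub>M s\<in>S. \<phi> (\<xi> t (h (\<xi> s p \<odot>\<^sub>P x s))) \<odot>\<^sub>M m)"
   unfolding endo_def if_P[OF t]
  proof (rule M.M.M.finsum_cong')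
   fix s assume s: "s \<in> S"
   note hx = hh(1)[OF xc[OF s]]
   have "\<phi> (\<xi> t (h (\<xi> s p \<odot>\<^sub>P x s))) = \<phi> (\<xi> t (h (x s))) \<otimes> \<phi> (\<xi> s p)"
    unfolding hh(3)[OF d(3)[OF s p] xc[OF s]] d(5)[OF t d(3)[OF s p] hx] by (rule phi_mult[OF d(3)[OF s p] d(3)[OF t hx]])
   then show "\<phi> (\<xi> t (h (x s))) \<odot>\<^sub>M \<theta> p m s = \<phi> (\<xi> t (h (\<xi> s p \<odot>\<^sub>P x s))) \<odot>\<^sub>M m"
    using M.M.smult_assoc[OF \<phi>\<xi>[OF t hx] \<phi>\<xi>[OF s p] m] s by (simp add: \<theta>_def)
  qed (use \<phi>\<xi>[OF t hh(1)[OF xp]] m in \<open>auto intro!: M.M.smult_closed\<close>)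
  also have "\<dots> = (\<Oplus>s\<in>S. \<phi> (\<xi> t (h (\<xi> s p \<odot>\<^sub>P x s)))) \<odot>\<^sub>M m"
   by (rule M.M.smult_finsum_l[symmetric, OF m]) (rule \<phi>\<xi>[OF t hh(1)[OF xp]])
  also have "(\<Oplus>s\<in>S. \<phi> (\<xi> t (h (\<xi> s p \<odot>\<^sub>P x s)))) = \<phi> (\<xi> t (h (\<Oplus>\<^sub>P s\<in>S. \<xi> s p \<odot>\<^sub>P x s)))"
   by (rule additive_finsum[OF P.M.M.abelian_group_axioms abelian_group_axioms, of "%y. \<phi> (\<xi> t (h y))", symmetric])
    (use \<phi>\<xi>[OF t] d(4)[OF t] d(3)[OF t] phi_add hh xp in auto)
  finally show ?thesis using t by (simp add: \<theta>_def d(7)[OF p])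
 qed (simp add: endo_def \<theta>_def)
qed

text \<open>\<open>endo h' m\<close> is a sum of vectors \<open>\<theta> (h' (x s)) (m s)\<close>,
  on which \<open>endo h\<close> acts by applying \<open>h\<close> to the first argument. So only
  the outer map must be a homomorphism.\<close>

lemma endo_endo:
 assumes h: "h \<in> graded_hom A P P" and h': "h' \<in> carrier P \<rightarrow> carrier P" and m: "m \<in> carrier W"
 shows "endo h (endo h' m) = endo (%p. h (h' p)) m"
proof -
 have hc: "h \<in> carrier P \<rightarrow> carrier P" using graded_homD(1)[OF h] by blast
 have hh': "(%p. h (h' p)) \<in> carrier P \<rightarrow> carrier P" using hc h' by blast
 have "endo h (endo h' m) = (\<Oplus>\<^sub>W s\<in>S. endo h (\<theta> (h' (x s)) (m s)))"
  unfolding endo_theta_sum[OF h' m]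
 proof (rule additive_finsum[OF W.M.abelian_group_axioms W.M.abelian_group_axioms, of "endo h"])
  show "endo h \<in> carrier W \<rightarrow> carrier W" by (rule funcsetI) (rule endo_closed[OF hc])
  show "endo h (f \<oplus>\<^sub>W g) = endo h f \<oplus>\<^sub>W endo h g" if "f \<in> carrier W" "g \<in> carrier W" for f g
   by (rule endo_add[OF hc that])
  show "\<theta> (h' (x s)) (m s) \<in> carrier W" if "s \<in> S" for s
   by (rule theta_closed[OF funcset_mem[OF h' xc[OF that]] W_closed[OF m]])
 qed
 also have "\<dots> = (\<Oplus>\<^sub>W s\<in>S. \<theta> (h (h' (x s))) (m s))"
 proof (rule W.M.finsum_cong')
  fix s assume s: "s \<in> S"
  show "endo h (\<theta> (h' (x s)) (m s)) = \<theta> (h (h' (x s))) (m s)"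
   by (rule endo_theta[OF h funcset_mem[OF h' xc[OF s]] W_closed[OF m]])
 qed (use theta_closed[OF funcset_mem[OF hh' xc] W_closed[OF m]] in \<open>auto simp del: power_space_sel\<close>)
 also have "\<dots> = endo (%p. h (h' p)) m"
  by (rule endo_theta_sum[OF hh' m, symmetric])
 finally show ?thesis .
qed

lemma endo_sum:
 assumes h: "h \<in> carrier P \<rightarrow> carrier P" and h': "h' \<in> carrier P \<rightarrow> carrier P" and m: "m \<in> carrier W"
 shows "endo (%p. h p \<oplus>\<^sub>P h' p) m = endo h m \<oplus>\<^sub>W endo h' m"
proof -
 have hh: "(%p. h p \<oplus>\<^sub>P h' p) \<in> carrier P \<rightarrow> carrier P" using h h' P.M.M.a_closed by blast
 have "endo (%p. h p \<oplus>\<^sub>P h' p) m = (\<Oplus>\<^sub>W s\<in>S. \<theta> (h (x s)) (m s) \<oplus>\<^sub>W \<theta> (h' (x s)) (m s))"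
  unfolding endo_theta_sum[OF hh m]
 proof (rule W.M.finsum_cong')
  fix s assume s: "s \<in> S"
  show "\<theta> (h (x s) \<oplus>\<^sub>P h' (x s)) (m s) = \<theta> (h (x s)) (m s) \<oplus>\<^sub>W \<theta> (h' (x s)) (m s)"
   by (rule theta_add_l[OF funcset_mem[OF h xc[OF s]] funcset_mem[OF h' xc[OF s]] W_closed[OF m]])
 qed (intro refl funcsetI W.M.a_closed theta_closed funcset_mem[OF h] funcset_mem[OF h'] xc W_closed m | assumption)+
 also have "\<dots> = endo h m \<oplus>\<^sub>W endo h' m"
  unfolding endo_theta_sum[OF h m] endo_theta_sum[OF h' m]
  by (rule W.M.finsum_addf) (intro funcsetI theta_closed funcset_mem[OF h] funcset_mem[OF h'] xc W_closed m, assumption)+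
 finally show ?thesis .
qed

end

context tensor_setup
begin

lemma endo_smult:
 assumes h: "h \<in> carrier P \<rightarrow> carrier P" and c: "c \<in> carrier K" and m: "m \<in> carrier W"
 shows "endo h (c \<odot>\<^sub>W m) = c \<odot>\<^sub>W endo h m"
proof -
 have tc: "\<theta> (h (x s)) (m s) \<in> carrier W" if "s \<in> S" for s
  by (rule theta_closed[OF funcset_mem[OF h xc[OF that]] W_closed[OF m]])
 have "endo h (c \<odot>\<^sub>W m) = (\<Oplus>\<^sub>W s\<in>S. c \<odot>\<^sub>W \<theta> (h (x s)) (m s))"
  unfolding endo_theta_sum[OF h W.smult_closed[OF c m]]
 proof (rule W.M.finsum_cong')
  fix s assume s: "s \<in> S"
  show "\<theta> (h (x s)) ((c \<odot>\<^sub>W m) s) = c \<odot>\<^sub>W \<theta> (h (x s)) (m s)"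
   using theta_scalar[OF c funcset_mem[OF h xc[OF s]] W_closed[OF m]] s by (simp add: scalar_def)
 qed (intro refl funcsetI W.smult_closed c tc | assumption)+
 also have "\<dots> = c \<odot>\<^sub>W endo h m"
  unfolding endo_theta_sum[OF h m] by (rule left_module.smult_finsum_r[OF W_left_module c, symmetric]) (rule tc)
 finally show ?thesis .
qed

lemma endo_cong:
 assumes hh': "!!p. p \<in> carrier P ==> h p = h' p" and h': "h' \<in> carrier P \<rightarrow> carrier P" and m: "m \<in> carrier W"
 shows "endo h m = endo h' m"
proof -
 have h: "h \<in> carrier P \<rightarrow> carrier P" using hh' h' by auto
 show ?thesis
  unfolding endo_theta_sum[OF h m] endo_theta_sum[OF h' m]
 proof (rule W.M.finsum_cong')
  show "\<theta> (h (x s)) (m s) = \<theta> (h' (x s)) (m s)" if "s \<in> S" for s by (simp only: hh'[OF xc[OF that]])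
  show "(%s. \<theta> (h' (x s)) (m s)) \<in> S \<rightarrow> carrier W"
   by (intro funcsetI theta_closed funcset_mem[OF h'] xc W_closed m)
 qed simp
qed

lemma endo_zero: "m \<in> carrier W ==> endo (%_. \<zero>\<^sub>P) m = \<zero>\<^sub>W"
proof -
 assume m: "m \<in> carrier W"
 have h: "(%_. \<zero>\<^sub>P) \<in> carrier P \<rightarrow> carrier P" by simp
 have "endo (%_. \<zero>\<^sub>P) m = endo (%_. \<zero>\<^sub>P) m \<oplus>\<^sub>W endo (%_. \<zero>\<^sub>P) m"
  using endo_sum[OF h h m] by simp
 then show ?thesis using W.M.add.l_cancel_one[OF endo_closed[OF h m] endo_closed[OF h m]] by metis
qed

lemma fixed_componentD:
 assumes "m \<in> fixed_component j"
 shows "m \<in> carrier W" "endo (%p. p) m = m" "!!s. s \<in> S ==> m s \<in> component M (j - k s)"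
 using assms by (auto simp: fixed_component_def fixed_endo simp del: power_space_sel)

lemma fixed_componentI:
 assumes "m \<in> carrier W" "endo (%p. p) m = m" "!!s. s \<in> S ==> m s \<in> component M (j - k s)"
 shows "m \<in> fixed_component j"
 using assms by (auto simp: fixed_component_def fixed_endo simp del: power_space_sel)

end

lemma lookup_monomial_times:
 fixes p :: laurent
 shows "Poly_Mapping.lookup (Poly_Mapping.single n 1 * p) j = Poly_Mapping.lookup p (j - n)"
proof -
 have "Poly_Mapping.keys p \<subseteq> UNIV" by simp
 then show ?thesis
 proof (induct p rule: frag_induction)
  case (one k)
  have "(n + k = j) = (k = j - n)" by auto
  then show ?case by (simp add: mult_single lookup_single when_def)
 next
  case (diff a b)
  then show ?case by (simp add: right_diff_distrib lookup_minus)
 qed simp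
qed

lemma (in graded_alg) fmodD:
 assumes "M \<in> fmod K A"
 shows "graded_module A M" "vectorspace.fin_dim K (underlying_space A M)"
 using assms by (auto simp: fmod_def)

section \<open>Additivity of the pairing and its behaviour under shifts\<close>

context anti_alg
begin

definition pairing :: "('a, 'p) gmodule => ('a, 'm) gmodule => laurent" where
 "pairing P M = gdim K (tensor K A (twist \<psi> P) M)"

lemma tensor_setupI:
 "graded_module A P ==> graded_module A M ==> dual_basis A P S x k \<xi> ==> tensor_setup K A \<psi> P M S x k \<xi>"
 using anti_alg_axioms by (simp add: tensor_setup_def tensor_setup_axioms_def)

lemma pmod_graded: "P \<in> Defs.pmod A ==> graded_module A P"
 by (simp add: Defs.pmod_def)

text \<open>The sequence splits because \<open>P''\<close> is projective. One dual basis of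
  \<open>P\<close>, transferred to \<open>P'\<close> and \<open>P''\<close> by retraction, places
  all three tensor products in the same power of \<open>M\<close>, where the idempotent of
  \<open>P\<close> is the sum of two orthogonal ones.\<close>

lemma pairing_add_left:
 assumes P': "P' \<in> Defs.pmod A" and P: "P \<in> Defs.pmod A" and P'': "P'' \<in> Defs.pmod A"
  and M: "M \<in> fmod K A" and ex: "short_exact A P' P P''"
 shows "pairing P M = pairing P' M + pairing P'' M"
proof -
 obtain f g where f: "f \<in> graded_hom A P' P" and g: "g \<in> graded_hom A P P''" and inj: "inj_on f (carrier P')"
  and im: "f ` carrier P' = a_kernel P P'' g" and surj: "g ` carrier P = carrier P''"
  using ex unfolding short_exact_def by blast
 have ker: "f ` carrier P' = {p \<in> carrier P. g p = \<zero>\<^sub>P''}" using im by (simp add: a_kernel_def')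
 note gm' = pmod_graded[OF P'] and gm = pmod_graded[OF P] and gm'' = pmod_graded[OF P'']
 interpret P: graded_mod K A P by (rule graded_modI[OF gm])
 interpret P': graded_mod K A P' by (rule graded_modI[OF gm'])
 interpret P'': graded_mod K A P'' by (rule graded_modI[OF gm''])
 interpret f: graded_map K A P' P f by (rule graded_mapI[OF graded_alg_axioms gm' gm f])
 interpret g: graded_map K A P P'' g by (rule graded_mapI[OF graded_alg_axioms gm gm'' g])
 obtain S :: "((nat => 'a) \<times> int) set" and x k \<xi> where db: "dual_basis A P S x k \<xi>" using pmod_dual_basis[OF P] .
 obtain S2 :: "((nat => 'a) \<times> int) set" and x2 k2 \<xi>2 where db2: "dual_basis A P'' S2 x2 k2 \<xi>2"
  using pmod_dual_basis[OF P''] .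
 obtain \<sigma> where \<sigma>: "\<sigma> \<in> graded_hom A P'' P" "\<forall>y\<in>carrier P''. g (\<sigma> y) = y"
  using P.graded_surjection_splits[OF db2 gm'' g surj] .
 interpret s: graded_map K A P'' P \<sigma> by (rule graded_mapI[OF graded_alg_axioms gm'' gm \<sigma>(1)])
 define h'' where "h'' p = \<sigma> (g p)" for p
 have h'': "h'' \<in> graded_hom A P P" unfolding h''_def by (rule graded_hom_compose[OF g \<sigma>(1)])
 note hh'' = graded_homD[OF h'']
 \<comment> \<open>The complement of the projection \<open>h''\<close> onto the copy of
   \<open>P''\<close>; its values lie in the kernel of \<open>g\<close>, that is, in the image of
   \<open>f\<close>.\<close>
 define \<kappa> where "\<kappa> p = p \<ominus>\<^sub>P h'' p" for p
 have \<kappa>: "\<kappa> \<in> graded_hom A P P"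
 proof (rule graded_homI)
  show "\<kappa> (p \<oplus>\<^sub>P q) = \<kappa> p \<oplus>\<^sub>P \<kappa> q" if "p \<in> carrier P" "q \<in> carrier P" for p q
   using that hh'' by (simp add: \<kappa>_def P.M.M.add_minus_add)
  show "\<kappa> (a \<odot>\<^sub>P p) = a \<odot>\<^sub>P \<kappa> p" if "a \<in> carrier A" "p \<in> carrier P" for a p
   using that hh'' by (simp add: \<kappa>_def P.M.smult_minus_r)
 qed (use hh'' P.M.component_minus in \<open>auto simp: \<kappa>_def\<close>)
 note h\<kappa> = graded_homD[OF \<kappa>]
 have g\<kappa>: "g (\<kappa> p) = \<zero>\<^sub>P''" if p: "p \<in> carrier P" for p
  using p hh''(1)[OF p] \<sigma>(2) g.closed[OF p] P''.M.M.minus_zero_iff[of "g p" "g p"]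
  by (simp add: \<kappa>_def g.minus) (simp add: h''_def)
 have \<kappa>\<sigma>: "\<kappa> (h'' p) = \<zero>\<^sub>P" if p: "p \<in> carrier P" for p
  using \<sigma>(2) g.closed[OF p] s.closed[OF g.closed[OF p]] P.M.M.minus_zero_iff[of "\<sigma> (g p)" "\<sigma> (g p)"]
  by (simp add: \<kappa>_def h''_def)
 \<comment> \<open>The retraction of \<open>f\<close> attached to the splitting. Its linearity and
   its degree are checked after applying the injective \<open>f\<close>.\<close>
 define \<rho> where "\<rho> p = inv_into (carrier P') f (\<kappa> p)" for p
 have \<rho>: "\<rho> p \<in> carrier P'" "f (\<rho> p) = \<kappa> p" if "p \<in> carrier P" for p
 proof -
  have "\<kappa> p \<in> f ` carrier P'" unfolding ker using h\<kappa>(1)[OF that] g\<kappa>[OF that] by blast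
  then show "\<rho> p \<in> carrier P'" "f (\<rho> p) = \<kappa> p" unfolding \<rho>_def by (rule inv_into_into, rule f_inv_into_f)
 qed
 have fi: "y = z" if "y \<in> carrier P'" "z \<in> carrier P'" "f y = f z" for y z
  using inj that by (auto simp: inj_on_def)
 have \<rho>h: "\<rho> \<in> graded_hom A P P'"
 proof (rule graded_homI)
  show "\<rho> p \<in> carrier P'" if "p \<in> carrier P" for p by (rule \<rho>(1)[OF that])
  show "\<rho> (p \<oplus>\<^sub>P q) = \<rho> p \<oplus>\<^sub>P' \<rho> q" if "p \<in> carrier P" "q \<in> carrier P" for p q
   by (rule fi) (use that \<rho> f.add h\<kappa> in auto)
  show "\<rho> (a \<odot>\<^sub>P p) = a \<odot>\<^sub>P' \<rho> p" if "a \<in> carrier A" "p \<in> carrier P" for a p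
   by (rule fi) (use that \<rho> f.smult h\<kappa> P'.M.smult_closed P.M.smult_closed in auto)
  fix i p assume p: "p \<in> component P i"
  note pc = P.M.component_closed[OF p]
  have "f (hcomp P' (\<rho> p) i) = f (\<rho> p)"
   using f.hcomp[OF \<rho>(1)[OF pc], of i] \<rho>(2)[OF pc] P.M.hcomp_homogeneous[OF h\<kappa>(4)[OF p], of i] by simp
  then have "hcomp P' (\<rho> p) i = \<rho> p" by (rule fi[OF P'.M.hcomp_closed[OF \<rho>(1)[OF pc]] \<rho>(1)[OF pc]])
  then show "\<rho> p \<in> component P' i" using P'.M.hcomp_component[OF \<rho>(1)[OF pc], of i] by simp
 qed
 have \<rho>f: "\<rho> (f y) = y" if y: "y \<in> carrier P'" for y
 proof (rule fi[OF \<rho>(1)[OF f.closed[OF y]] y])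
  have "g (f y) = \<zero>\<^sub>P''" using ker y by blast
  then have "h'' (f y) = \<zero>\<^sub>P" by (simp add: h''_def s.zero)
  then show "f (\<rho> (f y)) = f y" using \<rho>(2)[OF f.closed[OF y]] f.closed[OF y] by (simp add: \<kappa>_def P.M.M.minus_zero_r)
 qed
 have db': "dual_basis A P' S (%s. \<rho> (x s)) k (%s y. \<xi> s (f y))"
  by (rule P.dual_basis_retract[OF db gm' f \<rho>h \<rho>f])
 have db'': "dual_basis A P'' S (%s. g (x s)) k (%s y. \<xi> s (\<sigma> y))"
  by (rule P.dual_basis_retract[OF db gm'' \<sigma>(1) g]) (use \<sigma>(2) in blast)
 note Mm = fmodD[OF M]
 interpret t: tensor_setup K A \<psi> P M S x k \<xi> by (rule tensor_setupI[OF gm Mm(1) db])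
 interpret t': tensor_setup K A \<psi> P' M S "%s. \<rho> (x s)" k "%s y. \<xi> s (f y)" by (rule tensor_setupI[OF gm' Mm(1) db'])
 interpret t'': tensor_setup K A \<psi> P'' M S "%s. g (x s)" k "%s y. \<xi> s (\<sigma> y)" by (rule tensor_setupI[OF gm'' Mm(1) db''])
 let ?W = "power_space S (underlying_space A M)"
 \<comment> \<open>The matrix for \<open>P'\<close> has the entries of \<open>endo \<kappa>\<close>,
   because \<open>f (\<rho> p) = \<kappa> p\<close>.\<close>
 have e': "t'.endo (%p. p) m = t.endo \<kappa> m" if m: "m \<in> carrier ?W" for m
 proof
  fix t
  have "(\<Oplus>\<^sub>M s\<in>S. \<phi> (\<xi> t (f (\<rho> (x s)))) \<odot>\<^sub>M m s) = (\<Oplus>\<^sub>M s\<in>S. \<phi> (\<xi> t (\<kappa> (x s))) \<odot>\<^sub>M m s)" if t: "t \<in> S"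
  proof (rule t.M.M.M.finsum_cong')
   show "\<phi> (\<xi> t (f (\<rho> (x s)))) \<odot>\<^sub>M m s = \<phi> (\<xi> t (\<kappa> (x s))) \<odot>\<^sub>M m s" if "s \<in> S" for s
    by (simp only: \<rho>(2)[OF t.xc[OF that]])
   show "(%s. \<phi> (\<xi> t (\<kappa> (x s))) \<odot>\<^sub>M m s) \<in> S \<rightarrow> carrier M"
    by (intro funcsetI t.M.M.smult_closed t.\<phi>\<xi>[OF t] h\<kappa>(1) t.xc t.W_closed[OF m])
  qed simp
  then show "t'.endo (%p. p) m t = t.endo \<kappa> m t" by (simp add: t'.endo_def t.endo_def)
 qed
 have e'': "t''.endo (%p. p) m = t.endo h'' m" for m
  unfolding t''.endo_def t.endo_def h''_def by simp
 have \<kappa>c: "\<kappa> \<in> carrier P \<rightarrow> carrier P" and hc: "h'' \<in> carrier P \<rightarrow> carrier P" using h\<kappa>(1) hh''(1) by auto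
 have sum: "t.endo (%p. p) m = t.endo \<kappa> m \<oplus>\<^bsub>?W\<^esub> t.endo h'' m" if m: "m \<in> carrier ?W" for m
 proof -
  have "t.endo (%p. p) m = t.endo (%p. \<kappa> p \<oplus>\<^sub>P h'' p) m"
   by (rule t.endo_cong[OF _ _ m]) (use h\<kappa>(1) hh''(1) in \<open>auto simp: \<kappa>_def P.M.M.minus_add_cancel\<close>)
  then show ?thesis using t.endo_sum[OF \<kappa>c hc m] by simp
 qed
 have z1: "t.endo \<kappa> (t.endo h'' m) = \<zero>\<^bsub>?W\<^esub>" if m: "m \<in> carrier ?W" for m
  unfolding t.endo_endo[OF \<kappa> hc m] t.endo_zero[OF m, symmetric] by (rule t.endo_cong[OF \<kappa>\<sigma> _ m]) simp_all
 have z2: "t.endo h'' (t.endo \<kappa> m) = \<zero>\<^bsub>?W\<^esub>" if m: "m \<in> carrier ?W" for m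
  unfolding t.endo_endo[OF h'' \<kappa>c m] t.endo_zero[OF m, symmetric]
  by (rule t.endo_cong[OF _ _ m]) (simp_all add: h''_def g\<kappa> s.zero)
 have idem: "t.endo h'' (t.endo h'' m) = t.endo h'' m" if m: "m \<in> carrier ?W" for m
  unfolding t.endo_endo[OF h'' hc m]
  by (rule t.endo_cong[OF _ hc m]) (use \<sigma>(2) g.closed in \<open>simp add: h''_def\<close>)
 \<comment> \<open>Fixed vectors for \<open>P'\<close> include into those for \<open>P\<close>, and
   \<open>endo h''\<close> maps the latter onto those for \<open>P''\<close>; orthogonality of the
   two idempotents gives exactness.\<close>
 have dims: "vectorspace.dim K (?W\<lparr>carrier := t.fixed_component j\<rparr>) =
   vectorspace.dim K (?W\<lparr>carrier := t'.fixed_component j\<rparr>) + vectorspace.dim K (?W\<lparr>carrier := t''.fixed_component j\<rparr>)" for j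
 proof (rule dim_exact[where f = "%m. m" and g = "t.endo h''"])
  note sm = t.fixed_component_submodule[of j] and sm' = t'.fixed_component_submodule[of j]
   and sm'' = t''.fixed_component_submodule[of j]
  have inc: "m \<in> t.fixed_component j" if m: "m \<in> t'.fixed_component j" for m
  proof (rule t.fixed_componentI)
   note mD = t'.fixed_componentD[OF m]
   show mW: "m \<in> carrier ?W" by (rule mD(1))
   have k: "t.endo \<kappa> m = m" using mD(2) e'[OF mW] by simp
   then have "t.endo h'' m = \<zero>\<^bsub>?W\<^esub>" using z2[OF mW] by simp
   then show "t.endo (%p. p) m = m" unfolding sum[OF mW] k using mW t.W.M.r_zero by metis
  qed (rule t'.fixed_componentD(3)[OF m])
  show "linear_map K (?W\<lparr>carrier := t'.fixed_component j\<rparr>) (?W\<lparr>carrier := t.fixed_component j\<rparr>) (%m. m)"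
   by (rule linear_mapI[OF t.W.submodule_vectorspace[OF sm'] t.W.submodule_vectorspace[OF sm]]) (use inc in simp_all)
  have tar: "t.endo h'' m \<in> t''.fixed_component j" if m: "m \<in> t.fixed_component j" for m
  proof (rule t''.fixed_componentI)
   note mD = t.fixed_componentD[OF m]
   show "t.endo h'' m \<in> carrier ?W" by (rule t.endo_closed[OF hc mD(1)])
   show "t''.endo (%p. p) (t.endo h'' m) = t.endo h'' m" unfolding e'' by (rule idem[OF mD(1)])
   show "t.endo h'' m s \<in> component M (j - k s)" if "s \<in> S" for s
    using t.fixed_componentD(3)[OF t.endo_component[OF hh''(4) hc mD(1,3)] that] by blast
  qed
  show "linear_map K (?W\<lparr>carrier := t.fixed_component j\<rparr>) (?W\<lparr>carrier := t''.fixed_component j\<rparr>) (t.endo h'')"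
   by (rule linear_mapI[OF t.W.submodule_vectorspace[OF sm] t.W.submodule_vectorspace[OF sm'']])
    (use tar t.fixed_componentD(1)[of _ j] t.endo_add[OF hc] t.endo_smult[OF hc] in \<open>simp_all del: power_space_sel\<close>)
  show "inj_on (%m. m) (carrier (?W\<lparr>carrier := t'.fixed_component j\<rparr>))" by simp
  have "m \<in> t'.fixed_component j" if m: "m \<in> t.fixed_component j" and z: "t.endo h'' m = \<zero>\<^bsub>?W\<^esub>" for m
  proof (rule t'.fixed_componentI)
   note mD = t.fixed_componentD[OF m]
   show "m \<in> carrier ?W" by (rule mD(1))
   show "t'.endo (%p. p) m = m"
    unfolding e'[OF mD(1)] using sum[OF mD(1)] mD(2) z t.W.M.r_zero[OF t.endo_closed[OF \<kappa>c mD(1)]] by metis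
  qed (rule t.fixed_componentD(3)[OF m])
  moreover have "t.endo h'' m = \<zero>\<^bsub>?W\<^esub>" if m: "m \<in> t'.fixed_component j" for m
   using z2[OF t'.fixed_componentD(1)[OF m]] t'.fixed_componentD(2)[OF m] e'[OF t'.fixed_componentD(1)[OF m]] by simp
  ultimately show "(%m. m) ` carrier (?W\<lparr>carrier := t'.fixed_component j\<rparr>) =
   {m \<in> carrier (?W\<lparr>carrier := t.fixed_component j\<rparr>). t.endo h'' m = \<zero>\<^bsub>?W\<lparr>carrier := t''.fixed_component j\<rparr>\<^esub>}"
   using inc by (auto simp del: power_space_sel)
  have lift: "m \<in> t.fixed_component j \<and> t.endo h'' m = m" if m: "m \<in> t''.fixed_component j" for m
  proof
   note mD = t''.fixed_componentD[OF m]
   show hm: "t.endo h'' m = m" using mD(2) e'' by simp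
   show "m \<in> t.fixed_component j"
   proof (rule t.fixed_componentI)
    show mW: "m \<in> carrier ?W" by (rule mD(1))
    have "t.endo \<kappa> m = \<zero>\<^bsub>?W\<^esub>" using z1[OF mW] hm by simp
    then show "t.endo (%p. p) m = m" unfolding sum[OF mW] hm using t.W.M.l_zero[OF mW] by metis
   qed (rule mD(3))
  qed
  show "t.endo h'' ` carrier (?W\<lparr>carrier := t.fixed_component j\<rparr>) = carrier (?W\<lparr>carrier := t''.fixed_component j\<rparr>)"
  proof
   show "t.endo h'' ` carrier (?W\<lparr>carrier := t.fixed_component j\<rparr>) \<subseteq> carrier (?W\<lparr>carrier := t''.fixed_component j\<rparr>)"
    using tar by auto
   show "carrier (?W\<lparr>carrier := t''.fixed_component j\<rparr>) \<subseteq> t.endo h'' ` carrier (?W\<lparr>carrier := t.fixed_component j\<rparr>)"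
   proof
    fix m assume "m \<in> carrier (?W\<lparr>carrier := t''.fixed_component j\<rparr>)"
    then have "m \<in> t.fixed_component j" "m = t.endo h'' m" using lift[of m] by simp_all
    then show "m \<in> t.endo h'' ` carrier (?W\<lparr>carrier := t.fixed_component j\<rparr>)" by simp
   qed
  qed
  show "vectorspace.fin_dim K (?W\<lparr>carrier := t.fixed_component j\<rparr>)"
   by (rule t.W.subspace_fin_dim(1)[OF t.W_fin_dim[OF Mm(2)] sm])
 qed
 show ?thesis
  by (rule poly_mapping_eqI)
   (simp add: pairing_def lookup_add t.lookup_gdim[OF Mm(2)] t'.lookup_gdim[OF Mm(2)] t''.lookup_gdim[OF Mm(2)] dims)
qed

end

context anti_alg
begin

lemma pairing_shift_left:
 assumes P: "P \<in> Defs.pmod A" and M: "M \<in> fmod K A"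
 shows "pairing (shift n P) M = Poly_Mapping.single n 1 * pairing P M"
proof -
 note Pg = pmod_graded[OF P] and Mm = fmodD[OF M]
 interpret P: graded_mod K A P by (rule graded_modI[OF Pg])
 obtain S :: "((nat => 'a) \<times> int) set" and x k \<xi> where db: "dual_basis A P S x k \<xi>" using pmod_dual_basis[OF P] .
 interpret t: tensor_setup K A \<psi> P M S x k \<xi> by (rule tensor_setupI[OF Pg Mm(1) db])
 interpret t': tensor_setup K A \<psi> "shift n P" M S x "%s. k s + n" \<xi>
  by (rule tensor_setupI[OF P.shift_graded_module Mm(1) P.dual_basis_shift[OF db]])
 have "j - (k s + n) = j - n - k s" for j s by simp
 then have fc: "t'.fixed_component j = t.fixed_component (j - n)" for j
  unfolding t.fixed_component_def t'.fixed_component_def t.fixed_def t'.fixed_def by (simp only:)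
 show ?thesis
  by (rule poly_mapping_eqI)
   (simp only: pairing_def lookup_monomial_times t.lookup_gdim[OF Mm(2)] t'.lookup_gdim[OF Mm(2)] fc)
qed

lemma shift_fmod: "M \<in> fmod K A ==> shift n M \<in> fmod K A"
proof -
 assume M: "M \<in> fmod K A"
 interpret M: graded_mod K A M by (rule graded_modI[OF fmodD(1)[OF M]])
 have "underlying_space A (shift n M) = underlying_space A M"
  by (simp add: underlying_space_def pullback_def shift_def)
 then show ?thesis using fmodD(2)[OF M] M.shift_graded_module by (simp add: fmod_def)
qed

lemma pairing_shift_right:
 assumes P: "P \<in> Defs.pmod A" and M: "M \<in> fmod K A"
 shows "pairing P (shift n M) = Poly_Mapping.single n 1 * pairing P M"
proof -
 note Pg = pmod_graded[OF P] and Mm = fmodD[OF M] and Mm' = fmodD[OF shift_fmod[OF M, of n]]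
 obtain S :: "((nat => 'a) \<times> int) set" and x k \<xi> where db: "dual_basis A P S x k \<xi>" using pmod_dual_basis[OF P] .
 interpret t: tensor_setup K A \<psi> P M S x k \<xi> by (rule tensor_setupI[OF Pg Mm(1) db])
 interpret t': tensor_setup K A \<psi> P "shift n M" S x k \<xi> by (rule tensor_setupI[OF Pg Mm'(1) db])
 have us: "underlying_space A (shift n M) = underlying_space A M"
  by (simp add: underlying_space_def pullback_def shift_def)
 have fs: "finsum (shift n M) f J = finsum M f J" for f :: "_ => nat => 'a" and J
  by (rule finsum_cong_struct) (auto simp: shift_def)
 have sm: "smult (shift n M) = smult M" and cs: "component (shift n M) i = component M (i - n)" for i
  by (simp_all add: shift_def)
 have "j - k s - n = j - n - k s" for j s by simp
 then have fc: "t'.fixed_component j = t.fixed_component (j - n)" for j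
  unfolding t.fixed_component_def t'.fixed_component_def t.fixed_def t'.fixed_def us sm cs fs by (simp only:)
 show ?thesis
  by (rule poly_mapping_eqI)
   (simp only: pairing_def lookup_monomial_times t.lookup_gdim[OF Mm(2)] t'.lookup_gdim[OF Mm'(2)] fc us)
qed

text \<open>The homomorphisms \<open>f\<close> and \<open>g\<close> act coordinatewise and commute
  with the idempotent matrix, whose entries are elements of \<open>A\<close>. Being the image of an
  idempotent, the fixed part inherits exactness.\<close>

lemma pairing_add_right:
 assumes P: "P \<in> Defs.pmod A" and M': "M' \<in> fmod K A" and M: "M \<in> fmod K A" and M'': "M'' \<in> fmod K A"
  and ex: "short_exact A M' M M''"
 shows "pairing P M = pairing P M' + pairing P M''"
proof -
 obtain f g where f: "f \<in> graded_hom A M' M" and g: "g \<in> graded_hom A M M''" and inj: "inj_on f (carrier M')"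
  and im: "f ` carrier M' = a_kernel M M'' g" and surj: "g ` carrier M = carrier M''"
  using ex unfolding short_exact_def by blast
 have ker: "f ` carrier M' = {p \<in> carrier M. g p = \<zero>\<^sub>M''}" using im by (simp add: a_kernel_def')
 note Pg = pmod_graded[OF P] and Mm' = fmodD[OF M'] and Mm = fmodD[OF M] and Mm'' = fmodD[OF M'']
 obtain S :: "((nat => 'a) \<times> int) set" and x k \<xi> where db: "dual_basis A P S x k \<xi>" using pmod_dual_basis[OF P] .
 interpret t: tensor_setup K A \<psi> P M S x k \<xi> by (rule tensor_setupI[OF Pg Mm(1) db])
 interpret t': tensor_setup K A \<psi> P M' S x k \<xi> by (rule tensor_setupI[OF Pg Mm'(1) db])
 interpret t'': tensor_setup K A \<psi> P M'' S x k \<xi> by (rule tensor_setupI[OF Pg Mm''(1) db])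
 interpret f: graded_map K A M' M f by (rule graded_mapI[OF graded_alg_axioms Mm'(1) Mm(1) f])
 interpret g: graded_map K A M M'' g by (rule graded_mapI[OF graded_alg_axioms Mm(1) Mm''(1) g])
 have idP: "(%p. p) \<in> carrier P \<rightarrow> carrier P" by simp
 have fi: "y = z" if "y \<in> carrier M'" "z \<in> carrier M'" "f y = f z" for y z
  using inj that by (auto simp: inj_on_def)
 have fe: "(%s. f (t'.endo (%p. p) m s)) = t.endo (%p. p) (%s. f (m s))" if m: "m \<in> carrier t'.W" for m
 proof
  fix s
  have "f (\<Oplus>\<^sub>M' u\<in>S. \<phi> (\<xi> s (x u)) \<odot>\<^sub>M' m u) = (\<Oplus>\<^sub>M u\<in>S. \<phi> (\<xi> s (x u)) \<odot>\<^sub>M f (m u))" if s: "s \<in> S"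
  proof -
   have "f (\<Oplus>\<^sub>M' u\<in>S. \<phi> (\<xi> s (x u)) \<odot>\<^sub>M' m u) = (\<Oplus>\<^sub>M u\<in>S. f (\<phi> (\<xi> s (x u)) \<odot>\<^sub>M' m u))"
    by (rule f.finsum[OF t'.coefficient_closed[OF m s]])
   also have "\<dots> = (\<Oplus>\<^sub>M u\<in>S. \<phi> (\<xi> s (x u)) \<odot>\<^sub>M f (m u))"
    by (rule t.M.M.M.finsum_cong')
     (use f.smult[OF t.\<phi>\<xi>[OF s t.xc] t'.W_closed[OF m]] t.M.M.smult_closed[OF t.\<phi>\<xi>[OF s t.xc] f.closed[OF t'.W_closed[OF m]]] in auto)
   finally show ?thesis .
  qed
  then show "f (t'.endo (%p. p) m s) = t.endo (%p. p) (%s. f (m s)) s"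
   by (simp add: t.endo_def t'.endo_def f.zero)
 qed
 have ge: "(%s. g (t.endo (%p. p) m s)) = t''.endo (%p. p) (%s. g (m s))" if m: "m \<in> carrier t.W" for m
 proof
  fix s
  have "g (\<Oplus>\<^sub>M u\<in>S. \<phi> (\<xi> s (x u)) \<odot>\<^sub>M m u) = (\<Oplus>\<^sub>M'' u\<in>S. \<phi> (\<xi> s (x u)) \<odot>\<^sub>M'' g (m u))" if s: "s \<in> S"
  proof -
   have "g (\<Oplus>\<^sub>M u\<in>S. \<phi> (\<xi> s (x u)) \<odot>\<^sub>M m u) = (\<Oplus>\<^sub>M'' u\<in>S. g (\<phi> (\<xi> s (x u)) \<odot>\<^sub>M m u))"
    by (rule g.finsum[OF t.coefficient_closed[OF m s]])
   also have "\<dots> = (\<Oplus>\<^sub>M'' u\<in>S. \<phi> (\<xi> s (x u)) \<odot>\<^sub>M'' g (m u))"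
    by (rule t''.M.M.M.finsum_cong')
     (use g.smult[OF t.\<phi>\<xi>[OF s t.xc] t.W_closed[OF m]] t''.M.M.smult_closed[OF t.\<phi>\<xi>[OF s t.xc] g.closed[OF t.W_closed[OF m]]] in auto)
   finally show ?thesis .
  qed
  then show "g (t.endo (%p. p) m s) = t''.endo (%p. p) (%s. g (m s)) s"
   by (simp add: t.endo_def t''.endo_def g.zero)
 qed
 have dims: "vectorspace.dim K (t.W\<lparr>carrier := t.fixed_component j\<rparr>) =
   vectorspace.dim K (t'.W\<lparr>carrier := t'.fixed_component j\<rparr>) + vectorspace.dim K (t''.W\<lparr>carrier := t''.fixed_component j\<rparr>)" for j
 proof (rule dim_exact[where f = "%m s. f (m s)" and g = "%m s. g (m s)"])
  note sm = t.fixed_component_submodule[of j] and sm' = t'.fixed_component_submodule[of j]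
   and sm'' = t''.fixed_component_submodule[of j]
  have fm: "(%s. f (m s)) \<in> t.fixed_component j" if m: "m \<in> t'.fixed_component j" for m
  proof (rule t.fixed_componentI)
   note mD = t'.fixed_componentD[OF m]
   show "(%s. f (m s)) \<in> carrier t.W" using mD(1) f.closed f.zero by auto
   show "t.endo (%p. p) (%s. f (m s)) = (%s. f (m s))" unfolding fe[OF mD(1), symmetric] mD(2) ..
   show "f (m s) \<in> component M (j - k s)" if "s \<in> S" for s by (rule f.comp[OF mD(3)[OF that]])
  qed
  have gm: "(%s. g (m s)) \<in> t''.fixed_component j" if m: "m \<in> t.fixed_component j" for m
  proof (rule t''.fixed_componentI)
   note mD = t.fixed_componentD[OF m]
   show "(%s. g (m s)) \<in> carrier t''.W" using mD(1) g.closed g.zero by auto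
   show "t''.endo (%p. p) (%s. g (m s)) = (%s. g (m s))" unfolding ge[OF mD(1), symmetric] mD(2) ..
   show "g (m s) \<in> component M'' (j - k s)" if "s \<in> S" for s by (rule g.comp[OF mD(3)[OF that]])
  qed
  have fc: "m s \<in> carrier M'" if "m \<in> t'.fixed_component j" for m s by (rule t'.W_closed[OF t'.fixed_componentD(1)[OF that]])
  have gc: "m s \<in> carrier M" if "m \<in> t.fixed_component j" for m s by (rule t.W_closed[OF t.fixed_componentD(1)[OF that]])
  show "linear_map K (t'.W\<lparr>carrier := t'.fixed_component j\<rparr>) (t.W\<lparr>carrier := t.fixed_component j\<rparr>) (%m s. f (m s))"
  proof (rule linear_mapI[OF t'.W.submodule_vectorspace[OF sm'] t.W.submodule_vectorspace[OF sm]])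
   show "(%s. f ((c \<odot>\<^bsub>t'.W\<lparr>carrier := t'.fixed_component j\<rparr>\<^esub> m) s)) = c \<odot>\<^bsub>t.W\<lparr>carrier := t.fixed_component j\<rparr>\<^esub> (%s. f (m s))"
    if "c \<in> carrier K" "m \<in> carrier (t'.W\<lparr>carrier := t'.fixed_component j\<rparr>)" for c m
    using that f.smult[OF scalar_closed[OF that(1)] fc] by (auto simp: fun_eq_iff scalar_def f.zero)
  qed (use fm f.add[OF fc fc] in auto)
  show "linear_map K (t.W\<lparr>carrier := t.fixed_component j\<rparr>) (t''.W\<lparr>carrier := t''.fixed_component j\<rparr>) (%m s. g (m s))"
  proof (rule linear_mapI[OF t.W.submodule_vectorspace[OF sm] t''.W.submodule_vectorspace[OF sm'']])
   show "(%s. g ((c \<odot>\<^bsub>t.W\<lparr>carrier := t.fixed_component j\<rparr>\<^esub> m) s)) = c \<odot>\<^bsub>t''.W\<lparr>carrier := t''.fixed_component j\<rparr>\<^esub> (%s. g (m s))"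
    if "c \<in> carrier K" "m \<in> carrier (t.W\<lparr>carrier := t.fixed_component j\<rparr>)" for c m
    using that g.smult[OF scalar_closed[OF that(1)] gc] by (auto simp: fun_eq_iff scalar_def g.zero)
  qed (use gm g.add[OF gc gc] in auto)
  show "inj_on (%m s. f (m s)) (carrier (t'.W\<lparr>carrier := t'.fixed_component j\<rparr>))"
  proof (rule inj_onI)
   fix m n assume "m \<in> carrier (t'.W\<lparr>carrier := t'.fixed_component j\<rparr>)" "n \<in> carrier (t'.W\<lparr>carrier := t'.fixed_component j\<rparr>)"
    and e: "(%s. f (m s)) = (%s. f (n s))"
   then have mn: "m \<in> t'.fixed_component j" "n \<in> t'.fixed_component j" by simp_all
   show "m = n" by (rule ext, rule fi[OF fc[OF mn(1)] fc[OF mn(2)] fun_cong[OF e]])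
  qed
  have gf: "g (f y) = \<zero>\<^sub>M''" if "y \<in> carrier M'" for y using ker that by blast
  \<comment> \<open>The coordinatewise preimage under \<open>f\<close> is again fixed and of the
    right degree, because \<open>f\<close> is injective and compatible with both conditions.\<close>
  have lift: "m \<in> (%m s. f (m s)) ` t'.fixed_component j"
   if m: "m \<in> t.fixed_component j" and z: "(%s. g (m s)) = (%s. \<zero>\<^sub>M'')" for m
  proof
   define y where "y s = inv_into (carrier M') f (m s)" for s
   have "m s \<in> f ` carrier M'" for s using gc[OF m] fun_cong[OF z] unfolding ker by blast
   then have y: "y s \<in> carrier M'" "f (y s) = m s" for s
    unfolding y_def by (rule inv_into_into, rule f_inv_into_f)
   note mD = t.fixed_componentD[OF m]
   show my: "m = (%s. f (y s))" using y(2) by auto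
   show "y \<in> t'.fixed_component j"
   proof (rule t'.fixed_componentI)
    have "y s = \<zero>\<^sub>M'" if "s \<notin> S" for s
     by (rule fi[OF y(1)]) (use y(2) mD(1) that f.zero in \<open>auto simp del: split_paired_All\<close>)
    then show yW: "y \<in> carrier t'.W" using y(1) by auto
    have "(%s. f (t'.endo (%p. p) y s)) = (%s. f (y s))" unfolding fe[OF yW] using mD(2) my by simp
    note e = fun_cong[OF this]
    show "t'.endo (%p. p) y = y"
     by (rule ext, rule fi[OF t'.W_closed[OF t'.endo_closed[OF idP yW]] y(1) e])
    fix s assume s: "s \<in> S"
    have "f (hcomp M' (y s) (j - k s)) = f (y s)"
     using f.hcomp[OF y(1), of s "j - k s"] t.M.M.hcomp_homogeneous[OF mD(3)[OF s], of "j - k s"] y(2) by simp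
    then have "hcomp M' (y s) (j - k s) = y s" by (rule fi[OF t'.M.M.hcomp_closed[OF y(1)] y(1)])
    then show "y s \<in> component M' (j - k s)" using t'.M.M.hcomp_component[OF y(1), of s "j - k s"] by simp
   qed
  qed
  show "(%m s. f (m s)) ` carrier (t'.W\<lparr>carrier := t'.fixed_component j\<rparr>) =
   {m \<in> carrier (t.W\<lparr>carrier := t.fixed_component j\<rparr>). (%s. g (m s)) = \<zero>\<^bsub>t''.W\<lparr>carrier := t''.fixed_component j\<rparr>\<^esub>}"
  proof (intro equalityI subsetI)
   fix m assume "m \<in> (%m s. f (m s)) ` carrier (t'.W\<lparr>carrier := t'.fixed_component j\<rparr>)"
   then obtain y where y: "y \<in> t'.fixed_component j" "m = (%s. f (y s))" by auto
   show "m \<in> {m \<in> carrier (t.W\<lparr>carrier := t.fixed_component j\<rparr>). (%s. g (m s)) = \<zero>\<^bsub>t''.W\<lparr>carrier := t''.fixed_component j\<rparr>\<^esub>}"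
    using fm[OF y(1)] gf[OF fc[OF y(1)]] y(2) by simp
  next
   fix m assume "m \<in> {m \<in> carrier (t.W\<lparr>carrier := t.fixed_component j\<rparr>). (%s. g (m s)) = \<zero>\<^bsub>t''.W\<lparr>carrier := t''.fixed_component j\<rparr>\<^esub>}"
   then show "m \<in> (%m s. f (m s)) ` carrier (t'.W\<lparr>carrier := t'.fixed_component j\<rparr>)" using lift[of m] by simp
  qed
  show "(%m s. g (m s)) ` carrier (t.W\<lparr>carrier := t.fixed_component j\<rparr>) = carrier (t''.W\<lparr>carrier := t''.fixed_component j\<rparr>)"
  proof (intro equalityI subsetI)
   fix m assume "m \<in> (%m s. g (m s)) ` carrier (t.W\<lparr>carrier := t.fixed_component j\<rparr>)"
   then show "m \<in> carrier (t''.W\<lparr>carrier := t''.fixed_component j\<rparr>)" using gm by auto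
  next
   fix m assume "m \<in> carrier (t''.W\<lparr>carrier := t''.fixed_component j\<rparr>)"
   then have m: "m \<in> t''.fixed_component j" by simp
   note mD = t''.fixed_componentD[OF m]
   have "\<exists>z\<in>component M (j - k s). g z = m s" if s: "s \<in> S" for s
    using g.surj_component[OF surj mD(3)[OF s]] by blast
   then obtain z where z: "!!s. s \<in> S ==> z s \<in> component M (j - k s)" "!!s. s \<in> S ==> g (z s) = m s" by metis
   define y where "y s = (if s \<in> S then z s else \<zero>\<^sub>M)" for s
   have yW: "y \<in> carrier t.W" using z(1) t.M.M.component_closed by (auto simp: y_def)
   have gy: "(%s. g (y s)) = m" using z(2) mD(1) by (auto simp: y_def g.zero fun_eq_iff)
   \<comment> \<open>The coordinatewise lift \<open>y\<close> need not be fixed. Applying the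
     idempotent makes it so and leaves the image \<open>m\<close> unchanged, as \<open>m\<close> is
     fixed already.\<close>
   have "t.endo (%p. p) y \<in> t.fixed_component j"
    by (rule t.endo_component[OF _ idP yW]) (use z(1) in \<open>simp_all add: y_def\<close>)
   moreover have "(%s. g (t.endo (%p. p) y s)) = m" unfolding ge[OF yW] gy by (rule mD(2))
   ultimately show "m \<in> (%m s. g (m s)) ` carrier (t.W\<lparr>carrier := t.fixed_component j\<rparr>)" by force
  qed
  show "vectorspace.fin_dim K (t.W\<lparr>carrier := t.fixed_component j\<rparr>)"
   by (rule t.W.subspace_fin_dim(1)[OF t.W_fin_dim[OF Mm(2)] sm])
 qed
 show ?thesis
  by (rule poly_mapping_eqI)
   (simp add: pairing_def lookup_add t.lookup_gdim[OF Mm(2)] t'.lookup_gdim[OF Mm'(2)] t''.lookup_gdim[OF Mm''(2)] dims)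
qed

end

section \<open>Endomorphisms of graded simple modules\<close>

text \<open>\<open>p(T) x\<close> by Horner's scheme, where \<open>e 0\<close> is the leading
  coefficient and \<open>e n\<close> the constant one; truncating the scheme gives the partial
  quotients of synthetic division.\<close>

primrec horner :: "('k, 'v, 'z) module_scheme => ('v => 'v) => (nat => 'k) => 'v => nat => 'v" where
 "horner V T e x 0 = e 0 \<odot>\<^sub>V x"
| "horner V T e x (Suc n) = T (horner V T e x n) \<oplus>\<^sub>V e (Suc n) \<odot>\<^sub>V x"

context vectorspace
begin

context
 fixes T x
 assumes closed: "!!y. y \<in> carrier V ==> T y \<in> carrier V"
  and add: "!!y z. y \<in> carrier V ==> z \<in> carrier V ==> T (y \<oplus>\<^sub>V z) = T y \<oplus>\<^sub>V T z"
  and smult: "!!c y. c \<in> carrier K ==> y \<in> carrier V ==> T (c \<odot>\<^sub>V y) = c \<odot>\<^sub>V T y"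
  and x: "x \<in> carrier V"
begin

lemma horner_closed: "(!!i. e i \<in> carrier K) ==> horner V T e x n \<in> carrier V"
 by (induct n) (auto simp: x closed)

lemma horner_sum:
 assumes e: "!!i. e i \<in> carrier K"
 shows "horner V T e x n = (\<Oplus>\<^sub>V i\<in>{..n}. e (n - i) \<odot>\<^sub>V (T ^^ i) x)"
proof (induct n)
 case 0
 then show ?case using e x by simp
next
 case (Suc n)
 have vc: "(T ^^ i) x \<in> carrier V" for i by (induct i) (auto simp: x closed)
 have ec: "c \<odot>\<^sub>V (T ^^ i) x \<in> carrier V" if "c \<in> carrier K" for c i by (rule smult_closed[OF that vc])
 have "T (horner V T e x n) = (\<Oplus>\<^sub>V i\<in>{..n}. T (e (n - i) \<odot>\<^sub>V (T ^^ i) x))"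
  unfolding Suc by (rule additive_finsum[OF M.abelian_group_axioms M.abelian_group_axioms]) (auto simp: closed add ec e)
 also have "\<dots> = (\<Oplus>\<^sub>V i\<in>{..n}. e (Suc n - Suc i) \<odot>\<^sub>V (T ^^ Suc i) x)"
  by (rule M.finsum_cong') (auto simp: smult e vc closed)
 finally show ?case
  using M.finsum_Suc2[of "%i. e (Suc n - i) \<odot>\<^sub>V (T ^^ i) x" n] ec e by simp
qed

lemma horner_submodule:
 assumes W: "submodule K W V" "x \<in> W" "!!w. w \<in> W ==> T w \<in> W" and e: "!!i. e i \<in> carrier K"
 shows "horner V T e x n \<in> W"
 using W e by (induct n) (auto simp: submodule_def)

text \<open>In finite dimension some iterate of \<open>T\<close> on \<open>x\<close> depends on the
  earlier ones; moving everything to one side gives a monic relation.\<close>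

lemma horner_annihilated:
 assumes fd: fin_dim
 obtains e n where "!!i. e i \<in> carrier K" "e 0 = \<one>\<^sub>K" "horner V T e x n = \<zero>\<^sub>V"
proof -
 have vc: "(T ^^ i) x \<in> carrier V" for i by (induct i) (auto simp: x closed)
 obtain m where m: "(T ^^ m) x \<in> span ((%i. (T ^^ i) x) ` {..<m})"
  by (rule sequence_dependent[of "%i. (T ^^ i) x", OF fd vc])
 obtain c where c: "c \<in> {..<m} \<rightarrow> carrier K" "(T ^^ m) x = (\<Oplus>\<^sub>V i\<in>{..<m}. c i \<odot>\<^sub>V (T ^^ i) x)"
  by (rule span_image_finsum[of "{..<m}" "%i. (T ^^ i) x", OF vc finite_lessThan m])
 \<comment> \<open>Coefficients of the monic relation, listed from the leading one: position
   \<open>i\<close> belongs to the power \<open>m - i\<close>.\<close>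
 define e where "e i = (if i = 0 then \<one>\<^sub>K else if i \<le> m then \<ominus>\<^sub>K c (m - i) else \<zero>\<^sub>K)" for i
 have e: "e i \<in> carrier K" for i using c(1) by (auto simp: e_def)
 let ?f = "%i. c i \<odot>\<^sub>V (T ^^ i) x"
 have fc: "?f i \<in> carrier V" if "i \<in> {..<m}" for i using c(1) that vc by auto
 have "(\<Oplus>\<^sub>V i\<in>{..<m}. e (m - i) \<odot>\<^sub>V (T ^^ i) x) = (\<Oplus>\<^sub>V i\<in>{..<m}. \<ominus>\<^sub>V ?f i)"
  by (rule M.finsum_cong') (use c(1) vc fc in \<open>auto simp: e_def smult_l_minus Pi_def\<close>)
 also have "\<dots> = \<ominus>\<^sub>V (\<Oplus>\<^sub>V i\<in>{..<m}. ?f i)"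
  by (rule additive_finsum[OF M.abelian_group_axioms M.abelian_group_axioms, symmetric])
   (use fc in \<open>auto simp: M.minus_add\<close>)
 finally have 1: "(\<Oplus>\<^sub>V i\<in>{..<m}. e (m - i) \<odot>\<^sub>V (T ^^ i) x) = \<ominus>\<^sub>V (T ^^ m) x" by (simp only: c(2))
 have "{..m} = insert m {..<m}" by auto
 then have "horner V T e x m = e 0 \<odot>\<^sub>V (T ^^ m) x \<oplus>\<^sub>V \<ominus>\<^sub>V (T ^^ m) x"
  unfolding horner_sum[OF e] using e vc by (simp add: 1[symmetric])
 then have "horner V T e x m = \<zero>\<^sub>V" using vc by (simp add: e_def M.r_neg)
 then show thesis by (rule that[of e m, OF e, rotated]) (simp add: e_def)
qed

text \<open>
  For a root \<open>c\<close> of the polynomial \<open>p = \<Sum>\<^sub>i e\<^sub>i X\<^bsup>n-i\<^esup>\<close> of least degree with \<open>p(T) x = 0\<close>, the vector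
  \<open>(p / (X - c))(T) x\<close> is an eigenvector; the coefficients \<open>b\<close> of the quotient are those of the Horner scheme.
\<close>

lemma eigenvector:
 assumes ac: "algebraically_closed K" and fd: fin_dim and x0: "x ~= \<zero>\<^sub>V"
 obtains c b n where "c \<in> carrier K" "b \<in> UNIV \<rightarrow> carrier K" "horner V T b x n ~= \<zero>\<^sub>V"
  "T (horner V T b x n) = c \<odot>\<^sub>V horner V T b x n"
proof -
 let ?P = "%n. \<exists>e. (\<forall>i. e i \<in> carrier K) \<and> e 0 = \<one>\<^sub>K \<and> horner V T e x n = \<zero>\<^sub>V"
 have "\<exists>n. ?P n" by (rule horner_annihilated[OF fd]) blast
 then have P: "?P (LEAST n. ?P n)" by (rule LeastI_ex)
 define N where "N = (LEAST n. ?P n)"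
 have least: "\<not> ?P n" if "n < N" for n using that not_less_Least unfolding N_def by blast
 obtain e where e: "!!i. e i \<in> carrier K" "e 0 = \<one>\<^sub>K" "horner V T e x N = \<zero>\<^sub>V"
  using P unfolding N_def[symmetric] by blast
 have "N ~= 0" using e x0 x by (intro notI) simp
 then obtain n where N: "N = Suc n" by (cases N) auto
 interpret ac: algebraically_closed K by (rule ac)
 let ?p = "map e [0..<Suc N]"
 have hd: "hd ?p = e 0" by (simp add: upt_conv_Cons del: upt_Suc)
 have p: "?p \<in> carrier (poly_ring K)"
  unfolding univ_poly_def polynomial_def using e(1,2) hd one_not_zero by auto
 have "R.splitted ?p" by (rule ac.roots_over_carrier[OF p])
 then have "size (R.roots ?p) = N" by (simp add: R.splitted_def)
 then obtain c where "c \<in># R.roots ?p" using N by (cases "R.roots ?p") auto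
 then have "R.is_root ?p c" using domain.roots_mem_iff_is_root[OF field.axioms(1)[OF algebraically_closed.axioms(1)[OF ac]] p] by blast
 then have c: "c \<in> carrier K" "R.eval ?p c = \<zero>\<^sub>K" by (auto simp: R.is_root_def)
 \<comment> \<open>\<open>b i\<close> evaluates the first \<open>Suc i\<close> coefficients at
   \<open>c\<close>: these are the coefficients of the quotient by \<open>X - c\<close>, followed by
   the remainder \<open>b N\<close>, which is zero because \<open>c\<close> is a root.\<close>
 define b where "b i = R.eval (map e [0..<Suc i]) c" for i
 have b0: "b 0 = \<one>\<^sub>K" using e c by (simp add: b_def)
 have bS: "b (Suc i) = b i \<otimes>\<^sub>K c \<oplus>\<^sub>K e (Suc i)" for i
  using R.eval_append_aux[of "map e [0..<Suc i]" "e (Suc i)" c] e(1) c(1) by (auto simp: b_def)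
 have bc: "b i \<in> carrier K" for i by (induct i) (auto simp: b0 bS e(1) c(1))
 let ?u = "%n. horner V T b x n"
 have uc: "?u i \<in> carrier V" for i by (rule horner_closed[OF bc])
 \<comment> \<open>Synthetic division at stage \<open>i\<close>: \<open>T - c\<close> applied to the
   partial quotient is the truncated polynomial minus its remainder times \<open>x\<close>. At
   \<open>i = n\<close> both terms on the right vanish.\<close>
 have key: "T (?u i) \<oplus>\<^sub>V b (Suc i) \<odot>\<^sub>V x = c \<odot>\<^sub>V ?u i \<oplus>\<^sub>V horner V T e x (Suc i)" for i
 proof (induct i)
  case 0
  show ?case using e(1,2) c(1) x closed by (simp add: b0 bS smult_l_distr M.a_lcomm)
 next
  case (Suc i)
  have hc: "horner V T e x (Suc i) \<in> carrier V" by (rule horner_closed[OF e(1)])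
  have "T (?u (Suc i)) = T (c \<odot>\<^sub>V ?u i \<oplus>\<^sub>V horner V T e x (Suc i))" using Suc by simp
  also have "\<dots> = c \<odot>\<^sub>V T (?u i) \<oplus>\<^sub>V T (horner V T e x (Suc i))"
   using add[OF smult_closed[OF c(1) uc] hc] smult[OF c(1) uc] by simp
  finally have 1: "T (?u (Suc i)) = c \<odot>\<^sub>V T (?u i) \<oplus>\<^sub>V T (horner V T e x (Suc i))" .
  have 2: "b (Suc (Suc i)) \<odot>\<^sub>V x = c \<odot>\<^sub>V (b (Suc i) \<odot>\<^sub>V x) \<oplus>\<^sub>V e (Suc (Suc i)) \<odot>\<^sub>V x"
   unfolding bS[of "Suc i"] using bc[of "Suc i"] c(1) e(1) x R.m_comm[OF bc[of "Suc i"] c(1)]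
   by (simp add: smult_l_distr smult_assoc1)
  have 3: "c \<odot>\<^sub>V ?u (Suc i) = c \<odot>\<^sub>V T (?u i) \<oplus>\<^sub>V c \<odot>\<^sub>V (b (Suc i) \<odot>\<^sub>V x)"
   using smult_r_distr[OF c(1) closed[OF uc[of i]] smult_closed[OF bc[of "Suc i"] x]] by simp
  have hS: "horner V T e x (Suc (Suc i)) = T (horner V T e x (Suc i)) \<oplus>\<^sub>V e (Suc (Suc i)) \<odot>\<^sub>V x" by (rule horner.simps)
  have swap: "p \<oplus>\<^sub>V h \<oplus>\<^sub>V (q \<oplus>\<^sub>V g) = p \<oplus>\<^sub>V q \<oplus>\<^sub>V (h \<oplus>\<^sub>V g)"
   if "p \<in> carrier V" "h \<in> carrier V" "q \<in> carrier V" "g \<in> carrier V" for p h q g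
   using that by (simp add: M.a_ac)
  have 4: "c \<odot>\<^sub>V T (?u i) \<oplus>\<^sub>V T (horner V T e x (Suc i)) \<oplus>\<^sub>V
    (c \<odot>\<^sub>V (b (Suc i) \<odot>\<^sub>V x) \<oplus>\<^sub>V e (Suc (Suc i)) \<odot>\<^sub>V x) =
    c \<odot>\<^sub>V T (?u i) \<oplus>\<^sub>V c \<odot>\<^sub>V (b (Suc i) \<odot>\<^sub>V x) \<oplus>\<^sub>V
    (T (horner V T e x (Suc i)) \<oplus>\<^sub>V e (Suc (Suc i)) \<odot>\<^sub>V x)"
   by (rule swap[OF smult_closed[OF c(1) closed[OF uc]] closed[OF hc] smult_closed[OF c(1) smult_closed[OF bc x]] smult_closed[OF e(1) x]])
  show ?case by (simp only: 1 2 3 hS 4)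
 qed
 have "b N = \<zero>\<^sub>K" using c(2) by (simp add: b_def)
 then have "T (?u n) = c \<odot>\<^sub>V ?u n" using key[of n] e(3) x uc[of n] closed[OF uc[of n]] c(1) by (simp add: N del: horner.simps)
 \<comment> \<open>The quotient is monic of degree \<open>n < N\<close>, so minimality of
   \<open>N\<close> forbids that it annihilates \<open>x\<close>.\<close>
 moreover have "?u n ~= \<zero>\<^sub>V" using least[of n] bc b0 N by auto
 moreover have "b \<in> UNIV \<rightarrow> carrier K" using bc by simp
 ultimately show thesis using that c(1) by blast
qed

end

lemma dim_one:
 assumes x: "x \<in> carrier V" "x ~= \<zero>\<^sub>V" and gen: "!!y. y \<in> carrier V ==> \<exists>c\<in>carrier K. y = c \<odot>\<^sub>V x"
 shows "dim = 1"
proof -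
 have sp: "span {x} = carrier V"
 proof
  show "span {x} \<subseteq> carrier V" using x(1) by (intro span_is_subset2) simp
  show "carrier V \<subseteq> span {x}"
  proof
   fix y assume "y \<in> carrier V"
   then obtain c where c: "c \<in> carrier K" "y = c \<odot>\<^sub>V x" using gen by blast
   have "x \<in> span {x}" using in_own_span[of "{x}"] x(1) by simp
   then show "y \<in> span {x}" using span_is_submodule[of "{x}"] x(1) c by (simp add: submodule_def)
  qed
 qed
 have xs: "{x} \<subseteq> carrier V" using x(1) by simp
 have fd: "fin_dim" unfolding fin_dim_def by (rule exI[of _ "{x}"]) (intro conjI finite.intros xs sp)
 have "dim ~= 0" using dim_zeroD[OF fd] x by force
 moreover have "dim \<le> card {x}" by (rule gen_ge_dim[OF _ xs sp]) simp
 ultimately show ?thesis by simp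
qed

end

section \<open>Corners of graded simple modules and Schur's lemma\<close>

context nice_alg
begin

text \<open>Simplicity gives a homogeneous element carrying \<open>x\<close> to \<open>y\<close>;
  multiplying it by \<open>r\<close> on both sides changes nothing on \<open>x\<close>, since
  \<open>r\<close> fixes both vectors.\<close>

lemma corner_element:
 assumes S: "graded_simple A S" and r: "r \<in> component A 0" "r \<otimes> r = r"
  and x: "x \<in> component S i" "x ~= \<zero>\<^sub>S" "r \<odot>\<^sub>S x = x" and y: "y \<in> component S j" "r \<odot>\<^sub>S y = y"
 obtains a where "a \<in> component A (j - i)" "r \<otimes> a = a" "a \<otimes> r = a" "a \<odot>\<^sub>S x = y"
proof -
 interpret S: graded_mod K A S by (rule graded_simpleD(1)[OF S])
 obtain a where a: "a \<in> component A (j - i)" "y = a \<odot>\<^sub>S x"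
  using graded_simple_cyclic_homogeneous[OF S x(1,2) y(1)] .
 note rc = GA.component_closed[OF r(1)] and ac = GA.component_closed[OF a(1)] and xc = S.M.component_closed[OF x(1)]
 have "(r \<otimes> a \<otimes> r) \<odot>\<^sub>S x = y"
  using S.M.smult_assoc[OF m_closed[OF rc ac] rc xc] S.M.smult_assoc[OF rc ac xc] x(3) y(2) a(2) by simp
 moreover have "r \<otimes> (r \<otimes> a \<otimes> r) = r \<otimes> a \<otimes> r"
  using m_assoc[OF rc rc m_closed[OF ac rc]] m_assoc[OF rc ac rc] r(2) by simp
 moreover have "r \<otimes> a \<otimes> r \<otimes> r = r \<otimes> a \<otimes> r"
  using m_assoc[OF m_closed[OF rc ac] rc rc] r(2) by simp
 moreover have "r \<otimes> a \<otimes> r \<in> component A (j - i)" by (intro mult_component0 r(1) a(1))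
 ultimately show thesis using that by blast
qed

text \<open>Nonzero vectors of \<open>r S\<close> in two degrees would give an element of nonzero
  degree that is left invertible in the corner. Its iterates on \<open>x\<close> would then be
  nonzero in infinitely many degrees, which finite dimension excludes.\<close>

lemma corner_off_diagonal:
 assumes S: "graded_simple A S" and fd: "vectorspace.fin_dim K (underlying_space A S)" and r: "local_idempotent r"
  and x: "x \<in> component S i" "x ~= \<zero>\<^sub>S" "r \<odot>\<^sub>S x = x" and y: "y \<in> component S j" "r \<odot>\<^sub>S y = y"
  and ij: "i ~= j"
 shows "y = \<zero>\<^sub>S"
proof (rule ccontr)
 assume y0: "y ~= \<zero>\<^sub>S"
 interpret S: graded_mod K A S by (rule graded_simpleD(1)[OF S])
 have r0: "r \<in> component A 0" "r \<otimes> r = r" using r by (auto simp: local_idempotent_def)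
 obtain a where a: "a \<in> component A (j - i)" "r \<otimes> a = a" "a \<otimes> r = a" "a \<odot>\<^sub>S x = y"
  using corner_element[OF S r0 x y] .
 obtain b where b: "b \<in> component A (i - j)" "r \<otimes> b = b" "b \<otimes> r = b" "b \<odot>\<^sub>S y = x"
  using corner_element[OF S r0 y(1) y0 y(2) x(1,3)] .
 note rc = GA.component_closed[OF r0(1)] and ac = GA.component_closed[OF a(1)] and bc = GA.component_closed[OF b(1)]
  and xc = S.M.component_closed[OF x(1)]
 have t: "b \<otimes> a \<in> component A 0" using mult_component[OF b(1) a(1)] by simp
 obtain c where c: "c \<in> component A 0" "c \<otimes> (b \<otimes> a) = r"
  by (rule corner_unit[OF r S.M.left_module_axioms xc x(2) t])
   (use m_assoc[OF rc bc ac] m_assoc[OF bc ac rc] a b S.M.smult_assoc[OF bc ac xc] in auto)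
 note cc = GA.component_closed[OF c(1)]
 \<comment> \<open>The iterates of \<open>a\<close> on \<open>x\<close>; they stay nonzero because
   \<open>c b\<close> undoes one application of \<open>a\<close>.\<close>
 define v where "v n = ((%z. a \<odot>\<^sub>S z) ^^ n) x" for n
 have v: "v n \<in> component S (int n * (j - i) + i) \<and> r \<odot>\<^sub>S v n = v n \<and> v n ~= \<zero>\<^sub>S" for n
 proof (induct n)
  case 0
  then show ?case using x by (simp add: v_def)
 next
  case (Suc n)
  then have vn: "v n \<in> component S (int n * (j - i) + i)" "r \<odot>\<^sub>S v n = v n" "v n ~= \<zero>\<^sub>S" by auto
  note vc = S.M.component_closed[OF vn(1)]
  have vS: "v (Suc n) = a \<odot>\<^sub>S v n" by (simp add: v_def)
  have "(c \<otimes> b) \<odot>\<^sub>S v (Suc n) = v n"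
   using S.M.smult_assoc[OF m_closed[OF cc bc] ac vc] m_assoc[OF cc bc ac] c(2) vn(2) by (simp add: vS)
  then have "v (Suc n) ~= \<zero>\<^sub>S" using vn(3) S.M.smult_zero_r[OF m_closed[OF cc bc]] by auto
  moreover have "v (Suc n) \<in> component S (int (Suc n) * (j - i) + i)"
   using S.smult_component_M[OF a(1) vn(1)] unfolding vS by (simp add: algebra_simps)
  moreover have "r \<odot>\<^sub>S v (Suc n) = v (Suc n)"
   using S.M.smult_assoc[OF rc ac vc] a(2) by (simp add: vS)
  ultimately show ?case by blast
 qed
 have "range (%n. int n * (j - i) + i) \<subseteq> {k. component S k ~= {\<zero>\<^sub>S}}" using v by blast
 then have "finite (range (%n. int n * (j - i) + i))" using S.finite_degrees[OF fd] by (rule finite_subset)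
 moreover have "inj (%n. int n * (j - i) + i)" using ij by (auto simp: inj_def)
 ultimately show False using finite_imageD[of "%n. int n * (j - i) + i" UNIV] by simp
qed

lemma corner_submodule:
 assumes S: "graded_module A S" and r: "r \<in> component A 0"
 shows "submodule K {y \<in> component S j. r \<odot>\<^sub>S y = y} (underlying_space A S)"
proof -
 interpret S: graded_mod K A S by (rule graded_modI[OF S])
 note rc = GA.component_closed[OF r]
 show ?thesis
 proof (rule S.KM.submoduleI')
  fix c y assume c: "c \<in> carrier K" and "y \<in> {y \<in> component S j. r \<odot>\<^sub>S y = y}"
  then have y: "y \<in> component S j" "r \<odot>\<^sub>S y = y" by auto
  note yc = S.M.component_closed[OF y(1)]
  have "r \<odot>\<^sub>S (scalar c \<odot>\<^sub>S y) = scalar c \<odot>\<^sub>S y"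
   using S.M.smult_assoc[OF rc scalar_closed[OF c] yc] S.M.smult_assoc[OF scalar_closed[OF c] rc yc]
    scalar_mult_l[OF c rc] scalar_mult_r[OF c rc] y(2) by simp
  then show "c \<odot>\<^bsub>underlying_space A S\<^esub> y \<in> {y \<in> component S j. r \<odot>\<^sub>S y = y}"
   using S.smult_component_M[OF scalar_component[OF c] y(1)] by (simp add: scalar_def)
 qed (auto simp: S.M.component_closed S.M.component_zero S.M.component_add S.M.smult_zero_r[OF rc]
   S.M.smult_r_distr[OF rc])
qed

text \<open>Schur's lemma: an element \<open>a\<close> of the corner with \<open>a x = y\<close> has
  an eigenvector in \<open>r S\<close>. Subtracting the eigenvalue leaves a corner element that
  kills a nonzero vector, and such an element must kill \<open>x\<close>.\<close>

lemma corner_scalar: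
 assumes ac: "algebraically_closed K" and S: "graded_simple A S"
  and fd: "vectorspace.fin_dim K (underlying_space A S)" and r: "local_idempotent r"
  and x: "x \<in> component S i" "x ~= \<zero>\<^sub>S" "r \<odot>\<^sub>S x = x" and y: "y \<in> component S i" "r \<odot>\<^sub>S y = y"
 shows "\<exists>c\<in>carrier K. y = c \<odot>\<^bsub>underlying_space A S\<^esub> x"
proof -
 interpret S: graded_mod K A S by (rule graded_simpleD(1)[OF S])
 have r0: "r \<in> component A 0" "r \<otimes> r = r" using r by (auto simp: local_idempotent_def)
 obtain a where a: "a \<in> component A 0" "r \<otimes> a = a" "a \<otimes> r = a" "a \<odot>\<^sub>S x = y"
  using corner_element[OF S r0 x y] by auto
 note rc = GA.component_closed[OF r0(1)] and ac' = GA.component_closed[OF a(1)] and xc = S.M.component_closed[OF x(1)]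
  and yc = S.M.component_closed[OF y(1)]
 have sm: "a \<odot>\<^sub>S (c \<odot>\<^bsub>underlying_space A S\<^esub> y) = c \<odot>\<^bsub>underlying_space A S\<^esub> (a \<odot>\<^sub>S y)"
  if "c \<in> carrier K" "y \<in> carrier (underlying_space A S)" for c y
  using that S.M.smult_assoc[OF ac' scalar_closed[OF that(1)], of y] S.M.smult_assoc[OF scalar_closed[OF that(1)] ac', of y]
   scalar_mult_l[OF that(1) ac'] scalar_mult_r[OF that(1) ac'] by (simp add: scalar_def[symmetric])
 have cl: "a \<odot>\<^sub>S y \<in> carrier (underlying_space A S)" if "y \<in> carrier (underlying_space A S)" for y
  using that S.M.smult_closed[OF ac'] by simp
 have ad: "a \<odot>\<^sub>S (y \<oplus>\<^bsub>underlying_space A S\<^esub> z) = a \<odot>\<^sub>S y \<oplus>\<^bsub>underlying_space A S\<^esub> a \<odot>\<^sub>S z"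
  if "y \<in> carrier (underlying_space A S)" "z \<in> carrier (underlying_space A S)" for y z
  using that S.M.smult_r_distr[OF ac'] by simp
 have xU: "x \<in> carrier (underlying_space A S)" "x ~= \<zero>\<^bsub>underlying_space A S\<^esub>" using xc x(2) by simp_all
 obtain c b n where c: "c \<in> carrier K" "b \<in> UNIV \<rightarrow> carrier K"
  and z: "horner (underlying_space A S) (%y. a \<odot>\<^sub>S y) b x n ~= \<zero>\<^bsub>underlying_space A S\<^esub>"
   "a \<odot>\<^sub>S horner (underlying_space A S) (%y. a \<odot>\<^sub>S y) b x n =
    c \<odot>\<^bsub>underlying_space A S\<^esub> horner (underlying_space A S) (%y. a \<odot>\<^sub>S y) b x n"
  by (rule S.KM.eigenvector[OF cl ad sm xU(1) ac fd xU(2)])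
 define w where "w = horner (underlying_space A S) (%y. a \<odot>\<^sub>S y) b x n"
 \<comment> \<open>The eigenvector is a polynomial in \<open>a\<close> applied to \<open>x\<close>,
   so it stays in the degree \<open>i\<close> part of \<open>r S\<close>, which \<open>a\<close>
   preserves.\<close>
 have "w \<in> {y \<in> component S i. r \<odot>\<^sub>S y = y}"
  unfolding w_def
 proof (rule S.KM.horner_submodule[OF cl ad sm _ corner_submodule[OF S.graded_module r0(1)] _ _ funcset_mem[OF c(2) UNIV_I]])
  show "x \<in> carrier (underlying_space A S)" "x \<in> {y \<in> component S i. r \<odot>\<^sub>S y = y}" using xc x by simp_all
  fix y assume "y \<in> {y \<in> component S i. r \<odot>\<^sub>S y = y}"
  then have y: "y \<in> component S i" by simp
  show "a \<odot>\<^sub>S y \<in> {y \<in> component S i. r \<odot>\<^sub>S y = y}"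
   using S.smult_component_M[OF a(1) y] S.M.smult_assoc[OF rc ac' S.M.component_closed[OF y]] a(2) by simp
 qed
 then have w: "w \<in> component S i" "r \<odot>\<^sub>S w = w" "w ~= \<zero>\<^sub>S" "a \<odot>\<^sub>S w = scalar c \<odot>\<^sub>S w"
  using z by (auto simp: w_def[symmetric] scalar_def)
 note wc = S.M.component_closed[OF w(1)]
 \<comment> \<open>The scalar is subtracted as \<open>c r\<close>, not \<open>c 1\<close>, to remain
   in the corner. If \<open>d x\<close> were nonzero, some \<open>f d\<close> would fix
   \<open>x\<close> and be a unit of the corner, although it kills \<open>w\<close>.\<close>
 define d where "d = a \<ominus> c \<odot> r"
 have d: "d \<in> component A 0" unfolding d_def by (intro GA.component_minus a(1) smult_component c r0(1))
 note dc = GA.component_closed[OF d]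
 have crc: "c \<odot> r \<in> carrier A" using c(1) rc by simp
 have dr: "r \<otimes> d = d" "d \<otimes> r = d"
  unfolding d_def using r_distr[OF ac' a_inv_closed[OF crc] rc] l_distr[OF ac' a_inv_closed[OF crc] rc] a r0 c(1) rc crc
  by (simp_all add: a_minus_def r_minus l_minus smult_mult_l smult_mult_r)
 have act: "d \<odot>\<^sub>S u = a \<odot>\<^sub>S u \<ominus>\<^sub>S scalar c \<odot>\<^sub>S u" if u: "u \<in> carrier S" "r \<odot>\<^sub>S u = u" for u
  unfolding d_def using S.M.smult_minus_l[OF ac' crc u(1)] S.M.smult_assoc[OF scalar_closed[OF c(1)] rc u(1)] u(2)
  by (simp add: scalar_mult_l[OF c(1) rc])
 have dw: "d \<odot>\<^sub>S w = \<zero>\<^sub>S"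
  using act[OF wc w(2)] w(4) S.M.M.minus_zero_iff[OF S.M.smult_closed[OF scalar_closed[OF c(1)] wc] S.M.smult_closed[OF scalar_closed[OF c(1)] wc]]
  by simp
 have "d \<odot>\<^sub>S x = \<zero>\<^sub>S"
 proof (rule ccontr)
  assume n: "d \<odot>\<^sub>S x ~= \<zero>\<^sub>S"
  have dx: "d \<odot>\<^sub>S x \<in> component S i" using S.smult_component_M[OF d x(1)] by simp
  have "r \<odot>\<^sub>S (d \<odot>\<^sub>S x) = d \<odot>\<^sub>S x" using S.M.smult_assoc[OF rc dc xc] dr(1) by simp
  then obtain f where f: "f \<in> component A 0" "r \<otimes> f = f" "f \<otimes> r = f" "f \<odot>\<^sub>S (d \<odot>\<^sub>S x) = x"
   using corner_element[OF S r0 dx n _ x(1,3)] by auto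
  note fc = GA.component_closed[OF f(1)]
  have t: "f \<otimes> d \<in> component A 0" by (intro mult_component0 f(1) d)
  obtain g where g: "g \<in> component A 0" "g \<otimes> (f \<otimes> d) = r"
   by (rule corner_unit[OF r S.M.left_module_axioms xc x(2) t])
    (use m_assoc[OF rc fc dc] m_assoc[OF fc dc rc] f dr S.M.smult_assoc[OF fc dc xc] in auto)
  note gc = GA.component_closed[OF g(1)]
  have "w = (g \<otimes> f \<otimes> d) \<odot>\<^sub>S w" using g(2) m_assoc[OF gc fc dc] w(2) by simp
  also have "\<dots> = \<zero>\<^sub>S"
   using S.M.smult_assoc[OF m_closed[OF gc fc] dc wc] dw S.M.smult_zero_r[OF m_closed[OF gc fc]] by simp
  finally show False using w(3) by blast
 qed
 then have "y = scalar c \<odot>\<^sub>S x"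
  using act[OF xc x(3)] a(4) S.M.M.minus_zero_iff[OF yc S.M.smult_closed[OF scalar_closed[OF c(1)] xc]] by simp
 then show ?thesis using c(1) by (auto simp: scalar_def)
qed

end

section \<open>Values of the pairing on principal projective modules\<close>

context anti_alg
begin

text \<open>With the single generator \<open>\<psi> r\<close> the idempotent matrix has the one
  entry \<open>\<phi> (\<psi> r) = r\<close>, so the tensor product is \<open>r M\<close> with its
  grading.\<close>

lemma lookup_pairing_principal:
 assumes r: "r \<in> component A 0" "r \<otimes> r = r" and M: "M \<in> fmod K A"
 shows "Poly_Mapping.lookup (pairing (principal (\<psi> r)) M) j =
  int (vectorspace.dim K ((underlying_space A M)\<lparr>carrier := {y \<in> component M j. r \<odot>\<^sub>M y = y}\<rparr>))"
proof -
 note Mm = fmodD[OF M] and rc = GA.component_closed[OF r(1)]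
 have e: "\<psi> r \<in> component A 0" "\<psi> r \<otimes> \<psi> r = \<psi> r"
  using psi_component[OF r(1)] psi_mult[OF rc rc] r(2) by simp_all
 interpret t: tensor_setup K A \<psi> "principal (\<psi> r)" M "{()}" "%_ _. \<psi> r" "%_. 0" "%_ u. u 0"
  by (rule tensor_setupI[OF principal(1)[OF e] Mm(1) principal_dual_basis[OF e]])
 let ?U = "t.W\<lparr>carrier := t.fixed_component j\<rparr>"
 let ?C = "{y \<in> component M j. r \<odot>\<^sub>M y = y}"
 let ?V = "(underlying_space A M)\<lparr>carrier := ?C\<rparr>"
 note sub = corner_submodule[OF Mm(1) r(1), of j]
 have fc: "m \<in> t.fixed_component j \<longleftrightarrow> m () \<in> ?C" for m
  using rc t.M.M.smult_closed[OF rc] t.M.M.component_closed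
  by (auto simp: t.fixed_component_def t.fixed_def)
 have "linear_map K ?U ?V (%m. m ())"
  by (rule linear_mapI[OF t.W.submodule_vectorspace[OF t.fixed_component_submodule] t.M.KM.submodule_vectorspace[OF sub]])
   (use fc in simp_all)
 moreover have "bij_betw (%m. m ()) (carrier ?U) (carrier ?V)"
  by (rule bij_betwI[of _ _ _ "%y _. y"]) (use fc in auto)
 ultimately have "vectorspace.dim K ?U = vectorspace.dim K ?V"
  by (rule linear_bij_dim(2)) (rule t.M.KM.subspace_fin_dim(1)[OF Mm(2) sub])
 then show ?thesis by (simp only: pairing_def t.lookup_gdim[OF Mm(2)])
qed

lemma pairing_not_hit:
 assumes r: "r \<in> component A 0" "r \<otimes> r = r" and M: "M \<in> fmod K A" and n: "\<not> hits r M"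
 shows "pairing (principal (\<psi> r)) M = 0"
proof (rule poly_mapping_eqI)
 fix j
 interpret M: graded_mod K A M by (rule graded_modI[OF fmodD(1)[OF M]])
 have "{y \<in> component M j. r \<odot>\<^sub>M y = y} = {\<zero>\<^sub>M}"
  using n M.M.component_zero M.M.smult_zero_r[OF GA.component_closed[OF r(1)]] by (auto simp: hits_def)
 then show "Poly_Mapping.lookup (pairing (principal (\<psi> r)) M) j = Poly_Mapping.lookup 0 j"
  using vectorspace.fin_dim_if_zero[OF M.KM.submodule_vectorspace[OF corner_submodule[OF fmodD(1)[OF M] r(1), of j]]]
  by (simp add: lookup_pairing_principal[OF r M])
qed

lemma pairing_hit:
 assumes r: "r \<in> component A 0" "r \<otimes> r = r" and M: "M \<in> fmod K A"
  and x: "x \<in> component M j" "x ~= \<zero>\<^sub>M" "r \<odot>\<^sub>M x = x"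
 shows "Poly_Mapping.lookup (pairing (principal (\<psi> r)) M) j > 0"
proof (rule ccontr)
 interpret M: graded_mod K A M by (rule graded_modI[OF fmodD(1)[OF M]])
 note sub = corner_submodule[OF fmodD(1)[OF M] r(1), of j]
 assume "\<not> ?thesis"
 then have d: "vectorspace.dim K ((underlying_space A M)\<lparr>carrier := {y \<in> component M j. r \<odot>\<^sub>M y = y}\<rparr>) = 0"
  by (simp add: lookup_pairing_principal[OF r M])
 have "x \<in> {\<zero>\<^sub>M}"
  using vectorspace.dim_zeroD[OF M.KM.submodule_vectorspace[OF sub] M.KM.subspace_fin_dim(1)[OF fmodD(2)[OF M] sub] d]
   x(1,3) by auto
 then show False using x(2) by simp
qed

text \<open>In degree 0 every vector of \<open>r S\<close> is a multiple of \<open>x\<close>, by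
  \<open>corner_scalar\<close>; in the other degrees \<open>r S\<close> vanishes, by
  \<open>corner_off_diagonal\<close>.\<close>

lemma pairing_hit_simple:
 fixes S :: "'a amodule"
 assumes ac: "algebraically_closed K" and r: "local_idempotent r" and S: "graded_simple A S"
  and x: "x \<in> component S 0" "x ~= \<zero>\<^sub>S" "r \<odot>\<^sub>S x = x"
 shows "pairing (principal (\<psi> r)) S = 1"
proof (rule poly_mapping_eqI)
 fix j
 interpret S: graded_mod K A S by (rule graded_simpleD(1)[OF S])
 have r0: "r \<in> component A 0" "r \<otimes> r = r" using r by (auto simp: local_idempotent_def)
 note Sf = graded_simple_fin_dim[OF S]
 note fd = fmodD(2)[OF Sf]
 note sub = corner_submodule[OF S.graded_module r0(1), of j]
 let ?V = "(underlying_space A S)\<lparr>carrier := {y \<in> component S j. r \<odot>\<^sub>S y = y}\<rparr>"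
 have "vectorspace.dim K ?V = (if j = 0 then 1 else 0)"
 proof (cases "j = 0")
  case True
  have "vectorspace.dim K ?V = 1"
  proof (rule vectorspace.dim_one[OF S.KM.submodule_vectorspace[OF sub], of x])
   show "x \<in> carrier ?V" "x ~= \<zero>\<^bsub>?V\<^esub>" using x True by simp_all
   fix y assume "y \<in> carrier ?V"
   then have y: "y \<in> component S 0" "r \<odot>\<^sub>S y = y" using True by simp_all
   show "\<exists>c\<in>carrier K. y = c \<odot>\<^bsub>?V\<^esub> x"
    using corner_scalar[OF ac S fd r x y] by simp
  qed
  then show ?thesis using True by simp
 next
  case False
  have "y = \<zero>\<^sub>S" if "y \<in> component S j" "r \<odot>\<^sub>S y = y" for y
   by (rule corner_off_diagonal[OF S fd r x that]) (use False in simp)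
  then have "{y \<in> component S j. r \<odot>\<^sub>S y = y} = {\<zero>\<^sub>S}"
   using S.M.component_zero S.M.smult_zero_r[OF GA.component_closed[OF r0(1)]] by auto
  then show ?thesis
   using vectorspace.fin_dim_if_zero[OF S.KM.submodule_vectorspace[OF sub]] False by simp
 qed
 then show "Poly_Mapping.lookup (pairing (principal (\<psi> r)) S) j = Poly_Mapping.lookup 1 j"
  by (simp add: lookup_pairing_principal[OF r0 Sf] lookup_one when_def)
qed

lemma local_idempotent_psi:
 assumes r: "local_idempotent r"
 shows "local_idempotent (\<psi> r)"
proof -
 have r0: "r \<in> component A 0" "r \<otimes> r = r" "r ~= \<zero>" using r by (auto simp: local_idempotent_def)
 note rc = GA.component_closed[OF r0(1)]
 show ?thesis
  unfolding local_idempotent_def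
 proof (intro conjI ballI impI)
  show "\<psi> r \<in> component A 0" by (rule psi_component[OF r0(1)])
  show "\<psi> r \<otimes> \<psi> r = \<psi> r" using psi_mult[OF rc rc] r0(2) by simp
  show "\<psi> r ~= \<zero>" using r0(3) psi_inj[OF rc zero_closed] psi_zero by simp
  fix b assume b: "b \<in> component A 0" "\<psi> r \<otimes> b = b" "b \<otimes> \<psi> r = b"
  note bc [simp] = GA.component_closed[OF b(1)]
  have pc [simp]: "\<phi> b \<in> carrier A" by (rule phi_closed[OF bc])
  have "r \<otimes> \<phi> b = \<phi> b" "\<phi> b \<otimes> r = \<phi> b"
   using phi_mult[OF bc psi_closed[OF rc]] phi_mult[OF psi_closed[OF rc] bc] b rc by simp_all
  then consider n :: nat where "\<phi> b [^] n = \<zero>" | c where "c \<in> component A 0" "c \<otimes> \<phi> b = r" "\<phi> b \<otimes> c = r"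
   using r phi_component[OF b(1)] unfolding local_idempotent_def by blast
  then show "(\<exists>n::nat. b [^] n = \<zero>) \<or> (\<exists>c\<in>component A 0. c \<otimes> b = \<psi> r \<and> b \<otimes> c = \<psi> r)"
  proof cases
   case 1
   then show ?thesis using psi_pow[OF pc, of n] psi_zero by auto
  next
   case 2
   note cc = GA.component_closed[OF 2(1)]
   have "b \<otimes> \<psi> c = \<psi> r" "\<psi> c \<otimes> b = \<psi> r"
    using psi_mult[OF cc pc] psi_mult[OF pc cc] 2(2,3) by simp_all
   then show ?thesis using psi_component[OF 2(1)] by blast
  qed
 qed
qed

end

section \<open>Grothendieck groups\<close>

lemma laurent_ring_sel [simp]:
 "carrier laurent_ring = UNIV" "\<zero>\<^bsub>laurent_ring\<^esub> = 0" "\<one>\<^bsub>laurent_ring\<^esub> = 1"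
 "c \<oplus>\<^bsub>laurent_ring\<^esub> d = c + d" "c \<otimes>\<^bsub>laurent_ring\<^esub> d = c * d"
 by (simp_all add: class_ring_simps)

lemma laurent_cring: "cring laurent_ring"
proof (rule cringI)
 show "abelian_group laurent_ring"
  by (rule abelian_groupI) (auto simp: algebra_simps intro: exI[of _ "- x" for x])
 show "comm_monoid laurent_ring"
  by (rule comm_monoidI) (auto simp: algebra_simps)
qed (simp add: algebra_simps)

abbreviation functionals :: "(laurent, 'm, 'z) module_scheme => ('m => laurent) set" where
 "functionals M \<equiv> LinearCombinations.module_hom laurent_ring M (regular_left laurent_ring)"

lemma laurent_functional_iff:
 "t \<in> functionals M \<longleftrightarrow>
  (\<forall>x\<in>carrier M. \<forall>y\<in>carrier M. t (x \<oplus>\<^sub>M y) = t x + t y) \<and> (\<forall>c. \<forall>x\<in>carrier M. t (c \<odot>\<^sub>M x) = c * t x)"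
 by (auto simp: LinearCombinations.module_hom_def regular_left_def)

lemma shift_shift: "shift k (shift l M) = shift (k + l) M" for M :: "('a, 'm) gmodule"
 by (simp add: shift_def algebra_simps)

lemma shift_0 [simp]: "shift 0 M = M" for M :: "('a, 'm) gmodule"
 by (simp add: shift_def)

lemma short_exact_shift:
 assumes "short_exact A M' M M''"
 shows "short_exact A (shift n M') (shift n M) (shift n M'')"
proof -
 have h: "graded_hom A (shift n N) (shift n N') = graded_hom A N N'" for N N' :: "('a, 'm) gmodule"
 proof -
  have "(\<forall>i. h ` component N (i - n) \<subseteq> component N' (i - n)) \<longleftrightarrow> (\<forall>i. h ` component N i \<subseteq> component N' i)" for h
   by (metis add_diff_cancel)
  then show ?thesis by (simp add: graded_hom_def shift_def LinearCombinations.module_hom_def)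
 qed
 have c: "carrier (shift n N) = carrier N" and z: "\<zero>\<^bsub>shift n N\<^esub> = \<zero>\<^sub>N" for N :: "('a, 'm) gmodule"
  by (simp_all add: shift_def)
 show ?thesis using assms unfolding short_exact_def h a_kernel_def' c z .
qed

lemma frag_induct [case_names zero one diff]:
 fixes x :: "'c \<Rightarrow>\<^sub>0 int"
 assumes "Q 0" "!!k. Q (frag_of k)" "!!x y. Q x ==> Q y ==> Q (x - y)"
 shows "Q x"
 by (rule frag_induction[OF subset_UNIV]) (use assms in blast)+

text \<open>The scalar action inside \<open>free_grothendieck\<close>, given a name so that its
  biadditivity can be used for rewriting.\<close>

definition laurent_act :: "laurent => (('a, 'm) gmodule \<Rightarrow>\<^sub>0 int) => ('a, 'm) gmodule \<Rightarrow>\<^sub>0 int" where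
 "laurent_act c x = frag_extend (%k. frag_extend (%M. frag_of (shift k M)) x) c"

lemma laurent_act_left [simp]:
 "laurent_act 0 x = 0" "laurent_act (c - d) x = laurent_act c x - laurent_act d x"
 "laurent_act (c + d) x = laurent_act c x + laurent_act d x" "laurent_act (- c) x = - laurent_act c x"
 by (simp_all add: laurent_act_def frag_extend_diff frag_extend_add frag_extend_minus)

lemma laurent_act_monomial: "laurent_act (frag_of k) x = frag_extend (%M. frag_of (shift k M)) x"
 by (simp add: laurent_act_def)

lemma laurent_act_of [simp]: "laurent_act (frag_of k) (frag_of M) = frag_of (shift k M)"
 by (simp add: laurent_act_def)

lemma laurent_act_diff_right [simp]: "laurent_act c (x - y) = laurent_act c x - laurent_act c y"
proof (induct c rule: frag_induct)
 case (one k)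
 show ?case by (simp only: laurent_act_monomial frag_extend_diff)
qed simp_all

lemma laurent_act_0 [simp]: "laurent_act c 0 = 0"
 using laurent_act_diff_right[of c 0 0] by simp

lemma laurent_act_add_right [simp]: "laurent_act c (x + y) = laurent_act c x + laurent_act c y"
 using laurent_act_diff_right[of c "x + y" y] by (simp add: algebra_simps del: laurent_act_diff_right)

lemma laurent_act_assoc: "laurent_act (c * d) x = laurent_act c (laurent_act d x)"
proof -
 have 1: "laurent_act (frag_of k * frag_of l) x = laurent_act (frag_of k) (laurent_act (frag_of l) x)" for k l
  by (induct x rule: frag_induct) (simp_all add: mult_single shift_shift)
 have 2: "laurent_act (frag_of k * d) x = laurent_act (frag_of k) (laurent_act d x)" for k
  by (induct d rule: frag_induct) (simp_all only: 1 mult_zero_right right_diff_distrib laurent_act_left laurent_act_0 laurent_act_diff_right)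
 show ?thesis
  by (induct c rule: frag_induct) (simp_all only: 2 mult_zero_left left_diff_distrib laurent_act_left)
qed

lemma laurent_act_one [simp]: "laurent_act 1 x = x"
proof -
 have "laurent_act (frag_of 0) x = x"
  by (induct x rule: frag_induct) (simp_all del: single_one)
 then show ?thesis by simp
qed

section \<open>Grothendieck groups as modules over Laurent polynomials\<close>

locale shift_closed =
 fixes A :: "('k, 'a) gmodule" and C :: "('a, 'm) gmodule set"
 assumes shift_mem: "M \<in> C ==> shift n M \<in> C"
begin

abbreviation "F \<equiv> free_grothendieck C"
abbreviation "rel \<equiv> grothendieck_relations A C"

lemma F_carrier: "x \<in> carrier F \<longleftrightarrow> Poly_Mapping.keys x \<subseteq> C"
 by (simp add: free_grothendieck_def)

lemma F_sel [simp]: "\<zero>\<^sub>F = 0" "x \<oplus>\<^sub>F y = x + y" "c \<odot>\<^sub>F x = laurent_act c x"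
 by (simp_all add: free_grothendieck_def laurent_act_def)

lemma F_zero [simp]: "0 \<in> carrier F"
 by (simp add: F_carrier)

lemma frag_closed [simp]: "M \<in> C ==> frag_of M \<in> carrier F"
 by (simp add: F_carrier)

lemma F_diff [simp]: "x \<in> carrier F ==> y \<in> carrier F ==> x - y \<in> carrier F"
 unfolding F_carrier using keys_diff[of x y] by blast

lemma F_uminus [simp]: "x \<in> carrier F ==> - x \<in> carrier F"
 using F_diff[of 0 x] by simp

lemma F_add [simp]: "x \<in> carrier F ==> y \<in> carrier F ==> x + y \<in> carrier F"
 using F_diff[of x "- y"] by simp

lemma free_induct [consumes 1, case_names zero one diff]:
 assumes "x \<in> carrier F" "Q 0" "!!M. M \<in> C ==> Q (frag_of M)"
  "!!x y. x \<in> carrier F ==> y \<in> carrier F ==> Q x ==> Q y ==> Q (x - y)"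
 shows "Q x"
proof -
 have "x \<in> carrier F \<and> Q x"
  using assms(1)[unfolded F_carrier]
 proof (induct x rule: frag_induction)
  case (diff a b)
  then show ?case using assms(4)[of a b] by simp
 qed (use assms(2,3) in simp_all)
 then show ?thesis by simp
qed

lemma act_closed [simp]: "x \<in> carrier F ==> laurent_act c x \<in> carrier F"
proof -
 assume x: "x \<in> carrier F"
 have "laurent_act (frag_of k) x \<in> carrier F" for k
  using x by (induct rule: free_induct) (simp_all add: shift_mem)
 then show ?thesis by (induct c rule: frag_induct) simp_all
qed

lemma F_abelian_group: "abelian_group F"
proof (rule abelian_groupI)
 show "\<exists>y\<in>carrier F. y \<oplus>\<^sub>F x = \<zero>\<^sub>F" if "x \<in> carrier F" for x
  using that by (intro bexI[of _ "- x"]) simp_all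
qed (simp_all add: algebra_simps)

lemma F_left_module: "left_module laurent_ring F"
proof (rule left_moduleI)
 show "ring laurent_ring" using laurent_cring by (rule cring.axioms(1))
 show "abelian_group F" by (rule F_abelian_group)
qed (simp_all add: laurent_act_assoc)

lemma F_inv: "x \<in> carrier F ==> \<ominus>\<^sub>F x = - x"
proof -
 assume x: "x \<in> carrier F"
 interpret F: abelian_group F by (rule F_abelian_group)
 show ?thesis by (rule F.minus_equality) (use x in simp_all)
qed

lemma F_minus: "x \<in> carrier F ==> y \<in> carrier F ==> x \<ominus>\<^sub>F y = x - y"
 by (simp add: a_minus_def F_inv)

lemma rel_gens:
 "{frag_of M - (frag_of M' + frag_of M'') | M' M M''. M' \<in> C \<and> M \<in> C \<and> M'' \<in> C \<and> short_exact A M' M M''} \<subseteq> carrier F"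
proof
 fix x assume "x \<in> {frag_of M - (frag_of M' + frag_of M'') | M' M M''. M' \<in> C \<and> M \<in> C \<and> M'' \<in> C \<and> short_exact A M' M M''}"
 then obtain M' M M'' where "x = frag_of M - (frag_of M' + frag_of M'')" "M' \<in> C" "M \<in> C" "M'' \<in> C" by blast
 then show "x \<in> carrier F" by simp
qed

lemma rel_subgroup: "subgroup rel (add_monoid F)"
proof -
 interpret F: abelian_group F by (rule F_abelian_group)
 show ?thesis unfolding grothendieck_relations_def using F.add.generate_is_subgroup rel_gens by simp
qed

lemma rel_closed: "x \<in> rel ==> x \<in> carrier F"
 using subsetD[OF subgroup.subset[OF rel_subgroup]] by simp

lemma rel_diff: "x \<in> rel ==> y \<in> rel ==> x - y \<in> rel"
 using subgroup.m_closed[OF rel_subgroup, of x "- y"] subgroup.m_inv_closed[OF rel_subgroup, of y]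
  F_inv[OF rel_closed, of y] by (simp add: a_inv_def)

lemma rel_exact:
 "M' \<in> C ==> M \<in> C ==> M'' \<in> C ==> short_exact A M' M M'' ==> frag_of M - (frag_of M' + frag_of M'') \<in> rel"
 unfolding grothendieck_relations_def by (rule generate.incl) blast

text \<open>A subgroup is generated by differences alone: an inverse is a difference from 0, and a
  sum is the difference from an inverse. One closure case therefore suffices.\<close>

lemma rel_induct [consumes 1, case_names zero exact diff]:
 assumes "x \<in> rel" "Q 0"
  "!!M' M M''. M' \<in> C ==> M \<in> C ==> M'' \<in> C ==> short_exact A M' M M'' ==> Q (frag_of M - (frag_of M' + frag_of M''))"
  "!!x y. x \<in> rel ==> y \<in> rel ==> Q x ==> Q y ==> Q (x - y)"
 shows "Q x"
proof -
 have z: "0 \<in> rel" using subgroup.one_closed[OF rel_subgroup] by simp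
 have "x \<in> rel \<and> Q x"
  using assms(1)[unfolded grothendieck_relations_def]
 proof (induct rule: generate.induct)
  case one
  show ?case using z assms(2) by simp
 next
  case (incl h)
  then show ?case using assms(3) rel_exact by blast
 next
  case (inv h)
  then have h: "h \<in> rel" "Q h" using assms(3) rel_exact by auto
  have "inv\<^bsub>add_monoid F\<^esub> h = 0 - h" using F_inv[OF rel_closed[OF h(1)]] by (simp add: a_inv_def)
  then show ?case using assms(4)[OF z h(1) assms(2) h(2)] rel_diff[OF z h(1)] by simp
 next
  case (eng h1 h2)
  then have h: "h1 \<in> rel" "Q h1" "h2 \<in> rel" "Q h2" by simp_all
  have h2: "0 - h2 \<in> rel" "Q (0 - h2)" using assms(4)[OF z h(3) assms(2) h(4)] rel_diff[OF z h(3)] by simp_all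
  have "h1 \<otimes>\<^bsub>add_monoid F\<^esub> h2 = h1 - (0 - h2)" by simp
  then show ?case using assms(4)[OF h(1) h2(1) h(2) h2(2)] rel_diff[OF h(1) h2(1)] by simp
 qed
 then show ?thesis by simp
qed

text \<open>Shifting an exact sequence gives an exact sequence, so monomials preserve the relations;
  differences of monomials give the rest.\<close>

lemma rel_act: "x \<in> rel ==> laurent_act c x \<in> rel"
proof -
 assume x: "x \<in> rel"
 have z: "0 \<in> rel" using subgroup.one_closed[OF rel_subgroup] by simp
 have 1: "laurent_act (frag_of k) x \<in> rel" for k
  using x
 proof (induct rule: rel_induct)
  case (exact M' M M'')
  then show ?case
   using rel_exact[OF shift_mem[OF exact(1), of k] shift_mem[OF exact(2)] shift_mem[OF exact(3)] short_exact_shift[OF exact(4)]]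
   by simp
 qed (simp_all add: z rel_diff)
 show ?thesis by (induct c rule: frag_induct) (simp_all add: z rel_diff 1)
qed

sublocale Q: coset_quotient laurent_ring F rel
 using F_left_module rel_subgroup rel_act
 by (simp add: coset_quotient_def coset_quotient_axioms_def left_submodule_def)

lemma K0_left_module: "left_module laurent_ring (K0 A C)"
 unfolding K0_def by (rule Q.quotient_left_module)

lemma K0_carrierE:
 assumes "u \<in> carrier (K0 A C)"
 obtains x where "x \<in> carrier F" "u = rel +>\<^sub>F x"
 using assms Q.quotient_carrierE unfolding K0_def by blast

lemma K0_class_closed: "M \<in> C ==> K0_class A C M \<in> carrier (K0 A C)"
 unfolding K0_def K0_class_def Q.quotient_carrier using frag_closed by blast

lemma K0_class_exact:
 assumes "M' \<in> C" "M \<in> C" "M'' \<in> C" "short_exact A M' M M''"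
 shows "K0_class A C M = K0_class A C M' \<oplus>\<^bsub>K0 A C\<^esub> K0_class A C M''"
proof -
 have c: "frag_of M' + frag_of M'' \<in> carrier F" using assms(1,3) by simp
 show ?thesis
  unfolding K0_def K0_class_def Q.quotient_add[OF frag_closed[OF assms(1)] frag_closed[OF assms(3)]] F_sel(2)
  unfolding Q.coset_eq_iff[OF frag_closed[OF assms(2)] c] F_minus[OF frag_closed[OF assms(2)] c]
  by (rule rel_exact[OF assms])
qed

lemma K0_class_shift: "M \<in> C ==> K0_class A C (shift n M) = frag_of n \<odot>\<^bsub>K0 A C\<^esub> K0_class A C M"
 unfolding K0_def K0_class_def by (subst Q.quotient_smult[OF _ frag_closed]) simp_all

text \<open>Classes generate the free group, and subtraction is available in a submodule through the
  scalar -1.\<close>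

lemma K0_generated:
 assumes U: "left_submodule laurent_ring U (K0 A C)" and cl: "!!M. M \<in> C ==> K0_class A C M \<in> U"
 shows "carrier (K0 A C) \<subseteq> U"
proof
 interpret K: left_module laurent_ring "K0 A C" by (rule K0_left_module)
 interpret U: coset_quotient laurent_ring "K0 A C" U
  using U K.left_module_axioms by (simp add: coset_quotient_def coset_quotient_axioms_def)
 have *: "rel +>\<^sub>F x \<in> U" if "x \<in> carrier F" for x
  using that
 proof (induct rule: free_induct)
  case zero
  then show ?case using U.N(3) unfolding K0_def Q.quotient_zero by simp
 next
  case (one M)
  then show ?case using cl by (simp add: K0_class_def)
 next
  case (diff x y)
  have m: "(-1 :: laurent) \<in> carrier laurent_ring" by simp
  have ay: "laurent_act (-1) y = - y" by simp
  have nc: "- y \<in> carrier F" using diff(2) by simp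
  have "(rel +>\<^sub>F x) \<oplus>\<^bsub>K0 A C\<^esub> ((-1) \<odot>\<^bsub>K0 A C\<^esub> (rel +>\<^sub>F y)) = rel +>\<^sub>F (x - y)"
   unfolding K0_def Q.quotient_smult[OF m diff(2)] F_sel(3) ay Q.quotient_add[OF diff(1) nc] by simp
  moreover have "(rel +>\<^sub>F x) \<oplus>\<^bsub>K0 A C\<^esub> ((-1) \<odot>\<^bsub>K0 A C\<^esub> (rel +>\<^sub>F y)) \<in> U"
   by (intro U.N(4) diff(3) U.N(7)[OF m] diff(4))
  ultimately show ?case by simp
 qed
 fix u assume "u \<in> carrier (K0 A C)"
 then obtain x where "x \<in> carrier F" "u = rel +>\<^sub>F x" unfolding K0_def using Q.quotient_carrierE by blast
 then show "u \<in> U" using * by simp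
qed

lemma K0_functional_eq:
 assumes t: "t \<in> functionals (K0 A C)"
  "t' \<in> functionals (K0 A C)"
  and eq: "!!M. M \<in> C ==> t (K0_class A C M) = t' (K0_class A C M)" and u: "u \<in> carrier (K0 A C)"
 shows "t u = t' u"
proof -
 interpret K: left_module laurent_ring "K0 A C" by (rule K0_left_module)
 let ?U = "{u \<in> carrier (K0 A C). t u = t' u}"
 have t0: "t \<zero>\<^bsub>K0 A C\<^esub> = 0" if "t \<in> functionals (K0 A C)" for t
 proof -
  have "t (0 \<odot>\<^bsub>K0 A C\<^esub> \<zero>\<^bsub>K0 A C\<^esub>) = 0 * t \<zero>\<^bsub>K0 A C\<^esub>" using that unfolding laurent_functional_iff by simp
  then show ?thesis using K.smult_zero_l[OF K.M.zero_closed] by simp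
 qed
 have m: "\<ominus>\<^bsub>K0 A C\<^esub> x = (-1) \<odot>\<^bsub>K0 A C\<^esub> x" if "x \<in> carrier (K0 A C)" for x
 proof (rule K.M.minus_equality)
  show "(-1) \<odot>\<^bsub>K0 A C\<^esub> x \<oplus>\<^bsub>K0 A C\<^esub> x = \<zero>\<^bsub>K0 A C\<^esub>"
   using K.smult_l_distr[of "-1" 1 x] K.smult_one[OF that] K.smult_zero_l[OF that] that by simp
 qed (use that K.smult_closed[of "-1" x] in auto)
 have "left_submodule laurent_ring ?U (K0 A C)"
  unfolding left_submodule_def
 proof
  show "subgroup ?U (add_monoid (K0 A C))"
  proof (rule K.M.add_subgroupI)
   show "\<zero>\<^bsub>K0 A C\<^esub> \<in> ?U" using t0[OF t(1)] t0[OF t(2)] by simp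
  qed (use t in \<open>auto simp: laurent_functional_iff m K.smult_closed\<close>)
 qed (use t in \<open>auto simp: laurent_functional_iff K.smult_closed\<close>)
 then have "carrier (K0 A C) \<subseteq> ?U" by (rule K0_generated) (use eq K0_class_closed in auto)
 then show ?thesis using u by blast
qed

text \<open>The universal property: additivity of \<open>\<tau>\<close> on exact sequences makes its
  additive extension vanish on the relations, and compatibility with shifts makes it linear over
  Laurent polynomials.\<close>

lemma K0_functional_exists:
 fixes \<tau> :: "('a, 'm) gmodule => laurent"
 assumes ex: "!!M' M M''. M' \<in> C ==> M \<in> C ==> M'' \<in> C ==> short_exact A M' M M'' ==> \<tau> M = \<tau> M' + \<tau> M''"
  and sh: "!!n M. M \<in> C ==> \<tau> (shift n M) = frag_of n * \<tau> M"
 obtains t where "t \<in> functionals (K0 A C)"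
  "\<forall>M\<in>C. t (K0_class A C M) = \<tau> M"
proof -
 let ?E = "frag_extend \<tau>"
 have rel0: "?E x = 0" if "x \<in> rel" for x
  using that
 proof (induct rule: rel_induct)
  case (exact M' M M'')
  then show ?case using ex[OF exact] by (simp add: frag_extend_diff frag_extend_add)
 qed (simp_all add: frag_extend_diff)
 define t where "t u = ?E (SOME x. x \<in> carrier F \<and> u = rel +>\<^sub>F x)" for u
 have t: "t (rel +>\<^sub>F x) = ?E x" if x: "x \<in> carrier F" for x
 proof -
  define y where "y = (SOME y. y \<in> carrier F \<and> rel +>\<^sub>F x = rel +>\<^sub>F y)"
  have y: "y \<in> carrier F \<and> rel +>\<^sub>F x = rel +>\<^sub>F y"
   unfolding y_def by (rule someI[of _ x]) (use x in simp)
  have yc: "y \<in> carrier F" using y by blast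
  then have "x \<ominus>\<^sub>F y \<in> rel" using Q.coset_eq_iff[OF x yc] y by blast
  then have "?E (x - y) = 0" using rel0 unfolding F_minus[OF x yc] by blast
  then show ?thesis unfolding t_def y_def[symmetric] by (simp add: frag_extend_diff)
 qed
 have E: "?E (laurent_act c x) = c * ?E x" if x: "x \<in> carrier F" for c x
 proof -
  have 1: "?E (laurent_act (frag_of k) x) = frag_of k * ?E x" for k
   using x by (induct rule: free_induct) (simp_all add: sh frag_extend_diff right_diff_distrib)
  show ?thesis by (induct c rule: frag_induct) (simp_all add: 1 frag_extend_diff left_diff_distrib)
 qed
 have "t (u \<oplus>\<^bsub>K0 A C\<^esub> v) = t u + t v" if u: "u \<in> carrier (K0 A C)" and v: "v \<in> carrier (K0 A C)" for u v
 proof -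
  obtain x where x: "x \<in> carrier F" "u = rel +>\<^sub>F x" by (rule K0_carrierE[OF u])
  obtain y where y: "y \<in> carrier F" "v = rel +>\<^sub>F y" by (rule K0_carrierE[OF v])
  have "x + y \<in> carrier F" using x(1) y(1) by simp
  then show ?thesis
   unfolding x(2) y(2) K0_def Q.quotient_add[OF x(1) y(1)] F_sel(2) t[OF x(1)] t[OF y(1)] by (simp add: t frag_extend_add)
 qed
 moreover have "t (c \<odot>\<^bsub>K0 A C\<^esub> u) = c * t u" if u: "u \<in> carrier (K0 A C)" for c u
 proof -
  obtain x where x: "x \<in> carrier F" "u = rel +>\<^sub>F x" by (rule K0_carrierE[OF u])
  have c: "c \<in> carrier laurent_ring" by simp
  show ?thesis
   unfolding x(2) K0_def Q.quotient_smult[OF c x(1)] F_sel(3) t[OF x(1)] t[OF act_closed[OF x(1)]] by (rule E[OF x(1)])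
 qed
 ultimately have "t \<in> functionals (K0 A C)"
  unfolding laurent_functional_iff by blast
 moreover have "\<forall>M\<in>C. t (K0_class A C M) = \<tau> M"
  unfolding K0_class_def using t[OF frag_closed] by simp
 ultimately show thesis by (rule that)
qed

end

text \<open>For a zero module, \<open>M\<close>, \<open>M\<close>, \<open>M\<close> is itself a
  short exact sequence, so the class equals twice itself.\<close>

lemma (in shift_closed) K0_class_zero:
 assumes M: "M \<in> C" "carrier M = {\<zero>\<^sub>M}"
 shows "K0_class A C M = \<zero>\<^bsub>K0 A C\<^esub>"
proof -
 interpret K: left_module laurent_ring "K0 A C" by (rule K0_left_module)
 have "short_exact A M M M"
  unfolding short_exact_def a_kernel_def'
  by (intro bexI[of _ "%x. x"] graded_hom_id) (use M(2) in auto)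
 from K0_class_exact[OF M(1) M(1) M(1) this] show ?thesis
  using K.M.add.l_cancel_one[OF K0_class_closed[OF M(1)] K0_class_closed[OF M(1)]] by simp
qed

context graded_alg
begin

lemma short_exact_kernel:
 assumes M: "graded_module A M" and N: "graded_module A N" and h: "h \<in> graded_hom A M N" "h ` carrier M = carrier N"
 shows "short_exact A (submod M {x \<in> carrier M. h x = \<zero>\<^sub>N}) M N"
proof -
 interpret h: graded_map K A M N h by (rule graded_mapI[OF graded_alg_axioms M N h(1)])
 show ?thesis
  unfolding short_exact_def a_kernel_def'
  by (intro bexI[OF _ h.M.submod_inclusion[OF h.kernel]] bexI[OF _ h(1)]) (use h(2) in auto)
qed

lemma fin_dim_generates:
 assumes M: "graded_module A M" and fd: "vectorspace.fin_dim K (underlying_space A M)"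
 obtains G where "finite G" "generates A G M"
proof -
 interpret M: graded_mod K A M by (rule graded_modI[OF M])
 obtain G where G: "finite G" "G \<subseteq> carrier M" "M.KM.span G = carrier M"
  using fd by (auto simp: M.KM.fin_dim_def)
 have "N = carrier M" if N: "graded_submodule A N M" "G \<subseteq> N" for N
 proof -
  note D = M.graded_submoduleD[OF N(1)]
  have "submodule K N (underlying_space A M)"
   by (rule M.KM.submoduleI') (use D scalar_closed in \<open>auto simp: scalar_def\<close>)
  then show ?thesis using M.KM.span_is_subset[OF N(2)] G(3) D(2) by auto
 qed
 then show thesis using that G(1,2) by (auto simp: generates_def)
qed

lemma submod_fmod:
 fixes M :: "'a amodule"
 assumes M: "M \<in> fmod K A" and N: "graded_submodule A N M"
 shows "submod M N \<in> fmod K A"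
  and "N ~= carrier M ==> vectorspace.dim K (underlying_space A (submod M N)) < vectorspace.dim K (underlying_space A M)"
proof -
 interpret M: graded_mod K A M by (rule graded_modI[OF fmodD(1)[OF M]])
 note D = M.graded_submoduleD[OF N]
 have u: "underlying_space A (submod M N) = (underlying_space A M)\<lparr>carrier := N\<rparr>"
  by (simp add: underlying_space_def pullback_def submod_def)
 have s: "submodule K N (underlying_space A M)"
  by (rule M.KM.submoduleI') (use D scalar_closed in \<open>auto simp: scalar_def\<close>)
 show "submod M N \<in> fmod K A"
  using M.KM.subspace_fin_dim(1)[OF fmodD(2)[OF M] s] M.submod_graded_module[OF N] by (simp add: fmod_def u)
 show "vectorspace.dim K (underlying_space A (submod M N)) < vectorspace.dim K (underlying_space A M)" if "N ~= carrier M"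
  unfolding u using M.KM.subspace_fin_dim(2,3)[OF fmodD(2)[OF M] s] that by force
qed

end

text \<open>Evaluation at \<open>q = 1\<close>; on graded dimensions it gives the total
  dimension.\<close>

definition total :: "laurent => int" where
 "total p = (\<Sum>k\<in>Poly_Mapping.keys p. Poly_Mapping.lookup p k)"

lemma total_add: "total (p + q) = total p + total q"
proof -
 \<comment> \<open>Collapsing all exponents to a point writes \<open>total\<close> as an additive
   extension, from which additivity is immediate.\<close>
 have "total p = Poly_Mapping.lookup (frag_extend (%_. frag_of ()) p) ()" for p
  by (simp add: total_def frag_extend_def lookup_sum)
 then show ?thesis by (simp add: frag_extend_add lookup_add)
qed

lemma total_nonneg: "(!!j. Poly_Mapping.lookup p j \<ge> 0) ==> total p \<ge> 0"
 by (simp add: total_def sum_nonneg)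

lemma total_pos: "(!!j. Poly_Mapping.lookup p j \<ge> 0) ==> Poly_Mapping.lookup p j > 0 ==> total p > 0"
 unfolding total_def by (rule sum_pos2[of _ j]) (auto simp: in_keys_iff)

section \<open>Generators of the two Grothendieck groups\<close>

context anti_alg
begin

sublocale G: shift_closed A "fmod K A"
 by unfold_locales (rule shift_fmod)

sublocale P: shift_closed A "Defs.pmod A"
 by unfold_locales (rule shift_pmod)

text \<open>Induction on dimension instead of a composition series: a simple quotient
  \<open>Q\<close> has a kernel of smaller dimension, and \<open>Q\<close> is a shift of some
  \<open>L r\<close> because the same local idempotent hits both.\<close>

lemma fmod_generated:
 assumes R: "!!r. r \<in> R ==> local_idempotent r" "!!S :: 'a amodule. graded_simple A S ==> \<exists>r\<in>R. hits r S"
  "!!r. r \<in> R ==> graded_simple A (L r)" "!!r. r \<in> R ==> hits r (L r)"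
  and U: "left_submodule laurent_ring U (K0 A (fmod K A))" "!!r. r \<in> R ==> K0_class A (fmod K A) (L r) \<in> U"
 shows "M \<in> fmod K A ==> K0_class A (fmod K A) M \<in> U"
proof (induct "vectorspace.dim K (underlying_space A M)" arbitrary: M rule: less_induct)
 case less
 note M = less(2)
 interpret U: coset_quotient laurent_ring "K0 A (fmod K A)" U
  using U(1) G.K0_left_module by (simp add: coset_quotient_def coset_quotient_axioms_def)
 interpret M: graded_mod K A M by (rule graded_modI[OF fmodD(1)[OF M]])
 show ?case
 proof (cases "carrier M = {\<zero>\<^sub>M}")
  case True
  then show ?thesis using G.K0_class_zero[OF M] U.N(3) by simp
 next
  case False
  obtain G where G: "finite G" "generates A G M" using fin_dim_generates[OF fmodD[OF M]] .
  obtain Q :: "'a amodule" and \<rho> where Q: "graded_simple A Q" "\<rho> \<in> graded_hom A M Q" "carrier Q = \<rho> ` carrier M"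
   using M.exists_simple_quotient[OF G False] .
  have Qg: "graded_module A Q" using Q(1) by (simp add: graded_simple_def)
  interpret \<rho>: graded_map K A M Q \<rho> by (rule graded_mapI[OF graded_alg_axioms M.graded_module Qg Q(2)])
  let ?N = "{x \<in> carrier M. \<rho> x = \<zero>\<^sub>Q}"
  have "\<rho> ` carrier M ~= {\<zero>\<^sub>Q}" using graded_simpleD(2)[OF Q(1)] unfolding Q(3) .
  then have N: "?N ~= carrier M" using M.M.M.zero_closed by force
  note sub = submod_fmod[OF M \<rho>.kernel]
  have NU: "K0_class A (fmod K A) (submod M ?N) \<in> U" by (rule less(1)[OF sub(2)[OF N] sub(1)])
  have Qf: "Q \<in> fmod K A" by (rule graded_simple_fin_dim[OF Q(1)])
  obtain r where r: "r \<in> R" "hits r Q" using R(2)[OF Q(1)] by blast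
  obtain k h where h: "h \<in> graded_hom A Q (shift k (L r))" "bij_betw h (carrier Q) (carrier (L r))"
   using simple_iso[OF R(1)[OF r(1)] Q(1) R(3)[OF r(1)] r(2) R(4)[OF r(1)]] .
  have Lf: "L r \<in> fmod K A" by (rule graded_simple_fin_dim[OF R(3)[OF r(1)]])
  note sL = shift_fmod[OF Lf, of k]
  have hs: "h ` carrier Q = carrier (shift k (L r))" using bij_betw_imp_surj_on[OF h(2)] by (simp add: shift_def)
  interpret h: graded_map K A Q "shift k (L r)" h by (rule graded_mapI[OF graded_alg_axioms Qg fmodD(1)[OF sL] h(1)])
  \<comment> \<open>The isomorphism from \<open>Q\<close> to a shift of \<open>L r\<close> enters as
    an exact sequence with zero kernel, which identifies the classes.\<close>
  let ?Z = "{x \<in> carrier Q. h x = \<zero>\<^bsub>shift k (L r)\<^esub>}"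
  have inj: "inj_on h (carrier Q)" using h(2) by (rule bij_betw_imp_inj_on)
  have "x = \<zero>\<^sub>Q" if "x \<in> carrier Q" "h x = \<zero>\<^bsub>shift k (L r)\<^esub>" for x
   by (rule inj_onD[OF inj _ that(1) \<rho>.N.M.M.zero_closed]) (simp only: that(2) h.zero)
  then have "?Z = {\<zero>\<^sub>Q}" using h.zero \<rho>.N.M.M.zero_closed by blast
  then have Z: "K0_class A (fmod K A) (submod Q ?Z) = \<zero>\<^bsub>K0 A (fmod K A)\<^esub>"
   by (intro G.K0_class_zero submod_fmod(1)[OF Qf h.kernel]) simp
  have "K0_class A (fmod K A) Q = \<zero>\<^bsub>K0 A (fmod K A)\<^esub> \<oplus>\<^bsub>K0 A (fmod K A)\<^esub> frag_of k \<odot>\<^bsub>K0 A (fmod K A)\<^esub> K0_class A (fmod K A) (L r)"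
   using G.K0_class_exact[OF submod_fmod(1)[OF Qf h.kernel] Qf sL short_exact_kernel[OF Qg fmodD(1)[OF sL] h(1) hs]]
   unfolding Z G.K0_class_shift[OF Lf] .
  moreover have "\<dots> \<in> U" by (intro U.N(3,4,7) U(2)[OF r(1)]) simp
  ultimately have QU: "K0_class A (fmod K A) Q \<in> U" by simp
  show ?thesis
   unfolding G.K0_class_exact[OF sub(1) M Qf short_exact_kernel[OF M.graded_module Qg Q(2) Q(3)[symmetric]]]
   by (rule U.N(4)[OF NU QU])
 qed
qed

lemma pairing_nonneg: "P \<in> Defs.pmod A ==> M \<in> fmod K A ==> Poly_Mapping.lookup (pairing P M) j \<ge> 0"
proof -
 assume P: "P \<in> Defs.pmod A" and M: "M \<in> fmod K A"
 obtain S :: "((nat => 'a) \<times> int) set" and x k \<xi> where db: "dual_basis A P S x k \<xi>" using pmod_dual_basis[OF P] .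
 interpret t: tensor_setup K A \<psi> P M S x k \<xi> by (rule tensor_setupI[OF pmod_graded[OF P] fmodD(1)[OF M] db])
 show ?thesis by (simp add: pairing_def t.lookup_gdim[OF fmodD(2)[OF M]])
qed

text \<open>A hit of \<open>e\<close> in a simple quotient of \<open>P\<close> lifts to a surjection of \<open>P\<close> onto a shift of \<open>A e\<close>, because \<open>e\<close> is local.\<close>

lemma pmod_surjection:
 assumes P: "P \<in> Defs.pmod A" and S: "graded_simple A S" and \<rho>: "\<rho> \<in> graded_hom A P S" "carrier S = \<rho> ` carrier P"
  and e: "local_idempotent e" "hits e S"
 obtains j h where "h \<in> graded_hom A P (shift j (principal e))" "h ` carrier P = carrier (shift j (principal e))"
proof -
 have e0: "e \<in> component A 0" "e \<otimes> e = e" using e(1) by (auto simp: local_idempotent_def)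
 note ec = GA.component_closed[OF e0(1)] and Pg = pmod_graded[OF P] and pr = principal[OF e0]
  and gen = principal_smult_generator[OF e0]
 interpret S: graded_mod K A S by (rule graded_simpleD(1)[OF S])
 interpret E: graded_mod K A "principal e" by (rule graded_modI[OF pr(1)])
 obtain j x where x: "x \<in> component S j" "x ~= \<zero>\<^sub>S" "e \<odot>\<^sub>S x = x" using e(2) by (auto simp: hits_def)
 note xc = S.M.component_closed[OF x(1)]
 let ?E = "shift j (principal e)"
 interpret E': graded_mod K A ?E by (rule graded_modI[OF E.shift_graded_module])
 have Es: "carrier ?E = carrier (principal e)" "smult ?E = smult (principal e)" "add ?E = add (principal e)"
  "component ?E i = component (principal e) (i - j)" for i by (simp_all add: shift_def)
 \<comment> \<open>Elements of \<open>principal e\<close> are constant functions, so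
   \<open>u 0\<close> recovers the ring element; the generator \<open>e\<close> goes to
   \<open>x\<close>, and the shift by \<open>j\<close> accounts for the degree of
   \<open>x\<close>.\<close>
 define g where "g u = u 0 \<odot>\<^sub>S x" for u :: "nat => 'a"
 have g: "g \<in> graded_hom A ?E S"
 proof (rule graded_homI)
  show "g u \<in> carrier S" if "u \<in> carrier ?E" for u
   using gen(2)[of u] that S.M.smult_closed[OF _ xc] by (simp add: g_def Es)
  show "g (u \<oplus>\<^bsub>?E\<^esub> v) = g u \<oplus>\<^sub>S g v" if "u \<in> carrier ?E" "v \<in> carrier ?E" for u v
  proof -
   have u: "u 0 \<in> carrier A" "u 0 \<otimes> e = u 0" "u = (%_. u 0)" and v: "v 0 \<in> carrier A" "v 0 \<otimes> e = v 0" "v = (%_. v 0)"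
    using gen(2)[of u] gen(2)[of v] that by (auto simp only: Es)
   have "u \<oplus>\<^bsub>principal e\<^esub> v = (%_. u 0 \<oplus> v 0)" using pr(5)[OF u(1,2) v(1,2)] u(3) v(3) by simp
   then show ?thesis using S.M.smult_l_distr[OF u(1) v(1) xc] by (simp add: g_def Es)
  qed
  show "g (a \<odot>\<^bsub>?E\<^esub> u) = a \<odot>\<^sub>S g u" if "a \<in> carrier A" "u \<in> carrier ?E" for a u
  proof -
   have u: "u 0 \<in> carrier A" "u 0 \<otimes> e = u 0" "u = (%_. u 0)" using gen(2)[of u] that(2) by (auto simp only: Es)
   have "a \<odot>\<^bsub>principal e\<^esub> u = (%_. a \<otimes> u 0)" using pr(4)[OF that(1) u(1,2)] u(3) by simp
   then show ?thesis using S.M.smult_assoc[OF that(1) u(1) xc] by (simp add: g_def Es)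
  qed
  show "g u \<in> component S i" if "u \<in> component ?E i" for i u
   using S.smult_component_M[OF gen(3)[of u "i - j"] x(1)] that by (simp add: g_def Es)
 qed
 have gs: "g ` carrier ?E = carrier S"
 proof
  show "g ` carrier ?E \<subseteq> carrier S" using graded_homD(1)[OF g] by blast
  show "carrier S \<subseteq> g ` carrier ?E"
  proof
   fix y assume "y \<in> carrier S"
   then obtain a where a: "a \<in> carrier A" "y = a \<odot>\<^sub>S x" using graded_simple_cyclic[OF S x(1,2)] by metis
   have "y = g (%_. a \<otimes> e)" using a(2) x(3) S.M.smult_assoc[OF a(1) ec xc] by (simp add: g_def)
   moreover have "(%_. a \<otimes> e) \<in> carrier ?E" unfolding Es(1) pr(2) using m_assoc[OF a(1) ec ec] e0(2) a(1) ec by auto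
   ultimately show "y \<in> g ` carrier ?E" by blast
  qed
 qed
 obtain I :: "((nat => 'a) \<times> int) set" and z k \<xi> where db: "dual_basis A P I z k \<xi>" using pmod_dual_basis[OF P] .
 obtain h where h: "h \<in> graded_hom A P ?E" "\<forall>y\<in>carrier P. g (h y) = \<rho> y"
  using E'.graded_lift[OF db Pg S.graded_module g gs \<rho>(1)] .
 interpret \<rho>: graded_map K A P S \<rho> by (rule graded_mapI[OF graded_alg_axioms Pg S.graded_module \<rho>(1)])
 interpret h: graded_map K A P ?E h by (rule graded_mapI[OF graded_alg_axioms Pg E'.graded_module h(1)])
 obtain p where p: "p \<in> component P j" "\<rho> p = x" using \<rho>.surj_component[OF \<rho>(2)[symmetric] x(1)] .
 note pc = \<rho>.M.M.component_closed[OF p(1)]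
 \<comment> \<open>The lift sends a preimage \<open>p\<close> of \<open>x\<close> to an element
   \<open>a\<close> of \<open>A e\<close> with \<open>a x = x\<close>. So \<open>e a\<close> is a
   unit of the corner with some inverse \<open>c\<close>, and \<open>(c e) p\<close> is a preimage
   of the generator \<open>e\<close>.\<close>
 define a where "a = h p 0"
 have hp: "h p \<in> carrier (principal e)" using h.closed[OF pc] by (simp add: Es)
 have a: "a \<in> component A 0" "a \<otimes> e = a" "h p = (%_. a)" "a \<odot>\<^sub>S x = x"
  using gen(3)[of "h p" 0] h.comp[OF p(1)] gen(2)[OF hp] h(2) pc p(2) by (auto simp: a_def Es g_def)
 note ac = GA.component_closed[OF a(1)]
 have t: "e \<otimes> a \<in> component A 0" by (intro mult_component0 e0(1) a(1))
 obtain c where c: "c \<in> component A 0" "c \<otimes> (e \<otimes> a) = e"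
  by (rule corner_unit[OF e(1) S.M.left_module_axioms xc x(2) t])
   (use m_assoc[OF ec ec ac] m_assoc[OF ec ac ec] e0 a S.M.smult_assoc[OF ec ac xc] x(3) in auto)
 note cc = GA.component_closed[OF c(1)]
 have gen_image: "h ((c \<otimes> e) \<odot>\<^sub>P p) = (%_. e)"
  using h.smult[OF m_closed[OF cc ec] pc] pr(4)[OF m_closed[OF cc ec] ac a(2)] a(3) c(2) m_assoc[OF cc ec ac]
  by (simp add: Es)
 have q: "(c \<otimes> e) \<odot>\<^sub>P p \<in> carrier P" by (rule \<rho>.M.M.smult_closed[OF m_closed[OF cc ec] pc])
 have "h ` carrier P = carrier ?E"
 proof
  show "h ` carrier P \<subseteq> carrier ?E" using h.closed by blast
  show "carrier ?E \<subseteq> h ` carrier P"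
  proof
   fix u assume "u \<in> carrier ?E"
   then have u: "u 0 \<in> carrier A" "u 0 \<odot>\<^bsub>principal e\<^esub> (%_. e) = u" using gen(2)[of u] by (auto simp only: Es)
   have "u = h (u 0 \<odot>\<^sub>P ((c \<otimes> e) \<odot>\<^sub>P p))" using h.smult[OF u(1) q] u(2) gen_image by (simp add: Es)
   then show "u \<in> h ` carrier P" using \<rho>.M.M.smult_closed[OF u(1) q] by blast
  qed
 qed
 then show thesis using that h(1) by blast
qed

text \<open>Projectivity of \<open>Q\<close> splits \<open>h\<close> by some
  \<open>\<sigma>\<close>, and \<open>p - \<sigma> (h p)\<close> is a graded retraction onto the
  kernel.\<close>

lemma pmod_kernel:
 assumes P: "P \<in> Defs.pmod A" and Q: "Q \<in> Defs.pmod A" and h: "h \<in> graded_hom A P Q" "h ` carrier P = carrier Q"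
 shows "submod P {x \<in> carrier P. h x = \<zero>\<^sub>Q} \<in> Defs.pmod A" (is "submod P ?N \<in> _")
proof -
 note Pg = pmod_graded[OF P] and Qg = pmod_graded[OF Q]
 interpret h: graded_map K A P Q h by (rule graded_mapI[OF graded_alg_axioms Pg Qg h(1)])
 obtain I :: "((nat => 'a) \<times> int) set" and z k \<xi> where db: "dual_basis A P I z k \<xi>" using pmod_dual_basis[OF P] .
 obtain I' :: "((nat => 'a) \<times> int) set" and z' k' \<xi>' where db': "dual_basis A Q I' z' k' \<xi>'" using pmod_dual_basis[OF Q] .
 obtain \<sigma> where \<sigma>: "\<sigma> \<in> graded_hom A Q P" "\<forall>y\<in>carrier Q. h (\<sigma> y) = y"
  using h.M.graded_surjection_splits[OF db' Qg h] .
 interpret s: graded_map K A Q P \<sigma> by (rule graded_mapI[OF graded_alg_axioms Qg Pg \<sigma>(1)])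
 define \<kappa> where "\<kappa> p = p \<ominus>\<^sub>P \<sigma> (h p)" for p
 have Ng: "graded_module A (submod P ?N)" by (rule h.M.submod_graded_module[OF h.kernel])
 have \<kappa>N: "\<kappa> p \<in> ?N" if "p \<in> carrier P" for p
  using that \<sigma>(2) h.closed[OF that] s.closed[OF h.closed[OF that]] h.N.M.M.minus_zero_iff[of "h p" "h p"]
  by (simp add: \<kappa>_def h.minus)
 have \<kappa>: "\<kappa> \<in> graded_hom A P (submod P ?N)"
 proof (rule graded_homI)
  show "\<kappa> p \<in> carrier (submod P ?N)" if "p \<in> carrier P" for p using \<kappa>N[OF that] by simp
  show "\<kappa> (p \<oplus>\<^sub>P q) = \<kappa> p \<oplus>\<^bsub>submod P ?N\<^esub> \<kappa> q" if "p \<in> carrier P" "q \<in> carrier P" for p q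
   using that h.closed s.closed by (simp add: \<kappa>_def h.add s.add h.M.M.M.add_minus_add)
  show "\<kappa> (a \<odot>\<^sub>P p) = a \<odot>\<^bsub>submod P ?N\<^esub> \<kappa> p" if "a \<in> carrier A" "p \<in> carrier P" for a p
   using that h.closed s.closed by (simp add: \<kappa>_def h.smult s.smult h.M.M.smult_minus_r)
  show "\<kappa> p \<in> component (submod P ?N) i" if "p \<in> component P i" for i p
   using \<kappa>N[OF h.M.M.component_closed[OF that]] h.M.M.component_minus[OF that s.comp[OF h.comp[OF that]]]
   by (simp add: \<kappa>_def)
 qed
 have "\<kappa> y = y" if "y \<in> carrier (submod P ?N)" for y
  using that s.zero h.M.M.M.minus_zero_r by (simp add: \<kappa>_def)
 then show ?thesis
  by (rule pmodI[OF Ng h.M.dual_basis_retract[OF db Ng h.M.submod_inclusion[OF h.kernel] \<kappa>]])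
qed

text \<open>A nonzero \<open>P\<close> has a simple quotient, which some \<open>\<psi> r\<close>
  hits, so \<open>P\<close> maps onto a shift of \<open>A \<psi>(r)\<close>. The kernel is
  projective with strictly smaller total pairing against the \<open>L r\<close>; this measure
  replaces a dimension, as \<open>P\<close> may be infinite-dimensional.\<close>

lemma pmod_generated:
 assumes R: "finite R" "!!r. r \<in> R ==> local_idempotent r" "!!S :: 'a amodule. graded_simple A S ==> \<exists>r\<in>R. hits (\<psi> r) S"
  "!!r. r \<in> R ==> graded_simple A (L r :: 'a amodule)" "!!r. r \<in> R ==> hits r (L r)"
  and U: "left_submodule laurent_ring U (K0 A (Defs.pmod A))" "!!r. r \<in> R ==> K0_class A (Defs.pmod A) (principal (\<psi> r)) \<in> U"
 shows "P \<in> Defs.pmod A ==> K0_class A (Defs.pmod A) P \<in> U"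
proof (induct "nat (\<Sum>r\<in>R. total (pairing P (L r)))" arbitrary: P rule: less_induct)
 case less
 note P = less(2)
 interpret U: coset_quotient laurent_ring "K0 A (Defs.pmod A)" U
  using U(1) P.K0_left_module by (simp add: coset_quotient_def coset_quotient_axioms_def)
 note Pg = pmod_graded[OF P]
 interpret M: graded_mod K A P by (rule graded_modI[OF Pg])
 have Lf: "L r \<in> fmod K A" if "r \<in> R" for r by (rule graded_simple_fin_dim[OF R(4)[OF that]])
 show ?case
 proof (cases "carrier P = {\<zero>\<^sub>P}")
  case True
  then show ?thesis using P.K0_class_zero[OF P] U.N(3) by simp
 next
  case False
  have "finitely_generated A P" using P by (simp add: Defs.pmod_def)
  then obtain G where G: "finite G" "generates A G P" by (rule M.finitely_generated_generates)
  obtain S :: "'a amodule" and \<rho> where S: "graded_simple A S" "\<rho> \<in> graded_hom A P S" "carrier S = \<rho> ` carrier P"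
   using M.exists_simple_quotient[OF G False] .
  obtain r where r: "r \<in> R" "hits (\<psi> r) S" using R(3)[OF S(1)] by blast
  have r0: "r \<in> component A 0" "r \<otimes> r = r" using R(2)[OF r(1)] by (auto simp: local_idempotent_def)
  have e0: "\<psi> r \<in> component A 0" "\<psi> r \<otimes> \<psi> r = \<psi> r"
   using local_idempotent_psi[OF R(2)[OF r(1)]] by (auto simp: local_idempotent_def)
  obtain j h where h: "h \<in> graded_hom A P (shift j (principal (\<psi> r)))" "h ` carrier P = carrier (shift j (principal (\<psi> r)))"
   using pmod_surjection[OF P S local_idempotent_psi[OF R(2)[OF r(1)]] r(2)] .
  have pp: "principal (\<psi> r) \<in> Defs.pmod A" by (rule principal_pmod[OF e0])
  let ?Q = "shift j (principal (\<psi> r))"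
  have Q: "?Q \<in> Defs.pmod A" by (rule shift_pmod[OF pp])
  let ?N = "submod P {x \<in> carrier P. h x = \<zero>\<^bsub>?Q\<^esub>}"
  have N: "?N \<in> Defs.pmod A" by (rule pmod_kernel[OF P Q h])
  have ex: "short_exact A ?N P ?Q" by (rule short_exact_kernel[OF Pg pmod_graded[OF Q] h])
  have sp: "(\<Sum>r\<in>R. total (pairing P (L r))) = (\<Sum>r\<in>R. total (pairing ?N (L r))) + (\<Sum>r\<in>R. total (pairing ?Q (L r)))"
   unfolding sum.distrib[symmetric]
   by (rule sum.cong[OF refl]) (simp add: pairing_add_left[OF N P Q Lf ex] total_add)
  \<comment> \<open>\<open>r\<close> fixes a nonzero vector of \<open>L r\<close> in degree
    \<open>i\<close>, which contributes to the coefficient at \<open>i + j\<close>; no coefficient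
    is negative, so nothing cancels.\<close>
  have "total (pairing ?Q (L r)) > 0"
  proof -
   obtain i x where x: "x \<in> component (L r) i" "x ~= \<zero>\<^bsub>L r\<^esub>" "r \<odot>\<^bsub>L r\<^esub> x = x"
    using R(5)[OF r(1)] by (auto simp: hits_def)
   have "Poly_Mapping.lookup (pairing ?Q (L r)) (i + j) > 0"
    using pairing_hit[OF r0 Lf[OF r(1)] x] unfolding pairing_shift_left[OF pp Lf[OF r(1)]] lookup_monomial_times by simp
   then show ?thesis using total_pos pairing_nonneg[OF Q Lf[OF r(1)]] by blast
  qed
  then have "(\<Sum>r\<in>R. total (pairing ?Q (L r))) > 0"
   using R(1) r(1) pairing_nonneg[OF Q Lf] by (intro sum_pos2[of R r] total_nonneg) auto
  moreover have "(\<Sum>r\<in>R. total (pairing ?N (L r))) \<ge> 0"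
   using pairing_nonneg[OF N Lf] by (intro sum_nonneg total_nonneg) auto
  ultimately have "nat (\<Sum>r\<in>R. total (pairing ?N (L r))) < nat (\<Sum>r\<in>R. total (pairing P (L r)))" using sp by linarith
  then have NU: "K0_class A (Defs.pmod A) ?N \<in> U" by (rule less(1)[OF _ N])
  have QU: "K0_class A (Defs.pmod A) ?Q \<in> U"
   unfolding P.K0_class_shift[OF pp] by (intro U.N(7) U(2)[OF r(1)]) simp
  show ?thesis unfolding P.K0_class_exact[OF N P Q ex] by (rule U.N(4)[OF NU QU])
 qed
qed

end

section \<open>Perfect pairings with dual bases\<close>

lemma functional_zero:
 assumes M: "left_module laurent_ring M" and t: "t \<in> functionals M"
 shows "t \<zero>\<^sub>M = 0"
proof -
 interpret M: left_module laurent_ring M by (rule M)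
 have "t (0 \<odot>\<^sub>M \<zero>\<^sub>M) = 0 * t \<zero>\<^sub>M" using t unfolding laurent_functional_iff by simp
 then show ?thesis using M.smult_zero_l[OF M.M.zero_closed] by simp
qed

lemma functional_finsum:
 assumes M: "left_module laurent_ring M" and t: "t \<in> functionals M"
  and R: "finite R" "p \<in> R \<rightarrow> carrier M"
 shows "t (\<Oplus>\<^sub>M r\<in>R. c r \<odot>\<^sub>M p r) = (\<Sum>r\<in>R. c r * t (p r))"
proof -
 interpret M: left_module laurent_ring M by (rule M)
 show ?thesis
  using R
 proof (induct R)
  case empty
  then show ?case by (simp add: functional_zero[OF M t])
 next
  case (insert a J)
  have s: "c r \<odot>\<^sub>M p r \<in> carrier M" if "r \<in> insert a J" for r by (rule M.smult_closed) (use insert(4) that in auto)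
  have "(\<Oplus>\<^sub>M r\<in>insert a J. c r \<odot>\<^sub>M p r) = c a \<odot>\<^sub>M p a \<oplus>\<^sub>M (\<Oplus>\<^sub>M r\<in>J. c r \<odot>\<^sub>M p r)"
   by (rule M.M.finsum_insert[OF insert(1,2)]) (use s in auto)
  moreover have "(\<Oplus>\<^sub>M r\<in>J. c r \<odot>\<^sub>M p r) \<in> carrier M" by (rule M.M.finsum_closed) (use s in auto)
  ultimately show ?case
   using t insert s unfolding laurent_functional_iff by simp
 qed
qed

definition combinations :: "('r, 'y) ring_scheme => ('r, 'm, 'z) module_scheme => 'i set => ('i => 'm) => 'm set" where
 "combinations R M S p = {(\<Oplus>\<^sub>M s\<in>S. c s \<odot>\<^sub>M p s) |c. c \<in> S \<rightarrow> carrier R}"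

context left_module
begin

lemma combinations_closed:
 assumes "!!s. s \<in> S ==> p s \<in> carrier M" "c \<in> S \<rightarrow> carrier R"
 shows "(\<Oplus>\<^sub>M s\<in>S. c s \<odot>\<^sub>M p s) \<in> carrier M"
 by (rule M.finsum_closed) (use assms smult_closed in auto)

lemma combination_set_submodule:
 assumes S: "finite S" and p': "p \<in> S \<rightarrow> carrier M"
 shows "left_submodule R (combinations R M S p) M" "s \<in> S ==> p s \<in> combinations R M S p"
proof -
 have p: "p s \<in> carrier M" if "s \<in> S" for s using p' that by auto
 have sm: "a \<odot>\<^sub>M x \<in> combinations R M S p" if a: "a \<in> carrier R" and x: "x \<in> combinations R M S p" for a x
 proof -
  obtain c where c: "c \<in> S \<rightarrow> carrier R" "x = (\<Oplus>\<^sub>M s\<in>S. c s \<odot>\<^sub>M p s)" using x by (auto simp: combinations_def)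
  have "a \<odot>\<^sub>M x = (\<Oplus>\<^sub>M s\<in>S. a \<odot>\<^sub>M (c s \<odot>\<^sub>M p s))"
   unfolding c(2) by (rule smult_finsum_r[OF a]) (use c(1) p smult_closed in \<open>auto simp: Pi_def\<close>)
  also have "\<dots> = (\<Oplus>\<^sub>M s\<in>S. (a \<otimes> c s) \<odot>\<^sub>M p s)"
   by (rule M.finsum_cong') (use a c(1) p smult_closed smult_assoc in \<open>auto simp: Pi_def\<close>)
  finally show ?thesis using a c(1) unfolding combinations_def
   by (intro CollectI exI[of _ "%s. a \<otimes> c s"]) auto
 qed
 have sub: "combinations R M S p \<subseteq> carrier M"
  using combinations_closed[OF p] by (auto simp: combinations_def)
 have "subgroup (combinations R M S p) (add_monoid M)"
 proof (rule M.add_subgroupI)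
  have "\<zero>\<^sub>M = (\<Oplus>\<^sub>M s\<in>S. \<zero> \<odot>\<^sub>M p s)"
   using M.finsum_cong'[of S S "%s. \<zero>\<^sub>M" "%s. \<zero> \<odot>\<^sub>M p s"] p smult_zero_l by simp
  then show "\<zero>\<^sub>M \<in> combinations R M S p"
   unfolding combinations_def by (intro CollectI exI[of _ "%s. \<zero>"]) simp
  fix x y assume "x \<in> combinations R M S p" "y \<in> combinations R M S p"
  then obtain c d where c: "c \<in> S \<rightarrow> carrier R" "x = (\<Oplus>\<^sub>M s\<in>S. c s \<odot>\<^sub>M p s)"
   and d: "d \<in> S \<rightarrow> carrier R" "y = (\<Oplus>\<^sub>M s\<in>S. d s \<odot>\<^sub>M p s)" by (auto simp: combinations_def)
  have "x \<oplus>\<^sub>M y = (\<Oplus>\<^sub>M s\<in>S. c s \<odot>\<^sub>M p s \<oplus>\<^sub>M d s \<odot>\<^sub>M p s)"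
   unfolding c(2) d(2) by (rule M.finsum_addf[symmetric]) (use c(1) d(1) p smult_closed in \<open>auto simp: Pi_def\<close>)
  also have "\<dots> = (\<Oplus>\<^sub>M s\<in>S. (c s \<oplus> d s) \<odot>\<^sub>M p s)"
   by (rule M.finsum_cong') (use c(1) d(1) p smult_closed smult_l_distr in \<open>auto simp: Pi_def\<close>)
  finally show "x \<oplus>\<^sub>M y \<in> combinations R M S p"
   unfolding combinations_def by (intro CollectI exI[of _ "%s. c s \<oplus> d s"]) (use c(1) d(1) in auto)
 next
  fix x assume x: "x \<in> combinations R M S p"
  have "\<ominus>\<^sub>M x = (\<ominus> \<one>) \<odot>\<^sub>M x" using smult_neg_l[of \<one> x] smult_one[of x] x sub by auto
  then show "\<ominus>\<^sub>M x \<in> combinations R M S p" using sm[OF _ x] by simp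
 qed (rule sub)
 then show "left_submodule R (combinations R M S p) M" using sm by (simp add: left_submodule_def)
 show "p s \<in> combinations R M S p" if s: "s \<in> S"
 proof -
  have "(\<Oplus>\<^sub>M t\<in>S. (if t = s then \<one> else \<zero>) \<odot>\<^sub>M p t) = (\<Oplus>\<^sub>M t\<in>S. if t = s then p s else \<zero>\<^sub>M)"
   by (rule M.finsum_cong') (use p s smult_one smult_zero_l in auto)
  then have "p s = (\<Oplus>\<^sub>M t\<in>S. (if t = s then \<one> else \<zero>) \<odot>\<^sub>M p t)"
   using M.finsum_delta[OF S, of "p s" s] p[OF s] s by simp
  then show ?thesis
   unfolding combinations_def by (intro CollectI exI[of _ "%t. if t = s then \<one> else \<zero>"]) auto
 qed
qed

end

lemma bilinear_pairing_flip: "bilinear_pairing M N B ==> bilinear_pairing N M (%y x. B x y)"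
 by (auto simp: bilinear_pairing_def)

text \<open>Pairing a combination of the \<open>p r\<close> with \<open>l r\<close> returns its
  coefficient times \<open>d r\<close>. If the \<open>d r\<close> are nonzero, coefficients vanish
  with the pairing, Laurent polynomials having no zero divisors; if they are 1, the two families are
  dual and coefficients are read off directly.\<close>

lemma diagonal_pairing:
 assumes M: "left_module laurent_ring M" and N: "left_module laurent_ring N" and B: "bilinear_pairing M N B"
  and R: "finite R" "p \<in> R \<rightarrow> carrier M" "l \<in> R \<rightarrow> carrier N"
  and gM: "carrier M \<subseteq> combinations laurent_ring M R p" and gN: "carrier N \<subseteq> combinations laurent_ring N R l"
  and diag: "\<forall>r\<in>R. \<forall>r'\<in>R. B (p r) (l r') = (if r = r' then d r else 0)"
 shows "\<forall>r\<in>R. d r ~= 0 ==> x \<in> carrier M ==> (\<forall>y\<in>carrier N. B x y = 0) ==> x = \<zero>\<^sub>M"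
  and "\<forall>r\<in>R. d r = 1 ==> bij_betw (%x. \<lambda>y\<in>carrier N. B x y) (carrier M) (dual N)"
proof -
 interpret M: left_module laurent_ring M by (rule M)
 interpret N: left_module laurent_ring N by (rule N)
 have Bl: "(%x. B x y) \<in> functionals M" if "y \<in> carrier N" for y
  using B that by (simp add: bilinear_pairing_def)
 have Br: "B x \<in> functionals N" if "x \<in> carrier M" for x
  using B that by (simp add: bilinear_pairing_def)
 have coeff: "B (\<Oplus>\<^sub>M r\<in>R. c r \<odot>\<^sub>M p r) (l r) = c r * d r" if r: "r \<in> R" for c r
 proof -
  have "B (\<Oplus>\<^sub>M r\<in>R. c r \<odot>\<^sub>M p r) (l r) = (\<Sum>s\<in>R. c s * B (p s) (l r))"
   by (rule functional_finsum[OF M Bl[OF funcset_mem[OF R(3) r]] R(1,2)])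
  also have "\<dots> = (\<Sum>s\<in>R. if s = r then c r * d r else 0)" by (rule sum.cong) (use diag r in auto)
  finally show ?thesis using R(1) r by simp
 qed
 have exM: "\<exists>c. x = (\<Oplus>\<^sub>M r\<in>R. c r \<odot>\<^sub>M p r)" if "x \<in> carrier M" for x
  using gM that by (auto simp: combinations_def)
 have exN: "\<exists>c. y = (\<Oplus>\<^sub>N r\<in>R. c r \<odot>\<^sub>N l r)" if "y \<in> carrier N" for y
  using gN that by (auto simp: combinations_def)
 show "x = \<zero>\<^sub>M" if d: "\<forall>r\<in>R. d r ~= 0" and x: "x \<in> carrier M" and z: "\<forall>y\<in>carrier N. B x y = 0"
 proof -
  obtain c where c: "x = (\<Oplus>\<^sub>M r\<in>R. c r \<odot>\<^sub>M p r)" using exM[OF x] by blast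
  have "c r = 0" if "r \<in> R" for r using coeff[OF that, of c] z funcset_mem[OF R(3) that] d that c by simp
  then have "x = (\<Oplus>\<^sub>M r\<in>R. \<zero>\<^sub>M)"
   unfolding c by (intro M.M.finsum_cong') (use R(2) M.smult_zero_l in \<open>auto simp: Pi_def\<close>)
  then show ?thesis by simp
 qed
 assume d: "\<forall>r\<in>R. d r = 1"
 have ev: "B x (l r) = c r" if "r \<in> R" "x = (\<Oplus>\<^sub>M r\<in>R. c r \<odot>\<^sub>M p r)" for x c r
  using coeff[OF that(1), of c] d that by simp
 show "bij_betw (%x. \<lambda>y\<in>carrier N. B x y) (carrier M) (dual N)"
 proof (rule bij_betw_imageI)
  show "inj_on (%x. \<lambda>y\<in>carrier N. B x y) (carrier M)"
  proof (rule inj_onI)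
   fix x x' assume x: "x \<in> carrier M" "x' \<in> carrier M" and e: "(\<lambda>y\<in>carrier N. B x y) = (\<lambda>y\<in>carrier N. B x' y)"
   obtain c c' where c: "x = (\<Oplus>\<^sub>M r\<in>R. c r \<odot>\<^sub>M p r)" and c': "x' = (\<Oplus>\<^sub>M r\<in>R. c' r \<odot>\<^sub>M p r)"
    using exM[OF x(1)] exM[OF x(2)] by blast
   have "c r = c' r" if "r \<in> R" for r
    using fun_cong[OF e, of "l r"] funcset_mem[OF R(3) that] ev[OF that c] ev[OF that c'] by simp
   then show "x = x'" unfolding c c' by (intro M.M.finsum_cong') (use R(2) M.smult_closed in \<open>auto simp: Pi_def\<close>)
  qed
  show "(%x. \<lambda>y\<in>carrier N. B x y) ` carrier M = dual N"
  proof
   have "(\<lambda>y\<in>carrier N. B x y) \<in> dual N" if x: "x \<in> carrier M" for x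
    using Br[OF x] N.M.a_closed N.smult_closed by (auto simp: dual_def laurent_functional_iff)
   then show "(%x. \<lambda>y\<in>carrier N. B x y) ` carrier M \<subseteq> dual N" by blast
   show "dual N \<subseteq> (%x. \<lambda>y\<in>carrier N. B x y) ` carrier M"
   proof
    fix f assume "f \<in> dual N"
    then have f: "f \<in> functionals N" "f \<in> extensional (carrier N)"
     by (auto simp: dual_def)
    \<comment> \<open>The preimage of a functional \<open>f\<close> has the values of
      \<open>f\<close> on the dual generators as coefficients.\<close>
    define x where "x = (\<Oplus>\<^sub>M r\<in>R. f (l r) \<odot>\<^sub>M p r)"
    have x: "x \<in> carrier M" unfolding x_def by (rule M.combinations_closed[OF funcset_mem[OF R(2)]]) simp_all
    have "B x y = f y" if y: "y \<in> carrier N" for y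
    proof -
     obtain c where c: "y = (\<Oplus>\<^sub>N r\<in>R. c r \<odot>\<^sub>N l r)" using exN[OF y] by blast
     show ?thesis
      unfolding c functional_finsum[OF N Br[OF x] R(1,3)] functional_finsum[OF N f(1) R(1,3)]
      by (rule sum.cong) (use ev[of _ x "%r. f (l r)"] in \<open>simp_all add: x_def\<close>)
    qed
    then have "f = (\<lambda>y\<in>carrier N. B x y)" using f(2) by (auto simp: extensional_def restrict_def fun_eq_iff)
    then show "f \<in> (%x. \<lambda>y\<in>carrier N. B x y) ` carrier M" using x by blast
   qed
  qed
 qed
qed

section \<open>The pairing of the Grothendieck groups of one algebra\<close>

context anti_alg
begin

abbreviation "KP \<equiv> K0 A (Defs.pmod A)"
abbreviation "KG \<equiv> K0 A (fmod K A)"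

text \<open>The universal property is used twice: for fixed \<open>M\<close> the pairing extends to
  a functional \<open>t M\<close> of the first variable, and then for a fixed class \<open>u\<close>
  the values \<open>t M u\<close> extend in the second.\<close>

lemma K0_pairing_exists:
 obtains b where "bilinear_pairing KP KG b"
  "\<forall>P\<in>Defs.pmod A. \<forall>M\<in>fmod K A. b (K0_class A (Defs.pmod A) P) (K0_class A (fmod K A) M) = pairing P M"
proof -
 let ?HP = "functionals KP"
 let ?HG = "functionals KG"
 interpret KP: left_module laurent_ring KP by (rule P.K0_left_module)
 have "\<forall>M\<in>fmod K A. \<exists>t. t \<in> ?HP \<and> (\<forall>P\<in>Defs.pmod A. t (K0_class A (Defs.pmod A) P) = pairing P M)"
 proof
  fix M assume M: "M \<in> fmod K A"
  show "\<exists>t. t \<in> ?HP \<and> (\<forall>P\<in>Defs.pmod A. t (K0_class A (Defs.pmod A) P) = pairing P M)"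
   by (rule P.K0_functional_exists[of "%P. pairing P M", OF pairing_add_left[OF _ _ _ M] pairing_shift_left[OF _ M]])
    (assumption+, intro exI conjI)
 qed
 from bchoice[OF this] obtain t where
  "\<forall>M\<in>fmod K A. t M \<in> ?HP \<and> (\<forall>P\<in>Defs.pmod A. t M (K0_class A (Defs.pmod A) P) = pairing P M)" by (elim exE)
 then have t: "!!M. M \<in> fmod K A ==> t M \<in> ?HP"
  "!!M P. M \<in> fmod K A ==> P \<in> Defs.pmod A ==> t M (K0_class A (Defs.pmod A) P) = pairing P M" by blast+
 \<comment> \<open>Additivity in \<open>M\<close> holds on classes of projective modules; both sides
   are functionals of \<open>u\<close>, so it holds for every \<open>u\<close>.\<close>
 have add: "t M u = t M' u + t M'' u"
  if M: "M' \<in> fmod K A" "M \<in> fmod K A" "M'' \<in> fmod K A" and ex: "short_exact A M' M M''" and u: "u \<in> carrier KP" for M' M M'' u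
 proof (rule P.K0_functional_eq[OF t(1)[OF M(2)] _ _ u])
  show "(%u. t M' u + t M'' u) \<in> ?HP"
   using t(1)[OF M(1)] t(1)[OF M(3)] unfolding laurent_functional_iff by (auto simp: algebra_simps)
 qed (use t(2) M pairing_add_right[OF _ M ex] in simp)
 have sh: "t (shift n M) u = frag_of n * t M u" if M: "M \<in> fmod K A" and u: "u \<in> carrier KP" for n M u
 proof (rule P.K0_functional_eq[OF t(1)[OF shift_fmod[OF M]] _ _ u])
  show "(%u. frag_of n * t M u) \<in> ?HP"
   using t(1)[OF M] unfolding laurent_functional_iff by (auto simp: algebra_simps)
 qed (use t(2) M shift_fmod[OF M] pairing_shift_right[OF _ M] in simp)
 have "\<forall>u\<in>carrier KP. \<exists>b. b \<in> ?HG \<and> (\<forall>M\<in>fmod K A. b (K0_class A (fmod K A) M) = t M u)"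
 proof
  fix u assume u: "u \<in> carrier KP"
  show "\<exists>b. b \<in> ?HG \<and> (\<forall>M\<in>fmod K A. b (K0_class A (fmod K A) M) = t M u)"
   by (rule G.K0_functional_exists[of "%M. t M u", OF add[OF _ _ _ _ u] sh[OF _ u]])
    (assumption+, intro exI conjI)
 qed
 from bchoice[OF this] obtain b where
  "\<forall>u\<in>carrier KP. b u \<in> ?HG \<and> (\<forall>M\<in>fmod K A. b u (K0_class A (fmod K A) M) = t M u)" by (elim exE)
 then have b: "!!u. u \<in> carrier KP ==> b u \<in> ?HG"
  "!!u M. u \<in> carrier KP ==> M \<in> fmod K A ==> b u (K0_class A (fmod K A) M) = t M u" by blast+
 have ba: "b (u \<oplus>\<^bsub>KP\<^esub> v) y = b u y + b v y" if u: "u \<in> carrier KP" and v: "v \<in> carrier KP" and y: "y \<in> carrier KG" for u v y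
 proof (rule G.K0_functional_eq[OF b(1)[OF KP.M.a_closed[OF u v]] _ _ y])
  show "(%y. b u y + b v y) \<in> ?HG"
   using b(1)[OF u] b(1)[OF v] unfolding laurent_functional_iff by (auto simp: algebra_simps)
 qed (use b(2) u v KP.M.a_closed[OF u v] t(1) in \<open>simp add: laurent_functional_iff\<close>)
 have bs: "b (c \<odot>\<^bsub>KP\<^esub> u) y = c * b u y" if u: "u \<in> carrier KP" and y: "y \<in> carrier KG" for c u y
 proof -
  have cu: "c \<odot>\<^bsub>KP\<^esub> u \<in> carrier KP" by (rule KP.smult_closed[OF _ u]) simp
  show ?thesis
  proof (rule G.K0_functional_eq[OF b(1)[OF cu] _ _ y])
   show "(%y. c * b u y) \<in> ?HG"
    using b(1)[OF u] unfolding laurent_functional_iff by (auto simp: algebra_simps)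
  qed (use b(2) u cu t(1) in \<open>simp add: laurent_functional_iff\<close>)
 qed
 have "bilinear_pairing KP KG b"
  unfolding bilinear_pairing_def using b(1) ba bs by (auto simp: laurent_functional_iff)
 then show thesis by (rule that) (use b(2) t(2) P.K0_class_closed in simp)
qed

text \<open>The pairing is diagonal on the generators \<open>principal (\<psi> r)\<close> and
  \<open>L r\<close>. Off the diagonal it vanishes because only \<open>r\<close> itself, among the
  members of \<open>R\<close>, hits \<open>L r\<close>.\<close>

lemma K0_pairing:
 assumes b: "bilinear_pairing KP KG b"
  and val: "!!P M. P \<in> Defs.pmod A ==> M \<in> fmod K A ==> b (K0_class A (Defs.pmod A) P) (K0_class A (fmod K A) M) = pairing P M"
 shows "nondegenerate KP KG b \<and> (algebraically_closed K --> perfect KP KG b)"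
proof (rule representatives)
 fix R and L :: "'a => 'a amodule" assume R: "finite R" "!!r. r \<in> R ==> local_idempotent r"
  "!!S :: 'a amodule. graded_simple A S ==> \<exists>r\<in>R. hits r S"
  "!!S :: 'a amodule. graded_simple A S ==> \<exists>r\<in>R. hits (\<psi> r) S"
  "!!r. r \<in> R ==> graded_simple A (L r)"
  "!!r. r \<in> R ==> \<exists>x\<in>component (L r) 0. x ~= \<zero>\<^bsub>L r\<^esub> \<and> r \<odot>\<^bsub>L r\<^esub> x = x"
  "!!r r'. r \<in> R ==> r' \<in> R ==> hits r' (L r) ==> r' = r"
 have r0: "r \<in> component A 0" "r \<otimes> r = r" if "r \<in> R" for r using R(2)[OF that] by (auto simp: local_idempotent_def)
 have hit: "hits r (L r)" if "r \<in> R" for r using R(6)[OF that] by (auto simp: hits_def)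
 have Lf: "L r \<in> fmod K A" if "r \<in> R" for r by (rule graded_simple_fin_dim[OF R(5)[OF that]])
 have Pp: "principal (\<psi> r) \<in> Defs.pmod A" if "r \<in> R" for r
  using local_idempotent_psi[OF R(2)[OF that]] principal_pmod by (simp add: local_idempotent_def)
 let ?p = "%r. K0_class A (Defs.pmod A) (principal (\<psi> r))" and ?l = "%r. K0_class A (fmod K A) (L r)"
 interpret KP: left_module laurent_ring KP by (rule P.K0_left_module)
 interpret KG: left_module laurent_ring KG by (rule G.K0_left_module)
 have pc: "?p r \<in> carrier KP" and lc: "?l r \<in> carrier KG" if "r \<in> R" for r
  by (rule P.K0_class_closed[OF Pp[OF that]], rule G.K0_class_closed[OF Lf[OF that]])
 have pc': "?p \<in> R \<rightarrow> carrier KP" and lc': "?l \<in> R \<rightarrow> carrier KG" using pc lc by auto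
 note cP = KP.combination_set_submodule[OF R(1) pc'] and cG = KG.combination_set_submodule[OF R(1) lc']
 have gP: "carrier KP \<subseteq> combinations laurent_ring KP R ?p"
  by (rule P.K0_generated[OF cP(1)], rule pmod_generated[OF R(1,2,4,5) hit cP])
 have gG: "carrier KG \<subseteq> combinations laurent_ring KG R ?l"
  by (rule G.K0_generated[OF cG(1)], rule fmod_generated[OF R(2,3,5) hit cG])
 let ?d = "%r. pairing (principal (\<psi> r)) (L r)"
 have "b (?p r) (?l r') = (if r = r' then ?d r else 0)" if "r \<in> R" "r' \<in> R" for r r'
  using val[OF Pp[OF that(1)] Lf[OF that(2)]] pairing_not_hit[OF r0[OF that(1)] Lf[OF that(2)]] R(7)[OF that(2,1)] by auto
 then have diag: "\<forall>r\<in>R. \<forall>r'\<in>R. b (?p r) (?l r') = (if r = r' then ?d r else 0)"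
  and diag': "\<forall>r\<in>R. \<forall>r'\<in>R. b (?p r') (?l r) = (if r = r' then ?d r else 0)" by auto
 have nz: "\<forall>r\<in>R. ?d r ~= 0"
 proof
  fix r assume r: "r \<in> R"
  obtain x where "x \<in> component (L r) 0" "x ~= \<zero>\<^bsub>L r\<^esub>" "r \<odot>\<^bsub>L r\<^esub> x = x" using R(6)[OF r] by blast
  from pairing_hit[OF r0[OF r] Lf[OF r] this] show "?d r ~= 0" by auto
 qed
 note D = diagonal_pairing[OF KP.left_module_axioms KG.left_module_axioms b R(1) pc' lc' gP gG diag]
  and D' = diagonal_pairing[OF KG.left_module_axioms KP.left_module_axioms bilinear_pairing_flip[OF b] R(1) lc' pc' gG gP diag']
 have nd: "nondegenerate KP KG b" unfolding nondegenerate_def using D(1)[OF nz] D'(1)[OF nz] by blast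
 have one: "\<forall>r\<in>R. ?d r = 1" if ac: "algebraically_closed K"
 proof
  fix r assume r: "r \<in> R"
  obtain x where "x \<in> component (L r) 0" "x ~= \<zero>\<^bsub>L r\<^esub>" "r \<odot>\<^bsub>L r\<^esub> x = x" using R(6)[OF r] by blast
  from pairing_hit_simple[OF ac R(2)[OF r] R(5)[OF r] this] show "?d r = 1" .
 qed
 show "nondegenerate KP KG b \<and> (algebraically_closed K --> perfect KP KG b)"
  unfolding perfect_def using nd D(2)[OF one] D'(2)[OF one] by blast
qed

lemma tensor_fmod_fin_dim:
 assumes P: "P \<in> Defs.pmod A" and M: "M \<in> fmod K A"
 shows "vectorspace.fin_dim K (tensor K A (twist \<psi> P) M)"
proof -
 obtain S :: "((nat => 'a) \<times> int) set" and x k \<xi> where db: "dual_basis A P S x k \<xi>" using pmod_dual_basis[OF P] .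
 interpret t: tensor_setup K A \<psi> P M S x k \<xi> by (rule tensor_setupI[OF pmod_graded[OF P] fmodD(1)[OF M] db])
 show ?thesis by (rule t.tensor_fin_dim[OF fmodD(2)[OF M]])
qed

end

section \<open>Towers\<close>

lemma summand_same [simp]: "summand G n x n = x"
 by (simp add: summand_def)

lemma summand_other: "m ~= n ==> summand G n x m = \<zero>\<^bsub>G m\<^esub>"
 by (simp add: summand_def)

locale module_family =
 fixes G :: "nat => (laurent, 'x) module"
 assumes modules: "left_module laurent_ring (G n)"
begin

sublocale G: left_module laurent_ring "G n" for n
 by (rule modules)

lemma sum_sel [simp]:
 "x \<in> carrier (direct_sum_nat G) \<longleftrightarrow> (\<forall>n. x n \<in> carrier (G n)) \<and> finite {n. x n ~= \<zero>\<^bsub>G n\<^esub>}"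
 "\<zero>\<^bsub>direct_sum_nat G\<^esub> = (%n. \<zero>\<^bsub>G n\<^esub>)" "x \<oplus>\<^bsub>direct_sum_nat G\<^esub> y = (%n. x n \<oplus>\<^bsub>G n\<^esub> y n)"
 "c \<odot>\<^bsub>direct_sum_nat G\<^esub> x = (%n. c \<odot>\<^bsub>G n\<^esub> x n)"
 by (simp_all add: direct_sum_nat_def)

lemma summand_closed:
 assumes x: "x \<in> carrier (G n)"
 shows "summand G n x \<in> carrier (direct_sum_nat G)"
proof -
 have "{m. summand G n x m ~= \<zero>\<^bsub>G m\<^esub>} \<subseteq> {n}" by (auto simp: summand_def)
 then have "finite {m. summand G n x m ~= \<zero>\<^bsub>G m\<^esub>}" by (rule finite_subset) simp
 then show ?thesis using x by (auto simp: summand_def)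
qed

lemma summand_add: "summand G n (x \<oplus>\<^bsub>G n\<^esub> y) = summand G n x \<oplus>\<^bsub>direct_sum_nat G\<^esub> summand G n y"
 by (auto simp: summand_def)

lemma summand_smult: "summand G n (c \<odot>\<^bsub>G n\<^esub> x) = c \<odot>\<^bsub>direct_sum_nat G\<^esub> summand G n x"
 using G.smult_zero_r[of c] by (auto simp: summand_def)

lemma functional_summand:
 assumes "t \<in> functionals (direct_sum_nat G)"
 shows "(%x. t (summand G n x)) \<in> functionals (G n)"
 using assms summand_closed summand_add summand_smult unfolding laurent_functional_iff by simp

text \<open>Elements of the direct sum have finite support, so one summand after another can be
  split off.\<close>

lemma functional_eq_summands:
 assumes t: "t \<in> functionals (direct_sum_nat G)"
  and t': "t' \<in> functionals (direct_sum_nat G)"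
  and eq: "!!m u. u \<in> carrier (G m) ==> t (summand G m u) = t' (summand G m u)"
  and x: "x \<in> carrier (direct_sum_nat G)"
 shows "t x = t' x"
proof -
 have "finite S ==> x \<in> carrier (direct_sum_nat G) ==> {n. x n ~= \<zero>\<^bsub>G n\<^esub>} \<subseteq> S ==> t x = t' x" for S x
 proof (induct S arbitrary: x rule: finite_induct)
  case empty
  then have "x = summand G 0 \<zero>\<^bsub>G 0\<^esub>" by (auto simp: summand_def fun_eq_iff)
  then show ?case using eq[of "\<zero>\<^bsub>G 0\<^esub>" 0] by simp
 next
  case (insert m S)
  define y where "y n = (if n = m then \<zero>\<^bsub>G n\<^esub> else x n)" for n
  have xc: "x n \<in> carrier (G n)" for n using insert(4) by simp
  have "{n. y n ~= \<zero>\<^bsub>G n\<^esub>} \<subseteq> S" using insert(5) by (auto simp: y_def)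
  moreover have y: "y \<in> carrier (direct_sum_nat G)"
   using xc finite_subset[OF calculation insert(1)] by (simp add: y_def)
  ultimately have ty: "t y = t' y" by (intro insert(3))
  have "x = summand G m (x m) \<oplus>\<^bsub>direct_sum_nat G\<^esub> y" using xc by (auto simp: summand_def y_def fun_eq_iff)
  then show ?case
   using t t' summand_closed[OF xc[of m]] y ty eq[OF xc[of m]] unfolding laurent_functional_iff by metis
 qed
 then show ?thesis using x by auto
qed

end

context
 fixes K :: "'k ring" and A :: "nat => ('k, 'a) gmodule" and \<rho> :: "nat => nat => ('a \<times> 'a => 'k) set => 'a" and \<psi>
 assumes tower: "nice_tower K A \<rho> \<psi>"
begin

interpretation nice_tower K A \<rho> \<psi> by (rule tower)

lemma tower_anti_alg: "anti_alg K (A n) (\<psi> n)"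
proof -
 have "graded_alg K (A n)"
  using base_field nice[of n] by (simp add: graded_alg_def nice_graded_algebra_def)
 then show ?thesis
  using nice[of n] anti_automorphism[of n] by (simp add: anti_alg_def anti_alg_axioms_def nice_alg_def nice_alg_axioms_def)
qed

interpretation N: anti_alg K "A n" "\<psi> n" for n
 by (rule tower_anti_alg)

interpretation KP: module_family "K_proj A"
 by (rule module_family.intro) (rule N.P.K0_left_module)

interpretation KG: module_family "G_fin K A"
 by (rule module_family.intro) (rule N.G.K0_left_module)

abbreviation (input) "cP n P \<equiv> K0_class (A n) (Defs.pmod (A n)) P"
abbreviation (input) "cG n M \<equiv> K0_class (A n) (fmod K (A n)) M"

text \<open>The orthogonal sum of the pairings chosen for each \<open>n\<close>.\<close>

lemma tower_pairing_exists: "\<exists>B. tower_pairing K A \<psi> B"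
proof -
 have "\<forall>n. \<exists>b. bilinear_pairing (K_proj A n) (G_fin K A n) b \<and>
  (\<forall>P\<in>Defs.pmod (A n). \<forall>M\<in>fmod K (A n). b (cP n P) (cG n M) = N.pairing n P M)"
  by (rule allI, rule N.K0_pairing_exists, intro exI conjI)
 from choice[OF this] obtain b where b: "!!n. bilinear_pairing (K_proj A n) (G_fin K A n) (b n)"
  "!!n P M. P \<in> Defs.pmod (A n) ==> M \<in> fmod K (A n) ==> b n (cP n P) (cG n M) = N.pairing n P M" by blast
 have bl: "(%x. b n x y) \<in> functionals (K_proj A n)"
  if "y \<in> carrier (G_fin K A n)" for n y using b(1)[of n] that by (simp add: bilinear_pairing_def)
 have br: "b n x \<in> functionals (G_fin K A n)"
  if "x \<in> carrier (K_proj A n)" for n x using b(1)[of n] that by (simp add: bilinear_pairing_def)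
 have bl0: "b n \<zero>\<^bsub>K_proj A n\<^esub> y = 0" if "y \<in> carrier (G_fin K A n)" for n y
  by (rule functional_zero[OF KP.modules bl[OF that]])
 have br0: "b n x \<zero>\<^bsub>G_fin K A n\<^esub> = 0" if "x \<in> carrier (K_proj A n)" for n x
  by (rule functional_zero[OF KG.modules br[OF that]])
 \<comment> \<open>Summing over the nonzero terms avoids choosing an index set. On the carriers
   there are finitely many of them, and any larger finite set gives the same sum, so additivity can
   be checked over a common one.\<close>
 define B where "B x y = (\<Sum>n | b n (x n) (y n) ~= 0. b n (x n) (y n))" for x y
 have B: "B x y = (\<Sum>n\<in>S. b n (x n) (y n))"
  if "finite S" "{n. b n (x n) (y n) ~= 0} \<subseteq> S" for S x y
  unfolding B_def by (rule sum.mono_neutral_left) (use that in auto)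
 have fin: "finite {n. b n (x n) (y n) ~= 0}"
  if "x \<in> carrier (direct_sum_nat (K_proj A))" "y \<in> carrier (direct_sum_nat (G_fin K A))" for x y
 proof (rule finite_subset)
  show "{n. b n (x n) (y n) ~= 0} \<subseteq> {n. x n ~= \<zero>\<^bsub>K_proj A n\<^esub>}" using that bl0 by auto
 qed (use that in simp)
 have "bilinear_pairing (tower_K A) (tower_G K A) B"
  unfolding bilinear_pairing_def laurent_functional_iff tower_K_def tower_G_def
 proof (intro conjI ballI allI)
  fix x x' y assume x: "x \<in> carrier (direct_sum_nat (K_proj A))" "x' \<in> carrier (direct_sum_nat (K_proj A))"
   and y: "y \<in> carrier (direct_sum_nat (G_fin K A))"
  let ?S = "{n. b n (x n) (y n) ~= 0} \<union> {n. b n (x' n) (y n) ~= 0}"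
  have S: "finite ?S" using fin[OF x(1) y] fin[OF x(2) y] by simp
  have a: "b n ((x \<oplus>\<^bsub>direct_sum_nat (K_proj A)\<^esub> x') n) (y n) = b n (x n) (y n) + b n (x' n) (y n)" for n
   using bl[of "y n" n] x y unfolding laurent_functional_iff by simp
  show "B (x \<oplus>\<^bsub>direct_sum_nat (K_proj A)\<^esub> x') y = B x y + B x' y"
   using B[OF S, of x y] B[OF S, of x' y] B[OF S, of "x \<oplus>\<^bsub>direct_sum_nat (K_proj A)\<^esub> x'" y] unfolding a sum.distrib
   by fastforce
 next
  fix c x y assume x: "x \<in> carrier (direct_sum_nat (K_proj A))" and y: "y \<in> carrier (direct_sum_nat (G_fin K A))"
  have a: "b n ((c \<odot>\<^bsub>direct_sum_nat (K_proj A)\<^esub> x) n) (y n) = c * b n (x n) (y n)"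
   and a': "b n (x n) ((c \<odot>\<^bsub>direct_sum_nat (G_fin K A)\<^esub> y) n) = c * b n (x n) (y n)" for n
   using bl[of "y n" n] br[of "x n" n] x y unfolding laurent_functional_iff by simp_all
  show "B (c \<odot>\<^bsub>direct_sum_nat (K_proj A)\<^esub> x) y = c * B x y" "B x (c \<odot>\<^bsub>direct_sum_nat (G_fin K A)\<^esub> y) = c * B x y"
   using B[OF fin[OF x y], of x y] B[OF fin[OF x y], of "c \<odot>\<^bsub>direct_sum_nat (K_proj A)\<^esub> x" y]
    B[OF fin[OF x y], of x "c \<odot>\<^bsub>direct_sum_nat (G_fin K A)\<^esub> y"]
   unfolding a a' sum_distrib_left[symmetric] by fastforce+
 next
  fix x y y' assume x: "x \<in> carrier (direct_sum_nat (K_proj A))"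
   and y: "y \<in> carrier (direct_sum_nat (G_fin K A))" "y' \<in> carrier (direct_sum_nat (G_fin K A))"
  let ?S = "{n. b n (x n) (y n) ~= 0} \<union> {n. b n (x n) (y' n) ~= 0}"
  have S: "finite ?S" using fin[OF x y(1)] fin[OF x y(2)] by simp
  have a: "b n (x n) ((y \<oplus>\<^bsub>direct_sum_nat (G_fin K A)\<^esub> y') n) = b n (x n) (y n) + b n (x n) (y' n)" for n
   using br[of "x n" n] x y unfolding laurent_functional_iff by simp
  show "B x (y \<oplus>\<^bsub>direct_sum_nat (G_fin K A)\<^esub> y') = B x y + B x y'"
   using B[OF S, of x y] B[OF S, of x y'] B[OF S, of x "y \<oplus>\<^bsub>direct_sum_nat (G_fin K A)\<^esub> y'"] unfolding a sum.distrib
   by fastforce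
 qed
 moreover have "B (summand (K_proj A) n (cP n P)) (summand (G_fin K A) m (cG m M)) =
   (if n = m then gdim K (tensor K (A n) (twist (\<psi> n) P) M) else 0)"
  if P: "P \<in> Defs.pmod (A n)" and M: "M \<in> fmod K (A m)" for n m P M
 proof -
  note c = N.P.K0_class_closed[OF P] N.G.K0_class_closed[OF M]
  have z: "b k (summand (K_proj A) n (cP n P) k) (summand (G_fin K A) m (cG m M) k) =
   (if k = n \<and> n = m then N.pairing n P M else 0)" for k
  proof (cases "k = n")
   case k: True
   show ?thesis
   proof (cases "n = m")
    case True
    have "b n (cP n P) (cG n M) = N.pairing n P M" by (rule b(2)[OF P]) (use M True in simp)
    then show ?thesis using k True by simp
   next
    case False
    then show ?thesis using k br0[OF c(1)] by (simp add: summand_other)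
   qed
  next
   case False
   have "summand (G_fin K A) m (cG m M) k \<in> carrier (G_fin K A k)"
    using KG.summand_closed[OF c(2)] by (simp only: KG.sum_sel)
   then show ?thesis using False bl0 by (simp add: summand_other)
  qed
  have "{k. b k (summand (K_proj A) n (cP n P) k) (summand (G_fin K A) m (cG m M) k) ~= 0} \<subseteq> {n}" unfolding z by auto
  from B[OF _ this] have "B (summand (K_proj A) n (cP n P)) (summand (G_fin K A) m (cG m M)) =
   (\<Sum>k\<in>{n}. if k = n \<and> n = m then N.pairing n P M else 0)" unfolding z by simp
  then show ?thesis by (simp add: N.pairing_def)
 qed
 ultimately show ?thesis unfolding tower_pairing_def by blast
qed

section \<open>Reduction of an arbitrary tower pairing to its components\<close>

context
 fixes B
 assumes B: "tower_pairing K A \<psi> B"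
begin

lemma tower_functional:
 "y \<in> carrier (direct_sum_nat (G_fin K A)) ==>
  (%x. B x y) \<in> functionals (direct_sum_nat (K_proj A))"
 "x \<in> carrier (direct_sum_nat (K_proj A)) ==>
  B x \<in> functionals (direct_sum_nat (G_fin K A))"
 using B unfolding tower_pairing_def bilinear_pairing_def tower_K_def tower_G_def by blast+

lemma tower_value:
 "P \<in> Defs.pmod (A n) ==> M \<in> fmod K (A m) ==>
  B (summand (K_proj A) n (cP n P)) (summand (G_fin K A) m (cG m M)) = (if n = m then N.pairing n P M else 0)"
 using B unfolding tower_pairing_def N.pairing_def by blast

text \<open>Restricted to summand \<open>n\<close>, the pairing is bilinear with the prescribed
  values on classes, which is all that \<open>K0_pairing\<close> asks for.\<close>

lemma component_pairing:
 "nondegenerate (K_proj A n) (G_fin K A n) (%x y. B (summand (K_proj A) n x) (summand (G_fin K A) n y)) \<and>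
  (algebraically_closed K -->
   perfect (K_proj A n) (G_fin K A n) (%x y. B (summand (K_proj A) n x) (summand (G_fin K A) n y)))"
proof (rule N.K0_pairing)
 show "bilinear_pairing (K_proj A n) (G_fin K A n) (%x y. B (summand (K_proj A) n x) (summand (G_fin K A) n y))"
  unfolding bilinear_pairing_def
  by (intro conjI ballI KP.functional_summand[OF tower_functional(1)] KG.functional_summand[OF tower_functional(2)]
    KP.summand_closed KG.summand_closed)
qed (simp add: tower_value)

text \<open>The prescribed value 0 on pairs of classes spreads to all elements by uniqueness of
  functionals, first in the second variable and then in the first.\<close>

lemma summand_orthogonal:
 assumes nm: "n ~= m" and u: "u \<in> carrier (K_proj A n)" and v: "v \<in> carrier (G_fin K A m)"
 shows "B (summand (K_proj A) n u) (summand (G_fin K A) m v) = 0"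
proof -
 have z: "(%_. 0) \<in> functionals V" for V :: "(laurent, 'v) module"
  by (simp add: laurent_functional_iff)
 have "B (summand (K_proj A) n (cP n P)) (summand (G_fin K A) m v) = 0" if P: "P \<in> Defs.pmod (A n)" for P
  by (rule N.G.K0_functional_eq[OF KG.functional_summand[OF tower_functional(2)[OF KP.summand_closed[OF N.P.K0_class_closed[OF P]]]] z _ v])
   (use tower_value[OF P] nm in simp)
 then show ?thesis
  by (intro N.P.K0_functional_eq[OF KP.functional_summand[OF tower_functional(1)[OF KG.summand_closed[OF v]]] z _ u])
qed

text \<open>Both sides are functionals on the direct sum, so they may be compared on single
  summands, where orthogonality removes all but the \<open>n\<close>-th.\<close>

lemma tower_component:
 assumes x: "x \<in> carrier (direct_sum_nat (K_proj A))" and y: "y \<in> carrier (direct_sum_nat (G_fin K A))"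
 shows "v \<in> carrier (G_fin K A n) ==>
   B x (summand (G_fin K A) n v) = B (summand (K_proj A) n (x n)) (summand (G_fin K A) n v)"
  and "u \<in> carrier (K_proj A n) ==>
   B (summand (K_proj A) n u) y = B (summand (K_proj A) n u) (summand (G_fin K A) n (y n))"
proof -
 assume v: "v \<in> carrier (G_fin K A n)"
 note t = tower_functional(1)[OF KG.summand_closed[OF v]]
 show "B x (summand (G_fin K A) n v) = B (summand (K_proj A) n (x n)) (summand (G_fin K A) n v)"
 proof (rule KP.functional_eq_summands[OF t _ _ x])
  show "(%x. B (summand (K_proj A) n (x n)) (summand (G_fin K A) n v))
    \<in> functionals (direct_sum_nat (K_proj A))"
   using KP.functional_summand[OF t, of n] unfolding laurent_functional_iff by simp
  have "B (summand (K_proj A) n \<zero>\<^bsub>K_proj A n\<^esub>) (summand (G_fin K A) n v) = 0"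
   by (rule functional_zero[OF KP.modules KP.functional_summand[OF t]])
  then show "B (summand (K_proj A) m u) (summand (G_fin K A) n v) =
    B (summand (K_proj A) n (summand (K_proj A) m u n)) (summand (G_fin K A) n v)"
   if "u \<in> carrier (K_proj A m)" for m u
   using summand_orthogonal[OF _ that v] by (cases "m = n") (simp_all add: summand_other)
 qed
next
 assume u: "u \<in> carrier (K_proj A n)"
 note t = tower_functional(2)[OF KP.summand_closed[OF u]]
 show "B (summand (K_proj A) n u) y = B (summand (K_proj A) n u) (summand (G_fin K A) n (y n))"
 proof (rule KG.functional_eq_summands[OF t _ _ y])
  show "(%y. B (summand (K_proj A) n u) (summand (G_fin K A) n (y n)))
    \<in> functionals (direct_sum_nat (G_fin K A))"
   using KG.functional_summand[OF t, of n] unfolding laurent_functional_iff by simp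
  have "B (summand (K_proj A) n u) (summand (G_fin K A) n \<zero>\<^bsub>G_fin K A n\<^esub>) = 0"
   by (rule functional_zero[OF KG.modules KG.functional_summand[OF t]])
  then show "B (summand (K_proj A) n u) (summand (G_fin K A) m v) =
    B (summand (K_proj A) n u) (summand (G_fin K A) n (summand (G_fin K A) m v n))"
   if "v \<in> carrier (G_fin K A m)" for m v
   using summand_orthogonal[OF _ u that] by (cases "n = m") (simp_all add: summand_other)
 qed
qed

lemma tower_nondegenerate: "nondegenerate (tower_K A) (tower_G K A) B"
 unfolding nondegenerate_def tower_K_def tower_G_def
proof (intro conjI ballI impI)
 fix x assume x: "x \<in> carrier (direct_sum_nat (K_proj A))" and z: "\<forall>y\<in>carrier (direct_sum_nat (G_fin K A)). B x y = 0"
 have "x n = \<zero>\<^bsub>K_proj A n\<^esub>" for n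
 proof -
  have "\<forall>v\<in>carrier (G_fin K A n). B (summand (K_proj A) n (x n)) (summand (G_fin K A) n v) = 0"
  proof
   fix v assume v: "v \<in> carrier (G_fin K A n)"
   note vc = KG.summand_closed[OF v]
   have "B x (summand (G_fin K A) n v) = 0" by (rule bspec[OF z vc])
   then show "B (summand (K_proj A) n (x n)) (summand (G_fin K A) n v) = 0"
    unfolding tower_component(1)[OF x vc v] .
  qed
  moreover have "x n \<in> carrier (K_proj A n)" using x by simp
  ultimately show ?thesis using component_pairing[of n] unfolding nondegenerate_def by blast
 qed
 then show "x = \<zero>\<^bsub>direct_sum_nat (K_proj A)\<^esub>" by auto
next
 fix y assume y: "y \<in> carrier (direct_sum_nat (G_fin K A))" and z: "\<forall>x\<in>carrier (direct_sum_nat (K_proj A)). B x y = 0"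
 have "y n = \<zero>\<^bsub>G_fin K A n\<^esub>" for n
 proof -
  have "\<forall>u\<in>carrier (K_proj A n). B (summand (K_proj A) n u) (summand (G_fin K A) n (y n)) = 0"
  proof
   fix u assume u: "u \<in> carrier (K_proj A n)"
   note uc = KP.summand_closed[OF u]
   have "B (summand (K_proj A) n u) y = 0" by (rule bspec[OF z uc])
   then show "B (summand (K_proj A) n u) (summand (G_fin K A) n (y n)) = 0"
    unfolding tower_component(2)[OF uc y u] .
  qed
  moreover have "y n \<in> carrier (G_fin K A n)" using y by simp
  ultimately show ?thesis using component_pairing[of n] unfolding nondegenerate_def by blast
 qed
 then show "y = \<zero>\<^bsub>direct_sum_nat (G_fin K A)\<^esub>" by auto
qed

lemma tower_perfect: "algebraically_closed K ==> componentwise_perfect K A B"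
 unfolding componentwise_perfect_def using component_pairing by blast

end

lemma tower_tensor_fin_dim:
 "P \<in> Defs.pmod (A n) ==> M \<in> fmod K (A n) ==> vectorspace.fin_dim K (tensor K (A n) (twist (\<psi> n) P) M)"
 by (rule N.tensor_fmod_fin_dim)

end

theorem proposition2p2p3:
  fixes K :: "'k ring"
    and A :: "nat \<Rightarrow> ('k, 'a) gmodule"
    and \<rho> :: "nat \<Rightarrow> nat \<Rightarrow> ('a \<times> 'a \<Rightarrow> 'k) set \<Rightarrow> 'a"
    and \<psi> :: "nat \<Rightarrow> 'a \<Rightarrow> 'a"
  assumes "nice_tower K A \<rho> \<psi>"
  shows "(\<forall>n. \<forall>P \<in> pmod (A n). \<forall>M \<in> fmod K (A n).
            vectorspace.fin_dim K (tensor K (A n) (twist (\<psi> n) P) M)) \<and>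
         (\<exists>B. tower_pairing K A \<psi> B) \<and>
         (\<forall>B. tower_pairing K A \<psi> B \<longrightarrow>
            nondegenerate (tower_K A) (tower_G K A) B \<and>
            (algebraically_closed K \<longrightarrow> componentwise_perfect K A B))"
  using tower_tensor_fin_dim[OF assms] tower_pairing_exists[OF assms] tower_nondegenerate[OF assms]
    tower_perfect[OF assms] by blast

end
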